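(* Let $\sigma\ge1$ be an integer and $n\ge 1$. Assume that the initial data are $u_0=0$ and $u_1\in L^1(\mathbb{R}^n)\cap L^2(\mathbb{R}^n)$ satisfying $$\liminf_{R\to\infty}\int_{|x|<R}u_1(x)\,dx>0,$$ and suppose that $$1<p\le1+\frac{2\sigma}{n}.$$ Then there is no global (in time) energy solution to $$u_{tt}+(-\Delta)^\sigma u+u_t+(-\Delta)^\sigma u_t=|u|^p,\quad u(0,x)=u_0(x),\quad u_t(0,x)=u_1(x),\qquad x\in\mathbb{R}^n.$$ In other words, there are only local (in time) energy solutions $u$, that is, there exists $T_\varepsilon<\infty$ such that $$\lim_{t\to T_\varepsilon-0}\|(u,u_t)(t,\cdot)\|_{H^\sigma\times L^2}=+\infty.$$
   Context: An energy solution on $[0,T)$, $0<T\le\infty$, is a function $u\in C([0,T),H^\sigma)\cap C^1([0,T),L^2)$ solving the problem; such solutions are in particular understood as weak solutions in the following sense (global means $T=\infty$). A function $u\in L^p_{\mathrm{loc}}([0,T)\times\mathbb{R}^n)$ is a weak solution on $[0,T)$ if for every $\phi\in C_0^\infty([0,T)\times\mathbb{R}^n)$ $$\int_0^T\!\!\int_{\mathbb{R}^n}|u|^p\phi\,dx\,dt+\int_{\mathbb{R}^n}u_0(x)\big(\phi(0,x)+(-\Delta)^\sigma\phi(0,x)-\phi_t(0,x)\big)dx+\int_{\mathbb{R}^n}u_1(x)\phi(0,x)\,dx$$ $$=\int_0^T\!\!\int_{\mathbb{R}^n}u\,\big(\phi_{tt}-(-\Delta)^\sigma\phi_t+(-\Delta)^\sigma\phi-\phi_t\big)\,dx\,dt.$$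 $T_\varepsilon$ is just the name of a finite (maximal existence) time. *)

theory Defs
  imports "HOL-Analysis.Analysis"
begin

section \<open>Smooth functions, test functions and the operator $(-\Delta)^\sigma$\<close>

definition partial_deriv :: "'a::euclidean_space \<Rightarrow> ('a \<Rightarrow> real) \<Rightarrow> 'a \<Rightarrow> real" where
  "partial_deriv b f x = deriv (\<lambda>s. f (x + s *\<^sub>R b)) 0"

text \<open>\<open>iter_partial [b1, \<dots>, bk] f\<close> is $\partial_{b_1} \cdots \partial_{b_k} f$; the list plays the role
  of a multi-index of order \<open>k\<close>.\<close>

definition iter_partial :: "'a::euclidean_space list \<Rightarrow> ('a \<Rightarrow> real) \<Rightarrow> 'a \<Rightarrow> real" where
  "iter_partial bs f = foldr partial_deriv bs f"

definition smooth :: "('a::euclidean_space \<Rightarrow> real) \<Rightarrow> bool" where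
  "smooth f \<longleftrightarrow> (\<forall>bs \<in> lists Basis. \<forall>x. iter_partial bs f differentiable (at x))"

definition test_functions :: "'a::euclidean_space set \<Rightarrow> ('a \<Rightarrow> real) set" where
  "test_functions S =
     {\<phi>. smooth \<phi> \<and> compact (closure {x. \<phi> x \<noteq> 0}) \<and> closure {x. \<phi> x \<noteq> 0} \<subseteq> S}"

definition neg_laplacian :: "('a::euclidean_space \<Rightarrow> real) \<Rightarrow> 'a \<Rightarrow> real" where
  "neg_laplacian f x = - (\<Sum>b\<in>Basis. partial_deriv b (partial_deriv b f) x)"

definition neg_laplacian_pow :: "nat \<Rightarrow> ('a::euclidean_space \<Rightarrow> real) \<Rightarrow> 'a \<Rightarrow> real" where
  "neg_laplacian_pow \<sigma> f = (neg_laplacian ^^ \<sigma>) f"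

definition time_deriv :: "(real \<Rightarrow> 'a \<Rightarrow> real) \<Rightarrow> real \<Rightarrow> 'a \<Rightarrow> real" where
  "time_deriv \<phi> t x = deriv (\<lambda>s. \<phi> s x) t"


section \<open>The spaces $L^2$ and $H^k$\<close>

text \<open>Elements are functions rather than classes modulo null sets, so the norms below are
  really seminorms.\<close>

definition L2 :: "('a::euclidean_space \<Rightarrow> real) set" where
  "L2 = {f. f \<in> borel_measurable lebesgue \<and> integrable lebesgue (\<lambda>x. (f x)\<^sup>2)}"

definition L2_norm :: "('a::euclidean_space \<Rightarrow> real) \<Rightarrow> real" where
  "L2_norm f = sqrt (LINT x|lebesgue. (f x)\<^sup>2)"

definition has_weak_deriv ::
    "('a::euclidean_space \<Rightarrow> real) \<Rightarrow> 'a list \<Rightarrow> ('a \<Rightarrow> real) \<Rightarrow> bool" where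
  "has_weak_deriv f bs g \<longleftrightarrow>
     (\<forall>\<phi>\<in>test_functions UNIV.
        (LINT x|lebesgue. f x * iter_partial bs \<phi> x)
          = (-1) ^ length bs * (LINT x|lebesgue. g x * \<phi> x))"

definition Sobolev_H :: "nat \<Rightarrow> ('a::euclidean_space \<Rightarrow> real) set" where
  "Sobolev_H k =
     {f \<in> L2. \<forall>bs\<in>lists Basis. length bs \<le> k \<longrightarrow> (\<exists>g\<in>L2. has_weak_deriv f bs g)}"

text \<open>For \<open>f\<close> in \<open>Sobolev_H k\<close> and \<open>length bs \<le> k\<close> this is determined up to a null set.\<close>

definition weak_deriv :: "'a::euclidean_space list \<Rightarrow> ('a \<Rightarrow> real) \<Rightarrow> 'a \<Rightarrow> real" where
  "weak_deriv bs f = (SOME g. g \<in> L2 \<and> has_weak_deriv f bs g)"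

text \<open>The sum over lists is $\|f\|_{H^k}^2 = \sum_{j\le k} \|\nabla^j f\|_{L^2}^2$, with the
  Euclidean norm on the $j$-tensors $\nabla^j f(x)$.\<close>

definition H_norm :: "nat \<Rightarrow> ('a::euclidean_space \<Rightarrow> real) \<Rightarrow> real" where
  "H_norm k f = sqrt (\<Sum>bs \<in> {bs \<in> lists Basis. length bs \<le> k}. (L2_norm (weak_deriv bs f))\<^sup>2)"


section \<open>Curves in $H^k$ and $L^2$\<close>

definition time_interval :: "ereal \<Rightarrow> real set" where
  "time_interval T = {t. 0 \<le> t \<and> ereal t < T}"

definition continuous_in_L2 :: "real set \<Rightarrow> (real \<Rightarrow> 'a::euclidean_space \<Rightarrow> real) \<Rightarrow> bool" where
  "continuous_in_L2 I u \<longleftrightarrow>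
     (\<forall>t\<in>I. u t \<in> L2 \<and> ((\<lambda>s. L2_norm (\<lambda>x. u s x - u t x)) \<longlongrightarrow> 0) (at t within I))"

definition continuous_in_H :: "nat \<Rightarrow> real set \<Rightarrow> (real \<Rightarrow> 'a::euclidean_space \<Rightarrow> real) \<Rightarrow> bool" where
  "continuous_in_H k I u \<longleftrightarrow>
     (\<forall>t\<in>I. u t \<in> Sobolev_H k \<and>
        ((\<lambda>s. H_norm k (\<lambda>x. u s x - u t x)) \<longlongrightarrow> 0) (at t within I))"

text \<open>\<open>w\<close> is the derivative of the curve \<open>u\<close> at time \<open>t\<close> with respect to the norm of $L^2$. Near a
  point of \<open>time_interval T\<close> the sets \<open>time_interval T\<close> and \<open>{0..}\<close> agree, so the derivative is
  one-sided at \<open>t = 0\<close> and does not depend on \<open>T\<close>.\<close>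

definition has_L2_deriv ::
    "(real \<Rightarrow> 'a::euclidean_space \<Rightarrow> real) \<Rightarrow> ('a \<Rightarrow> real) \<Rightarrow> real \<Rightarrow> bool" where
  "has_L2_deriv u w t \<longleftrightarrow> w \<in> L2 \<and>
     ((\<lambda>s. L2_norm (\<lambda>x. (u s x - u t x) / (s - t) - w x)) \<longlongrightarrow> 0) (at t within {0..})"

definition L2_deriv :: "(real \<Rightarrow> 'a::euclidean_space \<Rightarrow> real) \<Rightarrow> real \<Rightarrow> 'a \<Rightarrow> real" where
  "L2_deriv u t = (SOME w. has_L2_deriv u w t)"

definition C1_in_L2 :: "real set \<Rightarrow> (real \<Rightarrow> 'a::euclidean_space \<Rightarrow> real) \<Rightarrow> bool" where
  "C1_in_L2 I u \<longleftrightarrow>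
     (\<forall>t\<in>I. u t \<in> L2 \<and> (\<exists>w. has_L2_deriv u w t)) \<and> continuous_in_L2 I (L2_deriv u)"


section \<open>Weak solutions and energy solutions\<close>

definition Lp_loc :: "real \<Rightarrow> ereal \<Rightarrow> (real \<Rightarrow> 'a::euclidean_space \<Rightarrow> real) \<Rightarrow> bool" where
  "Lp_loc p T u \<longleftrightarrow>
     set_borel_measurable lebesgue (time_interval T \<times> UNIV) (\<lambda>(t, x). u t x) \<and>
     (\<forall>K. compact K \<and> K \<subseteq> time_interval T \<times> UNIV \<longrightarrow>
        set_integrable lebesgue K (\<lambda>(t, x). \<bar>u t x\<bar> powr p))"

text \<open>$C_0^\infty([0,T)\times\mathbb{R}^n)$ consists of the restrictions to $t \ge 0$ of the functions
  in $C_0^\infty((-\infty,T)\times\mathbb{R}^n)$, so the test functions need not vanish at $t = 0$.\<close>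

definition is_weak_solution ::
    "nat \<Rightarrow> real \<Rightarrow> ('a::euclidean_space \<Rightarrow> real) \<Rightarrow> ('a \<Rightarrow> real) \<Rightarrow> ereal \<Rightarrow> (real \<Rightarrow> 'a \<Rightarrow> real) \<Rightarrow> bool"
  where
  "is_weak_solution \<sigma> p u0 u1 T u \<longleftrightarrow> Lp_loc p T u \<and>
     (\<forall>\<phi>. (\<lambda>(t, x). \<phi> t x) \<in> test_functions ({t. ereal t < T} \<times> UNIV) \<longrightarrow>
        (LINT (t, x):time_interval T \<times> UNIV|lebesgue. \<bar>u t x\<bar> powr p * \<phi> t x)
        + (LINT x|lebesgue. u0 x * (\<phi> 0 x + neg_laplacian_pow \<sigma> (\<phi> 0) x - time_deriv \<phi> 0 x))
        + (LINT x|lebesgue. u1 x * \<phi> 0 x)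
        = (LINT (t, x):time_interval T \<times> UNIV|lebesgue.
             u t x * (time_deriv (time_deriv \<phi>) t x - neg_laplacian_pow \<sigma> (time_deriv \<phi> t) x
                      + neg_laplacian_pow \<sigma> (\<phi> t) x - time_deriv \<phi> t x)))"

definition energy_solution ::
    "nat \<Rightarrow> real \<Rightarrow> ('a::euclidean_space \<Rightarrow> real) \<Rightarrow> ('a \<Rightarrow> real) \<Rightarrow> ereal \<Rightarrow> (real \<Rightarrow> 'a \<Rightarrow> real) \<Rightarrow> bool"
  where
  "energy_solution \<sigma> p u0 u1 T u \<longleftrightarrow>
     0 < T \<and>
     continuous_in_H \<sigma> (time_interval T) u \<and>
     C1_in_L2 (time_interval T) u \<and>
     (AE x in lebesgue. u 0 x = u0 x) \<and>
     (AE x in lebesgue. L2_deriv u 0 x = u1 x) \<and>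
     is_weak_solution \<sigma> p u0 u1 T u"

definition maximal_energy_solution ::
    "nat \<Rightarrow> real \<Rightarrow> ('a::euclidean_space \<Rightarrow> real) \<Rightarrow> ('a \<Rightarrow> real) \<Rightarrow> ereal \<Rightarrow> (real \<Rightarrow> 'a \<Rightarrow> real) \<Rightarrow> bool"
  where
  "maximal_energy_solution \<sigma> p u0 u1 T u \<longleftrightarrow>
     energy_solution \<sigma> p u0 u1 T u \<and>
     \<not> (\<exists>T' u'. T < T' \<and> energy_solution \<sigma> p u0 u1 T' u' \<and>
           (\<forall>t\<in>time_interval T. AE x in lebesgue. u' t x = u t x))"

text \<open>The norm of $(u, u_t)(t,\cdot)$ in $H^\sigma \times L^2$.\<close>

definition energy_norm :: "nat \<Rightarrow> (real \<Rightarrow> 'a::euclidean_space \<Rightarrow> real) \<Rightarrow> real \<Rightarrow> real" where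
  "energy_norm \<sigma> u t = sqrt ((H_norm \<sigma> (u t))\<^sup>2 + (L2_norm (L2_deriv u t))\<^sup>2)"

end

theory Submission
  imports Defs
begin

text \<open>Writing \<open>L = (-\<Delta>)\<^sup>\<sigma>\<close>, the linear part of the equation factors as \<open>(\<partial>\<^sub>t + L) (\<partial>\<^sub>t + 1)\<close>. So \<open>y = u\<^sub>t + u\<close>
solves the parabolic problem \<open>y\<^sub>t + L y = \<bar>u\<bar>\<^sup>p\<close> and \<open>u\<close> is recovered from \<open>u\<^sub>t + u = y\<close>. In this form the
equation has a contraction-mapping theory in the form domain \<open>H\<^sup>\<sigma>\<close>: parabolic problems are solved by Yosida
approximation, \<open>\<integral> e\<^sup>s y\<close> gains \<open>H\<^sup>\<sigma>\<close> regularity, and \<open>u \<mapsto> \<bar>u\<bar>\<^sup>p\<close> is locally Lipschitz from \<open>H\<^sup>\<sigma>\<close> to \<open>L\<^sup>2\<close> because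
\<open>n (p - 1) \<le> 2 \<sigma>\<close>. The existence time depends only on the size of the data, which gives a maximal solution and its
blow-up alternative; energy solutions are exactly the solutions of this abstract problem.

A global solution is excluded by testing with a cut-off of size \<open>R\<^sup>2\<^sup>\<sigma>\<close> in time and \<open>R\<close> in space. Young's inequality
bounds \<open>\<integral> \<bar>u\<bar>\<^sup>p\<close>, uniformly in \<open>R\<close> because \<open>p \<le> 1 + 2 \<sigma> / n\<close>. The error terms live where the cut-off is not
constant, so they only see the tail of a convergent integral; weighting Young's inequality with \<open>K \<rightarrow> \<infinity>\<close>
gives \<open>\<integral> u\<^sub>1 \<le> 0\<close>.\<close>

text \<open>Finite-time blow-up needs more than nonexistence: a maximal solution must exist, and
  none may have bounded norm along times tending to its end. Hence the weak formulation is
  translated into a Cauchy problem whose local existence time is uniform on bounded sets of data.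
  The obstacle is that \<open>y\<close> lives only in L^2, so \<open>L y\<close> has no meaning. Its
  equation is therefore integrated in time and hit with the resolvents \<open>(1 + h L)^-1\<close>,
  under which \<open>L\<close> becomes a bounded operator. The energy identity controls the time
  integral of the form of the regularised \<open>y\<close>, so a primitive of \<open>y\<close> lies
  in the form domain, with norm of order \<open>sqrt r\<close> on an interval of length
  \<open>r\<close>; this small factor drives the contraction. The bound on \<open>p\<close> enters
  twice: as the scaling borderline in an averaging proof of the embedding of H^sigma into L^(2p),
  and as the balance between the size of the adjoint of the cut-off and the volume of its support.
  At p = 1 + 2 sigma / n that balance is exact, so enlarging the cut-off alone gives no decay; this
  is why a free weight is kept in Young's inequality.\<close>

abbreviation (input) "test f \<equiv> f \<in> test_functions UNIV"
abbreviation (input) "lmeas f \<equiv> f \<in> borel_measurable lebesgue"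
abbreviation (input) "NL f \<equiv> nn_integral lebesgue (\<lambda>x. ennreal (f x))"
abbreviation (input) "I0 t f \<equiv> integral {0..t::real} f"
abbreviation (input) "C0 t f \<equiv> continuous_on {0..t::real} f"
abbreviation (input) "pd \<equiv> partial_deriv"
abbreviation (input) "ip \<equiv> iter_partial"

abbreviation (input) LIMSEQ_ASCII (infix "---->" 60) where "X ----> L \<equiv> LIMSEQ X L"
notation (input) tendsto (infixr "--->" 55)

lemmas LINT_mono = Bochner_Integration.integral_mono
lemmas LINT_bound = Bochner_Integration.integrable_bound
lemmas LINT_diff = Bochner_Integration.integral_diff
lemmas HK_cong = Henstock_Kurzweil_Integration.integral_cong

notation scaleR (infixr "*R" 75)

section \<open>Forms, resolvents and abstract parabolic problems\<close>

text \<open>The laws are required only on \<open>V\<close>: the weak derivatives behind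
  \<open>hform\<close> are picked by a description operator and act linearly only on the Sobolev
  space. Semidefiniteness suffices for Cauchy-Schwarz and lets \<open>a\<close> and
  \<open>Q h\<close> share these lemmas.\<close>

locale semi_inner_form =
 fixes V :: "'h::real_vector set" and b :: "'h => 'h => real"
 assumes V_subspace: "subspace V"
  and add_left: "x \<in> V ==> y \<in> V ==> z \<in> V ==> b (x + y) z = b x z + b y z"
  and scale_left: "x \<in> V ==> z \<in> V ==> b (c *R x) z = c * b x z"
  and sym: "x \<in> V ==> y \<in> V ==> b x y = b y x"
  and nonneg: "x \<in> V ==> 0 <= b x x"
begin

lemma V_add: "x \<in> V ==> y \<in> V ==> x + y \<in> V"
 and V_scale: "x \<in> V ==> c *R x \<in> V"
 and V_diff: "x \<in> V ==> y \<in> V ==> x - y \<in> V"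
 and V_zero: "0 \<in> V"
 and V_neg: "x \<in> V ==> - x \<in> V"
 using V_subspace by (auto simp: subspace_add subspace_mul subspace_diff subspace_0 subspace_neg)

lemma add_right: "x \<in> V ==> y \<in> V ==> z \<in> V ==> b z (x + y) = b z x + b z y"
 using add_left sym V_add by metis

lemma scale_right: "x \<in> V ==> z \<in> V ==> b z (c *R x) = c * b z x"
 using scale_left sym V_scale by metis

lemma diff_left: "x \<in> V ==> y \<in> V ==> z \<in> V ==> b (x - y) z = b x z - b y z"
 using add_left[of x "(-1) *R y" z] scale_left[of y z "-1"] V_scale[of y "-1"] by simp

lemma diff_right: "x \<in> V ==> y \<in> V ==> z \<in> V ==> b z (x - y) = b z x - b z y"
 using diff_left sym V_diff by metis

lemma zero_left: "x \<in> V ==> b 0 x = 0"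
 using scale_left[of 0 x 0] V_zero by simp

lemma square_add:
 assumes "x \<in> V" "y \<in> V"
 shows "b (x + y) (x + y) = b x x + 2 * b x y + b y y"
 using assms add_left[of x y "x + y"] add_right[of x y x] add_right[of x y y] sym[of x y] V_add by simp

lemma square_diff:
 assumes "x \<in> V" "y \<in> V"
 shows "b (x - y) (x - y) = b x x - 2 * b x y + b y y"
 using assms diff_left[of x y "x - y"] diff_right[of x y x] diff_right[of x y y] sym[of x y] V_diff by simp

lemma square_scale: "x \<in> V ==> b (c *R x) (c *R x) = c^2 * b x x"
 using scale_left scale_right V_scale by (simp add: power2_eq_square)

lemma twice_abs_le:
 assumes "x \<in> V" "y \<in> V"
 shows "2 * \<bar>b x y\<bar> <= b x x + b y y"
 using nonneg[of "x + y"] nonneg[of "x - y"] square_add[OF assms] square_diff[OF assms] assms V_add V_diff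
 by (smt (verit))

lemma Cauchy_Schwarz_square:
 assumes "x \<in> V" "y \<in> V"
 shows "(b x y)^2 <= b x x * b y y"
proof -
 have q: "0 <= b x x + t * (2 * b x y) + t^2 * b y y" for t
  using nonneg[of "x + t *R y"] square_add[of x "t *R y"] square_scale[of y t] scale_right[of y x t]
   assms V_add V_scale by simp
 show ?thesis
 proof (cases "b y y = 0")
  case True
  have "b x y = 0"
  proof (rule ccontr)
   assume n: "b x y ~= 0"
   \<comment> \<open>With \<open>b y y = 0\<close> the quadratic is affine in \<open>t\<close>; this
     value of \<open>t\<close> makes it equal to -1.\<close>
   define t where "t = - (b x x + 1) / (2 * b x y)"
   with q[of t] True show False using n by simp
  qed
  with True show ?thesis by simp
 next
  case False
  hence p: "b y y > 0" using nonneg[of y] assms by simp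
  \<comment> \<open>The minimiser of the quadratic in \<open>q\<close>.\<close>
  define t where "t = - b x y / b y y"
  hence "t^2 * b y y = - (t * b x y)" by (simp add: power2_eq_square)
  moreover have "t * b x y = - ((b x y)^2 / b y y)" by (simp add: t_def power2_eq_square)
  ultimately have "(b x y)^2 / b y y <= b x x" using q[of t] by linarith
  with p show ?thesis by (simp add: pos_divide_le_eq)
 qed
qed

lemma Cauchy_Schwarz:
 assumes "x \<in> V" "y \<in> V"
 shows "\<bar>b x y\<bar> <= sqrt (b x x) * sqrt (b y y)"
 using Cauchy_Schwarz_square[OF assms]
 by (metis real_sqrt_le_mono real_sqrt_mult real_sqrt_abs)

lemma triangle:
 assumes "x \<in> V" "y \<in> V"
 shows "sqrt (b (x + y) (x + y)) <= sqrt (b x x) + sqrt (b y y)"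
proof (rule real_le_lsqrt)
 show "0 <= sqrt (b x x) + sqrt (b y y)" using nonneg assms by simp
 have "b (x + y) (x + y) = b x x + 2 * b x y + b y y" by (rule square_add[OF assms])
 also have "... <= b x x + 2 * (sqrt (b x x) * sqrt (b y y)) + b y y"
  using Cauchy_Schwarz[OF assms] by simp
 also have "... = (sqrt (b x x) + sqrt (b y y))^2"
  using nonneg assms by (simp add: power2_sum)
 finally show "b (x + y) (x + y) <= (sqrt (b x x) + sqrt (b y y))^2" .
qed

end

text \<open>\<open>complete_form\<close> is completeness of \<open>V\<close> under the form norm
  \<open>N\<close>, that is, closedness of the form. It is written with the squared norm because
  \<open>V\<close> is a set without a metric of its own.\<close>

locale closed_form = semi_inner_form V a
 for V :: "'h::{real_inner,banach} set" and a :: "'h => 'h => real" +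
 assumes complete_form: "!!X. (!!n. X n \<in> V) ==>
   (!!e. e > 0 ==> EX M. ALL m>=M. ALL n>=M. (X m - X n) \<bullet> (X m - X n) + a (X m - X n) (X m - X n) < e) ==>
   EX x:V. (%n. (X n - x) \<bullet> (X n - x) + a (X n - x) (X n - x)) ----> 0"
begin

text \<open>The form of \<open>1 + h A\<close>, where \<open>A\<close> is the unbounded operator
  represented by \<open>a\<close>. \<open>A\<close> itself is never introduced; only its resolvents
  are.\<close>

definition Q :: "real => 'h => 'h => real" where
 "Q h x y = x \<bullet> y + h * a x y"

definition N :: "'h => real" where
 "N x = sqrt (x \<bullet> x + a x x)"

lemma semi_inner_Q: "h >= 0 ==> semi_inner_form V (Q h)"
 by unfold_locales
  (auto simp: Q_def V_subspace add_left scale_left sym nonneg algebra_simps inner_commute)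

lemma N_eq_Q: "N x = sqrt (Q 1 x x)"
 by (simp add: N_def Q_def)

lemma N_nonneg [simp]: "x \<in> V ==> 0 <= N x"
 by (simp add: N_def nonneg)

lemma N_triangle: "x \<in> V ==> y \<in> V ==> N (x + y) <= N x + N y"
 unfolding N_eq_Q using semi_inner_form.triangle[OF semi_inner_Q] by simp

lemma N_scale: "x \<in> V ==> N (c *R x) = \<bar>c\<bar> * N x"
 unfolding N_eq_Q using semi_inner_form.square_scale[OF semi_inner_Q, of 1] by (simp add: real_sqrt_mult)

lemma N_minus: "x \<in> V ==> y \<in> V ==> N (x - y) = N (y - x)"
 using N_scale[of "x - y" "-1"] V_diff by simp

lemma N_zero [simp]: "N 0 = 0"
 using zero_left V_zero by (simp add: N_def)

lemma N_triangle3: "x \<in> V ==> y \<in> V ==> z \<in> V ==> N (x - z) <= N (x - y) + N (y - z)"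
 using N_triangle[of "x - y" "y - z"] V_diff by simp

lemma N_diff_le: "x \<in> V ==> y \<in> V ==> \<bar>N x - N y\<bar> <= N (x - y)"
 using N_triangle[of "x - y" y] N_triangle[of "y - x" x] N_minus[of x y] V_diff by simp

lemma norm_le_N: "x \<in> V ==> norm x <= N x"
 using nonneg by (simp add: N_def norm_eq_sqrt_inner)

lemma a_le_N: "x \<in> V ==> y \<in> V ==> \<bar>a x y\<bar> <= N x * N y"
proof -
 assume xy: "x \<in> V" "y \<in> V"
 have "sqrt (a x x) * sqrt (a y y) <= N x * N y"
  using xy nonneg by (intro mult_mono) (auto simp: N_def)
 with Cauchy_Schwarz[OF xy] show ?thesis by simp
qed

lemma N_le_sqrt: "x \<in> V ==> norm x <= c ==> a x x <= d ==> N x <= sqrt (c^2 + d)"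
 unfolding N_def using power_mono[of "norm x" c 2] by (simp add: power2_norm_eq_inner)

text \<open>Riesz representation by minimising \<open>Q h v v / 2 - g \<bullet> v\<close>.\<close>

lemma resolvent_ex:
 assumes h: "h > 0"
 shows "EX v:V. ALL j:V. Q h v j = g \<bullet> j"
proof -
 interpret q: semi_inner_form V "Q h" by (rule semi_inner_Q) (use h in simp)
 define J where "J v = Q h v v - 2 * (g \<bullet> v)" for v
 have lower: "- (norm g)\<^sup>2 <= J v" if "v \<in> V" for v
 proof -
  have "2 * (g \<bullet> v) <= (norm g)^2 + (norm v)^2"
   using inner_ge_zero[of "g - v"]
   by (simp add: inner_diff_right inner_commute power2_norm_eq_inner)
  moreover have "(norm v)^2 <= Q h v v" using nonneg[OF that] h by (simp add: Q_def power2_norm_eq_inner)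
  ultimately show ?thesis by (simp add: J_def)
 qed
 define m where "m = Inf (J ` V)"
 have bdd: "bdd_below (J ` V)" using lower by force
 have m_le: "m <= J v" if "v \<in> V" for v
  unfolding m_def using that bdd by (intro cInf_lower) auto
 have "EX v:V. J v < m + inverse (Suc k)" for k
 proof -
  have "Inf (J ` V) < m + inverse (Suc k)" by (simp add: m_def)
  thus ?thesis using cInf_less_iff[of "J ` V"] bdd V_zero by auto
 qed
 then obtain v where vV: "!!k. v k \<in> V" and vJ: "!!k. J (v k) < m + inverse (Suc k)" by metis
 \<comment> \<open>The midpoint of two almost-minimisers cannot lie below \<open>m\<close>; by the
   parallelogram identity they are then close in \<open>Q h\<close>.\<close>
 have par: "Q h (v k - v l) (v k - v l) <= 2 * (inverse (Suc k) + inverse (Suc l))" for k l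
 proof -
  define w where "w = (1/2) *R (v k + v l)"
  have wV: "w \<in> V" unfolding w_def using vV V_add V_scale by blast
  have "Q h w w = (1/4) * Q h (v k + v l) (v k + v l)"
   unfolding w_def using q.square_scale[of "v k + v l" "1/2"] vV V_add by (simp add: power2_eq_square)
  moreover have "g \<bullet> w = (1/2) * (g \<bullet> v k + g \<bullet> v l)" by (simp add: w_def inner_add_right)
  ultimately show ?thesis using q.square_add[of "v k" "v l"] q.square_diff[of "v k" "v l"] vV m_le[OF wV] vJ[of k] vJ[of l] by (simp add: J_def)
 qed
 \<comment> \<open>Converts smallness in \<open>Q h\<close> into smallness of the squared form norm,
   for small as well as large \<open>h\<close>.\<close>
 define c where "c = max 1 (1 / h)"
 have cpos: "c > 0" by (simp add: c_def)
 have Qc: "x \<bullet> x + a x x <= c * Q h x x" if "x \<in> V" for x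
 proof -
  have "1 <= c" "1 / h <= c" by (auto simp: c_def)
  hence "1 <= c * h" using h by (simp add: pos_divide_le_eq)
  hence "1 * (x \<bullet> x) <= c * (x \<bullet> x)" "1 * a x x <= c * h * a x x"
   using nonneg[OF that] \<open>1 <= c\<close> by (intro mult_right_mono; simp)+
  thus ?thesis by (simp add: Q_def algebra_simps)
 qed
 have "EX x:V. (%n. (v n - x) \<bullet> (v n - x) + a (v n - x) (v n - x)) ----> 0"
 proof (rule complete_form[OF vV])
  fix e :: real assume e: "e > 0"
  define d where "d = e / c"
  then obtain M where M: "inverse (real (Suc M)) < d / 4" using e cpos reals_Archimedean[of "d / 4"] by auto
  have "(v k - v l) \<bullet> (v k - v l) + a (v k - v l) (v k - v l) < e" if "k >= M" "l >= M" for k l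
  proof -
   have "2 * (inverse (real (Suc k)) + inverse (real (Suc l))) <= 2 * (inverse (real (Suc M)) + inverse (real (Suc M)))" using that by (intro mult_left_mono add_mono) auto
   also have "... < d" using M by argo
   finally have "Q h (v k - v l) (v k - v l) < d"
    using par[of k l] by simp
   thus ?thesis using cpos Qc[of "v k - v l"] vV V_diff by (simp add: d_def field_simps)
  qed
  thus "EX M. ALL m>=M. ALL n>=M. (v m - v n) \<bullet> (v m - v n) + a (v m - v n) (v m - v n) < e" by blast
 qed
 then obtain x where xV: "x \<in> V"
  and lim: "(%n. (v n - x) \<bullet> (v n - x) + a (v n - x) (v n - x)) ----> 0" by blast
 have "Q h x j = g \<bullet> j" if j: "j \<in> V" for j
 proof -
  define r where "r = Q h x j - g \<bullet> j"
  have N0: "(%n. N (v n - x)) ----> 0"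
   using tendsto_real_sqrt[OF lim] by (simp add: N_def)
  have Qlim: "(%n. Q h (v n) j) ----> Q h x j"
  proof (rule LIM_zero_cancel, rule Lim_null_comparison)
   have "\<bar>Q h (v n) j - Q h x j\<bar> <= (1 + h) * (N (v n - x) * N j)" for n
   proof -
    have d: "v n - x \<in> V" using vV xV V_diff by blast
    have "\<bar>(v n - x) \<bullet> j\<bar> <= N (v n - x) * N j"
     using Cauchy_Schwarz_ineq2[of "v n - x" j] norm_le_N[OF d] norm_le_N[OF j]
      mult_mono[of "norm (v n - x)" "N (v n - x)" "norm j" "N j"] N_nonneg[OF d] by simp
    moreover have "\<bar>h * a (v n - x) j\<bar> <= h * (N (v n - x) * N j)"
     using a_le_N[OF d j] h by (simp add: abs_mult)
    ultimately show ?thesis using q.diff_left[of "v n" x j] vV xV j by (simp add: Q_def algebra_simps)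
   qed
   thus "\<forall>\<^sub>F n in sequentially. norm (Q h (v n) j - Q h x j) <= (1 + h) * (N (v n - x) * N j)"
    by simp
   show "(%n. (1 + h) * (N (v n - x) * N j)) ----> 0"
    using N0 by (auto intro!: tendsto_eq_intros)
  qed
  \<comment> \<open>First variation at the minimiser: \<open>J (v k + t *R j)\<close> stays above
    \<open>m\<close>, while \<open>J (v k)\<close> exceeds \<open>m\<close> by an error that
    vanishes as \<open>k\<close> grows.\<close>
  have quad: "0 <= 2 * t * r + t^2 * Q h j j" for t
  proof -
   have "- inverse (Suc k) <= 2 * t * (Q h (v k) j - g \<bullet> j) + t^2 * Q h j j" for k
   proof -
    have "J (v k + t *R j) = J (v k) + 2 * t * (Q h (v k) j - g \<bullet> j) + t^2 * Q h j j"
     using q.square_add[of "v k" "t *R j"] q.square_scale[OF j, of t] q.scale_right[of j "v k" t]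
      vV j V_scale by (simp add: J_def algebra_simps)
    moreover have "m <= J (v k + t *R j)" by (intro m_le V_add V_scale vV j)
    ultimately show ?thesis using vJ[of k] by simp
   qed
   moreover have "(%k. - inverse (real (Suc k))) ----> - 0"
    by (intro tendsto_intros LIMSEQ_inverse_real_of_nat)
   moreover have "(%k. 2 * t * (Q h (v k) j - g \<bullet> j) + t^2 * Q h j j) ----> 2 * t * r + t^2 * Q h j j"
    unfolding r_def by (intro tendsto_intros Qlim)
   ultimately show ?thesis using LIMSEQ_le[of "%k. - inverse (real (Suc k))" "-0"] by auto
  qed
  have "r = 0"
  proof (rule ccontr)
   assume r: "r ~= 0"
   define K where "K = Q h j j + 1"
   have K: "K > 0" using q.nonneg[OF j] by (simp add: K_def)
   \<comment> \<open>The 1 added in \<open>K\<close> leaves a strictly negative remainder: the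
     quadratic equals \<open>t * r - t^2\<close> here.\<close>
   define t where "t = - r / K"
   hence "t^2 * K = - (t * r)" by (simp add: power2_eq_square)
   hence "2 * t * r + t^2 * Q h j j = t * r - t^2" by (simp add: K_def algebra_simps)
   moreover have "t * r < 0" using r K by (simp add: t_def power2_eq_square[symmetric])
   ultimately show False using quad[of t] zero_le_power2[of t] by linarith
  qed
  thus ?thesis by (simp add: r_def)
 qed
 with xV show ?thesis by blast
qed

lemma resolvent_unique:
 assumes h: "h > 0" and "v \<in> V" "w \<in> V" and "!!g. g \<in> V ==> Q h v g = Q h w g"
 shows "v = w"
proof -
 interpret q: semi_inner_form V "Q h" by (rule semi_inner_Q) (use h in simp)
 have d: "v - w \<in> V" using assms V_diff by blast
 hence "Q h (v - w) (v - w) = 0" using assms q.diff_left[of v w "v - w"] by simp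
 moreover have "(v - w) \<bullet> (v - w) <= Q h (v - w) (v - w)" using nonneg[OF d] h by (simp add: Q_def)
 ultimately show ?thesis by (metis inner_gt_zero_iff right_minus_eq not_le)
qed

text \<open>The resolvent \<open>(1 + h A)^-1\<close>, defined weakly through the form.\<close>

definition R :: "real => 'h => 'h" where
 "R h g = (SOME v. v \<in> V \<and> (ALL q:V. Q h v q = g \<bullet> q))"

text \<open>The Yosida approximation \<open>A (1 + h A)^-1\<close>, bounded for each
  \<open>h > 0\<close>. The formula avoids \<open>A\<close>; \<open>a_R\<close> shows that it
  represents the functional \<open>a (R h g)\<close>.\<close>

definition B :: "real => 'h => 'h" where
 "B h g = (1 / h) *R (g - R h g)"

lemma R_in_V: "h > 0 ==> R h g \<in> V"
 and Q_R: "h > 0 ==> q \<in> V ==> Q h (R h g) q = g \<bullet> q"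
 using someI_ex[of "%v. v \<in> V \<and> (ALL q:V. Q h v q = g \<bullet> q)"] resolvent_ex[of h g]
 unfolding R_def by blast+

lemma R_eqI:
 assumes "h > 0" "v \<in> V" "!!q. q \<in> V ==> Q h v q = g \<bullet> q"
 shows "R h g = v"
 using assms Q_R R_in_V by (intro resolvent_unique[of h]) auto

lemma a_R: "h > 0 ==> q \<in> V ==> a (R h g) q = B h g \<bullet> q"
 using Q_R[of h q g] by (simp add: Q_def B_def inner_diff_left field_simps)

lemma R_linear: assumes h: "h > 0" shows "linear (R h)"
proof
 interpret q: semi_inner_form V "Q h" by (rule semi_inner_Q) (use h in simp)
 fix x y :: 'h and c
 show "R h (x + y) = R h x + R h y"
  using h by (intro R_eqI) (auto simp: R_in_V V_add q.add_left Q_R inner_add_left)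
 show "R h (c *R x) = c *R R h x"
  using h by (intro R_eqI) (auto simp: R_in_V V_scale q.scale_left Q_R)
qed

lemma R_energy: "h > 0 ==> (norm (R h g))\<^sup>2 + h * a (R h g) (R h g) = g \<bullet> R h g"
 using Q_R[of h "R h g" g] R_in_V by (simp add: Q_def power2_norm_eq_inner)

lemma R_norm_le: assumes h: "h > 0" shows "norm (R h g) <= norm g"
proof -
 have "norm (R h g) * norm (R h g) <= norm g * norm (R h g)"
  using R_energy[OF h, of g] nonneg[OF R_in_V[OF h, of g]] h norm_cauchy_schwarz[of g "R h g"]
  by (simp add: power2_eq_square)
   (smt (verit) mult_nonneg_nonneg)
 thus ?thesis by (cases "norm (R h g) = 0") auto
qed

lemma R_blin: "h > 0 ==> bounded_linear (R h)"
 using R_linear R_norm_le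
 by (intro bounded_linear_intro[of _ 1]) (auto simp: linear_add linear_scale)

lemma B_blin: "h > 0 ==> bounded_linear (B h)"
 unfolding B_def[abs_def]
 by (intro bounded_linear_const_scaleR bounded_linear_sub bounded_linear_ident R_blin)

lemma a_R_le: assumes h: "h > 0" shows "a (R h g) (R h g) <= (norm g)^2 / h"
proof -
 have "h * a (R h g) (R h g) <= norm g * norm (R h g)"
  using R_energy[OF h, of g] norm_cauchy_schwarz[of g "R h g"] zero_le_power2[of "norm (R h g)"] by linarith
 also have "... <= (norm g)^2" using R_norm_le[OF h] by (simp add: power2_eq_square mult_left_mono)
 finally show ?thesis using h by (simp add: field_simps)
qed

lemma R_sym: assumes h: "h > 0" shows "R h x \<bullet> y = x \<bullet> R h y"
proof -
 interpret q: semi_inner_form V "Q h" by (rule semi_inner_Q) (use h in simp)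
 have "x \<bullet> R h y = Q h (R h x) (R h y)" using Q_R[OF h R_in_V[OF h]] by simp
 also have "... = Q h (R h y) (R h x)" using q.sym R_in_V[OF h] by blast
 finally show ?thesis using Q_R[OF h R_in_V[OF h]] by (simp add: inner_commute)
qed

lemma B_sym: "h > 0 ==> B h x \<bullet> y = x \<bullet> B h y"
 using R_sym[of h x y] by (simp add: B_def inner_diff_left inner_diff_right)

lemma B_norm_le: assumes h: "h > 0" shows "norm (B h g) <= 2 / h * norm g"
proof -
 have "(1 / h) * norm (g - R h g) <= (1 / h) * (2 * norm g)" using norm_triangle_ineq4[of g "R h g"] R_norm_le[OF h, of g] h by (intro mult_left_mono) auto
 thus ?thesis using h unfolding B_def by simp
qed

lemma B_nonneg: assumes h: "h > 0" shows "0 <= B h x \<bullet> x"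
proof -
 show ?thesis using norm_cauchy_schwarz[of "R h x" x] R_norm_le[OF h, of x] mult_right_mono[of "norm (R h x)" "norm x" "norm x"] h by (simp add: power2_norm_eq_inner[symmetric] power2_eq_square B_def inner_diff_left)
qed

text \<open>\<open>R h\<close> undoes \<open>1 + h A\<close>, and \<open>A (R k g)\<close> is
  \<open>B k g\<close>.\<close>

lemma R_split: assumes h: "h > 0" and k: "k > 0" shows "R k g = R h (R k g) + h *R R h (B k g)"
proof -
 have "R h (R k g + h *R B k g) = R k g"
  using R_in_V[OF k] a_R[OF k, of _ g] by (intro R_eqI h) (auto simp: Q_def inner_add_left)
 thus ?thesis using R_linear[OF h] by (simp add: linear_add linear_scale)
qed

text \<open>Both sides are \<open>A\<close> combined with the two resolvents. The identity moves a
  parameter off the Yosida operator, which is how limits in that parameter are taken.\<close>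

lemma B_R_swap: assumes h: "h > 0" and k: "k > 0" shows "B h (R k g) = R h (B k g)"
proof -
 have "R k g - R h (R k g) = h *R R h (B k g)" using R_split[OF h k, of g] by (metis add_diff_cancel_left')
 thus ?thesis using h by (simp add: B_def[of h])
qed

text \<open>The resolvent identity. The explicit factor \<open>h - k\<close> is the source of the
  Cauchy estimate for the Yosida approximations.\<close>

lemma R_minus_R: assumes h: "h > 0" and k: "k > 0"
 shows "R k g - R h g = (h - k) *R R h (B k g)"
proof -
 have g: "g = R k g + k *R B k g" using k by (simp add: B_def)
 have "R h g = R h (R k g) + k *R R h (B k g)"
  by (subst g) (use R_linear[OF h] in "simp only: linear_add linear_scale")
 thus ?thesis using R_split[OF h k, of g] by (simp add: algebra_simps)
qed

text \<open>The resolvent identity is written in both orders of \<open>h\<close> and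
  \<open>k\<close>. The two composites agree after multiplication by \<open>h - k\<close>, hence the
  separate case of equal parameters.\<close>

lemma R_commute: assumes h: "h > 0" and k: "k > 0" shows "R h (R k g) = R k (R h g)"
proof (cases "h = k")
 case False
 have A: "R k g - R h g = (h - k) *R R h (B k g)" by (rule R_minus_R[OF h k])
 have B': "R h g - R k g = (k - h) *R R k (B h g)" by (rule R_minus_R[OF k h])
 have "k *R R h (B k g) = R h g - R h (R k g)"
  using R_linear[OF h] k by (simp add: B_def[of k] linear_diff linear_scale)
 hence "k *R (R k g - R h g) = (h - k) *R (R h g - R h (R k g))"
  unfolding A by (metis scaleR_left_commute)
 hence 1: "(h - k) *R R h (R k g) = (h - k) *R R h g - k *R (R k g - R h g)"
  by (simp add: scaleR_diff_right)
 have "h *R R k (B h g) = R k g - R k (R h g)"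
  using R_linear[OF k] h by (simp add: B_def[of h] linear_diff linear_scale)
 hence "h *R (R h g - R k g) = (k - h) *R (R k g - R k (R h g))"
  unfolding B' by (metis scaleR_left_commute)
 hence 2: "(k - h) *R R k (R h g) = (k - h) *R R k g - h *R (R h g - R k g)"
  by (simp add: scaleR_diff_right)
 have "(h - k) *R R h (R k g) = h *R R h g - k *R R k g"
  using 1 by (simp add: algebra_simps)
 moreover have "(h - k) *R R k (R h g) = h *R R h g - k *R R k g"
  using arg_cong[OF 2, of uminus] by (simp add: algebra_simps)
 ultimately have "(h - k) *R R h (R k g) = (h - k) *R R k (R h g)" by simp
 with False show ?thesis by simp
qed simp

text \<open>Testing the resolvent equation with \<open>R h x - x\<close> itself gives a rate in
  \<open>h\<close> on the form domain.\<close>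

lemma R_approx_V:
 assumes h: "h > 0" and x: "x \<in> V" shows "(norm (R h x - x))^2 <= h * a x x"
proof -
 let ?d = "R h x - x"
 have dV: "?d \<in> V" using R_in_V[OF h] x V_diff by blast
 have "Q h (R h x) ?d = x \<bullet> ?d" by (rule Q_R[OF h dV])
 hence "(norm ?d)^2 + h * a (R h x) ?d = 0"
  by (simp add: Q_def power2_norm_eq_inner inner_diff_left)
 moreover have "a (R h x) ?d = a ?d ?d + a x ?d"
  using diff_left[of "R h x" x ?d] R_in_V[OF h] x dV by simp
 moreover have "- (h * a x ?d) <= h * (a x x + a ?d ?d)"
 proof -
  have "h * (- a x ?d) <= h * (a x x + a ?d ?d)" using twice_abs_le[OF x dV] h by (intro mult_left_mono) auto
  thus ?thesis by simp
 qed
 ultimately show ?thesis by (simp add: algebra_simps)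
qed

end

locale hilbert_form = closed_form V a
 for V :: "'h::{real_inner,banach} set" and a :: "'h => 'h => real" +
 assumes dense_V: "closure V = UNIV"
begin

abbreviation rs :: "nat => real" where "rs k \<equiv> inverse (real (Suc k))"

text \<open>Convergence on the dense set \<open>V\<close> and the uniform bound
  \<open>R_norm_le\<close> give strong convergence everywhere.\<close>

lemma R_tendsto: "(%k. R (rs k) x) ----> x"
proof (rule LIMSEQ_I)
 fix e :: real assume e: "e > 0"
 obtain y where y: "y \<in> V" "dist y x < e / 3"
  using dense_V closure_approachable[of x V] e by (metis UNIV_I divide_pos_pos zero_less_numeral)
 have "(%k. rs k * a y y) ----> 0 * a y y"
  by (intro tendsto_intros LIMSEQ_inverse_real_of_nat)
 then obtain M where M: "!!k. k >= M ==> rs k * a y y < (e/3)^2"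
  using order_tendstoD(2)[of _ 0 sequentially "(e/3)^2"] e by (auto simp: eventually_sequentially)
 have "norm (R (rs k) x - x) < e" if "k >= M" for k
 proof -
  have "(norm (R (rs k) y - y))^2 < (e/3)^2"
   using R_approx_V[of "rs k" y] y M[OF that] by simp
  hence 1: "norm (R (rs k) y - y) < e / 3" by (rule power_less_imp_less_base) (use e in simp)
  have 2: "norm (R (rs k) (x - y)) < e / 3"
   using R_norm_le[of "rs k" "x - y"] y(2) by (simp add: dist_norm norm_minus_commute)
  show ?thesis using R_linear[of "rs k"] norm_triangle_ineq[of "R (rs k) (x - y) + (R (rs k) y - y)" "y - x"]
    norm_triangle_ineq[of "R (rs k) (x - y)" "R (rs k) y - y"] 1 2 y(2) by (simp add: linear_diff dist_norm)
 qed
 thus "EX M. ALL k>=M. norm (R (rs k) x - x) < e" by blast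
qed

end

section \<open>Integrals of curves and linear differential equations\<close>

lemma int_initial:
 fixes f :: "real => 'b::banach"
 assumes "C0 r f" "t \<in> {0..r}"
 shows "f integrable_on {0..t}"
 using assms by (intro integrable_continuous_interval) (auto intro: continuous_on_subset)

lemma cont_int0:
 fixes f :: "real => 'b::banach"
 assumes "C0 r f"
 shows "C0 r (%t. I0 t f)"
 by (rule indefinite_integral_continuous_1) (use assms in "rule integrable_continuous_interval")

lemma int_blin:
 fixes f :: "real => 'b::banach"
 assumes "C0 r f" "t \<in> {0..r}" "bounded_linear P"
 shows "I0 t (%s. P (f s)) = P (I0 t f)"
 using integral_linear[OF int_initial[OF assms(1,2)] assms(3)] by (simp add: o_def)

lemma integral_uniform_tendsto:
 fixes f :: "nat => real => 'b::banach"
 assumes "uniform_limit {0..r} f g sequentially" "!!n. C0 r (f n)" "t \<in> {0..r}"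
 shows "(%n. I0 t (f n)) ----> I0 t g"
proof -
 have u: "uniform_limit {0..t} f g sequentially"
  using assms(3) by (intro uniform_limit_on_subset[OF assms(1)]) auto
 have c: "C0 t (f n)" for n
  using assms(3) by (intro continuous_on_subset[OF assms(2)]) auto
 obtain I J where IJ: "!!n. (f n has_integral I n) {0..t}" "(g has_integral J) {0..t}" "I ----> J"
  by (rule uniform_limit_integral[OF u c, of thesis]) auto
 hence "I0 t (f n) = I n" "I0 t g = J" for n by auto
 with IJ(3) show ?thesis by simp
qed

lemma norm_integral_initial_le:
 fixes f :: "real => 'b::banach"
 assumes "C0 r f" "t \<in> {0..r}" "!!s. s \<in> {0..t} ==> norm (f s) <= M"
 shows "norm (I0 t f) <= M * t"
proof -
 have "norm (I0 t f) <= I0 t (%s. M)"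
  by (rule integral_norm_bound_integral) (use int_initial[OF assms(1,2)] assms(3) in auto)
 thus ?thesis using assms(2) by (simp add: mult.commute)
qed

lemma integral_initial_le:
 fixes f :: "real => real"
 assumes "C0 r f" "t \<in> {0..r}" "!!s. s \<in> {0..t} ==> f s <= M"
 shows "I0 t f <= M * t"
proof -
 have "I0 t f <= I0 t (%s. M)"
  by (rule integral_le) (use int_initial[OF assms(1,2)] assms(3) in auto)
 thus ?thesis using assms(2) by (simp add: mult.commute)
qed

text \<open>A contraction in the weighted norm \<open>sup (exp (- 2 K t) * norm (y t))\<close>, where \<open>K\<close> bounds \<open>L\<close>.\<close>

lemma linear_ode_solvable:
 fixes L :: "'b::banach => 'b" and F :: "real => 'b"
 assumes L: "bounded_linear L" and F: "C0 r F" and r: "0 <= r"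
 shows "EX y. C0 r y \<and> (ALL t:{0..r}. y t = y0 + I0 t (%s. L (y s) + F s))"
proof -
 obtain K where K: "K > 0" "!!x. norm (L x) <= norm x * K"
  using bounded_linear.pos_bounded[OF L] by blast
 define l where "l = 2 * K"
 \<comment> \<open>Curves on \<open>{0..r}\<close> are treated inside the Banach space of bounded
   continuous functions on the whole line by freezing time outside the interval.\<close>
 define cl where "cl t = max 0 (min r t)" for t
 have clc: "continuous_on UNIV cl" unfolding cl_def by (intro continuous_intros)
 have clr: "cl t \<in> {0..r}" for t using r by (auto simp: cl_def)
 have clid: "cl t = t" if "t \<in> {0..r}" for t using that by (auto simp: cl_def)
 \<comment> \<open>The unknown \<open>z\<close> is the solution multiplied by
   \<open>exp (- l * t)\<close>, so its plain supremum norm is the weighted one; the factor 2 in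
   \<open>l\<close> gives the contraction constant 1/2.\<close>
 define T where "T z t = exp (- l * t) *R (y0 + I0 t (%s. exp (l * s) *R L (z s) + F s))"
  for z and t
 have Lc: "continuous_on S (%s. L (z s))" if "continuous_on S z" for S and z
  by (rule bounded_linear.continuous_on[OF L that])
 have ic: "C0 r (%s. exp (l * s) *R L (z s) + F s)" if "C0 r z" for z
  by (intro continuous_intros Lc[OF that] F)
 have Tc: "C0 r (T z)" if "C0 r z" for z
  unfolding T_def by (intro continuous_intros cont_int0 ic that)
 have Tb: "(%t. T z (cl t)) \<in> bcontfun" if z: "C0 r z" for z
 proof -
  have "bounded (T z ` {0..r})" by (intro compact_imp_bounded compact_continuous_image Tc z) auto
  then obtain b where b: "ALL x : T z ` {0..r}. norm x <= b" unfolding bounded_iff by blast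
  have "norm (T z (cl t)) <= b" for t using b clr[of t] by blast
  moreover have "continuous_on UNIV (%t. T z (cl t))"
   using clr by (intro continuous_on_compose2[OF Tc[OF z] clc]) auto
  ultimately show ?thesis by (intro bcontfun_normI)
 qed
 define g where "g z = Bcontfun (%t. T (apply_bcontfun z) (cl t))" for z
 have g: "apply_bcontfun (g z) t = T (apply_bcontfun z) (cl t)" for z t
  unfolding g_def by (subst Bcontfun_inverse) (auto intro!: Tb)
 have "dist (g z) (g w) <= (1/2) * dist z w" for z w
 proof (rule dist_bound)
  fix t0
  define t where "t = cl t0"
  have t: "t \<in> {0..r}" unfolding t_def by (rule clr)
  let ?f = "%s. exp (l * s) *R L (apply_bcontfun z s - apply_bcontfun w s)"
  have fc: "C0 r ?f" by (intro continuous_intros Lc) auto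
  have "apply_bcontfun (g z) t0 - apply_bcontfun (g w) t0 = exp (- l * t) *R I0 t ?f"
  proof -
   have "I0 t ?f = I0 t (%s. (exp (l * s) *R L (z s) + F s) - (exp (l * s) *R L (w s) + F s))"
    by (rule integral_cong) (simp add: linear_diff[OF bounded_linear.linear[OF L]] scaleR_diff_right)
   also have "... = I0 t (%s. exp (l * s) *R L (z s) + F s) - I0 t (%s. exp (l * s) *R L (w s) + F s)"
    by (intro integral_diff int_initial[OF _ t] ic) auto
   finally show ?thesis by (simp add: g t_def T_def scaleR_diff_right scaleR_add_right)
  qed
  moreover have "norm (I0 t ?f) <= I0 t (%s. K * dist z w * exp (l * s))"
  proof (rule integral_norm_bound_integral)
   show "?f integrable_on {0..t}" by (rule int_initial[OF fc t])
   show "(%s. K * dist z w * exp (l * s)) integrable_on {0..t}"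
    by (intro integrable_continuous_interval continuous_intros)
   fix s
   have "norm (?f s) <= exp (l * s) * (norm (apply_bcontfun z s - apply_bcontfun w s) * K)" using K(2) by simp
   also have "... <= exp (l * s) * (dist z w * K)"
    using K(1) dist_bounded[of z s w] by (intro mult_left_mono) (auto simp: dist_norm)
   finally show "norm (?f s) <= K * dist z w * exp (l * s)" by (simp add: mult_ac)
  qed
  moreover have "I0 t (%s. K * dist z w * exp (l * s)) = dist z w / 2 * (exp (l * t) - 1)"
  proof -
   have "((%s. K * dist z w * exp (l * s)) has_integral dist z w / 2 * exp (l * t) - dist z w / 2 * exp (l * 0)) {0..t}"
    using t unfolding l_def
    by (intro fundamental_theorem_of_calculus)
     (auto intro!: derivative_eq_intros simp: has_real_derivative_iff_has_vector_derivative[symmetric])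
   from integral_unique[OF this] show ?thesis
    by (simp only: right_diff_distrib mult_zero_right exp_zero)
  qed
  ultimately have n: "norm (apply_bcontfun (g z) t0 - apply_bcontfun (g w) t0) = exp (- l * t) * norm (I0 t ?f)"
    and le: "norm (I0 t ?f) <= dist z w / 2 * (exp (l * t) - 1)"
   by (simp_all only: norm_scaleR abs_exp_cancel)
  have factor: "x * (d / 2 * (y - 1)) = d / 2 * (x * y - x)" for x y d :: real by (simp add: field_simps)
  have "exp (- l * t) * norm (I0 t ?f) <= exp (- l * t) * (dist z w / 2 * (exp (l * t) - 1))"
   using le by simp
  also have "... = dist z w / 2 * (exp (- l * t) * exp (l * t) - exp (- l * t))" by (rule factor)
  also have "... = dist z w / 2 * (1 - exp (- l * t))" by (simp add: exp_add[symmetric])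
  also have "... <= dist z w / 2 * 1" by (intro mult_left_mono) auto
  finally show "dist (apply_bcontfun (g z) t0) (apply_bcontfun (g w) t0) <= (1/2) * dist z w"
   unfolding dist_norm[of "apply_bcontfun (g z) t0"] n by simp
 qed
 hence "\<exists>!z. g z = z" by (intro banach_fix_type[of "1/2"]) simp_all
 then obtain z where z: "g z = z" by blast
 have cancel: "exp (l * t) *R exp (- l * t) *R x = x" for t and x :: 'b
  by (simp add: exp_add[symmetric])
 define y where "y t = exp (l * t) *R apply_bcontfun z t" for t
 have "y t = y0 + I0 t (%s. L (y s) + F s)" if t: "t \<in> {0..r}" for t
 proof -
  have "y t = y0 + I0 t (%s. exp (l * s) *R L (apply_bcontfun z s) + F s)" using g[of z t] clid[OF t] z unfolding y_def T_def by (simp only: cancel)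
  thus ?thesis unfolding y_def by (simp only: linear_scale[OF bounded_linear.linear[OF L]])
 qed
 moreover have "C0 r y" unfolding y_def by (intro continuous_intros continuous_on_apply_bcontfun)
 ultimately show ?thesis by blast
qed

lemma norm_square_ode:
 fixes z G :: "real => 'h::{real_inner,banach}"
 assumes G: "C0 r G" and z: "!!t. t \<in> {0..r} ==> z t = z0 + I0 t G"
  and t: "t \<in> {0..r}"
 shows "(norm (z t))^2 = (norm z0)^2 + 2 * I0 t (%s. G s \<bullet> z s)"
proof -
 have dz: "(z has_vector_derivative G s) (at s within {0..r})" if s: "s \<in> {0..r}" for s
 proof -
  have "((%t. z0 + I0 t G) has_vector_derivative (0 + G s)) (at s within {0..r})"
   by (rule has_vector_derivative_add[OF has_vector_derivative_const integral_has_vector_derivative[OF G s]])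
  thus ?thesis
   using has_vector_derivative_transform[OF s, of z "%t. z0 + I0 t G" "0 + G s"] z by simp
 qed
 have "((%s. 2 * (G s \<bullet> z s)) has_integral z t \<bullet> z t - z 0 \<bullet> z 0) {0..t}"
 proof (rule fundamental_theorem_of_calculus)
  show "0 <= t" using t by simp
  fix s assume s: "s \<in> {0..t}"
  have d: "(z has_vector_derivative G s) (at s within {0..t})"
   using has_vector_derivative_within_subset[OF dz[of s], of "{0..t}"] s t by auto
  have "((%s. z s \<bullet> z s) has_vector_derivative (z s \<bullet> G s + G s \<bullet> z s)) (at s within {0..t})"
   by (rule bounded_bilinear.has_vector_derivative[OF bounded_bilinear_inner d d])
  thus "((%s. z s \<bullet> z s) has_vector_derivative (2 * (G s \<bullet> z s))) (at s within {0..t})"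
   by (simp add: inner_commute)
 qed
 hence "I0 t (%s. 2 * (G s \<bullet> z s)) = z t \<bullet> z t - z 0 \<bullet> z 0" by blast
 moreover have "z 0 = z0" using z[of 0] t by auto
 ultimately show ?thesis by (simp add: power2_norm_eq_inner)
qed

lemma quadratic_self_bound:
 fixes m :: real
 assumes "m^2 <= b^2 + 2 * c * m" "0 <= b" "0 <= c"
 shows "m <= b + 2 * c"
proof -
 have "(m - c)^2 <= b^2 + c^2" using assms(1) by (simp add: power2_diff mult_ac)
 also have "... <= (b + c)^2" using assms by (simp add: power2_sum)
 finally have "m - c <= b + c" by (rule power2_le_imp_le) (use assms in auto)
 thus ?thesis by simp
qed

text \<open>The hypothesis \<open>le\<close> contains a bound \<open>m\<close> of the whole curve on
  its right-hand side. Read at a time where the norm is largest, it becomes a quadratic inequality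
  for that maximum, which \<open>quadratic_self_bound\<close> solves.\<close>

lemma dissipative_bound:
 fixes y F :: "real => 'h::{real_inner,banach}"
 assumes y: "C0 l y" and t: "t \<in> {0..l}" and M: "0 <= M"
  and le: "!!t m. t \<in> {0..l} ==> (!!s. s \<in> {0..l} ==> norm (y s) <= m) ==>
   (norm (y t))^2 <= b^2 + 2 * (M * m * t)"
  and b: "0 <= b"
 shows "norm (y t) <= b + 2 * l * M"
proof -
 have "EX r:{0..l}. ALL s:{0..l}. norm (y s) <= norm (y r)"
  using t by (intro continuous_attains_sup continuous_on_norm y) auto
 then obtain r where r: "r \<in> {0..l}" "!!s. s \<in> {0..l} ==> norm (y s) <= norm (y r)" by blast
 have "(norm (y r))^2 <= b^2 + 2 * (M * norm (y r) * r)" by (rule le[OF r])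
 also have "... <= b^2 + 2 * (M * norm (y r) * l)" using r(1) M by (intro add_left_mono mult_left_mono) auto
 finally have "(norm (y r))^2 <= b^2 + 2 * (l * M) * norm (y r)" by (simp add: mult_ac)
 hence "norm (y r) <= b + 2 * (l * M)" by (rule quadratic_self_bound) (use b M t in auto)
 thus ?thesis using r(2)[OF t] by simp
qed

section \<open>Mild solutions and the energy identity\<close>

context hilbert_form
begin

lemma cont_BL: "bounded_linear P ==> continuous_on S y ==> continuous_on S (%s. P (y s))"
 by (rule bounded_linear.continuous_on)

text \<open>\<open>P\<close> and \<open>C\<close> stand for \<open>R h\<close> and
  \<open>B h\<close>, but also for differences of two such pairs; the second choice yields the
  Cauchy property of regularised primitives. \<open>P y\<close> solves a differential equation with
  continuous right-hand side, to which \<open>norm_square_ode\<close> applies.\<close>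

lemma energy_identity:
 fixes y F :: "real => 'h"
 assumes P: "bounded_linear P" and C: "bounded_linear C" and PV: "!!x. P x \<in> V"
  and aC: "!!x g. g \<in> V ==> a (P x) g = C x \<bullet> g"
  and y: "C0 r y" and F: "C0 r F"
  and eq: "!!t. t \<in> {0..r} ==> P (y t) + C (I0 t y) = P y0 + P (I0 t F)"
  and t: "t \<in> {0..r}"
 shows "(norm (P (y t)))^2 + 2 * I0 t (%s. a (P (y s)) (P (y s)))
  = (norm (P y0))^2 + 2 * I0 t (%s. P (F s) \<bullet> P (y s))"
proof -
 let ?G = "%s. P (F s) - C (y s)"
 have c: "C0 r ?G" by (intro continuous_intros cont_BL[OF P] cont_BL[OF C] y F)
 have z: "P (y t) = P y0 + I0 t ?G" if t: "t \<in> {0..r}" for t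
 proof -
  have I: "I0 t ?G = P (I0 t F) - C (I0 t y)"
   using integral_diff[OF int_initial[OF cont_BL[OF P F] t] int_initial[OF cont_BL[OF C y] t]]
    int_blin[OF F t P] int_blin[OF y t C] by simp
  show ?thesis using eq[OF t] unfolding I by (simp only: add_diff_eq eq_diff_eq)
 qed
 have "(norm (P (y t)))^2 = (norm (P y0))^2 + 2 * I0 t (%s. ?G s \<bullet> P (y s))"
  by (rule norm_square_ode[OF c z t])
 also have "I0 t (%s. ?G s \<bullet> P (y s))
   = I0 t (%s. P (F s) \<bullet> P (y s) - C (y s) \<bullet> P (y s))"
  by (simp add: inner_diff_left)
 also have "... = I0 t (%s. P (F s) \<bullet> P (y s)) - I0 t (%s. C (y s) \<bullet> P (y s))"
  by (intro integral_diff int_initial[OF _ t] continuous_on_inner cont_BL[OF P] cont_BL[OF C] y F)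
 finally show ?thesis using aC PV by simp
qed

text \<open>The problem \<open>y' + A y = F\<close>, \<open>y 0 = y0\<close>, integrated in time and
  hit with \<open>R h\<close>. The values of \<open>y\<close> may lie outside the form domain, so
  \<open>A\<close> occurs only through \<open>R h A = B h\<close>, applied to the primitive of
  \<open>y\<close>. The limit of small \<open>h\<close> recovers the curve itself.\<close>

definition mild :: "real => 'h => (real => 'h) => (real => 'h) => bool" where
 "mild r y0 F y \<longleftrightarrow> C0 r F \<and> C0 r y \<and>
  (ALL h>0. ALL t:{0..r}. R h (y t) + B h (I0 t y) = R h y0 + R h (I0 t F))"

lemma mildD:
 assumes "mild r y0 F y"
 shows "C0 r F" "C0 r y"
  "h > 0 ==> t \<in> {0..r} ==> R h (y t) + B h (I0 t y) = R h y0 + R h (I0 t F)"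
 using assms by (auto simp: mild_def)

lemma mild_initial: "mild t y0 F y ==> 0 <= t ==> y 0 = y0"
proof -
 assume m: "mild t y0 F y" and "0 <= t"
 hence "R (rs k) (y 0) = R (rs k) y0" for k
  using mildD(3)[OF m, of "rs k" 0] bounded_linear.linear[OF B_blin[of "rs k"]]
   R_linear[of "rs k"] by (simp add: linear_0)
 thus ?thesis using R_tendsto[of "y 0"] R_tendsto[of y0] by (simp add: LIMSEQ_unique)
qed

lemma mild_diff:
 assumes 1: "mild r y0 F y" and 2: "mild r z0 G z"
 shows "mild r (y0 - z0) (%s. F s - G s) (%s. y s - z s)"
 unfolding mild_def
proof (intro conjI allI impI ballI)
 fix h :: real and t assume h: "h > 0" and t: "t \<in> {0..r}"
 have [simp]: "I0 t (%s. y s - z s) = I0 t y - I0 t z"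
  "I0 t (%s. F s - G s) = I0 t F - I0 t G"
  using mildD[OF 1] mildD[OF 2] by (intro integral_diff int_initial[OF _ t]; blast)+
 show "R h (y t - z t) + B h (I0 t (%s. y s - z s)) = R h (y0 - z0) + R h (I0 t (%s. F s - G s))"
  using mildD(3)[OF 1 h t] mildD(3)[OF 2 h t]
  by (simp add: linear_diff[OF bounded_linear.linear[OF R_blin[OF h]]] linear_diff[OF bounded_linear.linear[OF B_blin[OF h]]] algebra_simps)
qed (intro continuous_on_diff mildD[OF 1] mildD[OF 2])+

lemma R_energy_le:
 assumes m: "mild r y0 F y" and h: "h > 0" and t: "t \<in> {0..r}"
  and M: "!!s. s \<in> {0..r} ==> norm (F s) <= M" and b: "!!s. s \<in> {0..r} ==> norm (y s) <= b"
 shows "(norm (R h (y t)))^2 + 2 * I0 t (%s. a (R h (y s)) (R h (y s))) <= (norm y0)^2 + 2 * (M * b * t)"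
proof -
 note P = R_blin[OF h]
 have "I0 t (%s. R h (F s) \<bullet> R h (y s)) <= M * b * t"
 proof (rule integral_initial_le[OF _ t])
  show "C0 r (%s. R h (F s) \<bullet> R h (y s))"
   by (intro continuous_on_inner cont_BL[OF P] mildD[OF m])
  fix s assume "s \<in> {0..t}"
  hence s: "s \<in> {0..r}" using t by auto
  have "R h (F s) \<bullet> R h (y s) <= norm (R h (F s)) * norm (R h (y s))" by (rule norm_cauchy_schwarz)
  also have "... <= M * b"
   using R_norm_le[OF h, of "F s"] R_norm_le[OF h, of "y s"] M[OF s] b[OF s]
   by (intro mult_mono) (auto intro: order_trans[OF norm_ge_zero])
  finally show "R h (F s) \<bullet> R h (y s) <= M * b" .
 qed
 moreover have "(norm (R h y0))^2 <= (norm y0)^2" using R_norm_le[OF h] by simp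
 moreover have "(norm (R h (y t)))^2 + 2 * I0 t (%s. a (R h (y s)) (R h (y s)))
  = (norm (R h y0))^2 + 2 * I0 t (%s. R h (F s) \<bullet> R h (y s))"
  by (rule energy_identity[OF P B_blin[OF h] R_in_V[OF h] a_R[OF h] mildD(2,1)[OF m] mildD(3)[OF m h] t])
 ultimately show ?thesis by linarith
qed

lemma integral_a_R_nonneg:
 fixes y :: "real => 'h"
 assumes "C0 r y" "h > 0" "t \<in> {0..r}"
 shows "0 <= I0 t (%s. a (R h (y s)) (R h (y s)))"
proof (rule Henstock_Kurzweil_Integration.integral_nonneg)
 have "C0 r (%s. B h (y s) \<bullet> R h (y s))"
  by (intro continuous_on_inner cont_BL[OF R_blin[OF assms(2)]] cont_BL[OF B_blin[OF assms(2)]] assms(1))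
 thus "(%s. a (R h (y s)) (R h (y s))) integrable_on {0..t}"
  using int_initial[OF _ assms(3)] a_R[OF assms(2) R_in_V[OF assms(2)]] by simp
qed (use nonneg R_in_V assms in auto)

text \<open>The energy inequality for \<open>R h y\<close> is stripped of its nonnegative form term
  and \<open>h\<close> is sent to 0; \<open>dissipative_bound\<close> then removes the supremum of
  \<open>y\<close>. Applied to differences, this is uniqueness of mild solutions and their
  continuous dependence on the data.\<close>

lemma mild_bound:
 assumes m: "mild r y0 F y" and t: "t \<in> {0..r}" and M: "!!s. s \<in> {0..r} ==> norm (F s) <= M"
 shows "norm (y t) <= norm y0 + 2 * r * M"
proof (rule dissipative_bound[OF mildD(2)[OF m] t])
 show "0 <= M" using M[OF t] norm_ge_zero order_trans by blast
 fix t b assume t: "t \<in> {0..r}" and b: "!!s. s \<in> {0..r} ==> norm (y s) <= b"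
 have "(norm (R (rs k) (y t)))^2 <= (norm y0)^2 + 2 * (M * b * t)" for k
  using R_energy_le[OF m _ t M b, of "rs k"] integral_a_R_nonneg[OF mildD(2)[OF m] _ t, of "rs k"] by simp
 moreover have "(%k. (norm (R (rs k) (y t)))^2) ----> (norm (y t))\<^sup>2"
  by (intro tendsto_intros R_tendsto)
 ultimately show "(norm (y t))^2 <= (norm y0)^2 + 2 * (M * b * t)" by (intro LIMSEQ_le_const2) auto
qed auto

end

section \<open>Form-domain regularity of primitives of mild solutions\<close>

context hilbert_form
begin

text \<open>Contractions that converge pointwise converge uniformly on compact sets, here the image
  of the curve, by a finite net.\<close>

lemma R_uniform:
 fixes f :: "real => 'h"
 assumes f: "C0 t f"
 shows "uniform_limit {0..t} (%k s. R (rs k) (f s)) f sequentially"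
 unfolding uniform_limit_iff
proof (intro allI impI)
 fix e :: real assume e: "e > 0"
 have "compact (f ` {0..t})" by (intro compact_continuous_image f) auto
 then obtain K where K: "finite K" "f ` {0..t} \<subseteq> (\<Union>x\<in>K. ball x (e/3))"
  using e unfolding compact_eq_totally_bounded by (meson divide_pos_pos zero_less_numeral)
 have "\<forall>\<^sub>F k in sequentially. dist (R (rs k) x) x < e / 3" for x
  using R_tendsto[of x] e by (intro tendstoD) auto
 hence "\<forall>\<^sub>F k in sequentially. ALL x:K. dist (R (rs k) x) x < e / 3"
  using K(1) by (intro eventually_ball_finite) auto
 thus "\<forall>\<^sub>F k in sequentially. ALL s:{0..t}. dist (R (rs k) (f s)) (f s) < e"
 proof (rule eventually_mono, intro ballI)
  fix k s assume k: "ALL x:K. dist (R (rs k) x) x < e / 3" and s: "s \<in> {0..t}"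
  obtain x where x: "x \<in> K" "dist x (f s) < e / 3" using K(2) s by force
  have "dist (R (rs k) (f s)) (R (rs k) x) <= dist x (f s)"
   using R_norm_le[of "rs k" "f s - x"] linear_diff[OF R_linear[of "rs k"]]
   by (simp add: dist_norm norm_minus_commute)
  moreover have "dist (R (rs k) (f s)) (f s)
    <= dist (R (rs k) (f s)) (R (rs k) x) + dist (R (rs k) x) x + dist x (f s)"
   using dist_triangle[of "R (rs k) (f s)" "f s" x] dist_triangle[of "R (rs k) (f s)" x "R (rs k) x"] by simp
  ultimately show "dist (R (rs k) (f s)) (f s) < e" using x k by fastforce
 qed
qed

text \<open>Cauchy-Schwarz in time for the form of \<open>P y\<close>. The form of the primitive is
  written as an integral of \<open>C (y s) \<bullet> P X\<close>; Young's inequality under the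
  integral leaves the term \<open>A / 2\<close>, which is absorbed on the left.\<close>

lemma form_integral_le:
 fixes y :: "real => 'h"
 assumes P: "bounded_linear P" and C: "bounded_linear C" and PV: "!!x. P x \<in> V"
  and aC: "!!x g. g \<in> V ==> a (P x) g = C x \<bullet> g"
  and y: "C0 r y" and t: "t \<in> {0..r}"
 shows "a (P (I0 t y)) (P (I0 t y)) <= t * I0 t (%s. a (P (y s)) (P (y s)))"
proof (cases "t = 0")
 case True
 thus ?thesis using linear_0[OF bounded_linear.linear[OF P]] zero_left[OF V_zero] by simp
next
 case False
 hence t0: "t > 0" using t by simp
 define X where "X = I0 t y"
 define A where "A = a (P X) (P X)"
 have cq: "C0 r (%s. a (P (y s)) (P (y s)))"
  using aC[OF PV] by (simp add: continuous_on_inner cont_BL[OF P] cont_BL[OF C] y)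
 have cA: "C0 r (%s. C (y s) \<bullet> P X)"
  by (intro continuous_on_inner cont_BL[OF C] y continuous_on_const)
 have "A = C X \<bullet> P X" unfolding A_def by (rule aC[OF PV])
 also have "... = I0 t (%s. C (y s) \<bullet> P X)" using int_blin[OF cont_BL[OF C y] t bounded_linear_inner_left[of "P X"]] unfolding X_def by (simp add: int_blin[OF y t C])
 finally have A: "A = I0 t (%s. C (y s) \<bullet> P X)" .
 have "t * A = I0 t (%s. t * (C (y s) \<bullet> P X))" unfolding A by simp
 also have "... <= I0 t (%s. t^2 / 2 * a (P (y s)) (P (y s)) + A / 2)"
 proof (rule integral_le)
  show "(%s. t * (C (y s) \<bullet> P X)) integrable_on {0..t}"
   by (intro int_initial[OF _ t] continuous_on_mult_left cA)
  show "(%s. t^2 / 2 * a (P (y s)) (P (y s)) + A / 2) integrable_on {0..t}"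
   by (intro int_initial[OF _ t] continuous_on_add continuous_on_mult_left cq continuous_on_const)
  fix s
  show "t * (C (y s) \<bullet> P X) <= t^2 / 2 * a (P (y s)) (P (y s)) + A / 2" using twice_abs_le[OF V_scale[OF PV] PV, of t "y s" X] square_scale[OF PV, of t "y s"]
    scale_left[OF PV PV, of t "y s" X] aC[OF PV] unfolding A_def by simp
 qed
 also have "... = t^2 / 2 * I0 t (%s. a (P (y s)) (P (y s))) + A / 2 * t"
  using t0 by (subst integral_add)
   (auto intro!: int_initial[OF _ t] cq)
 finally have "t * A <= t * (t * I0 t (%s. a (P (y s)) (P (y s))))"
  by (simp add: power2_eq_square mult_ac)
 thus ?thesis using t0 unfolding A_def X_def by simp
qed

text \<open>Completeness supplies a limit in the form norm. Convergence in that norm implies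
  convergence in the ambient one, so the limit can only be \<open>x\<close>.\<close>

lemma R_Cauchy_in_V:
 assumes "!!e. e > 0 ==> EX M. ALL k>=M. ALL l>=M. N (R (rs k) x - R (rs l) x) < e"
 shows "x \<in> V \<and> (%k. N (R (rs k) x - x)) ----> 0"
proof -
 have RV: "R (rs k) x \<in> V" for k by (intro R_in_V) simp
 have "EX z:V. (%n. (R (rs n) x - z) \<bullet> (R (rs n) x - z) + a (R (rs n) x - z) (R (rs n) x - z)) ----> 0"
 proof (rule complete_form[OF RV])
  fix e :: real assume e: "e > 0"
  obtain M where M: "ALL k>=M. ALL l>=M. N (R (rs k) x - R (rs l) x) < sqrt e" using assms[of "sqrt e"] e by auto
  thus "EX M. ALL m>=M. ALL n>=M. (R (rs m) x - R (rs n) x) \<bullet> (R (rs m) x - R (rs n) x)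
    + a (R (rs m) x - R (rs n) x) (R (rs m) x - R (rs n) x) < e" by (auto simp: N_def)
 qed
 then obtain z where z: "z \<in> V"
  and lim: "(%n. (R (rs n) x - z) \<bullet> (R (rs n) x - z) + a (R (rs n) x - z) (R (rs n) x - z)) ----> 0" by blast
 have Nl: "(%n. N (R (rs n) x - z)) ----> 0" using tendsto_real_sqrt[OF lim] by (simp add: N_def)
 have "(%n. R (rs n) x - z) ----> 0"
  by (rule Lim_null_comparison[OF _ Nl]) (use norm_le_N V_diff RV z in auto)
 hence "(%n. R (rs n) x) ----> z" by (rule LIM_zero_cancel)
 with z Nl show ?thesis using R_tendsto LIMSEQ_unique by blast
qed

text \<open>Continuity in the norm \<open>N\<close>, spelled out because the form domain is a set
  and not a type with its own topology.\<close>

definition Vcont :: "real set => (real => 'h) => bool" where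
 "Vcont I u \<longleftrightarrow> (ALL t:I. u t \<in> V \<and> ((%s. N (u s - u t)) ---> 0) (at t within I))"

lemma Vcont_in_V: "Vcont I u ==> t \<in> I ==> u t \<in> V"
 by (simp add: Vcont_def)

lemma eventually_in_V: "Vcont I u ==> \<forall>\<^sub>F s in at t within I. u s \<in> V"
 unfolding eventually_at_filter by (rule always_eventually) (auto simp: Vcont_def)

lemma Vcont_subset: "Vcont I u ==> J \<subseteq> I ==> Vcont J u"
 unfolding Vcont_def by (meson subsetD tendsto_within_subset)

lemma Vcont_cong: "(!!t. t \<in> I ==> u t = v t) ==> Vcont I u \<longleftrightarrow> Vcont I v"
 unfolding Vcont_def
 by (intro ball_cong conj_cong tendsto_cong) (auto simp: eventually_at_filter)

lemma Vcont_continuous_N: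
 assumes "Vcont I u" shows "continuous_on I (%t. N (u t))"
 unfolding continuous_on_def
proof (intro ballI)
 fix t assume t: "t \<in> I"
 have "((%s. N (u s) - N (u t)) ---> 0) (at t within I)"
 proof (rule Lim_null_comparison)
  show "\<forall>\<^sub>F s in at t within I. norm (N (u s) - N (u t)) <= N (u s - u t)"
   using eventually_in_V[OF assms] by eventually_elim (use N_diff_le assms t in "auto simp: Vcont_def")
  show "((%s. N (u s - u t)) ---> 0) (at t within I)" using assms t by (simp add: Vcont_def)
 qed
 thus "((%t. N (u t)) ---> N (u t)) (at t within I)" by (rule LIM_zero_cancel)
qed

lemma Vcont_continuous:
 assumes "Vcont I u" shows "continuous_on I u"
 unfolding continuous_on_def
proof (intro ballI)
 fix t assume t: "t \<in> I"
 have "((%s. u s - u t) ---> 0) (at t within I)"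
 proof (rule Lim_null_comparison)
  show "\<forall>\<^sub>F s in at t within I. norm (u s - u t) <= N (u s - u t)"
   using eventually_in_V[OF assms] by eventually_elim (use norm_le_N V_diff assms t in "auto simp: Vcont_def")
  show "((%s. N (u s - u t)) ---> 0) (at t within I)" using assms t by (simp add: Vcont_def)
 qed
 thus "(u ---> u t) (at t within I)" by (rule LIM_zero_cancel)
qed

lemma Vcont_bounded:
 assumes "Vcont {0..r} u" shows "EX M. ALL t:{0..r}. N (u t) <= M"
proof -
 have "bounded ((%t. N (u t)) ` {0..r})"
  by (intro compact_imp_bounded compact_continuous_image Vcont_continuous_N assms) auto
 then obtain M where "ALL x:(%t. N (u t)) ` {0..r}. norm x <= M" unfolding bounded_iff by blast
 thus ?thesis by (intro exI[of _ M]) auto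
qed

lemma Vcont_add_const: "Vcont I u ==> v \<in> V ==> Vcont I (%t. v + u t)"
 unfolding Vcont_def by (simp add: V_add)

lemma Vcont_scale:
 assumes u: "Vcont I u" and c: "continuous_on I c"
 shows "Vcont I (%t. c t *R u t)"
 unfolding Vcont_def
proof (intro ballI conjI)
 fix t assume t: "t \<in> I"
 thus "c t *R u t \<in> V" using u V_scale by (simp add: Vcont_def)
 show "((%s. N (c s *R u s - c t *R u t)) ---> 0) (at t within I)"
 proof (rule Lim_null_comparison)
  have "norm (N (c s *R u s - c t *R u t)) <= \<bar>c s\<bar> * N (u s - u t) + \<bar>c s - c t\<bar> * N (u t)" if s: "u s \<in> V" for s
  proof -
   have tV: "u t \<in> V" using u t by (simp add: Vcont_def)
   have e: "c s *R u s - c t *R u t = c s *R (u s - u t) + (c s - c t) *R u t" by (simp add: algebra_simps)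
   have "N (c s *R u s - c t *R u t) <= N (c s *R (u s - u t)) + N ((c s - c t) *R u t)"
    unfolding e by (intro N_triangle V_scale V_diff s tV)
   also have "... = \<bar>c s\<bar> * N (u s - u t) + \<bar>c s - c t\<bar> * N (u t)" using N_scale V_diff s tV by simp
   finally show ?thesis using V_diff V_scale s tV by simp
  qed
  thus "\<forall>\<^sub>F s in at t within I. norm (N (c s *R u s - c t *R u t)) <= \<bar>c s\<bar> * N (u s - u t) + \<bar>c s - c t\<bar> * N (u t)"
   using eventually_in_V[OF u] by (rule eventually_mono[rotated])
  have "(c ---> c t) (at t within I)" using c t by (simp add: continuous_on_def)
  hence "((%s. \<bar>c s\<bar> * N (u s - u t) + \<bar>c s - c t\<bar> * N (u t)) ---> \<bar>c t\<bar> * 0 + \<bar>c t - c t\<bar> * N (u t)) (at t within I)"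
   using u t unfolding Vcont_def by (intro tendsto_intros) auto
  thus "((%s. \<bar>c s\<bar> * N (u s - u t) + \<bar>c s - c t\<bar> * N (u t)) ---> 0) (at t within I)" by simp
 qed
qed

lemma N_R_le: assumes h: "h > 0" shows "N (R h x) <= sqrt (1 + 1 / h) * norm x"
proof -
 have "N (R h x) <= sqrt ((norm x)^2 + (norm x)^2 / h)"
  by (intro N_le_sqrt R_in_V R_norm_le a_R_le h)
 also have "(norm x)^2 + (norm x)^2 / h = (1 + 1 / h) * (norm x)^2" by (simp add: algebra_simps)
 finally show ?thesis by (simp add: real_sqrt_mult)
qed

lemma Vcont_R:
 assumes h: "h > 0" and x: "continuous_on I x" shows "Vcont I (%t. R h (x t))"
 unfolding Vcont_def
proof (intro ballI conjI)
 fix t assume t: "t \<in> I"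
 show "R h (x t) \<in> V" by (rule R_in_V[OF h])
 show "((%s. N (R h (x s) - R h (x t))) ---> 0) (at t within I)"
 proof (rule Lim_null_comparison)
  have "norm (N (R h (x s) - R h (x t))) <= sqrt (1 + 1 / h) * norm (x s - x t)" for s
   using N_R_le[OF h, of "x s - x t"] linear_diff[OF R_linear[OF h]] N_nonneg[OF R_in_V[OF h, of "x s - x t"]] by simp
  thus "\<forall>\<^sub>F s in at t within I. norm (N (R h (x s) - R h (x t))) <= sqrt (1 + 1 / h) * norm (x s - x t)" by simp
  have "((%s. sqrt (1 + 1 / h) * norm (x s - x t)) ---> sqrt (1 + 1 / h) * norm (x t - x t)) (at t within I)"
   using x t unfolding continuous_on_def by (intro tendsto_intros) auto
  thus "((%s. sqrt (1 + 1 / h) * norm (x s - x t)) ---> 0) (at t within I)" by simp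
 qed
qed

lemma Vcont_uniform_limit:
 assumes k: "!!k. Vcont I (f k)" and gV: "!!t. t \<in> I ==> g t \<in> V"
  and u: "!!e. e > 0 ==> EX k. ALL t:I. N (f k t - g t) <= e"
 shows "Vcont I g"
 unfolding Vcont_def
proof (intro ballI conjI)
 fix t assume t: "t \<in> I"
 show "g t \<in> V" by (rule gV[OF t])
 show "((%s. N (g s - g t)) ---> 0) (at t within I)"
 proof (rule tendstoI)
  fix e :: real assume e: "e > 0"
  then obtain k where k': "ALL t:I. N (f k t - g t) <= e / 4" using u[of "e / 4"] by auto
  have "\<forall>\<^sub>F s in at t within I. dist (N (f k s - f k t)) 0 < e / 4"
   using k[of k] t e unfolding Vcont_def by (intro tendstoD) auto
  moreover have "\<forall>\<^sub>F s in at t within I. s \<in> I" by (simp add: eventually_at_filter)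
  ultimately show "\<forall>\<^sub>F s in at t within I. dist (N (g s - g t)) 0 < e"
  proof eventually_elim
   case (elim s)
   have V: "g s \<in> V" "g t \<in> V" "f k s \<in> V" "f k t \<in> V" using elim t gV Vcont_in_V[OF k[of k]] by auto
   have "N (g s - g t) <= N (g s - f k s) + (N (f k s - f k t) + N (f k t - g t))"
    using N_triangle3[OF V(1) V(3) V(2)] N_triangle3[OF V(3) V(4) V(2)] by simp
   moreover have "N (g s - f k s) = N (f k s - g s)" using N_minus V by blast
   moreover have "N (f k s - g s) <= e / 4" "N (f k t - g t) <= e / 4" using k' elim t by auto
   ultimately show ?case using elim(1) N_nonneg V_diff V e by simp
  qed
 qed
qed

text \<open>The energy identity for \<open>P = R (rs k) - R (rs l)\<close> has small data, uniformly
  in time, since the resolvents converge uniformly along \<open>F\<close> and \<open>y\<close>. Its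
  form term controls the form of \<open>P\<close> applied to the primitive. The factor
  \<open>exp s\<close> is the integrating factor of \<open>u' + u = y\<close>.\<close>

lemma mild_integral_uniform:
 assumes m: "mild r y0 F y" and r: "0 <= r" and e: "e > 0"
 shows "EX M. ALL k>=M. ALL l>=M. ALL t:{0..r}.
  N (R (rs k) (I0 t (%s. exp s *R y s)) - R (rs l) (I0 t (%s. exp s *R y s))) < e"
proof -
 define X where "X t = I0 t (%s. exp s *R y s)" for t
 have cg: "C0 r (%s. exp s *R y s)" by (intro continuous_intros mildD(2)[OF m])
 have cX: "C0 r X" unfolding X_def by (rule cont_int0[OF cg])
 \<comment> \<open>The constant for which the estimate will end in
   \<open>N (P (X t)) <= sqrt (c * d^2)\<close>; \<open>d\<close> is chosen to make this equal to
   \<open>e / 2\<close>.\<close>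
 define c where "c = 1 + r * (exp (2 * r) * ((1 + 2 * r) / 2))"
 have c1: "c >= 1" using r by (simp add: c_def)
 define d where "d = e / (2 * sqrt c)"
 have d: "d > 0" using e c1 by (simp add: d_def)
 have u: "EX M. ALL k>=M. ALL s:{0..r}. dist (R (rs k) (f s)) (f s) < d / 2" if "C0 r f" for f
  using R_uniform[OF that] d unfolding uniform_limit_iff eventually_sequentially by (meson half_gt_zero)
 obtain M1 where M1: "!!k s. k >= M1 ==> s \<in> {0..r} ==> dist (R (rs k) (F s)) (F s) < d / 2"
  using u[OF mildD(1)[OF m]] by blast
 obtain M2 where M2: "!!k s. k >= M2 ==> s \<in> {0..r} ==> dist (R (rs k) (y s)) (y s) < d / 2"
  using u[OF mildD(2)[OF m]] by blast
 obtain M3 where M3: "!!k s. k >= M3 ==> s \<in> {0..r} ==> dist (R (rs k) (X s)) (X s) < d / 2"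
  using u[OF cX] by blast
 obtain M4 where M4: "!!k s. k >= M4 ==> s \<in> {0..r} ==> dist (R (rs k) y0) y0 < d / 2"
  using u[of "%_. y0"] by auto
 define K where "K = max (max M1 M2) (max M3 M4)"
 have "N (R (rs k) (X t) - R (rs l) (X t)) < e" if kl: "k >= K" "l >= K" and t: "t \<in> {0..r}" for k l t
 proof -
  define P where "P x = R (rs k) x - R (rs l) x" for x
  define C where "C x = B (rs k) x - B (rs l) x" for x
  have P: "bounded_linear P" unfolding P_def[abs_def] by (intro bounded_linear_sub R_blin) auto
  have C: "bounded_linear C" unfolding C_def[abs_def] by (intro bounded_linear_sub B_blin) auto
  have PV: "P x \<in> V" for x unfolding P_def by (intro V_diff R_in_V) auto
  have aC: "a (P x) g = C x \<bullet> g" if "g \<in> V" for x g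
   unfolding P_def C_def using that by (simp add: diff_left R_in_V a_R inner_diff_left)
  have small: "norm (P x) < d" if "dist (R (rs k) x) x < d / 2" "dist (R (rs l) x) x < d / 2" for x
   using that dist_triangle_half_l[of "R (rs k) x" x d "R (rs l) x"] by (simp add: P_def dist_norm)
  have sF: "norm (P (F s)) < d" and sy: "norm (P (y s)) < d" and sX: "norm (P (X s)) < d" and s0: "norm (P y0) < d"
   if "s \<in> {0..r}" for s using M1 M2 M3 M4 that kl unfolding K_def by (auto intro!: small)
  have "(norm (P (y t)))^2 + 2 * I0 t (%s. a (P (y s)) (P (y s)))
    = (norm (P y0))^2 + 2 * I0 t (%s. P (F s) \<bullet> P (y s))"
  proof (rule energy_identity[OF P C PV aC mildD(2,1)[OF m] _ t])
   fix t assume "t \<in> {0..r}"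
   thus "P (y t) + C (I0 t y) = P y0 + P (I0 t F)"
    using mildD(3)[OF m, of "rs k" t] mildD(3)[OF m, of "rs l" t] unfolding P_def C_def
    by (simp add: algebra_simps)
  qed
  moreover have "I0 t (%s. P (F s) \<bullet> P (y s)) <= d * d * t"
  proof (rule integral_initial_le[OF _ t])
   show "C0 r (%s. P (F s) \<bullet> P (y s))"
    by (intro continuous_on_inner cont_BL[OF P] mildD[OF m])
   fix s assume "s \<in> {0..t}"
   hence s: "s \<in> {0..r}" using t by auto
   have "P (F s) \<bullet> P (y s) <= norm (P (F s)) * norm (P (y s))" by (rule norm_cauchy_schwarz)
   also have "... <= d * d" using sF[OF s] sy[OF s] d by (intro mult_mono) auto
   finally show "P (F s) \<bullet> P (y s) <= d * d" .
  qed
  moreover have "d * d * t <= d^2 * r" using t by (simp add: power2_eq_square mult_left_mono)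
  moreover have "(norm (P y0))^2 <= d^2" using s0[OF t] by (intro power_mono) auto
  ultimately have "2 * I0 t (%s. a (P (y s)) (P (y s))) <= d^2 + 2 * (d^2 * r)"
   using zero_le_power2[of "norm (P (y t))"] by linarith
  hence E: "I0 t (%s. a (P (y s)) (P (y s))) <= d^2 * ((1 + 2 * r) / 2)"
   by (simp add: algebra_simps)
  have cq: "C0 r (%s. a (P (y s)) (P (y s)))"
   using aC[OF PV] by (simp add: continuous_on_inner cont_BL[OF P] cont_BL[OF C] mildD[OF m])
  have q: "a (P (exp s *R y s)) (P (exp s *R y s)) = exp (2 * s) * a (P (y s)) (P (y s))" for s
   using square_scale[OF PV, of "exp s" "y s"] linear_scale[OF bounded_linear.linear[OF P]]
   by (simp add: exp_double)
  have "a (P (X t)) (P (X t)) <= t * I0 t (%s. exp (2 * s) * a (P (y s)) (P (y s)))"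
   using form_integral_le[OF P C PV aC cg t] unfolding X_def q .
  also have "... <= t * I0 t (%s. exp (2 * r) * a (P (y s)) (P (y s)))"
   using t nonneg[OF PV]
   by (intro mult_left_mono integral_le int_initial[OF _ t] continuous_intros cq)
    (auto intro!: mult_right_mono)
  also have "... = t * (exp (2 * r) * I0 t (%s. a (P (y s)) (P (y s))))" by simp
  also have "... <= r * (exp (2 * r) * (d^2 * ((1 + 2 * r) / 2)))"
  proof -
   have "0 <= I0 t (%s. a (P (y s)) (P (y s)))"
    by (intro Henstock_Kurzweil_Integration.integral_nonneg int_initial[OF _ t] cq nonneg PV)
   thus ?thesis using t by (intro mult_mono E) auto
  qed
  finally have aX: "a (P (X t)) (P (X t)) <= r * (exp (2 * r) * (d^2 * ((1 + 2 * r) / 2)))" .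
  have "N (P (X t)) <= sqrt (d^2 + r * (exp (2 * r) * (d^2 * ((1 + 2 * r) / 2))))"
   by (intro N_le_sqrt PV aX less_imp_le sX t)
  also have "d^2 + r * (exp (2 * r) * (d^2 * ((1 + 2 * r) / 2))) = c * d^2" by (simp add: c_def algebra_simps)
  finally show ?thesis using c1 e by (simp add: real_sqrt_mult d_def P_def)
 qed
 thus ?thesis unfolding X_def by blast
qed

lemma mild_Vcont:
 assumes m: "mild r y0 F y" and r: "0 <= r"
 shows "Vcont {0..r} (%t. I0 t (%s. exp s *R y s))"
  and "t \<in> {0..r} ==> (%k. N (R (rs k) (I0 t (%s. exp s *R y s)) - I0 t (%s. exp s *R y s))) ----> 0"
proof -
 define X where "X t = I0 t (%s. exp s *R y s)" for t
 have cX: "C0 r X"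
  unfolding X_def by (intro cont_int0 continuous_intros mildD(2)[OF m])
 have lim: "X t \<in> V \<and> (%k. N (R (rs k) (X t) - X t)) ----> 0" if "t \<in> {0..r}" for t
  by (rule R_Cauchy_in_V) (use mild_integral_uniform[OF m r] that in "unfold X_def; meson")
 show "Vcont {0..r} (%t. I0 t (%s. exp s *R y s))" unfolding X_def[symmetric]
 proof (rule Vcont_uniform_limit[where f = "%k t. R (rs k) (X t)"])
  show "Vcont {0..r} (%t. R (rs k) (X t))" for k by (intro Vcont_R cX) simp
  show "X t \<in> V" if "t \<in> {0..r}" for t using lim that by blast
  fix e :: real assume e: "e > 0"
  then obtain M where M: "!!k l t. k >= M ==> l >= M ==> t \<in> {0..r} ==> N (R (rs k) (X t) - R (rs l) (X t)) < e"
   using mild_integral_uniform[OF m r e] unfolding X_def by blast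
  have "N (R (rs M) (X t) - X t) <= e" if t: "t \<in> {0..r}" for t
  proof (rule LIMSEQ_le_const[of "%l. e + N (R (rs l) (X t) - X t)"])
   have "(%l. e + N (R (rs l) (X t) - X t)) ----> e + 0" using lim[OF t] by (intro tendsto_intros) auto
   thus "(%l. e + N (R (rs l) (X t) - X t)) ----> e" by simp
   have "N (R (rs M) (X t) - X t) <= e + N (R (rs l) (X t) - X t)" if "l >= M" for l
    using N_triangle3[of "R (rs M) (X t)" "R (rs l) (X t)" "X t"] M[OF _ that t, of M] lim[OF t] R_in_V by simp
   thus "EX K. ALL l>=K. N (R (rs M) (X t) - X t) <= e + N (R (rs l) (X t) - X t)" by blast
  qed
  thus "EX k. ALL t:{0..r}. N (R (rs k) (X t) - X t) <= e" by blast
 qed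
 show "t \<in> {0..r} ==> (%k. N (R (rs k) (I0 t (%s. exp s *R y s)) - I0 t (%s. exp s *R y s))) ----> 0"
  using lim unfolding X_def by blast
qed

text \<open>The gain of a full form norm comes with the factor \<open>sqrt r\<close>: the energy
  inequality bounds the time integral of the form, and Cauchy-Schwarz in time contributes a factor
  \<open>t\<close>. The restriction \<open>r <= 1\<close> allows \<open>t^2 <= t\<close>, and
  \<open>exp (- t)\<close> cancels the growth of the weight.\<close>

lemma mild_N_bound:
 assumes m: "mild r y0 F y" and r: "0 <= r" "r <= 1" and t: "t \<in> {0..r}"
  and M: "!!s. s \<in> {0..r} ==> norm (F s) <= M"
 shows "N (exp (- t) *R I0 t (%s. exp s *R y s)) <= 2 * sqrt r * (norm y0 + 2 * r * M)"
proof -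
 define X where "X = I0 t (%s. exp s *R y s)"
 define b where "b = norm y0 + 2 * r * M"
 have M0: "0 <= M" using M[OF t] norm_ge_zero order_trans by blast
 have b0: "0 <= b" using M0 r by (simp add: b_def)
 have yb: "norm (y s) <= b" if "s \<in> {0..r}" for s unfolding b_def by (rule mild_bound[OF m that M])
 have cg: "C0 r (%s. exp s *R y s)" by (intro continuous_intros mildD(2)[OF m])
 have XV: "X \<in> V" using Vcont_in_V[OF mild_Vcont(1)[OF m r(1)] t] by (simp add: X_def)
 have "a (R (rs k) X) (R (rs k) X) <= t * (exp (2 * t) * b^2)" for k
 proof -
  have h: "rs k > 0" by simp
  note P = R_blin[OF h] and C = B_blin[OF h]
  have q: "a (R (rs k) (exp s *R y s)) (R (rs k) (exp s *R y s)) = exp (2 * s) * a (R (rs k) (y s)) (R (rs k) (y s))" for s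
   using square_scale[OF R_in_V[OF h], of "exp s" "y s"] linear_scale[OF bounded_linear.linear[OF P]]
   by (simp add: exp_double)
  have "C0 r (%s. B (rs k) (y s) \<bullet> R (rs k) (y s))"
   by (intro continuous_on_inner cont_BL[OF P] cont_BL[OF C] mildD(2)[OF m])
  hence cq: "C0 r (%s. a (R (rs k) (y s)) (R (rs k) (y s)))"
   by (simp only: a_R[OF h R_in_V[OF h]])
  have "a (R (rs k) X) (R (rs k) X) <= t * I0 t (%s. exp (2 * s) * a (R (rs k) (y s)) (R (rs k) (y s)))"
   using form_integral_le[OF P C R_in_V[OF h] a_R[OF h] cg t] unfolding X_def q .
  also have "... <= t * I0 t (%s. exp (2 * t) * a (R (rs k) (y s)) (R (rs k) (y s)))"
   using t nonneg[OF R_in_V[OF h]]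
   by (intro mult_left_mono integral_le int_initial[OF _ t] continuous_intros cq)
    (auto intro!: mult_right_mono)
  also have "... <= t * (exp (2 * t) * b^2)"
  proof -
   have "2 * I0 t (%s. a (R (rs k) (y s)) (R (rs k) (y s))) <= (norm y0)^2 + 2 * (M * b * t)"
    using R_energy_le[OF m h t M yb] zero_le_power2[of "norm (R (rs k) (y t))"] by linarith
   moreover have "(norm y0)^2 <= b^2" using M0 r by (intro power_mono) (auto simp: b_def)
   moreover have "2 * (M * b * t) <= b^2"
   proof -
    have "2 * (M * b * t) <= b * (2 * r * M)"
     using t M0 b0 mult_right_mono[of t r "M * b"] by (simp add: mult_ac)
    also have "... <= b * b" using b0 by (intro mult_left_mono) (auto simp: b_def)
    finally show ?thesis by (simp add: power2_eq_square)
   qed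
   ultimately show ?thesis using t by (intro mult_left_mono) auto
  qed
  finally show ?thesis .
 qed
 moreover have "norm (R (rs k) X) <= t * exp t * b" for k
 proof -
  have "norm X <= exp t * b * t" unfolding X_def
  proof (rule norm_integral_initial_le[OF cg t])
   fix s assume "s \<in> {0..t}"
   thus "norm (exp s *R y s) <= exp t * b" using yb[of s] t by (auto intro!: mult_mono)
  qed
  thus ?thesis using R_norm_le[of "rs k" X] by (simp add: mult_ac)
 qed
 ultimately have "N (R (rs k) X) <= sqrt ((t * exp t * b)^2 + t * (exp (2 * t) * b^2))" for k
  by (intro N_le_sqrt R_in_V) auto
 moreover have "(t * exp t * b)^2 + t * (exp (2 * t) * b^2) = (t^2 + t) * (exp t * b)^2"
  unfolding exp_double by (simp add: algebra_simps)
 moreover have "sqrt ((t^2 + t) * (exp t * b)^2) = sqrt (t^2 + t) * (exp t * b)"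
  using b0 by (simp add: real_sqrt_mult)
 moreover have "sqrt (t^2 + t) <= 2 * sqrt r"
 proof -
  have "t^2 <= t" using t r by (simp add: power2_eq_square mult_left_le)
  hence "sqrt (t^2 + t) <= sqrt (4 * r)" using t by simp
  thus ?thesis by (simp add: real_sqrt_mult)
 qed
 ultimately have R: "N (R (rs k) X) <= 2 * sqrt r * (exp t * b)" for k
  using mult_right_mono[of "sqrt (t^2 + t)" "2 * sqrt r" "exp t * b"] b0 by (metis exp_ge_zero mult_nonneg_nonneg order_trans)
 have "(%k. N (R (rs k) X) - N X) ----> 0"
  by (rule Lim_null_comparison[OF _ mild_Vcont(2)[OF m r(1) t, folded X_def]])
   (use N_diff_le R_in_V XV in auto)
 hence "(%k. N (R (rs k) X)) ----> N X" by (rule LIM_zero_cancel)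
 hence "N X <= 2 * sqrt r * (exp t * b)" using R by (intro LIMSEQ_le_const2) auto
 hence "exp (- t) * N X <= exp (- t) * (2 * sqrt r * (exp t * b))" by simp
 also have "... = 2 * sqrt r * b" by (simp add: exp_minus)
 finally show ?thesis using N_scale[OF XV, of "exp (- t)"] by (simp add: X_def b_def)
qed

end

section \<open>Existence for the linear problem\<close>

context hilbert_form
begin

lemma dissipative_ode_bound:
 fixes y F :: "real => 'h"
 assumes L: "bounded_linear L" and pos: "!!x. 0 <= L x \<bullet> x"
  and F: "C0 r F" and y: "C0 r y"
  and eq: "!!t. t \<in> {0..r} ==> y t = y0 + I0 t (%s. F s - L (y s))"
  and M: "!!s. s \<in> {0..r} ==> norm (F s) <= M" and t: "t \<in> {0..r}"
 shows "norm (y t) <= norm y0 + 2 * r * M"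
proof (rule dissipative_bound[OF y t])
 show "0 <= M" using M[OF t] norm_ge_zero order_trans by blast
 fix t b assume t: "t \<in> {0..r}" and b: "!!s. s \<in> {0..r} ==> norm (y s) <= b"
 have c: "C0 r (%s. F s - L (y s))" by (intro continuous_on_diff F cont_BL[OF L] y)
 have "I0 t (%s. (F s - L (y s)) \<bullet> y s) <= M * b * t"
 proof (rule integral_initial_le[OF _ t])
  show "C0 r (%s. (F s - L (y s)) \<bullet> y s)" by (intro continuous_on_inner c y)
  fix s assume "s \<in> {0..t}"
  hence s: "s \<in> {0..r}" using t by auto
  have "(F s - L (y s)) \<bullet> y s <= F s \<bullet> y s" using pos[of "y s"] by (simp add: inner_diff_left)
  also have "... <= norm (F s) * norm (y s)" by (rule norm_cauchy_schwarz)
  also have "... <= M * b" using M[OF s] b[OF s] by (intro mult_mono) (auto intro: order_trans[OF norm_ge_zero])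
  finally show "(F s - L (y s)) \<bullet> y s <= M * b" .
 qed
 thus "(norm (y t))^2 <= (norm y0)^2 + 2 * (M * b * t)"
  using norm_square_ode[OF c eq t] by simp
qed auto

text \<open>Every term in the definition of \<open>mild\<close> is a bounded operator applied to a
  value or an integral of the data, hence survives uniform limits.\<close>

lemma mild_uniform_limit:
 assumes m: "!!k. mild r (c k) (F k) (y k)"
  and y: "uniform_limit {0..r} y z sequentially" and F: "uniform_limit {0..r} F G sequentially"
  and c: "c ----> d"
 shows "mild r d G z"
 unfolding mild_def
proof (intro conjI allI impI ballI)
 show "C0 r G" by (rule uniform_limit_theorem[OF _ F]) (auto simp: mildD[OF m])
 show "C0 r z" by (rule uniform_limit_theorem[OF _ y]) (auto simp: mildD[OF m])
 fix h :: real and t assume h: "h > 0" and t: "t \<in> {0..r}"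
 note R = R_blin[OF h] and B = B_blin[OF h]
 have "(%k. R h (y k t) + B h (I0 t (y k))) ----> R h (z t) + B h (I0 t z)"
  by (intro tendsto_add bounded_linear.tendsto[OF R] bounded_linear.tendsto[OF B]
    tendsto_uniform_limitI[OF y t] integral_uniform_tendsto[OF y mildD(2)[OF m] t])
 moreover have "(%k. R h (c k) + R h (I0 t (F k))) ----> R h d + R h (I0 t G)"
  by (intro tendsto_add bounded_linear.tendsto[OF R] c integral_uniform_tendsto[OF F mildD(1)[OF m] t])
 ultimately show "R h (z t) + B h (I0 t z) = R h d + R h (I0 t G)"
  using mildD(3)[OF m h t] by (simp add: LIMSEQ_unique)
qed

text \<open>For regularised data the solutions of \<open>y' = F - B h y\<close> are Cauchy as \<open>h\<close> tends to \<open>0\<close>, because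
 \<open>(B h - B k) (R r (R r x)) = (k - h) R k (R h (B r (B r x)))\<close>.\<close>

lemma B_diff_le:
 assumes h: "h > 0" and k: "k > 0" and r: "r > 0"
 shows "norm (B h (R r (R r x)) - B k (R r (R r x))) <= \<bar>k - h\<bar> * ((2 / r)^2 * norm x)"
proof -
 define g where "g = R r (B r x)"
 have e: "B h' (R r (R r x)) = R h' g" if "h' > 0" for h'
  using B_R_swap[OF that r, of "R r x"] B_R_swap[OF r r, of x] by (simp add: g_def)
 have "R h g - R k g = (k - h) *R R k (B h g)" by (rule R_minus_R[OF k h])
 also have "B h g = R h (B r (B r x))" unfolding g_def by (rule B_R_swap[OF h r])
 finally have "norm (R h g - R k g) = \<bar>k - h\<bar> * norm (R k (R h (B r (B r x))))" by simp
 also have "norm (R k (R h (B r (B r x)))) <= norm (B r (B r x))"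
  using R_norm_le[OF k] R_norm_le[OF h] order_trans by blast
 also have "norm (B r (B r x)) <= 2 / r * norm (B r x)" by (rule B_norm_le[OF r])
 also have "... <= 2 / r * (2 / r * norm x)" using r by (intro mult_left_mono B_norm_le) auto
 finally show ?thesis using e[OF h] e[OF k] by (simp add: power2_eq_square mult_left_mono)
qed

lemma mild_exists_regular:
 fixes F :: "real => 'h"
 assumes F: "C0 c F" and c: "0 <= c" and r: "r > 0"
 shows "EX z. mild c (R r (R r y0)) (%s. R r (R r (F s))) z"
proof -
 define T where "T x = R r (R r x)" for x
 have T: "bounded_linear T" unfolding T_def[abs_def] by (rule bounded_linear_compose[OF R_blin[OF r] R_blin[OF r]])
 have "EX y. C0 c y \<and> (ALL t:{0..c}. y t = y0 + I0 t (%s. - B (rs k) (y s) + F s))" for k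
  by (rule linear_ode_solvable[OF bounded_linear_minus F c]) (simp add: B_blin)
 hence "ALL k. EX y. C0 c y \<and> (ALL t:{0..c}. y t = y0 + I0 t (%s. F s - B (rs k) (y s)))"
  by simp
 from choice[OF this] obtain y where y: "ALL k. C0 c (y k) \<and>
   (ALL t:{0..c}. y k t = y0 + I0 t (%s. F s - B (rs k) (y k s)))" ..
 have yk: "C0 c (y k) \<and> (ALL t:{0..c}. y k t = y0 + I0 t (%s. F s - B (rs k) (y k s)))" for k
  using y ..
 have yc: "C0 c (y k)" for k using yk ..
 have ye: "y k t = y0 + I0 t (%s. F s - B (rs k) (y k s))" if t: "t \<in> {0..c}" for k t
  using conjunct2[OF yk[of k]] t ..
 have "bounded (F ` {0..c})" by (intro compact_imp_bounded compact_continuous_image F) auto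
 then obtain M where M: "!!s. s \<in> {0..c} ==> norm (F s) <= M" unfolding bounded_iff by blast
 define b where "b = norm y0 + 2 * c * M"
 have b: "norm (y k t) <= b" if "t \<in> {0..c}" for k t unfolding b_def
  by (rule dissipative_ode_bound[OF B_blin B_nonneg F yc ye M that]) auto
 have b0: "0 <= b" using order_trans[OF norm_ge_zero b[of 0 0]] c by simp
 define Z where "Z k t = T (y k t)" for k t
 have Zc: "C0 c (Z k)" for k unfolding Z_def by (rule cont_BL[OF T yc])
 \<comment> \<open>\<open>T\<close> commutes with the Yosida operators, so \<open>T (y k)\<close>
   solves the same equation with regularised data.\<close>
 have "R r (B (rs k) x) = B (rs k) (R r x)" for k x
  unfolding B_def linear_diff[OF R_linear[OF r]] linear_scale[OF R_linear[OF r]]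
  by (subst R_commute[OF r]) simp_all
 hence TB: "T (B (rs k) x) = B (rs k) (T x)" for k x by (simp only: T_def)
 have intc: "C0 c (%s. F s - B (rs k) (y k s))" for k
  by (intro continuous_on_diff F cont_BL[OF B_blin] yc) simp
 have Ze: "Z k t = T y0 + I0 t (%s. T (F s) - B (rs k) (Z k s))" if t: "t \<in> {0..c}" for k t
 proof -
  have "Z k t = T y0 + T (I0 t (%s. F s - B (rs k) (y k s)))"
   unfolding Z_def by (subst ye[OF t]) (rule linear_add[OF bounded_linear.linear[OF T]])
  also have "T (I0 t (%s. F s - B (rs k) (y k s))) = I0 t (%s. T (F s - B (rs k) (y k s)))"
   by (rule int_blin[OF intc t T, symmetric])
  finally show ?thesis unfolding Z_def by (simp only: linear_diff[OF bounded_linear.linear[OF T]] TB)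
 qed
 \<comment> \<open>The factor \<open>2 * c\<close> comes from \<open>dissipative_ode_bound\<close>,
   the rest from \<open>B_diff_le\<close> applied to the curves \<open>y l\<close>, which are
   bounded by \<open>b\<close> independently of \<open>l\<close>.\<close>
 define q where "q = 2 * c * ((2 / r)^2 * b)"
 have q0: "0 <= q" using c b0 by (simp add: q_def)
 have diff: "norm (Z k t - Z l t) <= q * \<bar>rs l - rs k\<bar>" if t: "t \<in> {0..c}" for k l t
 proof -
  define G where "G s = B (rs l) (Z l s) - B (rs k) (Z l s)" for s
  have Gc: "C0 c G" unfolding G_def by (intro continuous_on_diff cont_BL[OF B_blin] Zc) auto
  have "norm (Z k t - Z l t) <= norm (0 :: 'h) + 2 * c * (\<bar>rs l - rs k\<bar> * ((2 / r)^2 * b))"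
  proof (rule dissipative_ode_bound[OF B_blin[of "rs k"] B_nonneg Gc continuous_on_diff[OF Zc Zc] _ _ t])
   fix t assume t: "t \<in> {0..c}"
   have ci: "(%s. T (F s) - B (rs i) (Z i s)) integrable_on {0..t}" for i
    by (intro int_initial[OF _ t] continuous_on_diff cont_BL[OF T] F cont_BL[OF B_blin] Zc) simp
   have "Z k t - Z l t = I0 t (%s. (T (F s) - B (rs k) (Z k s)) - (T (F s) - B (rs l) (Z l s)))"
    by (subst integral_diff[OF ci ci]) (simp only: Ze[OF t] add_diff_cancel_left)
   also have "... = I0 t (%s. G s - B (rs k) (Z k s - Z l s))"
    by (rule integral_cong) (simp add: G_def linear_diff[OF bounded_linear.linear[OF B_blin]])
   finally show "Z k t - Z l t = 0 + I0 t (%s. G s - B (rs k) (Z k s - Z l s))" by simp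
  next
   fix s assume s: "s \<in> {0..c}"
   have "norm (G s) <= \<bar>rs k - rs l\<bar> * ((2 / r)^2 * norm (y l s))"
    unfolding G_def Z_def T_def by (rule B_diff_le) (use r in auto)
   also have "... <= \<bar>rs k - rs l\<bar> * ((2 / r)^2 * b)" by (intro mult_left_mono b s) auto
   finally show "norm (G s) <= \<bar>rs l - rs k\<bar> * ((2 / r)^2 * b)" by (simp add: abs_minus_commute)
  qed auto
  thus ?thesis by (simp add: q_def mult_ac)
 qed
 have "uniformly_Cauchy_on {0..c} Z"
 proof (rule uniformly_Cauchy_onI)
  fix e :: real assume e: "e > 0"
  define d where "d = e / (q + 1)"
  have d: "d > 0" using e q0 by (simp add: d_def)
  then obtain M where M: "inverse (real (Suc M)) < d" using reals_Archimedean by blast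
  have "dist (Z k t) (Z l t) < e" if "t \<in> {0..c}" "k >= M" "l >= M" for k l t
  proof -
   have "rs k <= rs M" "rs l <= rs M" "0 < rs k" "0 < rs l" using that by auto
   moreover have "\<bar>y - x\<bar> <= z" if "x <= z" "y <= z" "0 < x" "0 < y" for x y z :: real using that by linarith
   ultimately have "\<bar>rs l - rs k\<bar> <= rs M" by blast
   hence "\<bar>rs l - rs k\<bar> <= d" using M by simp
   hence "q * \<bar>rs l - rs k\<bar> <= q * d" using q0 by (rule mult_left_mono)
   moreover have "q * d < e" using e q0 by (simp add: d_def field_simps)
   ultimately show ?thesis using diff[OF that(1), of k l] unfolding dist_norm by simp
  qed
  thus "EX M. ALL t:{0..c}. ALL m>=M. ALL n>=M. dist (Z m t) (Z n t) < e" by blast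
 qed
 then obtain z where z: "uniform_limit {0..c} Z z sequentially"
  using Cauchy_uniformly_convergent unfolding uniformly_convergent_on_def by blast
 have zc: "C0 c z" by (rule uniform_limit_theorem[OF _ z]) (auto simp: Zc)
 have TFc: "C0 c (%s. T (F s))" by (rule cont_BL[OF T F])
 have "R h (z t) + B h (I0 t z) = R h (T y0) + R h (I0 t (%s. T (F s)))"
  if h: "h > 0" and t: "t \<in> {0..c}" for h t
 proof -
  \<comment> \<open>By \<open>B_R_swap\<close> the operator \<open>R h (B (rs k) w)\<close> becomes
    \<open>B h (R (rs k) w)\<close>: a fixed bounded operator is outside, and
    \<open>R (rs k)\<close> tends to the identity, so the limit in \<open>k\<close> can be
    taken.\<close>
  have eq: "R h (Z k t) + B h (R (rs k) (I0 t (Z k))) = R h (T y0) + R h (I0 t (%s. T (F s)))" for k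
  proof -
   have "I0 t (%s. T (F s) - B (rs k) (Z k s))
     = I0 t (%s. T (F s)) - I0 t (%s. B (rs k) (Z k s))"
    by (intro integral_diff int_initial[OF _ t] TFc cont_BL[OF B_blin] Zc) simp
   also have "I0 t (%s. B (rs k) (Z k s)) = B (rs k) (I0 t (Z k))"
    by (rule int_blin[OF Zc t B_blin]) simp
   finally have "Z k t + B (rs k) (I0 t (Z k)) = T y0 + I0 t (%s. T (F s))"
    using Ze[OF t, of k] by simp
   hence "R h (Z k t) + R h (B (rs k) (I0 t (Z k))) = R h (T y0) + R h (I0 t (%s. T (F s)))"
    using linear_add[OF R_linear[OF h]] by metis
   thus ?thesis using B_R_swap[OF h, of "rs k"] by simp
  qed
  have "(%k. R (rs k) (I0 t (Z k))) ----> I0 t z"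
  proof -
   have I: "(%k. I0 t (Z k)) ----> I0 t z" by (rule integral_uniform_tendsto[OF z Zc t])
   have "(%k. R (rs k) (I0 t (Z k) - I0 t z)) ----> 0"
   proof (rule Lim_null_comparison)
    show "\<forall>\<^sub>F k in sequentially. norm (R (rs k) (I0 t (Z k) - I0 t z)) <= norm (I0 t (Z k) - I0 t z)"
     by (intro always_eventually allI R_norm_le) simp
    show "(%k. norm (I0 t (Z k) - I0 t z)) ----> 0"
     using I by (simp add: LIM_zero_iff tendsto_norm_zero_iff)
   qed
   hence "(%k. R (rs k) (I0 t (Z k) - I0 t z) + R (rs k) (I0 t z)) ----> 0 + I0 t z"
    by (intro tendsto_add R_tendsto)
   thus ?thesis by (simp add: linear_diff[OF R_linear])
  qed
  hence "(%k. R h (Z k t) + B h (R (rs k) (I0 t (Z k)))) ----> R h (z t) + B h (I0 t z)"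
   by (intro tendsto_add bounded_linear.tendsto[OF R_blin[OF h]] bounded_linear.tendsto[OF B_blin[OF h]]
     tendsto_uniform_limitI[OF z t])
  thus ?thesis unfolding eq by (simp add: LIMSEQ_const_iff)
 qed
 thus ?thesis using zc TFc unfolding mild_def T_def by blast
qed

lemma RR_uniform:
 fixes f :: "real => 'h"
 assumes f: "C0 t f"
 shows "uniform_limit {0..t} (%k s. R (rs k) (R (rs k) (f s))) f sequentially"
 unfolding uniform_limit_iff
proof (intro allI impI)
 fix e :: real assume "e > 0"
 hence "\<forall>\<^sub>F k in sequentially. ALL s:{0..t}. dist (R (rs k) (f s)) (f s) < e / 2"
  using R_uniform[OF f] unfolding uniform_limit_iff by (meson half_gt_zero)
 thus "\<forall>\<^sub>F k in sequentially. ALL s:{0..t}. dist (R (rs k) (R (rs k) (f s))) (f s) < e"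
 proof (rule eventually_mono, intro ballI)
  fix k s assume k: "ALL s:{0..t}. dist (R (rs k) (f s)) (f s) < e / 2" and s: "s \<in> {0..t}"
  have "dist (R (rs k) (R (rs k) (f s))) (R (rs k) (f s)) <= dist (R (rs k) (f s)) (f s)"
   using R_norm_le[of "rs k" "R (rs k) (f s) - f s"] by (simp add: dist_norm linear_diff[OF R_linear])
  thus "dist (R (rs k) (R (rs k) (f s))) (f s) < e"
   using dist_triangle[of "R (rs k) (R (rs k) (f s))" "f s" "R (rs k) (f s)"] k s by fastforce
 qed
qed

text \<open>Initial value and forcing are both regularised by two resolvents.
  \<open>mild_bound\<close> for differences makes the corresponding solutions uniformly Cauchy, and
  their limit is mild.\<close>

lemma mild_exists:
 fixes F :: "real => 'h"
 assumes F: "C0 r F" and r: "0 <= r"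
 shows "EX z. mild r y0 F z"
proof -
 define c where "c k = R (rs k) (R (rs k) y0)" for k
 define G where "G k s = R (rs k) (R (rs k) (F s))" for k s
 have "ALL k. EX z. mild r (c k) (G k) z"
  unfolding c_def G_def by (intro allI mild_exists_regular[OF F r]) simp
 from choice[OF this] obtain y where m: "!!k. mild r (c k) (G k) (y k)" by blast
 have uG: "uniform_limit {0..r} G F sequentially" unfolding G_def by (rule RR_uniform[OF F])
 have uc: "uniform_limit {0..r} (%k _. c k) (%_. y0) sequentially"
  unfolding c_def by (rule RR_uniform) (rule continuous_on_const)
 have cl: "c ----> y0" using tendsto_uniform_limitI[OF uc, of 0] r by simp
 have "uniformly_Cauchy_on {0..r} y"
 proof (rule uniformly_Cauchy_onI)
  fix e :: real assume e: "e > 0"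
  define q where "q = 1 + 2 * r"
  have q: "q > 0" using r by (simp add: q_def)
  define d where "d = (e / 2) / q"
  have d: "d > 0" using e q by (simp add: d_def)
  have "\<forall>\<^sub>F k in sequentially. (ALL s:{0..r}. dist (G k s) (F s) < d / 2) \<and> dist (c k) y0 < d / 2"
   using uG tendstoD[OF cl half_gt_zero[OF d]] half_gt_zero[OF d] unfolding uniform_limit_iff
   by (intro eventually_conj) blast+
  then obtain M where M: "!!k. k >= M ==> (ALL s:{0..r}. dist (G k s) (F s) < d / 2) \<and> dist (c k) y0 < d / 2"
   unfolding eventually_sequentially by blast
  have "dist (y k t) (y l t) < e" if t: "t \<in> {0..r}" and kl: "k >= M" "l >= M" for k l t
  proof -
   have "norm (y k t - y l t) <= norm (c k - c l) + 2 * r * d"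
   proof (rule mild_bound[OF mild_diff[OF m m] t])
    fix s assume s: "s \<in> {0..r}"
    show "norm (G k s - G l s) <= d"
     using M[OF kl(1)] M[OF kl(2)] s dist_triangle_half_l[of "G k s" "F s" d "G l s"] by (simp add: dist_norm)
   qed
   also have "norm (c k - c l) <= d"
    using M[OF kl(1)] M[OF kl(2)] dist_triangle_half_l[of "c k" "y0" d "c l"] by (simp add: dist_norm)
   also have "d + 2 * r * d = q * d" by (simp add: q_def algebra_simps)
   finally show ?thesis using q e by (simp add: d_def dist_norm)
  qed
  thus "EX M. ALL t:{0..r}. ALL m>=M. ALL n>=M. dist (y m t) (y n t) < e" by blast
 qed
 then obtain z where z: "uniform_limit {0..r} y z sequentially"
  using Cauchy_uniformly_convergent unfolding uniformly_convergent_on_def by blast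
 show ?thesis using mild_uniform_limit[OF m z uG cl] by blast
qed

end

section \<open>The semilinear equation: restriction, shift, concatenation and uniqueness\<close>

locale semilinear_form = hilbert_form V a
 for V :: "'h::{real_inner,banach} set" and a :: "'h => 'h => real" +
 fixes f :: "'h => 'h"
 assumes f_Lipschitz: "!!M. EX K>=0. ALL v:V. ALL w:V. N v <= M --> N w <= M --> norm (f v - f w) <= K * N (v - w)"
begin

lemma f_Vcont:
 assumes u: "Vcont {0..r} u" shows "C0 r (%t. f (u t))"
 unfolding continuous_on_def
proof (intro ballI)
 fix t assume t: "t \<in> {0..r}"
 obtain M where M: "ALL t:{0..r}. N (u t) <= M" using Vcont_bounded[OF u] by blast
 obtain K where K: "K >= 0" "!!v w. v \<in> V ==> w \<in> V ==> N v <= M ==> N w <= M ==> norm (f v - f w) <= K * N (v - w)"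
  using f_Lipschitz[of M] by blast
 have "((%s. f (u s) - f (u t)) ---> 0) (at t within {0..r})"
 proof (rule Lim_null_comparison)
  have "\<forall>\<^sub>F s in at t within {0..r}. s \<in> {0..r}" by (simp add: eventually_at_filter)
  thus "\<forall>\<^sub>F s in at t within {0..r}. norm (f (u s) - f (u t)) <= K * N (u s - u t)"
   by (rule eventually_mono) (use K M t Vcont_in_V[OF u] in blast)
  have "((%s. N (u s - u t)) ---> 0) (at t within {0..r})" using u t by (simp add: Vcont_def)
  thus "((%s. K * N (u s - u t)) ---> 0) (at t within {0..r})" by (rule tendsto_mult_right_zero)
 qed
 thus "((%t. f (u t)) ---> f (u t)) (at t within {0..r})" by (rule LIM_zero_cancel)
qed

text \<open>\<open>u\<close> solves \<open>u' + u = y\<close>, where \<open>y\<close> is the mild solution of \<open>y' + A y = f u\<close>.\<close>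

definition sol :: "real => 'h => 'h => (real => 'h) => (real => 'h) => bool" where
 "sol r u0 y0 u y \<longleftrightarrow> mild r y0 (%t. f (u t)) y \<and> u0 \<in> V \<and>
  (ALL t:{0..r}. u t = exp (- t) *R (u0 + I0 t (%s. exp s *R y s)))"

lemma solD:
 assumes "sol r u0 y0 u y"
 shows "mild r y0 (%t. f (u t)) y" "u0 \<in> V"
  "t \<in> {0..r} ==> u t = exp (- t) *R (u0 + I0 t (%s. exp s *R y s))"
 using assms unfolding sol_def by blast+

lemma sol_Vcont:
 assumes s: "sol r u0 y0 u y" shows "Vcont {0..r} u"
proof (cases "0 <= r")
 case True
 have "Vcont {0..r} (%t. exp (- t) *R (u0 + I0 t (%s. exp s *R y s)))"
  by (intro Vcont_scale Vcont_add_const mild_Vcont(1)[OF solD(1)[OF s] True] solD(2)[OF s] continuous_intros)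
 thus ?thesis by (subst Vcont_cong[OF solD(3)[OF s]])
qed (simp add: Vcont_def)

lemma mild_cong:
 assumes m: "mild r y0 F y" and "r' <= r" and e: "!!t. t \<in> {0..r'} ==> F' t = F t" "!!t. t \<in> {0..r'} ==> y' t = y t"
 shows "mild r' y0 F' y'"
 unfolding mild_def
proof (intro conjI allI impI ballI)
 have s: "{0..r'} \<subseteq> {0..r}" using assms(2) by auto
 show "C0 r' F'" by (rule continuous_on_eq[OF continuous_on_subset[OF mildD(1)[OF m] s]]) (simp add: e)
 show "C0 r' y'" by (rule continuous_on_eq[OF continuous_on_subset[OF mildD(2)[OF m] s]]) (simp add: e)
 fix h :: real and t assume h: "h > 0" and t: "t \<in> {0..r'}"
 have "I0 t y' = I0 t y" "I0 t F' = I0 t F"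
  using t by (auto intro!: integral_cong e)
 thus "R h (y' t) + B h (I0 t y') = R h y0 + R h (I0 t F')"
  using mildD(3)[OF m h, of t] s t e(2)[OF t] by simp
qed

lemma sol_cong:
 assumes s: "sol r u0 y0 u y" and "r' <= r" and e: "!!t. t \<in> {0..r'} ==> u' t = u t" "!!t. t \<in> {0..r'} ==> y' t = y t"
 shows "sol r' u0 y0 u' y'"
 unfolding sol_def
proof (intro conjI ballI)
 show "mild r' y0 (%t. f (u' t)) y'" by (rule mild_cong[OF solD(1)[OF s] assms(2)]) (use e in auto)
 show "u0 \<in> V" by (rule solD(2)[OF s])
 fix t assume t: "t \<in> {0..r'}"
 show "u' t = exp (- t) *R (u0 + I0 t (%s. exp s *R y' s))" using t solD(3)[OF s, of t] assms(2) by (auto intro!: integral_cong simp: e)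
qed

lemma sol_restrict: "sol t u0 y0 u y ==> t' <= t ==> sol t' u0 y0 u y"
 by (rule sol_cong) auto

lemma integral_shift_initial:
 fixes g :: "real => 'h"
 assumes g: "C0 r g" and t0: "0 <= t0" and t: "0 <= t" "t0 + t <= r"
 shows "I0 (t0 + t) g = I0 t0 g + I0 t (%s. g (t0 + s))"
proof -
 have "I0 t0 g + integral {t0..t0 + t} g = I0 (t0 + t) g"
  by (rule Henstock_Kurzweil_Integration.integral_combine) (use t0 t int_initial[OF g, of "t0 + t"] in auto)
 moreover have "I0 t (g \<circ> (+) t0) = integral {0 + t0..t + t0} g" by (rule integral_shift_Icc_real)
 ultimately show ?thesis by (simp add: o_def add.commute)
qed

lemma continuous_on_shift:
 fixes g :: "real => 'h"
 assumes "C0 r g" "0 <= t0"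
 shows "continuous_on {0..r - t0} (%s. g (t0 + s))"
 using assms(2) by (intro continuous_on_compose2[OF assms(1)] continuous_intros) auto

lemma sol_shift:
 assumes s: "sol r u0 y0 u y" and t0: "t0 \<in> {0..r}"
 shows "sol (r - t0) (u t0) (y t0) (%t. u (t0 + t)) (%t. y (t0 + t))"
 unfolding sol_def mild_def
proof (intro conjI allI impI ballI)
 note m = solD(1)[OF s]
 have t0': "0 <= t0" using t0 by simp
 show "continuous_on {0..r - t0} (%t. f (u (t0 + t)))" by (rule continuous_on_shift[OF mildD(1)[OF m] t0'])
 show "continuous_on {0..r - t0} (%t. y (t0 + t))" by (rule continuous_on_shift[OF mildD(2)[OF m] t0'])
 show "u t0 \<in> V" by (rule Vcont_in_V[OF sol_Vcont[OF s] t0])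
 fix t assume t: "t \<in> {0..r - t0}"
 hence tt: "t0 + t \<in> {0..r}" "0 <= t" "t0 + t <= r" using t0 by auto
 have cg: "C0 r (%s. exp s *R y s)" by (intro continuous_intros mildD(2)[OF m])
 have "I0 t (%s. exp (t0 + s) *R y (t0 + s)) = I0 t (%s. exp t0 *R (exp s *R y (t0 + s)))"
  by (simp add: exp_add)
 also have "... = exp t0 *R I0 t (%s. exp s *R y (t0 + s))" by (rule integral_cmul)
 finally have i: "I0 (t0 + t) (%s. exp s *R y s) = I0 t0 (%s. exp s *R y s)
   + exp t0 *R I0 t (%s. exp s *R y (t0 + s))"
  using integral_shift_initial[OF cg t0' tt(2,3)] by simp
 have c: "exp (- (t0 + t)) *R x = exp (- t) *R exp (- t0) *R x" "exp (- t0) *R exp t0 *R x = x" for x :: 'h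
  by (simp_all add: exp_add[symmetric])
 show "u (t0 + t) = exp (- t) *R (u t0 + I0 t (%s. exp s *R y (t0 + s)))"
  unfolding solD(3)[OF s t0] solD(3)[OF s tt(1)] i by (simp only: c scaleR_add_right add.assoc)
 fix h :: real assume h: "h > 0"
 have "B h (I0 t0 y) + (R h (y (t0 + t)) + B h (I0 t (%t. y (t0 + t))))
   = R h (y (t0 + t)) + B h (I0 (t0 + t) y)"
  unfolding integral_shift_initial[OF mildD(2)[OF m] t0' tt(2,3)]
  by (simp only: linear_add[OF bounded_linear.linear[OF B_blin[OF h]]] add_ac)
 also have "... = (R h y0 + R h (I0 t0 (%t. f (u t)))) + R h (I0 t (%t. f (u (t0 + t))))"
  unfolding mildD(3)[OF m h tt(1)] integral_shift_initial[OF mildD(1)[OF m] t0' tt(2,3)]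
  by (simp only: linear_add[OF R_linear[OF h]] add_ac)
 finally show "R h (y (t0 + t)) + B h (I0 t (%t. y (t0 + t))) = R h (y t0) + R h (I0 t (%t. f (u (t0 + t))))" unfolding mildD(3)[OF m h t0, symmetric] by simp
qed

text \<open>The second piece starts from the state reached by the first, so both \<open>u\<close>
  and \<open>y\<close> match at the joint. Past \<open>t0\<close> the integrals split, and the
  equation at \<open>t0\<close> is inserted into that of the second piece.\<close>

lemma sol_concat:
 assumes s: "sol t0 u0 y0 u y" and v: "sol l (u t0) (y t0) v x" and t0: "0 <= t0" and l: "0 <= l"
 shows "sol (t0 + l) u0 y0 (%t. if t <= t0 then u t else v (t - t0)) (%t. if t <= t0 then y t else x (t - t0))"
proof -
 note m = solD(1)[OF s] and n = solD(1)[OF v]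
 define U where "U t = (if t <= t0 then u t else v (t - t0))" for t
 define Y where "Y t = (if t <= t0 then y t else x (t - t0))" for t
 have x0: "x 0 = y t0" by (rule mild_initial[OF n l])
 have v0: "v 0 = u t0" using solD(3)[OF v, of 0] l by simp
 have glue: "continuous_on {0..t0 + l} (%t. if t <= t0 then g t else k (t - t0))"
  if "C0 t0 g" "C0 l k" "g t0 = k 0" for g k
 proof (rule continuous_on_cases_le)
  show "continuous_on {t \<in> {0..t0 + l}. t <= t0} g" by (rule continuous_on_subset[OF that(1)]) auto
  show "continuous_on {t \<in> {0..t0 + l}. t0 <= t} (%t. k (t - t0))"
   by (rule continuous_on_compose2[OF that(2)]) (auto intro!: continuous_on_diff)
 qed (use that in "auto intro: continuous_on_id")
 have Yc: "continuous_on {0..t0 + l} Y" unfolding Y_def by (rule glue) (use mildD[OF m] mildD[OF n] x0 in auto)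
 have "continuous_on {0..t0 + l} (%t. if t <= t0 then f (u t) else f (v (t - t0)))"
  by (rule glue) (use mildD[OF m] mildD[OF n] v0 in auto)
 hence Fc: "continuous_on {0..t0 + l} (%t. f (U t))" unfolding U_def by (simp add: if_distrib)
 have Ys: "Y (t0 + t) = x t" and Us: "U (t0 + t) = v t" if "0 <= t" for t
  using that x0 v0 by (auto simp: Y_def U_def)
 have Yt: "Y t = y t" and Ut: "U t = u t" if "t <= t0" for t using that by (auto simp: Y_def U_def)
 have main: "U t = exp (- t) *R (u0 + I0 t (%s. exp s *R Y s)) \<and>
   (ALL h>0. R h (Y t) + B h (I0 t Y) = R h y0 + R h (I0 t (%t. f (U t))))"
  if t: "t \<in> {0..t0 + l}" for t
 proof (cases "t <= t0")
  case True
  hence "I0 t (%s. exp s *R Y s) = I0 t (%s. exp s *R y s)"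
   "I0 t Y = I0 t y" "I0 t (%t. f (U t)) = I0 t (%t. f (u t))"
   by (auto intro!: integral_cong simp: Yt Ut)
  thus ?thesis using mildD(3)[OF m] solD(3)[OF s] t True by (simp add: Yt Ut)
 next
  case False
  define r where "r = t - t0"
  have r: "0 <= r" "t0 + r <= t0 + l" "r \<in> {0..l}" "t = t0 + r" using False t by (auto simp: r_def)
  have t0i: "t0 \<in> {0..t0}" using t0 by simp
  have i0: "I0 t0 (%s. exp s *R Y s) = I0 t0 (%s. exp s *R y s)"
   "I0 t0 Y = I0 t0 y" "I0 t0 (%t. f (U t)) = I0 t0 (%t. f (u t))"
   by (auto intro!: integral_cong simp: Yt Ut)
  have i1: "I0 r (%s. Y (t0 + s)) = I0 r x"
   "I0 r (%s. f (U (t0 + s))) = I0 r (%s. f (v s))"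
   "I0 r (%s. exp (t0 + s) *R Y (t0 + s)) = I0 r (%s. exp t0 *R (exp s *R x s))"
   by (auto intro!: integral_cong simp: Ys Us exp_add)
  have cg: "continuous_on {0..t0 + l} (%s. exp s *R Y s)" by (intro continuous_intros Yc)
  have "I0 t (%s. exp s *R Y s) = I0 t0 (%s. exp s *R y s) + exp t0 *R I0 r (%s. exp s *R x s)"
   unfolding r(4) integral_shift_initial[OF cg t0 r(1,2)] i0 i1 integral_cmul ..
  moreover have "U t = exp (- r) *R (u t0 + I0 r (%s. exp s *R x s))"
   using solD(3)[OF v r(3)] Us[OF r(1)] r(4) by simp
  moreover have "u t0 = exp (- t0) *R (u0 + I0 t0 (%s. exp s *R y s))" by (rule solD(3)[OF s t0i])
  moreover have "exp (- t) = exp (- r) * exp (- t0)" "exp (- t) * exp t0 = exp (- r)"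
   using r(4) by (simp_all add: exp_add[symmetric])
  ultimately have "U t = exp (- t) *R (u0 + I0 t (%s. exp s *R Y s))"
   by (simp only: scaleR_add_right scaleR_scaleR add.assoc)
  moreover have "R h (Y t) + B h (I0 t Y) = R h y0 + R h (I0 t (%t. f (U t)))" if h: "h > 0" for h
  proof -
   have "Y t = x r" using Ys[OF r(1)] r(4) by simp
   moreover have "I0 t Y = I0 t0 y + I0 r x"
    unfolding r(4) integral_shift_initial[OF Yc t0 r(1,2)] i0 i1 ..
   moreover have "I0 t (%t. f (U t)) = I0 t0 (%t. f (u t)) + I0 r (%t. f (v t))"
    unfolding r(4) integral_shift_initial[OF Fc t0 r(1,2)] i0 i1 ..
   ultimately have "R h (Y t) + B h (I0 t Y)
     = B h (I0 t0 y) + (R h (x r) + B h (I0 r x))"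
    by (simp add: linear_add[OF bounded_linear.linear[OF B_blin[OF h]]])
   also have "... = (R h (y t0) + B h (I0 t0 y)) + R h (I0 r (%t. f (v t)))"
    unfolding mildD(3)[OF n h r(3)] by simp
   also have "... = R h y0 + R h (I0 t (%t. f (U t)))"
    unfolding mildD(3)[OF m h t0i] \<open>I0 t (%t. f (U t)) = _\<close>
    by (simp only: linear_add[OF R_linear[OF h]] add_ac)
   finally show ?thesis .
  qed
  ultimately show ?thesis by blast
 qed
 have "sol (t0 + l) u0 y0 U Y"
  unfolding sol_def mild_def using main Fc Yc solD(2)[OF s] by blast
 thus ?thesis unfolding U_def[abs_def] Y_def[abs_def] .
qed

text \<open>Equal initial data cancel in the difference, so only the forcing is left in
  \<open>mild_N_bound\<close>; the remaining factor \<open>r\<close> is bounded by 1.\<close>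

lemma sol_difference_bound:
 assumes m: "mild r y0 F y" and n: "mild r y0 G x" and r: "0 <= r" "r <= 1" and t: "t \<in> {0..r}"
  and u: "u = exp (- t) *R (u0 + I0 t (%s. exp s *R y s))"
  and v: "v = exp (- t) *R (u0 + I0 t (%s. exp s *R x s))"
  and M: "!!s. s \<in> {0..r} ==> norm (F s - G s) <= M"
 shows "N (u - v) <= 4 * sqrt r * M"
proof -
 have M0: "0 <= M" using order_trans[OF norm_ge_zero M[OF t]] .
 have "I0 t (%s. exp s *R (y s - x s)) = I0 t (%s. exp s *R y s) - I0 t (%s. exp s *R x s)"
  unfolding scaleR_diff_right
  by (intro integral_diff int_initial[OF _ t] continuous_intros mildD(2)[OF m] mildD(2)[OF n])
 hence "N (u - v) <= 2 * sqrt r * (norm (y0 - y0) + 2 * r * M)" using mild_N_bound[OF mild_diff[OF m n] r t M] unfolding u v by (simp add: scaleR_diff_right[symmetric])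
 also have "... <= 2 * sqrt r * (2 * M)"
  using r M0 mult_right_mono[of r 1 M] by (intro mult_left_mono) auto
 finally show ?thesis by simp
qed

text \<open>The largest value of \<open>N (u t - v t)\<close> is at most half of itself. Once
  \<open>u\<close> and \<open>v\<close> agree so do their forcings, and \<open>mild_bound\<close>
  identifies \<open>y\<close> and \<open>x\<close>.\<close>

lemma sol_unique_short:
 assumes s: "sol l u0 y0 u y" and r: "sol l u0 y0 v x" and l: "0 <= l" "l <= 1" and K: "0 <= K" "4 * sqrt l * K <= 1 / 2"
  and lip: "!!t. t \<in> {0..l} ==> norm (f (u t) - f (v t)) <= K * N (u t - v t)"
  and t: "t \<in> {0..l}"
 shows "u t = v t \<and> y t = x t"
proof -
 have V: "u s \<in> V" "v s \<in> V" if "s \<in> {0..l}" for s using Vcont_in_V sol_Vcont s r that by blast+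
 have "Vcont {0..l} (%t. u t - v t)"
 proof -
  have "Vcont {0..l} (%t. exp (- t) *R (0 + I0 t (%s. exp s *R (y s - x s))))"
   by (intro Vcont_scale Vcont_add_const V_zero mild_Vcont(1)[OF mild_diff[OF solD(1)[OF s] solD(1)[OF r]] l(1)] continuous_intros)
  moreover have "u t - v t = exp (- t) *R (0 + I0 t (%s. exp s *R (y s - x s)))" if t: "t \<in> {0..l}" for t
  proof -
   have "I0 t (%s. exp s *R (y s - x s)) = I0 t (%s. exp s *R y s) - I0 t (%s. exp s *R x s)"
    unfolding scaleR_diff_right
    by (intro integral_diff int_initial[OF _ t] continuous_intros mildD(2)[OF solD(1)[OF s]] mildD(2)[OF solD(1)[OF r]])
   thus ?thesis using solD(3)[OF s t] solD(3)[OF r t] by (simp add: scaleR_diff_right[symmetric])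
  qed
  ultimately show ?thesis by (subst Vcont_cong)
 qed
 hence "C0 l (%t. N (u t - v t))" by (rule Vcont_continuous_N)
 then obtain r' where r': "r' \<in> {0..l}" "ALL t:{0..l}. N (u t - v t) <= N (u r' - v r')"
  using continuous_attains_sup[of "{0..l}" "%t. N (u t - v t)"] l by auto
 define m where "m = N (u r' - v r')"
 have m0: "0 <= m" unfolding m_def by (intro N_nonneg V_diff V r'(1))
 have Kb: "norm (f (u s) - f (v s)) <= K * m" if "s \<in> {0..l}" for s
  unfolding m_def by (rule order_trans[OF lip[OF that] mult_left_mono[OF bspec[OF r'(2) that] K(1)]])
 have "m <= 4 * sqrt l * (K * m)" unfolding m_def
  by (rule sol_difference_bound[OF solD(1)[OF s] solD(1)[OF r] l r'(1) solD(3)[OF s r'(1)] solD(3)[OF r r'(1)] Kb[unfolded m_def]])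
 also have "... <= 1 / 2 * m" using mult_right_mono[OF K(2) m0] by simp
 finally have mz: "m = 0" using m0 by simp
 have eq: "u s = v s" if "s \<in> {0..l}" for s
 proof -
  have "N (u s - v s) <= 0" using r'(2) that mz unfolding m_def by metis
  hence "norm (u s - v s) <= 0" using norm_le_N[OF V_diff[OF V(1)[OF that] V(2)[OF that]]] by linarith
  thus ?thesis by simp
 qed
 have "norm (y t - x t) <= norm (y0 - y0) + 2 * l * 0"
  by (rule mild_bound[OF mild_diff[OF solD(1)[OF s] solD(1)[OF r]] t]) (simp add: eq)
 thus ?thesis using eq[OF t] by simp
qed

text \<open>The Lipschitz constant is taken for a bound valid on the whole interval, so one step
  length \<open>d\<close> works everywhere and induction over multiples of \<open>d\<close> exhausts
  the interval.\<close>

lemma sol_unique: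
 assumes s: "sol l u0 y0 u y" and r: "sol l u0 y0 v x" and t: "t \<in> {0..l}"
 shows "u t = v t \<and> y t = x t"
proof -
 obtain M1 where M1: "ALL t:{0..l}. N (u t) <= M1" using Vcont_bounded[OF sol_Vcont[OF s]] by blast
 obtain M2 where M2: "ALL t:{0..l}. N (v t) <= M2" using Vcont_bounded[OF sol_Vcont[OF r]] by blast
 define M where "M = max M1 M2"
 obtain K where K: "K >= 0" "!!v w. v \<in> V ==> w \<in> V ==> N v <= M ==> N w <= M ==> norm (f v - f w) <= K * N (v - w)"
  using f_Lipschitz[of M] by blast
 have lip: "norm (f (u t) - f (v t)) <= K * N (u t - v t)" if "t \<in> {0..l}" for t
  using M1 M2 that Vcont_in_V[OF sol_Vcont[OF s] that] Vcont_in_V[OF sol_Vcont[OF r] that]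
  by (intro K(2)) (simp_all add: M_def le_max_iff_disj)
 \<comment> \<open>Chosen for \<open>4 * sqrt d * K <= 1 / 2\<close>; the 1 in the denominator
   covers \<open>K = 0\<close>.\<close>
 define d where "d = (1 / (8 * K + 1))^2"
 have d: "0 < d" "sqrt d = 1 / (8 * K + 1)" using K(1) by (auto simp: d_def)
 have d1: "d <= 1" using K(1) by (simp add: d_def power_le_one)
 have dK: "4 * sqrt h * K <= 1 / 2" if "h <= d" for h
 proof -
  have "4 * sqrt h * K <= 4 * (1 / (8 * K + 1)) * K"
   using real_sqrt_le_mono[OF that] d(2) K(1) by (intro mult_right_mono) auto
  also have "... <= 1 / 2" using K(1) by simp
  finally show ?thesis .
 qed
 have "ALL t:{0..l}. t <= real n * d --> u t = v t \<and> y t = x t" for n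
 proof (induction n)
  case 0
  thus ?case using solD(3)[OF s, of 0] solD(3)[OF r, of 0] mild_initial[OF solD(1)[OF s]] mild_initial[OF solD(1)[OF r]] by auto
 next
  case (Suc n)
  show ?case
  proof (intro ballI impI)
   fix t assume t: "t \<in> {0..l}" "t <= real (Suc n) * d"
   show "u t = v t \<and> y t = x t"
   proof (cases "t <= real n * d")
    case True
    thus ?thesis using Suc t by blast
   next
    case False
    define t0 where "t0 = real n * d"
    have t0: "t0 \<in> {0..l}" "t0 < t" using False t d by (auto simp: t0_def)
    have e: "u t0 = v t0" "y t0 = x t0" using Suc t0 by (auto simp: t0_def)
    define h where "h = t - t0"
    have h: "0 <= h" "h <= d" "h <= l - t0" using t0 t by (auto simp: h_def t0_def algebra_simps)
    have "u (t0 + h) = v (t0 + h) \<and> y (t0 + h) = x (t0 + h)"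
     by (rule sol_unique_short[OF sol_restrict[OF sol_shift[OF s t0(1)] h(3)] sol_restrict[OF sol_shift[OF r t0(1), folded e] h(3)]
        h(1) order_trans[OF h(2) d1] K(1) dK[OF h(2)] lip])
      (use h t0 in auto)
    thus ?thesis by (simp add: h_def)
   qed
  qed
 qed
 moreover obtain n where "t / d <= real n" using real_arch_simple by blast
 ultimately show ?thesis using d(1) t by (simp add: field_simps)
qed

end

section \<open>Local existence, continuation and maximal solutions\<close>

context semilinear_form
begin

text \<open>The fixed point is sought for the forcing \<open>F = f u\<close> and not for
  \<open>u\<close>: the forcing is a bounded continuous curve in the ambient Banach space, where
  closed balls are complete, whereas \<open>u\<close> has to stay in the form domain. The length
  \<open>r\<close> depends on the data only through \<open>M\<close>, as continuation
  requires.\<close>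

lemma local_existence:
 "EX r>0. ALL u0:V. ALL y0. N u0 <= M --> norm y0 <= M --> (EX u y. sol r u0 y0 u y)"
proof (cases "M >= 0")
 case False
 hence "N u0 <= M --> False" if "u0 \<in> V" for u0 using N_nonneg[OF that] by linarith
 thus ?thesis by (intro exI[of _ 1]) auto
next
 case M: True
 obtain K where K: "K >= 0" "!!v w. v \<in> V ==> w \<in> V ==> N v <= M + 1 ==> N w <= M + 1 ==> norm (f v - f w) <= K * N (v - w)"
  using f_Lipschitz[of "M + 1"] by blast
 \<comment> \<open>Bounds \<open>f\<close> on the ball of radius \<open>M + 1\<close>, by comparison
   with \<open>f 0\<close>.\<close>
 define MF where "MF = norm (f 0) + K * (M + 1)"
 have MF: "0 <= MF" using K M by (simp add: MF_def)
 \<comment> \<open>With \<open>sqrt r = 1 / c\<close> both smallness conditions hold: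
   \<open>u\<close> stays in the ball of radius \<open>M + 1\<close>, and the map halves
   distances.\<close>
 define c where "c = 2 * (M + 2 * MF) + 8 * K + 1"
 have c: "c >= 1" using K M MF by (simp add: c_def)
 define r where "r = (1 / c)^2"
 have sq: "sqrt r = 1 / c" and r: "r > 0" "r <= 1" using c by (auto simp: r_def power_le_one)
 have c1: "2 * sqrt r * (M + 2 * MF) <= 1" and c2: "4 * sqrt r * K <= 1 / 2"
  using M MF K by (auto simp: sq c_def)
 have "EX u y. sol r u0 y0 u y" if u0: "u0 \<in> V" "N u0 <= M" and y0: "norm y0 <= M" for u0 y0
 proof -
  define cl where "cl t = max 0 (min r t)" for t
  have clc: "continuous_on UNIV cl" unfolding cl_def by (intro continuous_intros)
  have clr: "cl t \<in> {0..r}" for t using r by (auto simp: cl_def)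
  have clid: "cl t = t" if "t \<in> {0..r}" for t using that by (auto simp: cl_def)
  define Y where "Y F = (SOME y. mild r y0 (apply_bcontfun F) y)" for F
  have Y: "mild r y0 (apply_bcontfun F) (Y F)" for F
   unfolding Y_def by (rule someI_ex[OF mild_exists]) (use r in auto)
  define U where "U F t = exp (- t) *R (u0 + I0 t (%s. exp s *R Y F s))" for F t
  have UV: "Vcont {0..r} (U F)" for F
   unfolding U_def using r by (intro Vcont_scale Vcont_add_const mild_Vcont(1)[OF Y] u0 continuous_intros) auto
  have Ub: "N (U F t) <= M + 1" if F: "norm F <= MF" and t: "t \<in> {0..r}" for F t
  proof -
   define I where "I = I0 t (%s. exp s *R Y F s)"
   have IV: "I \<in> V" unfolding I_def using Vcont_in_V[OF mild_Vcont(1)[OF Y] t] r by simp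
   have "N (U F t) <= N (exp (- t) *R u0) + N (exp (- t) *R I)"
    unfolding U_def I_def[symmetric] scaleR_add_right by (intro N_triangle V_scale u0 IV)
   also have "N (exp (- t) *R u0) <= M"
    using u0 t mult_right_mono[of "exp (- t)" 1 "N u0"] by (simp add: N_scale)
   also have "N (exp (- t) *R I) <= 2 * sqrt r * (norm y0 + 2 * r * MF)"
    unfolding I_def by (rule mild_N_bound[OF Y _ _ t]) (use r F norm_bounded[of F] order_trans in auto)
   also have "... <= 2 * sqrt r * (M + 2 * MF)"
    using r y0 MF mult_right_mono[of r 1 MF] by simp
   finally show ?thesis using c1 by simp
  qed
  have fU: "(%t. f (U F (cl t))) \<in> bcontfun" for F
  proof -
   have fc: "C0 r (%t. f (U F t))" by (rule f_Vcont[OF UV])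
   hence "bounded ((%t. f (U F t)) ` {0..r})" by (intro compact_imp_bounded compact_continuous_image) auto
   then obtain b where b: "ALL x : (%t. f (U F t)) ` {0..r}. norm x <= b" unfolding bounded_iff by blast
   have "norm (f (U F (cl t))) <= b" for t using b clr[of t] by blast
   moreover have "continuous_on UNIV (%t. f (U F (cl t)))"
    using clr by (intro continuous_on_compose2[OF fc clc]) auto
   ultimately show ?thesis by (intro bcontfun_normI)
  qed
  define g where "g F = Bcontfun (%t. f (U F (cl t)))" for F
  have g: "apply_bcontfun (g F) t = f (U F (cl t))" for F t
   unfolding g_def using Bcontfun_inverse[OF fU] by simp
  have "\<exists>!F \<in> cball 0 MF. g F = F"
  proof (rule Banach_fix[where c = "1/2"])
   show "complete (cball 0 MF :: (real \<Rightarrow>\<^sub>C 'h) set)" by (simp add: complete_eq_closed)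
   show "cball 0 MF ~= ({} :: (real \<Rightarrow>\<^sub>C 'h) set)" using MF by simp
   show "g ` cball 0 MF \<subseteq> cball 0 MF"
   proof (intro image_subsetI)
    fix F :: "real \<Rightarrow>\<^sub>C 'h" assume "F \<in> cball 0 MF"
    hence F: "norm F <= MF" by simp
    have "norm (g F) <= MF"
    proof (rule norm_bound)
     fix t
     have v: "U F (cl t) \<in> V" "N (U F (cl t)) <= M + 1" by (rule Vcont_in_V[OF UV clr], rule Ub[OF F clr])
     have "norm (f (U F (cl t)) - f 0) <= K * N (U F (cl t) - 0)"
      using M by (intro K(2) v V_zero) auto
     also have "... <= K * (M + 1)" using v(2) K(1) by (intro mult_left_mono) auto
     finally show "norm (apply_bcontfun (g F) t) <= MF"
      using norm_triangle_ineq2[of "f (U F (cl t))" "f 0"] by (simp add: g MF_def)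
    qed
    thus "g F \<in> cball 0 MF" by simp
   qed
   fix F G :: "real \<Rightarrow>\<^sub>C 'h" assume "F \<in> cball 0 MF" "G \<in> cball 0 MF"
   hence F: "norm F <= MF" and G: "norm G <= MF" by auto
   show "dist (g F) (g G) <= 1 / 2 * dist F G"
   proof (rule dist_bound)
    fix t
    have "norm (f (U F (cl t)) - f (U G (cl t))) <= K * N (U F (cl t) - U G (cl t))"
     by (intro K(2) Vcont_in_V[OF UV clr] Ub[OF F clr] Ub[OF G clr])
    also have "... <= K * (4 * sqrt r * dist F G)"
    proof (intro mult_left_mono K(1) sol_difference_bound[OF Y[of F] Y[of G] _ _ clr U_def U_def])
     fix s show "norm (apply_bcontfun F s - apply_bcontfun G s) <= dist F G"
      using dist_bounded[of F s G] by (simp add: dist_norm)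
    qed (use r in auto)
    also have "... = (4 * sqrt r * K) * dist F G" by simp
    also have "... <= 1 / 2 * dist F G" using c2 by (intro mult_right_mono) auto
    finally show "dist (apply_bcontfun (g F) t) (apply_bcontfun (g G) t) <= 1 / 2 * dist F G"
     unfolding g dist_norm[of "f _"] .
   qed
  qed auto
  then obtain F where F: "g F = F" by blast
  have "f (U F t) = apply_bcontfun F t" if "t \<in> {0..r}" for t using g[of F t] clid[OF that] F by simp
  hence "mild r y0 (%t. f (U F t)) (Y F)" by (intro mild_cong[OF Y]) auto
  thus ?thesis using u0 U_def unfolding sol_def by blast
 qed
 thus ?thesis by (intro exI[of _ r] conjI r(1) ballI allI impI)
qed

text \<open>At each time the value is taken from some solution living at least that long; uniqueness
  makes these values fit together.\<close>

lemma sol_glue: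
 assumes ex: "!!s. s \<in> J ==> EX u y. sol s u0 y0 u y"
 shows "EX u y. ALL s:J. sol s u0 y0 u y"
proof -
 obtain U Y where UY: "!!s. s \<in> J ==> sol s u0 y0 (U s) (Y s)" using ex by metis
 define r where "r t = (SOME s. s \<in> J \<and> t <= s)" for t
 have "sol s u0 y0 (%t. U (r t) t) (%t. Y (r t) t)" if s: "s \<in> J" for s
 proof -
  have "U (r t) t = U s t \<and> Y (r t) t = Y s t" if t: "t \<in> {0..s}" for t
  proof -
   have r: "r t \<in> J \<and> t <= r t" unfolding r_def by (rule someI[of _ s]) (use s t in auto)
   show ?thesis using t r
    by (intro sol_unique[of t u0 y0] sol_restrict[OF UY[of "r t"]] sol_restrict[OF UY[OF s]]) auto
  qed
  thus ?thesis by (intro sol_cong[OF UY[OF s]]) auto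
 qed
 thus ?thesis by blast
qed

text \<open>The existence time \<open>d\<close> for data of size \<open>M\<close> is known in
  advance, so restarting from a time closer to \<open>T\<close> than \<open>d\<close> carries the
  solution past \<open>T\<close>. Boundedness along some times tending to \<open>T\<close> is enough
  for this.\<close>

lemma sol_continuation:
 assumes s: "!!r. 0 <= r ==> r < T ==> sol r u0 y0 u y"
  and freq: "!!d. d > 0 ==> EX t. 0 <= t \<and> t < T \<and> T - t < d \<and> N (u t) <= M \<and> norm (y t) <= M"
 shows "EX r>T. EX v x. sol r u0 y0 v x \<and> (ALL t. 0 <= t --> t < T --> v t = u t \<and> x t = y t)"
proof -
 obtain d where d: "d > 0" "!!u0 y0. u0 \<in> V ==> N u0 <= M ==> norm y0 <= M ==> EX u y. sol d u0 y0 u y"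
  using local_existence[of M] by blast
 obtain t0 where t0: "0 <= t0" "t0 < T" "T - t0 < d" "N (u t0) <= M" "norm (y t0) <= M" using freq[OF d(1)] by blast
 have s0: "sol t0 u0 y0 u y" using s t0 by blast
 have "u t0 \<in> V" using Vcont_in_V[OF sol_Vcont[OF s0]] t0 by simp
 then obtain v x where v: "sol d (u t0) (y t0) v x" using d(2) t0 by blast
 have c: "sol (t0 + d) u0 y0 (%t. if t <= t0 then u t else v (t - t0)) (%t. if t <= t0 then y t else x (t - t0))"
  (is "sol _ _ _ ?v ?x") by (rule sol_concat[OF s0 v t0(1)]) (use d in simp)
 have "?v t = u t \<and> ?x t = y t" if t: "0 <= t" "t < T" for t
  using sol_unique[OF sol_restrict[OF c, of t] s[OF t]] t t0 by simp
 with c show ?thesis using t0 by (intro exI[of _ "t0 + d"]) auto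
qed

text \<open>The times reached by some solution form an interval, by restriction. Were it unbounded,
  gluing would give a global solution; \<open>T\<close> is its supremum, and nothing is asserted
  about reaching \<open>T\<close> itself.\<close>

lemma maximal_sol_exists:
 assumes u0: "u0 \<in> V" and no_global: "!!u y. \<not> (ALL t>=0. sol t u0 y0 u y)"
 shows "EX T>0. (EX u y. ALL t. 0 <= t --> t < T --> sol t u0 y0 u y) \<and> (ALL t>T. ALL u y. \<not> sol t u0 y0 u y)"
proof -
 define S where "S = {t. 0 <= t \<and> (EX u y. sol t u0 y0 u y)}"
 obtain d where d: "d > 0" "EX u y. sol d u0 y0 u y"
  using local_existence[of "max (N u0) (norm y0)"] u0 by auto
 hence dS: "d \<in> S" by (auto simp: S_def)
 have down: "t \<in> S" if "r \<in> S" "0 <= t" "t <= r" for r t using that sol_restrict unfolding S_def by blast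
 have bdd: "bdd_above S"
 proof (rule ccontr)
  assume "\<not> bdd_above S"
  hence "t \<in> S" if "0 <= t" for t
   using down[OF _ that] by (meson bdd_above.unfold linear)
  then obtain u y where "ALL t:{0..}. sol t u0 y0 u y" using sol_glue[of "{0..}" u0 y0] by (auto simp: S_def)
  thus False using no_global by auto
 qed
 define T where "T = Sup S"
 have T: "T > 0" using cSup_upper[OF dS bdd] d by (simp add: T_def)
 have "t \<in> S" if "0 <= t" "t < T" for t
  using less_cSup_iff[of S t] bdd dS that down unfolding T_def by force
 then obtain u y where "ALL t:{0..<T}. sol t u0 y0 u y" using sol_glue[of "{0..<T}" u0 y0] by (auto simp: S_def)
 moreover have "\<not> sol t u0 y0 u y" if "t > T" for t u y
  using cSup_upper[of t S] bdd that T unfolding T_def[symmetric] by (auto simp: S_def)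
 ultimately show ?thesis using T by (intro exI[of _ T] conjI exI[of _ u] exI[of _ y]) auto
qed

text \<open>Symmetry of \<open>R h\<close> and \<open>B h\<close> moves them onto the vector
  \<open>g\<close>, the shape in which the weak formulation can be compared with
  \<open>mild\<close>; \<open>mildI\<close> is the way back.\<close>

lemma mild_test:
 assumes m: "mild r y0 F y" and t: "t \<in> {0..r}" and h: "h > 0"
 shows "y t \<bullet> R h g + I0 t y \<bullet> B h g = y0 \<bullet> R h g + I0 t F \<bullet> R h g"
proof -
 have "(R h (y t) + B h (I0 t y)) \<bullet> g = (R h y0 + R h (I0 t F)) \<bullet> g"
  using mildD(3)[OF m h t] by simp
 thus ?thesis by (simp add: inner_add_left R_sym[OF h] B_sym[OF h])
qed

lemma mildI:
 assumes "C0 r F" "C0 r y"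
  and e: "!!h t g. h > 0 ==> t \<in> {0..r} ==>
   y t \<bullet> R h g + I0 t y \<bullet> B h g = y0 \<bullet> R h g + I0 t F \<bullet> R h g"
 shows "mild r y0 F y"
proof -
 have "R h (y t) + B h (I0 t y) = R h y0 + R h (I0 t F)"
  if h: "h > 0" and t: "t \<in> {0..r}" for h t
 proof -
  have "(R h (y t) + B h (I0 t y)) \<bullet> g = (R h y0 + R h (I0 t F)) \<bullet> g" for g
   unfolding inner_add_left R_sym[OF h] B_sym[OF h] by (rule e[OF h t])
  thus ?thesis by (rule iffD1[OF vector_eq_rdot, OF allI])
 qed
 thus ?thesis using assms(1,2) by (simp add: mild_def)
qed

text \<open>If \<open>h\<close> lies in the domain of the operator and \<open>L\<close> is its
  image, then \<open>(1 + A)^-1 (h + L) = h\<close>. Thus \<open>mild_test\<close> with parameter 1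
  can be evaluated on test functions.\<close>

lemma R_of_domain:
 assumes "h \<in> V" and "!!v. v \<in> V ==> a v h = v \<bullet> L"
 shows "R 1 (h + L) = h" and "B 1 (h + L) = L"
proof -
 show R: "R 1 (h + L) = h"
  using assms sym by (intro R_eqI) (auto simp: Q_def inner_add_right inner_commute)
 show "B 1 (h + L) = L" by (simp add: B_def R)
qed

end

section \<open>Smooth functions\<close>

lemma pd_eq:
 assumes "(f has_derivative f') (at x)"
 shows "pd b f x = f' b"
proof -
 have "((%s::real. x + s *R b) has_derivative (%s. s *R b)) (at 0)"
  by (auto intro!: derivative_eq_intros)
 moreover have "(f has_derivative f') (at (x + 0 *R b))" using assms by simp
 ultimately have "((%s. f (x + s *R b)) has_derivative (%s. f' (s *R b))) (at 0)"
  by (rule has_derivative_compose)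
 hence "((%s. f (x + s *R b)) has_real_derivative f' b) (at 0)"
  using linear_scale[OF has_derivative_linear[OF assms]]
  by (simp add: has_field_derivative_def mult.commute[of _ "f' b"])
 thus ?thesis unfolding partial_deriv_def by (rule DERIV_imp_deriv)
qed

lemma has_derivative_partial:
 fixes f :: "'a::euclidean_space => real"
 assumes "f differentiable (at x)"
 shows "(f has_derivative (%h. \<Sum>b\<in>Basis. (h \<bullet> b) * pd b f x)) (at x)"
proof -
 obtain f' where f': "(f has_derivative f') (at x)" using assms unfolding differentiable_def by blast
 have "f' = (%h. \<Sum>b\<in>Basis. (h \<bullet> b) * pd b f x)"
 proof
  fix h
  have "f' h = f' (\<Sum>b\<in>Basis. (h \<bullet> b) *R b)" by (simp add: euclidean_representation)
  also have "... = (\<Sum>b\<in>Basis. (h \<bullet> b) * f' b)"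
   using has_derivative_linear[OF f'] by (simp add: linear_sum linear_scale)
  finally show "f' h = (\<Sum>b\<in>Basis. (h \<bullet> b) * pd b f x)" by (simp add: pd_eq[OF f'])
 qed
 with f' show ?thesis by simp
qed

lemma has_derivative_directional:
 fixes f :: "'a::euclidean_space => real"
 assumes "f differentiable (at (x + s *R v))"
 shows "((%s. f (x + s *R v)) has_real_derivative (\<Sum>b\<in>Basis. (v \<bullet> b) * pd b f (x + s *R v))) (at s)"
proof -
 have "((%s::real. x + s *R v) has_derivative (%s. s *R v)) (at s)"
  by (auto intro!: derivative_eq_intros)
 note D = has_derivative_compose[OF this has_derivative_partial[OF assms]]
 have "(%r. \<Sum>b\<in>Basis. (r *R v \<bullet> b) * pd b f (x + s *R v))
   = (*) (\<Sum>b\<in>Basis. (v \<bullet> b) * pd b f (x + s *R v))"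
  by (rule ext) (simp add: sum_distrib_left mult_ac)
 with D show ?thesis by (simp add: has_field_derivative_def)
qed

lemma pd_real: "pd 1 f x = deriv f (x::real)"
proof -
 show ?thesis using deriv_shift_0[of f x] unfolding partial_deriv_def by (simp add: o_def)
qed

text \<open>Recursion on the derivative applied first, the opposite end from
  \<open>iter_partial\<close>. In this form closure under sums, products, reciprocals and affine
  maps follows by induction with the function generalised.\<close>

primrec Ck :: "nat => ('a::euclidean_space => real) => bool" where
 "Ck 0 f \<longleftrightarrow> (ALL x. f differentiable (at x))"
| "Ck (Suc n) f \<longleftrightarrow> (ALL x. f differentiable (at x)) \<and> (ALL b:Basis. Ck n (pd b f))"

lemma Ck_differentiable: "Ck n f ==> f differentiable (at x)"
 by (cases n) auto

lemma Ck_pred: "Ck (Suc n) f ==> Ck n f"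
 by (induction n arbitrary: f) auto

lemma ip_Nil [simp]: "ip [] f = f"
 by (simp add: iter_partial_def)

lemma ip_Cons: "ip (b # bs) f = pd b (ip bs f)"
 by (simp add: iter_partial_def)

lemma ip_snoc: "ip (bs @ [b]) f = ip bs (pd b f)"
 by (simp add: iter_partial_def)

lemma Ck_iff: "Ck n f \<longleftrightarrow> (ALL bs:lists Basis. length bs <= n --> (ALL x. ip bs f differentiable (at x)))"
proof (induction n arbitrary: f)
 case (Suc n)
 show ?case
 proof
  assume C: "Ck (Suc n) f"
  show "ALL bs:lists Basis. length bs <= Suc n --> (ALL x. ip bs f differentiable (at x))"
  proof (intro ballI impI)
   fix bs :: "'a list" assume bs: "bs \<in> lists Basis" "length bs <= Suc n"
   show "ALL x. ip bs f differentiable (at x)"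
   proof (cases bs rule: rev_cases)
    case Nil thus ?thesis using C by simp
   next
    case (snoc cs b)
    thus ?thesis using C bs Suc.IH[of "pd b f"] by (simp add: ip_snoc)
   qed
  qed
 next
  assume A: "ALL bs:lists Basis. length bs <= Suc n --> (ALL x. ip bs f differentiable (at x))"
  have "Ck n (pd b f)" if b: "b \<in> Basis" for b
   unfolding Suc.IH
  proof (intro ballI impI)
   fix bs :: "'a list" assume "bs \<in> lists Basis" "length bs <= n"
   thus "ALL x. ip bs (pd b f) differentiable (at x)"
    using A[rule_format, of "bs @ [b]"] b by (simp add: ip_snoc)
  qed
  thus "Ck (Suc n) f" using A[rule_format, of "[]"] by simp
 qed
qed simp

lemma smooth_iff_Ck: "smooth f \<longleftrightarrow> (ALL n. Ck n f)"
 unfolding smooth_def Ck_iff by blast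

lemma smooth_diffable: "smooth f ==> f differentiable (at x)"
 using Ck_differentiable smooth_iff_Ck by blast

lemma smooth_partial: "smooth f ==> b \<in> Basis ==> smooth (pd b f)"
 unfolding smooth_iff_Ck by (metis Ck.simps(2))

lemma smooth_iter_partial: "smooth f ==> bs \<in> lists Basis ==> smooth (ip bs f)"
 by (induction bs) (auto simp: ip_Cons smooth_partial)

lemma smooth_continuous: "smooth f ==> continuous_on S f"
 by (meson smooth_diffable continuous_at_imp_continuous_on differentiable_imp_continuous_within)

lemma smooth_deriv_real: "smooth f ==> (f has_real_derivative deriv f x) (at (x::real))"
 using smooth_diffable[of f x] by (simp add: DERIV_deriv_iff_real_differentiable)

lemma pd_add:
 assumes "f differentiable (at x)" "g differentiable (at x)"
 shows "pd b (%x. f x + g x) x = pd b f x + pd b g x"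
proof -
 obtain f' g' where "(f has_derivative f') (at x)" "(g has_derivative g') (at x)"
  using assms unfolding differentiable_def by blast
 thus ?thesis using pd_eq[OF has_derivative_add] by (metis pd_eq)
qed

lemma pd_mult:
 assumes "f differentiable (at x)" "g differentiable (at x)"
 shows "pd b (%x. f x * g x) x = f x * pd b g x + pd b f x * g x"
proof -
 obtain f' g' where "(f has_derivative f') (at x)" "(g has_derivative g') (at x)"
  using assms unfolding differentiable_def by blast
 thus ?thesis using pd_eq[OF has_derivative_mult] by (metis pd_eq)
qed

lemma pd_const [simp]: "pd b (%x. c) = (%x. 0)"
 by (rule ext) (simp add: pd_eq[OF has_derivative_const])

lemma Ck_const: "Ck n (%x. c)"
 by (induction n arbitrary: c) auto

lemma Ck_add: "Ck n f ==> Ck n g ==> Ck n (%x. f x + g x)"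
proof (induction n arbitrary: f g)
 case (Suc n)
 hence d: "f differentiable (at x)" "g differentiable (at x)" for x by auto
 hence "pd b (%x. f x + g x) = (%x. pd b f x + pd b g x)" for b
  by (intro ext pd_add)
 thus ?case using Suc by simp
qed simp

lemma Ck_mult: "Ck n f ==> Ck n g ==> Ck n (%x. f x * g x)"
proof (induction n arbitrary: f g)
 case (Suc n)
 hence d: "f differentiable (at x)" "g differentiable (at x)" for x by auto
 hence "pd b (%x. f x * g x) = (%x. f x * pd b g x + pd b f x * g x)" for b
  by (intro ext pd_mult)
 thus ?case using Suc.IH Suc.prems Ck_pred[OF Suc.prems(1)] Ck_pred[OF Suc.prems(2)] by (simp add: Ck_add)
qed simp

lemma smooth_const [simp]: "smooth (%x. c)"
 by (simp add: smooth_iff_Ck Ck_const)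

lemma smooth_add: "smooth f ==> smooth g ==> smooth (%x. f x + g x)"
 by (simp add: smooth_iff_Ck Ck_add)

lemma smooth_mult: "smooth f ==> smooth g ==> smooth (%x. f x * g x)"
 by (simp add: smooth_iff_Ck Ck_mult)

lemma smooth_minus: "smooth f ==> smooth (%x. - f x)"
 using smooth_mult[OF smooth_const[of "-1"]] by simp

lemma smooth_sum: "(!!i. i \<in> I ==> smooth (f i)) ==> smooth (%x. \<Sum>i\<in>I. f i x)"
 by (induction I rule: infinite_finite_induct) (auto intro: smooth_add)

lemma smooth_prod: "(!!i. i \<in> I ==> smooth (f i)) ==> smooth (%x. \<Prod>i\<in>I. f i x)"
 by (induction I rule: infinite_finite_induct) (auto intro: smooth_mult)

lemma smooth_power: "smooth f ==> smooth (%x. f x ^ n)"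
 by (induction n) (auto intro: smooth_mult)

lemma pd_affine:
 fixes T :: "'b::euclidean_space => 'a::euclidean_space"
 assumes T: "bounded_linear T" and Tc: "T c = k *R e" and f: "f differentiable (at (T x + d))"
 shows "pd c (%x. f (T x + d)) x = k * pd e f (T x + d)"
  and "(%x. f (T x + d)) differentiable (at x)"
proof -
 obtain f' where f': "(f has_derivative f') (at (T x + d))" using f unfolding differentiable_def by blast
 have "((%x. T x + d) has_derivative T) (at x)"
  using bounded_linear.has_derivative[OF T has_derivative_ident] by (auto intro!: derivative_eq_intros)
 from has_derivative_compose[OF this f']
 have D: "((%x. f (T x + d)) has_derivative (%h. f' (T h))) (at x)" .
 thus "(%x. f (T x + d)) differentiable (at x)" by (rule differentiableI)
 show "pd c (%x. f (T x + d)) x = k * pd e f (T x + d)" using pd_eq[OF D] linear_scale[OF has_derivative_linear[OF f']] by (simp add: Tc pd_eq[OF f'])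
qed

text \<open>Sending each basis vector to a multiple of a basis vector keeps every partial derivative
  a single term. Dilations, reflections, coordinate functions, slices and projections are all of
  this kind.\<close>

lemma Ck_affine:
 fixes T :: "'b::euclidean_space => 'a::euclidean_space"
 assumes T: "bounded_linear T" and Tc: "!!c. c \<in> Basis ==> e c \<in> Basis \<and> T c = k c *R e c" and f: "Ck n f"
 shows "Ck n (%x. f (T x + d))"
 using f
proof (induction n arbitrary: f)
 case 0
 thus ?case using pd_affine(2)[OF T, of 0 0 0] linear_0[OF bounded_linear.linear[OF T]] by simp
next
 case (Suc n)
 hence fd: "f differentiable (at x)" for x by simp
 have "pd c (%x. f (T x + d)) = (%x. k c * pd (e c) f (T x + d))" if "c \<in> Basis" for c
  using pd_affine(1)[OF T _ fd] Tc[OF that] by blast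
 moreover have "Ck n (%x. k c * pd (e c) f (T x + d))" if "c \<in> Basis" for c
  using Suc.IH[of "pd (e c) f"] Suc.prems Tc[OF that] by (intro Ck_mult Ck_const) auto
 ultimately show ?case using pd_affine(2)[OF T, of 0 0 0] linear_0[OF bounded_linear.linear[OF T]] fd by simp
qed

lemma smooth_affine:
 fixes T :: "'b::euclidean_space => 'a::euclidean_space"
 assumes "bounded_linear T" and "!!c. c \<in> Basis ==> e c \<in> Basis \<and> T c = k c *R e c" and "smooth f"
 shows "smooth (%x. f (T x + d))"
 using Ck_affine[OF assms(1,2)] assms(3) by (simp add: smooth_iff_Ck)

lemma smooth_scale: "smooth f ==> smooth (%x. f (c *R x + d))"
 by (rule smooth_affine[where e = "%b. b" and k = "%_. c"]) (auto intro: bounded_linear_scaleR_right)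

lemma smooth_inner: "smooth f ==> smooth (%x. f (x \<bullet> b))"
 using smooth_affine[where T = "%x. x \<bullet> b" and e = "%_. 1" and k = "%c. c \<bullet> b" and d = 0 and f = f]
 by auto

lemma smooth_snd:
 assumes "smooth f"
 shows "smooth (%p::'a::euclidean_space \<times> 'b::euclidean_space. f (snd p))"
proof -
 \<comment> \<open>On basis vectors of the first factor the second component is 0, represented as 0
   times an arbitrary basis vector.\<close>
 define e :: "'a \<times> 'b => 'b" where "e c = (if snd c = 0 then SOME b. b \<in> Basis else snd c)" for c
 define k :: "'a \<times> 'b => real" where "k c = (if snd c = 0 then 0 else 1)" for c
 have "e c \<in> Basis \<and> snd c = k c *R e c" if "c \<in> Basis" for c
  using that unfolding Basis_prod_def e_def k_def by (auto simp: SOME_Basis)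
 from smooth_affine[OF bounded_linear_snd this assms, of 0] show ?thesis by simp
qed

lemma smooth_fst:
 assumes "smooth f"
 shows "smooth (%p::'a::euclidean_space \<times> 'b::euclidean_space. f (fst p))"
proof -
 define e :: "'a \<times> 'b => 'a" where "e c = (if fst c = 0 then SOME b. b \<in> Basis else fst c)" for c
 define k :: "'a \<times> 'b => real" where "k c = (if fst c = 0 then 0 else 1)" for c
 have "e c \<in> Basis \<and> fst c = k c *R e c" if "c \<in> Basis" for c
  using that unfolding Basis_prod_def e_def k_def by (auto simp: SOME_Basis)
 from smooth_affine[OF bounded_linear_fst this assms, of 0] show ?thesis by simp
qed

lemma smooth_slice: "smooth f ==> smooth (%x::'a::euclidean_space. f (t::'b::euclidean_space, x))"
 using smooth_affine[where T = "%x::'a. (0::'b, x)" and d = "(t, 0)" and f = f and e = "%c. (0, c)" and k = "%c. 1"]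
 by (simp add: bounded_linear_Pair Basis_prod_def)

lemma Ck_inverse:
 assumes "Ck n f" "!!x. f x ~= 0" shows "Ck n (%x. inverse (f x))"
 using assms(1)
proof (induction n)
 case 0
 thus ?case using assms(2) by simp
next
 case (Suc n)
 have fd: "f differentiable (at x)" for x using Suc.prems by simp
 have "pd b (%x. inverse (f x)) = (%x. (-1) * (inverse (f x) * (pd b f x * inverse (f x))))" for b
 proof
  fix x
  obtain f' where f': "(f has_derivative f') (at x)" using fd unfolding differentiable_def by blast
  show "pd b (%x. inverse (f x)) x = (-1) * (inverse (f x) * (pd b f x * inverse (f x)))"
   using pd_eq[OF Deriv.has_derivative_inverse[OF assms(2) f']] by (simp add: pd_eq[OF f'])
 qed
 moreover have "Ck n (%x. (-1) * (inverse (f x) * (pd b f x * inverse (f x))))" if "b \<in> Basis" for b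
  using Suc.IH[OF Ck_pred[OF Suc.prems]] Suc.prems that by (intro Ck_mult Ck_const) auto
 ultimately show ?case using fd assms(2) by simp
qed

lemma smooth_divide: "smooth f ==> smooth g ==> (!!x. g x ~= 0) ==> smooth (%x. f x / g x)"
 unfolding divide_inverse by (intro smooth_mult) (auto simp: smooth_iff_Ck Ck_inverse)

section \<open>Smooth steps and plateaus\<close>

text \<open>The functions \<open>exp (- 1 / x) / x^k\<close>, extended by 0, form a family closed
  under differentiation up to linear combinations; smoothness then follows for all \<open>k\<close>
  at once.\<close>

definition flat_exp :: "nat => real => real" where
 "flat_exp k x = (if x <= 0 then 0 else exp (- inverse x) * inverse x ^ k)"

lemma flat_exp_limit: "(flat_exp k ---> 0) (at_right 0)"
proof -
 have "((%x::real. x ^ k / exp x) ---> 0) at_top" by (rule tendsto_power_div_exp_0)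
 hence "((%x::real. inverse x ^ k / exp (inverse x)) ---> 0) (at_right 0)"
  by (rule filterlim_compose) (rule filterlim_inverse_at_top_right)
 moreover have "\<forall>\<^sub>F x in at_right 0. inverse x ^ k / exp (inverse x) = flat_exp k x"
  by (auto simp: eventually_at_filter flat_exp_def exp_minus field_simps)
 ultimately show ?thesis by (rule Lim_transform_eventually)
qed

lemma flat_exp_deriv:
 "(flat_exp k has_real_derivative (flat_exp (k + 2) x - real k * flat_exp (k + 1) x)) (at x)"
proof -
 consider "x < 0" | "x = 0" | "x > 0" by linarith
 thus ?thesis
 proof cases
  case 1
  have "(flat_exp k has_real_derivative 0) (at x)" by (rule has_field_derivative_transform_within_open[of _ _ _ "{..<0}"]) (use 1 in "auto simp: flat_exp_def")
  thus ?thesis using 1 by (simp add: flat_exp_def)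
 next
  case 3
  have e: "real k * (- (y ^ Suc (Suc 0)) * y ^ (k - Suc 0)) = - (real k * y ^ (k + 1))" for y
   by (cases k) auto
  have "((%x. inverse x ^ k) has_real_derivative - (real k * inverse x ^ (k + 1))) (at x)"
   using DERIV_power[OF DERIV_inverse[of x], of k] 3 unfolding e by simp
  moreover have "((%x. exp (- inverse x)) has_real_derivative exp (- inverse x) * inverse x ^ 2) (at x)"
   using 3 by (auto intro!: derivative_eq_intros simp: power2_eq_square)
  ultimately have "((%x. exp (- inverse x) * inverse x ^ k) has_real_derivative
    (exp (- inverse x) * - (real k * inverse x ^ (k + 1)) + exp (- inverse x) * inverse x ^ 2 * inverse x ^ k)) (at x)"
   by (intro DERIV_mult')
  moreover have "exp (- inverse x) * - (real k * inverse x ^ (k + 1)) + exp (- inverse x) * inverse x ^ 2 * inverse x ^ k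
    = flat_exp (k + 2) x - real k * flat_exp (k + 1) x"
   using 3 unfolding flat_exp_def power_add by simp
  ultimately have "((%x. exp (- inverse x) * inverse x ^ k) has_real_derivative
    (flat_exp (k + 2) x - real k * flat_exp (k + 1) x)) (at x)" by simp
  thus ?thesis
   by (rule has_field_derivative_transform_within_open[of _ _ _ "{0<..}"]) (use 3 in "auto simp: flat_exp_def")
 next
  case 2
  \<comment> \<open>The difference quotient at 0 from the right is \<open>flat_exp (k + 1)\<close>,
    which again tends to 0.\<close>
  have "((%h. flat_exp k h / h) ---> 0) (at_right 0)"
   by (rule Lim_transform_eventually[OF flat_exp_limit[of "k + 1"]])
    (auto simp: flat_exp_def field_simps)
  moreover have "((%h. flat_exp k h / h) ---> 0) (at_left 0)"
   by (rule Lim_transform_eventually[OF tendsto_const]) (auto simp: eventually_at_filter flat_exp_def)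
  ultimately have "((%h. flat_exp k h / h) ---> 0) (at 0)" by (rule filterlim_split_at[rotated])
  thus ?thesis using 2 by (simp add: DERIV_def flat_exp_def)
 qed
qed

lemma smooth_flat_exp: "smooth (flat_exp k)"
proof -
 have "Ck n (flat_exp k)" for n k
 proof (induction n arbitrary: k)
  case 0
  thus ?case using flat_exp_deriv[of k] by (simp add: real_differentiable_def) blast
 next
  case (Suc n)
  have "pd 1 (flat_exp k) = (%x. flat_exp (k + 2) x + (- real k) * flat_exp (k + 1) x)"
   using DERIV_imp_deriv[OF flat_exp_deriv[of k]] by (simp add: pd_real fun_eq_iff)
  moreover have "Ck n (%x. flat_exp (k + 2) x + (- real k) * flat_exp (k + 1) x)"
   by (intro Ck_add Ck_mult Ck_const Suc.IH)
  ultimately show ?case using flat_exp_deriv[of k] by (simp add: real_differentiable_def) blast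
 qed
 thus ?thesis by (simp add: smooth_iff_Ck)
qed

definition step :: "real => real" where
 "step x = flat_exp 0 x / (flat_exp 0 x + flat_exp 0 (1 - x))"

lemma flat_exp_nonneg: "0 <= flat_exp k x"
 by (simp add: flat_exp_def)

lemma flat_exp_pos: "x > 0 ==> 0 < flat_exp k x"
 by (simp add: flat_exp_def)

lemma step_denominator: "0 < flat_exp 0 x + flat_exp 0 (1 - x)"
 using flat_exp_pos[of x 0] flat_exp_pos[of "1 - x" 0] flat_exp_nonneg[of 0 x] flat_exp_nonneg[of 0 "1 - x"]
 by force

lemma smooth_step: "smooth step"
proof -
 show ?thesis using smooth_scale[OF smooth_flat_exp, where c = "-1" and d = 1] step_denominator unfolding step_def[abs_def] by (intro smooth_divide smooth_add smooth_flat_exp) (auto simp: less_imp_neq[symmetric])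
qed

lemma step_0: "x <= 0 ==> step x = 0"
 by (simp add: step_def flat_exp_def)

lemma step_1: "x >= 1 ==> step x = 1"
 by (simp add: step_def flat_exp_def)

lemma step_range: "0 <= step x" "step x <= 1"
 using step_denominator[of x] flat_exp_nonneg[of 0 x] flat_exp_nonneg[of 0 "1 - x"]
 by (auto simp: step_def)

text \<open>The numerator of the quotient rule is a sum of two nonnegative products. The sign is
  needed where the derivative of a time cut-off serves as a density.\<close>

lemma deriv_step_nonneg: "0 <= deriv step x"
proof -
 define A where "A = flat_exp 0"
 have d: "(A has_real_derivative flat_exp 2 x) (at x)" for x
  using flat_exp_deriv[of 0 x] by (simp add: A_def numeral_2_eq_2)
 have "((%x::real. 1 - x) has_real_derivative -1) (at x)" by (auto intro!: derivative_eq_intros)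
 from DERIV_chain2[where g = "%x. 1 - x", OF d this]
 have d1: "((%x. A (1 - x)) has_real_derivative - flat_exp 2 (1 - x)) (at x)" by simp
 have n: "A x + A (1 - x) ~= 0" using step_denominator[of x] by (simp add: A_def)
 have "(step has_real_derivative
   (flat_exp 2 x * (A x + A (1 - x)) - A x * (flat_exp 2 x + - flat_exp 2 (1 - x))) / ((A x + A (1 - x)) * (A x + A (1 - x)))) (at x)"
  unfolding step_def[abs_def] A_def[symmetric] by (intro DERIV_divide DERIV_add d d1 n)
 moreover have "flat_exp 2 x * (A x + A (1 - x)) - A x * (flat_exp 2 x + - flat_exp 2 (1 - x))
   = flat_exp 2 x * A (1 - x) + A x * flat_exp 2 (1 - x)" by (simp add: algebra_simps)
 moreover have "0 <= flat_exp 2 x * A (1 - x) + A x * flat_exp 2 (1 - x)"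
  by (simp add: A_def flat_exp_nonneg)
 ultimately show ?thesis using DERIV_imp_deriv by force
qed

definition plateau :: "real => real" where
 "plateau x = step (2 - x) * step (2 + x)"

lemma smooth_plateau: "smooth plateau"
 using smooth_scale[OF smooth_step, of "-1" 2] smooth_scale[OF smooth_step, of 1 2]
 unfolding plateau_def[abs_def] by (intro smooth_mult) (simp_all add: add.commute)

lemma plateau_range: "0 <= plateau x" "plateau x <= 1"
 using step_range by (auto simp: plateau_def mult_le_one)

lemma plateau_1: "\<bar>x\<bar> <= 1 ==> plateau x = 1"
 by (simp add: plateau_def step_1)

lemma plateau_0: "\<bar>x\<bar> >= 2 ==> plateau x = 0"
 by (auto simp: plateau_def step_0 abs_if split: if_splits)

text \<open>A product over coordinates reduces smoothness to one variable: the value is 1 on the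
  cube of half-side 1 and 0 outside that of half-side 2.\<close>

definition bump :: "'a::euclidean_space => real" where
 "bump x = (\<Prod>b\<in>Basis. plateau (x \<bullet> b))"

lemma smooth_bump: "smooth bump"
 unfolding bump_def[abs_def] by (intro smooth_prod smooth_inner smooth_plateau)

lemma bump_range: "0 <= bump x" "bump x <= 1"
 using plateau_range by (auto simp: bump_def intro!: prod_nonneg prod_le_1)

lemma bump_1: "(!!b. b \<in> Basis ==> \<bar>x \<bullet> b\<bar> <= 1) ==> bump x = 1"
 by (simp add: bump_def plateau_1)

lemma bump_0: "b \<in> Basis ==> \<bar>x \<bullet> b\<bar> >= 2 ==> bump x = 0"
 unfolding bump_def using plateau_0 by auto

section \<open>Mixed derivatives and powers of the Laplacian\<close>

lemma smooth_along_basis: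
 assumes "smooth f" "b \<in> Basis"
 shows "((%s. f (x + s *R b)) has_real_derivative pd b f (x + s *R b)) (at s)"
proof -
 have "(\<Sum>c\<in>Basis. (b \<bullet> c) * pd c f (x + s *R b)) = (\<Sum>c\<in>Basis. if c = b then pd c f (x + s *R b) else 0)"
  using assms(2) by (intro sum.cong) (auto simp: inner_Basis)
 also have "... = pd b f (x + s *R b)" using assms(2) by simp
 finally show ?thesis using has_derivative_directional[where x = x and s = s and v = b, OF smooth_diffable[OF assms(1)]] by simp
qed

lemma mixed_increment:
 assumes f: "smooth f" and b: "b \<in> Basis" and c: "c \<in> Basis" and h: "h > 0"
 shows "EX s t. 0 < s \<and> s < h \<and> 0 < t \<and> t < h \<and>
  f (x + h *R b + h *R c) - f (x + h *R b) - f (x + h *R c) + f x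
   = h^2 * pd c (pd b f) (x + s *R b + t *R c)"
proof -
 define G where "G s = f ((x + h *R c) + s *R b) - f (x + s *R b)" for s
 have "(G has_real_derivative pd b f ((x + h *R c) + s *R b) - pd b f (x + s *R b)) (at s)" for s
  unfolding G_def by (intro DERIV_diff smooth_along_basis f b)
 then obtain s where s: "0 < s" "s < h" and
  G: "G h - G 0 = (h - 0) * (pd b f ((x + h *R c) + s *R b) - pd b f (x + s *R b))"
  using MVT2[OF h, of G "%s. pd b f ((x + h *R c) + s *R b) - pd b f (x + s *R b)"] by blast
 define H where "H t = pd b f ((x + s *R b) + t *R c)" for t
 have "(H has_real_derivative pd c (pd b f) ((x + s *R b) + t *R c)) (at t)" for t
  unfolding H_def by (intro smooth_along_basis smooth_partial f b c)
 then obtain t where t: "0 < t" "t < h" and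
  H: "H h - H 0 = (h - 0) * pd c (pd b f) ((x + s *R b) + t *R c)"
  using MVT2[OF h, of H "%t. pd c (pd b f) ((x + s *R b) + t *R c)"] by blast
 have "G h - G 0 = h^2 * pd c (pd b f) ((x + s *R b) + t *R c)" using G H by (simp add: H_def add_ac power2_eq_square)
 moreover have "G h - G 0 = f (x + h *R b + h *R c) - f (x + h *R b) - f (x + h *R c) + f x"
  by (simp add: G_def add_ac)
 ultimately show ?thesis using s t by metis
qed

text \<open>The second difference in the directions \<open>b\<close> and \<open>c\<close> is
  symmetric in them, and by \<open>mixed_increment\<close> it equals \<open>h^2\<close> times either
  mixed derivative at some point near \<open>x\<close>. Continuity of both derivatives identifies
  them at \<open>x\<close>.\<close>

lemma pd_commute:
 fixes f :: "'a::euclidean_space => real"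
 assumes f: "smooth f" and b: "b \<in> Basis" and c: "c \<in> Basis"
 shows "pd b (pd c f) = pd c (pd b f)"
proof
 fix x
 define P where "P = pd b (pd c f)"
 define Q where "Q = pd c (pd b f)"
 have cont: "continuous_on UNIV P" "continuous_on UNIV Q"
  unfolding P_def Q_def by (intro smooth_continuous smooth_partial f b c)+
 have "dist (P x) (Q x) < e" if e: "e > 0" for e
 proof -
  obtain d1 where d1: "d1 > 0" "!!y. dist y x < d1 ==> dist (P y) (P x) < e / 2"
   using cont(1) e unfolding continuous_on_iff by (meson UNIV_I half_gt_zero)
  obtain d2 where d2: "d2 > 0" "!!y. dist y x < d2 ==> dist (Q y) (Q x) < e / 2"
   using cont(2) e unfolding continuous_on_iff by (meson UNIV_I half_gt_zero)
  define h where "h = min d1 d2 / 2"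
  have h: "h > 0" "2 * h <= d1" "2 * h <= d2" using d1 d2 by (auto simp: h_def)
  obtain s t where st: "0 < s" "s < h" "0 < t" "t < h" and
   Q: "f (x + h *R b + h *R c) - f (x + h *R b) - f (x + h *R c) + f x = h^2 * Q (x + s *R b + t *R c)"
   using mixed_increment[OF f b c h(1)] unfolding Q_def by blast
  obtain s' t' where st': "0 < s'" "s' < h" "0 < t'" "t' < h" and
   P: "f (x + h *R c + h *R b) - f (x + h *R c) - f (x + h *R b) + f x = h^2 * P (x + s' *R c + t' *R b)"
   using mixed_increment[OF f c b h(1)] unfolding P_def by blast
  have "h^2 * P (x + s' *R c + t' *R b) = h^2 * Q (x + s *R b + t *R c)"
   unfolding P[symmetric] Q[symmetric] by (simp add: algebra_simps)
  hence eq: "P (x + s' *R c + t' *R b) = Q (x + s *R b + t *R c)" using h by simp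
  have near: "dist (x + r *R u + q *R v) x < 2 * h"
   if "0 < r" "r < h" "0 < q" "q < h" "u \<in> Basis" "v \<in> Basis" for r q and u v :: 'a
   using norm_triangle_ineq[of "r *R u" "q *R v"] that by (simp add: dist_norm)
  have "dist (P (x + s' *R c + t' *R b)) (P x) < e / 2" "dist (Q (x + s *R b + t *R c)) (Q x) < e / 2"
   by (rule d1(2)[OF order.strict_trans2[OF near[OF st' c b] h(2)]], rule d2(2)[OF order.strict_trans2[OF near[OF st b c] h(3)]])
  thus ?thesis using eq dist_triangle_half_r by metis
 qed
 hence "P x = Q x" by (metis less_irrefl zero_less_dist_iff)
 thus "pd b (pd c f) x = pd c (pd b f) x" by (simp add: P_def Q_def)
qed

lemma ip_commute:
 assumes "smooth f" "bs \<in> lists Basis" "b \<in> Basis"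
 shows "pd b (ip bs f) = ip bs (pd b f)"
 using assms(2)
proof (induction bs)
 case (Cons c cs)
 thus ?case
  using pd_commute[OF smooth_iter_partial[OF assms(1)] assms(3), of cs c] by (simp add: ip_Cons)
qed simp

lemma pd_cmult:
 assumes "f differentiable (at x)" shows "pd b (%x. c * f x) x = c * pd b f x"
 using pd_mult[OF differentiable_const assms, of b c] by simp

lemma pd_sum:
 assumes "finite I" "!!i. i \<in> I ==> f i differentiable (at x)"
 shows "pd b (%x. \<Sum>i\<in>I. f i x) x = (\<Sum>i\<in>I. pd b (f i) x)"
 using assms by (induction I rule: finite_induct) (simp_all add: pd_add)

lemma ip_add:
 assumes "smooth f" "smooth g" "bs \<in> lists Basis"
 shows "ip bs (%x. f x + g x) = (%x. ip bs f x + ip bs g x)"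
 using assms(3)
proof (induction bs)
 case (Cons c cs)
 thus ?case using assms
  by (auto simp: ip_Cons intro!: pd_add smooth_diffable smooth_iter_partial)
qed simp

lemma ip_cmult:
 assumes "smooth f" "bs \<in> lists Basis"
 shows "ip bs (%x. c * f x) = (%x. c * ip bs f x)"
 using assms(2)
proof (induction bs)
 case (Cons d cs)
 thus ?case using assms
  by (auto simp: ip_Cons intro!: pd_cmult smooth_diffable smooth_iter_partial)
qed simp

lemma ip_affine:
 fixes T :: "'b::euclidean_space => 'a::euclidean_space"
 assumes T: "bounded_linear T" and Tc: "!!c. c \<in> Basis ==> e c \<in> Basis \<and> T c = k c *R e c"
  and f: "smooth f" and bs: "bs \<in> lists Basis"
 shows "ip bs (%x. f (T x + d)) = (%x. prod_list (map k bs) * ip (map e bs) f (T x + d))"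
 using bs
proof (induction bs)
 case (Cons c cs)
 hence c: "c \<in> Basis" and cs: "cs \<in> lists Basis" by auto
 have m: "map e cs \<in> lists Basis" using cs Tc by auto
 have s: "smooth (ip (map e cs) f)" by (rule smooth_iter_partial[OF f m])
 show ?case
 proof
  fix x
  show "ip (c # cs) (%x. f (T x + d)) x = prod_list (map k (c # cs)) * ip (map e (c # cs)) f (T x + d)" using pd_affine[OF T conjunct2[OF Tc[OF c]] smooth_diffable[OF s]] Cons.IH by (simp add: pd_cmult ip_Cons)
 qed
qed simp

lemma smooth_neg_laplacian: "smooth f ==> smooth (neg_laplacian f)"
 unfolding neg_laplacian_def[abs_def] by (intro smooth_minus smooth_sum smooth_partial)

lemma neg_laplacian_partial:
 assumes f: "smooth f" and b: "b \<in> Basis"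
 shows "neg_laplacian (pd b f) = pd b (neg_laplacian f)"
proof
 fix x
 have "pd b (neg_laplacian f) x = (-1) * pd b (%x. \<Sum>c\<in>Basis. pd c (pd c f) x) x"
  unfolding neg_laplacian_def[abs_def]
  using pd_cmult[of "%x. \<Sum>c\<in>Basis. pd c (pd c f) x" x b "-1"]
  by (simp add: smooth_diffable smooth_partial f)
 also have "pd b (%x. \<Sum>c\<in>Basis. pd c (pd c f) x) x
   = (\<Sum>c\<in>Basis. pd b (pd c (pd c f)) x)"
  by (intro pd_sum smooth_diffable smooth_partial f) auto
 finally show "neg_laplacian (pd b f) x = pd b (neg_laplacian f) x" using pd_commute[OF smooth_partial[OF f] b] pd_commute[OF f b] by (simp add: neg_laplacian_def[of "pd b f"])
qed

lemma neg_laplacian_iter_partial: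
 assumes "smooth f" "bs \<in> lists Basis"
 shows "neg_laplacian (ip bs f) = ip bs (neg_laplacian f)"
 using assms(2)
proof (induction bs)
 case (Cons c cs)
 thus ?case using neg_laplacian_partial[OF smooth_iter_partial[OF assms(1)]] by (simp add: ip_Cons)
qed simp

lemma lap_pow_0 [simp]: "neg_laplacian_pow 0 f = f"
 by (simp add: neg_laplacian_pow_def)

lemma lap_pow_Suc: "neg_laplacian_pow (Suc n) f = neg_laplacian (neg_laplacian_pow n f)"
 and lap_pow_Suc2: "neg_laplacian_pow (Suc n) f = neg_laplacian_pow n (neg_laplacian f)"
 by (simp_all add: neg_laplacian_pow_def funpow_swap1)

lemma smooth_neg_laplacian_pow: "smooth f ==> smooth (neg_laplacian_pow n f)"
 by (induction n) (auto simp: lap_pow_Suc smooth_neg_laplacian)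

lemma neg_laplacian_add:
 assumes "smooth f" "smooth g"
 shows "neg_laplacian (%x. f x + g x) = (%x. neg_laplacian f x + neg_laplacian g x)"
 using ip_add[OF assms, of "[b, b]" for b]
 by (simp add: neg_laplacian_def[abs_def] ip_Cons sum.distrib)

lemma neg_laplacian_cmult:
 assumes "smooth f" shows "neg_laplacian (%x. c * f x) = (%x. c * neg_laplacian f x)"
 using ip_cmult[OF assms, of "[b, b]" c for b]
 by (simp add: neg_laplacian_def[abs_def] ip_Cons sum_distrib_left)

lemma lap_pow_cmult:
 assumes "smooth f" shows "neg_laplacian_pow n (%x. c * f x) = (%x. c * neg_laplacian_pow n f x)"
 by (induction n) (simp_all add: lap_pow_Suc neg_laplacian_cmult smooth_neg_laplacian_pow assms)

lemma lap_pow_add: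
 assumes "smooth f" "smooth g"
 shows "neg_laplacian_pow n (%x. f x + g x) = (%x. neg_laplacian_pow n f x + neg_laplacian_pow n g x)"
 by (induction n) (simp_all add: lap_pow_Suc neg_laplacian_add smooth_neg_laplacian_pow assms)

section \<open>Test functions\<close>

lemma test_iff: "test g \<longleftrightarrow> smooth g \<and> (EX r. ALL x. g x ~= 0 --> norm x <= r)"
proof
 assume t: "test g"
 hence "bounded (closure {x. g x ~= 0})" by (auto simp: test_functions_def)
 then obtain r where r: "ALL x:closure {x. g x ~= 0}. norm x <= r" unfolding bounded_iff by blast
 with t show "smooth g \<and> (EX r. ALL x. g x ~= 0 --> norm x <= r)" using closure_subset[of "{x. g x ~= 0}"] by (auto simp: test_functions_def)
next
 assume a: "smooth g \<and> (EX r. ALL x. g x ~= 0 --> norm x <= r)"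
 then obtain r where "ALL x. g x ~= 0 --> norm x <= r" by blast
 thus "test g" using a by (auto simp: bounded_iff test_functions_def)
qed

lemma test_smooth: "g \<in> test_functions S ==> smooth g"
 by (simp add: test_functions_def)

lemma test_support: assumes "test g" obtains r where "r > 0" "!!x. g x ~= 0 ==> norm x <= r"
proof -
 obtain r where "ALL x. g x ~= 0 --> norm x <= r" using assms test_iff by blast
 thus thesis by (intro that[of "max r 1"]) auto
qed

lemma pd_zero_outside:
 assumes "!!x. f x ~= 0 ==> norm x <= r" and nz: "pd b f x ~= 0"
 shows "norm x <= r"
proof (rule ccontr)
 assume "\<not> norm x <= r"
 hence x: "x \<in> - cball 0 r" by simp
 have "((%x. 0) has_derivative (%h. 0)) (at x)" by simp
 hence "(f has_derivative (%h. 0)) (at x)"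
  by (rule has_derivative_transform_within_open[OF _ _ x]) (use assms(1) in "auto simp: closed_cball open_Compl")
 thus False using nz pd_eq by fastforce
qed

lemma test_partial: "test g ==> b \<in> Basis ==> test (pd b g)"
 unfolding test_iff using smooth_partial pd_zero_outside by metis

lemma test_iter: "test g ==> bs \<in> lists Basis ==> test (ip bs g)"
 by (induction bs) (auto simp: ip_Cons test_partial)

lemma test_mult:
 assumes "test g" "smooth f"
 shows "test (%x. g x * f x)" "test (%x. f x * g x)"
proof -
 show "test (%x. g x * f x)"
  using assms unfolding test_iff by (auto intro: smooth_mult)
 thus "test (%x. f x * g x)" by (simp add: mult.commute)
qed

lemma test_cmult: "test g ==> test (%x. c * g x)"
 by (rule test_mult(2)) auto

lemma test_zero: "test (%x. 0)"
 by (auto simp: test_iff)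

lemma test_add:
 assumes "test g" "test h"
 shows "test (%x. g x + h x)"
proof -
 obtain r where r: "!!x. g x ~= 0 ==> norm x <= r" using assms(1) test_iff by blast
 obtain s where s: "!!x. h x ~= 0 ==> norm x <= s" using assms(2) test_iff by blast
 have "norm x <= max r s" if "g x + h x ~= 0" for x
  using that r[of x] s[of x] by force
 thus ?thesis using assms by (auto simp: test_iff intro: smooth_add)
qed

lemma test_diff: "test g ==> test h ==> test (%x. g x - h x)"
 using test_add[OF _ test_cmult[of h "-1"]] by simp

lemma test_sum: "(!!i. i \<in> I ==> test (f i)) ==> test (%x. \<Sum>i\<in>I. f i x)"
 by (induction I rule: infinite_finite_induct) (auto intro: test_add test_zero)

lemma test_neg_laplacian: "test g ==> test (neg_laplacian g)"
 using test_cmult[OF test_sum[OF test_partial[OF test_partial]], where c = "-1" and I1 = Basis]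
 by (simp add: neg_laplacian_def[abs_def])

lemma test_neg_laplacian_pow: "test g ==> test (neg_laplacian_pow n g)"
 by (induction n) (auto simp: lap_pow_Suc test_neg_laplacian)

lemma integrable_compact_support:
 fixes f :: "'a::euclidean_space => real"
 assumes "continuous_on UNIV f" "!!x. f x ~= 0 ==> norm x <= r"
 shows "integrable lborel f" "integrable lebesgue f"
proof -
 have "integrable lborel (%x. indicator (cball 0 r) x *R f x)"
  by (rule borel_integrable_compact) (use assms(1) in "auto intro: continuous_on_subset")
 also have "(%x. indicator (cball 0 r) x *R f x) = f"
  using assms(2) by force
 finally show "integrable lborel f" .
 thus "integrable lebesgue f" by (simp add: integrable_completion)
qed

lemma integral_lebesgue_borel:
 fixes f :: "'a::euclidean_space => real"
 shows "f \<in> borel_measurable borel ==> (LINT x|lebesgue. f x) = (LINT x|lborel. f x)"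
 by (rule integral_completion) simp

lemma test_integrable: "test g ==> integrable lborel g" "test g ==> integrable lebesgue g"
 using integrable_compact_support smooth_continuous unfolding test_iff by blast+

lemma test_measurable: "test g ==> g \<in> borel_measurable borel"
 by (intro borel_measurable_continuous_onI smooth_continuous test_smooth)

lemma test_bounded: assumes "test g" obtains C where "C >= 0" "!!x. \<bar>g x\<bar> <= C"
proof -
 obtain r where r: "r > 0" "!!x. g x ~= 0 ==> norm x <= r" using test_support[OF assms] by blast
 have "bounded (g ` cball 0 r)"
  by (intro compact_imp_bounded compact_continuous_image smooth_continuous test_smooth[OF assms]) auto
 then obtain C where C: "ALL y:g ` cball 0 r. norm y <= C" unfolding bounded_iff by blast
 have "\<bar>g x\<bar> <= max C 0" for x
  using C r(2)[of x] by force
 thus thesis by (intro that[of "max C 0"]) auto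
qed

lemma test_increment_le:
 assumes "test g"
 obtains C where "C >= 0" "!!x y. \<bar>g x - g y\<bar> <= C * norm (x - y)"
proof -
 have "EX C. 0 <= C \<and> (ALL x. \<bar>pd b g x\<bar> <= C)" if "b \<in> Basis" for b
  using test_bounded[OF test_partial[OF assms that]] by metis
 then obtain K where K: "!!b. b \<in> Basis ==> 0 <= K b" "!!b x. b \<in> Basis ==> \<bar>pd b g x\<bar> <= K b" by metis
 define C where "C = (\<Sum>b\<in>Basis. K b)"
 have C: "C >= 0" using K by (auto simp: C_def intro: sum_nonneg)
 have "norm (g y - g x) <= C * norm (y - x)" for x y
 proof (rule differentiable_bound[where S = UNIV and f' = "%x h. \<Sum>b\<in>Basis. (h \<bullet> b) * pd b g x"])
  show "(g has_derivative (%h. \<Sum>b\<in>Basis. (h \<bullet> b) * pd b g x)) (at x within UNIV)" for x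
   using has_derivative_partial[OF smooth_diffable[OF test_smooth[OF assms]]] by simp
  show "onorm (%h. \<Sum>b\<in>Basis. (h \<bullet> b) * pd b g x) <= C" for x
  proof (rule onorm_le)
   fix h
   have "norm (\<Sum>b\<in>Basis. (h \<bullet> b) * pd b g x) <= (\<Sum>b\<in>Basis. norm h * K b)"
    using K(2) by (intro sum_norm_le) (auto simp: abs_mult intro!: mult_mono Basis_le_norm)
   thus "norm (\<Sum>b\<in>Basis. (h \<bullet> b) * pd b g x) <= C * norm h"
    by (simp add: C_def sum_distrib_left mult.commute)
  qed
 qed auto
 thus thesis using C by (intro that[of C]) (auto)
qed

section \<open>Integration by parts and interpolation of derivatives\<close>

lemma integral_translate:
 fixes f :: "'a::euclidean_space => real"
 assumes "f \<in> borel_measurable borel"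
 shows "(LINT x|lborel. f (c + x)) = (LINT x|lborel. f x)"
proof -
 have "(LINT x|lborel. f x) = (LINT x|distr lborel borel ((+) c). f x)" by (simp add: lborel_distr_plus)
 also have "... = (LINT x|lborel. f (c + x))" by (rule integral_distr) (use assms in auto)
 finally show ?thesis ..
qed

text \<open>Translation invariance makes the integral of every difference quotient vanish, and
  dominated convergence passes to the derivative. The steps \<open>h i\<close> are at most 1, so all
  quotients live in the ball of radius \<open>r + 1\<close> and are bounded by the Lipschitz
  constant.\<close>

lemma integral_partial_zero:
 fixes g :: "'a::euclidean_space => real"
 assumes g: "test g" and b: "b \<in> Basis"
 shows "(LINT x|lebesgue. pd b g x) = 0"
proof -
 obtain r where r: "r > 0" "!!x. g x ~= 0 ==> norm x <= r" using test_support[OF g] by blast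
 obtain C where C: "C >= 0" "!!x y. \<bar>g x - g y\<bar> <= C * norm (x - y)" using test_increment_le[OF g] by blast
 define h where "h i = inverse (real (Suc i))" for i
 have h: "0 < h i" "h i <= 1" for i by (auto simp: h_def inverse_le_1_iff)
 define s where "s i x = (g (h i *R b + x) - g x) / h i" for i x
 have meas [measurable]: "g \<in> borel_measurable borel" by (rule test_measurable[OF g])
 have "(%i. LINT x|lborel. s i x) ----> (LINT x|lborel. pd b g x)"
 proof (rule integral_dominated_convergence[where w = "%x. C * indicator (cball 0 (r + 1)) x"])
  show "pd b g \<in> borel_measurable lborel" using test_measurable[OF test_partial[OF g b]] by simp
  show "s i \<in> borel_measurable lborel" for i unfolding s_def by simp
  have "emeasure lborel (cball (0::'a) (r + 1)) < \<infinity>" by (rule emeasure_lborel_cball_finite)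
  thus "integrable lborel (%x. C * indicator (cball (0::'a) (r + 1)) x)" by simp
  show "AE x in lborel. (%i. s i x) ----> pd b g x"
  proof (rule AE_I2)
   fix x
   have "((%t. (g (x + t *R b) - g x) / t) ---> pd b g x) (at 0)"
    using smooth_along_basis[OF test_smooth[OF g] b, of x 0] by (simp add: DERIV_def)
   moreover have "filterlim h (at 0) sequentially"
    unfolding filterlim_at h_def using LIMSEQ_inverse_real_of_nat by auto
   ultimately have "(%i. (g (x + h i *R b) - g x) / h i) ----> pd b g x"
    by (rule filterlim_compose)
   thus "(%i. s i x) ----> pd b g x" by (simp add: s_def add.commute)
  qed
  show "AE x in lborel. norm (s i x) <= C * indicator (cball 0 (r + 1)) x" for i
  proof (rule AE_I2)
   fix x
   show "norm (s i x) <= C * indicator (cball 0 (r + 1)) x"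
   proof (cases "norm x <= r + 1")
    case True
    show ?thesis using C(2)[of "h i *R b + x" x] b h[of i] True by (simp add: s_def pos_divide_le_eq)
   next
    case False
    have "g (h i *R b + x) = 0" "g x = 0" using norm_triangle_ineq4[of "h i *R b + x" "h i *R b"] b h[of i] False r(2)[of x] r(2)[of "h i *R b + x"] by force+
    thus ?thesis using C by (simp add: s_def)
   qed
  qed
 qed
 moreover have "(LINT x|lborel. s i x) = 0" for i
 proof -
  have i: "integrable lborel (%x. g (h i *R b + x))"
  proof (rule integrable_compact_support(1)[where r = "r + 1"])
   show "continuous_on UNIV (%x. g (h i *R b + x))"
    by (intro continuous_on_compose2[OF smooth_continuous[OF test_smooth[OF g], of UNIV]] continuous_intros) auto
   fix x assume "g (h i *R b + x) ~= 0"
   hence "norm (h i *R b + x) <= r" by (rule r(2))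
   moreover have "norm x <= norm (h i *R b + x) + norm (h i *R b)"
    using norm_triangle_ineq4[of "h i *R b + x" "h i *R b"] by simp
   ultimately show "norm x <= r + 1" using b h[of i] by simp
  qed
  show ?thesis using integral_translate[OF meas] unfolding s_def by (simp add: i test_integrable[OF g])
 qed
 ultimately show ?thesis using integral_lebesgue_borel[OF test_measurable[OF test_partial[OF g b]]] by (simp add: LIMSEQ_const_iff)
qed

lemma integration_by_parts:
 assumes g: "test g" and f: "smooth f" and b: "b \<in> Basis"
 shows "(LINT x|lebesgue. pd b g x * f x) = - (LINT x|lebesgue. g x * pd b f x)"
proof -
 have "pd b (%x. g x * f x) = (%x. g x * pd b f x + pd b g x * f x)"
  by (intro ext pd_mult smooth_diffable f test_smooth[OF g])
 hence "(LINT x|lebesgue. g x * pd b f x + pd b g x * f x) = 0"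
  using integral_partial_zero[OF test_mult(1)[OF g f] b] by simp
 moreover have "(LINT x|lebesgue. g x * pd b f x + pd b g x * f x)
   = (LINT x|lebesgue. g x * pd b f x) + (LINT x|lebesgue. pd b g x * f x)"
  by (intro Bochner_Integration.integral_add test_integrable(2) test_mult test_partial g f b smooth_partial)
 ultimately show ?thesis by simp
qed

lemma iterated_integration_by_parts:
 assumes g: "test g" and f: "smooth f" and bs: "bs \<in> lists Basis"
 shows "(LINT x|lebesgue. ip bs g x * f x) = (-1) ^ length bs * (LINT x|lebesgue. g x * ip bs f x)"
 using bs f
proof (induction bs arbitrary: f)
 case (Cons b bs)
 hence b: "b \<in> Basis" and bs: "bs \<in> lists Basis" by auto
 have "(LINT x|lebesgue. ip (b # bs) g x * f x) = - (LINT x|lebesgue. ip bs g x * pd b f x)"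
  unfolding ip_Cons by (rule integration_by_parts[OF test_iter[OF g bs] Cons.prems b])
 also have "... = - ((-1) ^ length bs * (LINT x|lebesgue. g x * ip bs (pd b f) x))"
  using Cons.IH[OF smooth_partial[OF Cons.prems b]] by simp
 finally show ?case using ip_commute[OF Cons.prems bs b] by (simp add: ip_Cons)
qed simp

text \<open>Derivatives of order \<open>k\<close> are indexed by words over the basis and not by
  multi-indices, so permutations count separately and sums over \<open>words k\<close> give the
  Euclidean norm of the tensor of \<open>k\<close>-th derivatives.\<close>

definition words :: "nat => 'a::euclidean_space list set" where
 "words k = {bs \<in> lists Basis. length bs = k}"

lemma finite_words [simp]: "finite (words k)"
 using finite_lists_length_eq[OF finite_Basis, of k] by (simp add: words_def lists_eq_set)

lemma words_0 [simp]: "words 0 = {[]}"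
 by (auto simp: words_def)

lemma sum_words_Suc:
 fixes f :: "'a::euclidean_space list => 'c::comm_monoid_add"
 shows "(\<Sum>bs\<in>words (Suc k). f bs) = (\<Sum>bs\<in>words k. \<Sum>b\<in>Basis. f (b # bs))"
proof -
 have "words (Suc k) = (%(bs, b). b # bs) ` (words k \<times> (Basis :: 'a set))"
  by (auto simp: words_def length_Suc_conv)
 moreover have "inj_on (%(bs, b). b # bs) (words k \<times> (Basis :: 'a set))" by (auto simp: inj_on_def)
 ultimately show ?thesis by (simp add: sum.reindex case_prod_unfold sum.cartesian_product)
qed

text \<open>Moving the outermost letter of the word from \<open>h\<close> to \<open>q\<close> and
  summing over it turns two derivatives of \<open>q\<close> into its negative Laplacian, while the
  word becomes shorter by one.\<close>

lemma integral_neg_laplacian_pow: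
 fixes h q :: "'a::euclidean_space => real"
 assumes h: "test h" and q: "test q"
 shows "(LINT x|lebesgue. h x * neg_laplacian_pow k q x)
  = (\<Sum>bs\<in>words k. LINT x|lebesgue. ip bs h x * ip bs q x)"
 using q
proof (induction k arbitrary: q)
 case (Suc k)
 note s = test_smooth[OF Suc.prems]
 have "(\<Sum>bs\<in>words (Suc k). LINT x|lebesgue. ip bs h x * ip bs q x)
   = (\<Sum>bs\<in>words k. LINT x|lebesgue. ip bs h x * ip bs (neg_laplacian q) x)"
  unfolding sum_words_Suc
 proof (rule sum.cong[OF refl])
  fix bs :: "'a list" assume "bs \<in> words k"
  hence bs: "bs \<in> lists Basis" by (simp add: words_def)
  let ?f = "ip bs h" and ?g = "ip bs q"
  note f = test_iter[OF h bs] and g = test_iter[OF Suc.prems bs]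
  have "(\<Sum>b\<in>Basis. LINT x|lebesgue. ip (b # bs) h x * ip (b # bs) q x)
    = (\<Sum>b\<in>Basis. LINT x|lebesgue. ?f x * (- pd b (pd b ?g) x))"
   using integration_by_parts[OF f smooth_partial[OF test_smooth[OF g]]]
   by (intro sum.cong) (auto simp: ip_Cons)
  also have "... = (LINT x|lebesgue. (\<Sum>b\<in>Basis. ?f x * (- pd b (pd b ?g) x)))"
   by (intro Bochner_Integration.integral_sum[symmetric] test_integrable(2) test_mult f smooth_minus smooth_partial test_smooth[OF g])
  also have "... = (LINT x|lebesgue. ?f x * neg_laplacian ?g x)"
   by (simp add: neg_laplacian_def sum_distrib_left sum_negf)
  finally show "(\<Sum>b\<in>Basis. LINT x|lebesgue. ip (b # bs) h x * ip (b # bs) q x)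
    = (LINT x|lebesgue. ip bs h x * ip bs (neg_laplacian q) x)"
   by (simp add: neg_laplacian_iter_partial[OF s bs])
 qed
 also have "... = (LINT x|lebesgue. h x * neg_laplacian_pow k (neg_laplacian q) x)"
  by (rule Suc.IH[OF test_neg_laplacian[OF Suc.prems], symmetric])
 finally show ?case by (simp add: lap_pow_Suc2)
qed simp

text \<open>A convex sequence lies below the larger of its end values, since after an increase it
  never decreases again; nonnegativity replaces the maximum by the sum.\<close>

lemma discrete_convex_le:
 fixes m :: "nat => real"
 assumes c: "!!j. 2 * m (Suc j) <= m j + m (Suc (Suc j))" and nn: "!!j. 0 <= m j" and "j <= s"
 shows "m j <= m 0 + m s"
proof (cases "m j <= m 0")
 case True thus ?thesis using nn[of s] by linarith
next
 case False
 have mono: "m (Suc i) - m i <= m (Suc k) - m k" if "i <= k" for i k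
  using that
 proof (induction k rule: dec_induct)
  case (step n)
  thus ?case using c[of n] by linarith
 qed simp
 obtain i where i: "i < j" "m i < m (Suc i)"
 proof (rule ccontr)
  assume "\<not> thesis"
  hence "m (Suc i) <= m i" if "i < j" for i using that \<open>!!i. i < j ==> m i < m (Suc i) ==> thesis\<close> by force
  hence "m k <= m 0" if "k <= j" for k using that
  proof (induction k)
   case (Suc k)
   hence "m (Suc k) <= m k" "m k <= m 0" using \<open>!!i. i < j ==> m (Suc i) <= m i\<close> by auto
   thus ?case by linarith
  qed simp
  with False show False by blast
 qed
 have "m j <= m k" if "j <= k" for k
  using that
 proof (induction k rule: dec_induct)
  case (step n)
  thus ?case using mono[of i n] i by linarith
 qed simp
 thus ?thesis using assms(3) nn[of 0] by (smt (verit))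
qed

text \<open>The squared norm \<open>m k\<close> of the \<open>k\<close>-th derivatives is the
  pairing of \<open>h\<close> with \<open>(-Delta)^k h\<close>. Positivity of the
  \<open>k\<close>-th pairing at \<open>h + Delta h\<close> says that \<open>m\<close> is a convex
  sequence.\<close>

lemma interpolation_test:
 fixes h :: "'a::euclidean_space => real"
 assumes h: "test h" and j: "j <= s"
 shows "(\<Sum>bs\<in>words j. LINT x|lebesgue. (ip bs h x)^2)
  <= (LINT x|lebesgue. (h x)^2) + (\<Sum>bs\<in>words s. LINT x|lebesgue. (ip bs h x)^2)"
proof -
 define c where "c k f g = (LINT x|lebesgue. f x * neg_laplacian_pow k g x)" for k and f g :: "'a => real"
 have c_sum: "c k f g = (\<Sum>bs\<in>words k. LINT x|lebesgue. ip bs f x * ip bs g x)"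
  if "test f" "test g" for k f g
  unfolding c_def by (rule integral_neg_laplacian_pow[OF that])
 have c_sym: "c k f g = c k g f" if "test f" "test g" for k f g
  using that by (simp add: c_sum mult.commute)
 have c_nonneg: "0 <= c k f f" if "test f" for k f
  using that by (auto simp: c_sum intro!: sum_nonneg)
 have c_Suc: "c k f (neg_laplacian g) = c (Suc k) f g" for k f g
  by (simp add: c_def lap_pow_Suc2)
 define m where "m k = c k h h" for k
 have "2 * m (Suc k) <= m k + m (Suc (Suc k))" for k
 proof -
  let ?n = "neg_laplacian h"
  note n = test_neg_laplacian[OF h]
  let ?d = "%x. h x + (-1) * ?n x"
  have d: "test (?d)" by (intro test_add test_cmult h n)
  have "c k ?d ?d = (LINT x|lebesgue. (h x * neg_laplacian_pow k h x - h x * neg_laplacian_pow k ?n x)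
    - (?n x * neg_laplacian_pow k h x - ?n x * neg_laplacian_pow k ?n x))" using lap_pow_add[OF test_smooth[OF h] test_smooth[OF test_cmult[OF n]], of k "-1"]
    lap_pow_cmult[OF test_smooth[OF n], of k "-1"] unfolding c_def by (simp add: algebra_simps)
  also have "... = (c k h h - c k h ?n) - (c k ?n h - c k ?n ?n)"
   unfolding c_def
   by (intro LINT_diff[THEN trans] arg_cong2[of _ _ _ _ "(-)"] LINT_diff
     Bochner_Integration.integrable_diff test_integrable(2) test_mult h n test_smooth[where S = UNIV] test_neg_laplacian_pow)
  finally show ?thesis using c_sym[OF n h] c_Suc c_nonneg[OF d, of k] by (simp add: m_def)
 qed
 hence "m j <= m 0 + m s" by (rule discrete_convex_le) (use c_nonneg h j in "auto simp: m_def")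
 thus ?thesis by (simp add: m_def c_sum[OF h h] power2_eq_square)
qed

section \<open>Square integrable functions modulo null sets\<close>

lemma L2D: assumes "f \<in> L2" shows "lmeas f" "integrable lebesgue (%x. (f x)^2)"
 using assms by (auto simp: L2_def)

lemma L2_zero: "(%x. 0) \<in> L2"
 by (simp add: L2_def)

lemma L2_cmult: assumes "f \<in> L2" shows "(%x. c * f x) \<in> L2"
proof -
 have [measurable]: "lmeas f" by (rule L2D(1)[OF assms])
 show ?thesis using L2D(2)[OF assms] by (simp add: L2_def power_mult_distrib)
qed

lemma L2_add: assumes "f \<in> L2" "g \<in> L2" shows "(%x. f x + g x) \<in> L2"
proof -
 have [measurable]: "lmeas f" "lmeas g" using assms L2D by auto
 have "integrable lebesgue (%x. 2 * (f x)^2 + 2 * (g x)^2)"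
  using L2D(2)[OF assms(1)] L2D(2)[OF assms(2)] by simp
 hence "integrable lebesgue (%x. (f x + g x)^2)"
 proof (rule LINT_bound)
  have "(f x + g x)^2 <= 2 * (f x)^2 + 2 * (g x)^2" for x
   using zero_le_power2[of "f x - g x"] by (simp add: power2_sum power2_diff)
  thus "AE x in lebesgue. norm ((f x + g x)^2) <= norm (2 * (f x)^2 + 2 * (g x)^2)" by simp
 qed simp
 thus ?thesis by (simp add: L2_def)
qed

lemma L2_minus: "f \<in> L2 ==> (%x. - f x) \<in> L2"
 using L2_cmult[of f "-1"] by simp

lemma L2_diff: "f \<in> L2 ==> g \<in> L2 ==> (%x. f x - g x) \<in> L2"
 using L2_add[OF _ L2_minus] by simp

lemma L2_mult_integrable: assumes "f \<in> L2" "g \<in> L2" shows "integrable lebesgue (%x. f x * g x)"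
proof -
 have [measurable]: "lmeas f" "lmeas g" using assms L2D by auto
 have "integrable lebesgue (%x. (f x)^2 + (g x)^2)"
  using L2D(2)[OF assms(1)] L2D(2)[OF assms(2)] by simp
 thus ?thesis
 proof (rule LINT_bound)
  have "\<bar>f x * g x\<bar> <= (f x)^2 + (g x)^2" for x
  proof -
   have "2 * (\<bar>f x\<bar> * \<bar>g x\<bar>) <= (f x)^2 + (g x)^2"
    using zero_le_power2[of "\<bar>f x\<bar> - \<bar>g x\<bar>"] by (simp add: power2_diff)
   moreover have "0 <= \<bar>f x\<bar> * \<bar>g x\<bar>" by simp
   ultimately show ?thesis by linarith
  qed
  thus "AE x in lebesgue. norm (f x * g x) <= norm ((f x)^2 + (g x)^2)" by simp
 qed simp
qed

lemma L2_cong_AE: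
 assumes "f \<in> L2" "AE x in lebesgue. f x = g x" "lmeas g"
 shows "g \<in> L2"
proof -
 have "integrable lebesgue (%x. (f x)^2) \<longleftrightarrow> integrable lebesgue (%x. (g x)^2)"
  by (rule integrable_cong_AE) (use assms L2D[OF assms(1)] in auto)
 thus ?thesis using assms by (simp add: L2_def)
qed

lemma test_L2: assumes "test g" shows "g \<in> L2"
proof -
 have "g \<in> borel_measurable lborel" using test_measurable[OF assms] by simp
 hence "lmeas g" by (rule measurable_completion)
 moreover have "integrable lebesgue (%x. (g x)^2)"
  using test_integrable(2)[OF test_mult(1)[OF assms test_smooth[OF assms]]] by (simp add: power2_eq_square)
 ultimately show ?thesis by (simp add: L2_def)
qed

\<comment> \<open>A partial quotient: functions outside \<open>L2\<close> are discarded and null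
  sets are factored out, so that the inner product becomes definite and the abstract Hilbert space
  theory applies.\<close>
quotient_type (overloaded) 'a ell2 = "'a::euclidean_space => real" /
 partial: "%f g. f \<in> L2 \<and> g \<in> L2 \<and> (AE x in lebesgue. f x = g x)"
proof (rule part_equivpI)
 show "EX f :: 'a => real. f \<in> L2 \<and> f \<in> L2 \<and> (AE x in lebesgue. f x = f x)"
  using L2_zero by (intro exI[of _ "%x. 0"]) auto
 show "symp (%f g :: 'a => real. f \<in> L2 \<and> g \<in> L2 \<and> (AE x in lebesgue. f x = g x))"
  by (auto intro!: sympI elim: AE_mp)
 show "transp (%f g :: 'a => real. f \<in> L2 \<and> g \<in> L2 \<and> (AE x in lebesgue. f x = g x))"
  by (rule transpI) (auto elim: eventually_elim2)
qed

instantiation ell2 :: (euclidean_space) real_inner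
begin

lift_definition zero_ell2 :: "'a ell2" is "%x. 0" by (simp add: L2_zero)

lift_definition plus_ell2 :: "'a ell2 => 'a ell2 => 'a ell2" is "%f g x. f x + g x"
 by (auto simp: L2_add elim: eventually_elim2)

lift_definition minus_ell2 :: "'a ell2 => 'a ell2 => 'a ell2" is "%f g x. f x - g x"
 by (auto simp: L2_diff elim: eventually_elim2)

lift_definition uminus_ell2 :: "'a ell2 => 'a ell2" is "%f x. - f x"
 by (auto simp: L2_minus)

lift_definition scaleR_ell2 :: "real => 'a ell2 => 'a ell2" is "%c f x. c * f x"
 by (auto simp: L2_cmult elim: eventually_mono)

lift_definition inner_ell2 :: "'a ell2 => 'a ell2 => real" is "%f g. LINT x|lebesgue. f x * g x"
 by (intro integral_cong_AE borel_measurable_times) (auto dest: L2D elim: eventually_elim2)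

definition norm_ell2 :: "'a ell2 => real" where "norm_ell2 x = sqrt (inner x x)"
definition dist_ell2 :: "'a ell2 => 'a ell2 => real" where "dist_ell2 x y = norm (x - y)"
definition sgn_ell2 :: "'a ell2 => 'a ell2" where "sgn_ell2 x = scaleR (inverse (norm x)) x"
definition uniformity_ell2 :: "('a ell2 \<times> 'a ell2) filter" where
 "uniformity_ell2 = (INF e\<in>{0<..}. principal {(x, y). dist x y < e})"
definition open_ell2 :: "'a ell2 set => bool" where
 "open_ell2 U = (ALL x:U. eventually (%(x', y). x' = x --> y \<in> U) uniformity)"

instance
proof
 fix x y z :: "'a ell2" and c d :: real
 show "x + y + z = x + (y + z)" by transfer (auto simp: L2_add)
 show "x + y = y + x" by transfer (auto simp: L2_add add.commute)
 show "0 + x = x" by transfer auto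
 show "- x + x = 0" by transfer (auto simp: L2_zero)
 show "x - y = x + - y" by transfer (auto simp: L2_diff)
 show "c *R (x + y) = c *R x + c *R y" by transfer (auto simp: distrib_left L2_add L2_cmult)
 show "(c + d) *R x = c *R x + d *R x" by transfer (auto simp: distrib_right L2_add L2_cmult)
 show "c *R d *R x = (c * d) *R x" by transfer (auto simp: mult.assoc L2_cmult)
 show "1 *R x = x" by transfer auto
 show "inner x y = inner y x" by transfer (simp add: mult.commute)
 show "inner (x + y) z = inner x z + inner y z"
  by transfer (auto simp: distrib_right L2_mult_integrable intro!: Bochner_Integration.integral_add)
 show "inner (c *R x) y = c * inner x y" by transfer (simp add: mult.assoc)
 show "0 <= inner x x" by transfer (auto intro!: integral_nonneg)
 show "inner x x = 0 \<longleftrightarrow> x = 0"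
  by transfer (auto simp: integral_nonneg_eq_0_iff_AE L2_mult_integrable L2_zero)
qed (rule norm_ell2_def dist_ell2_def sgn_ell2_def uniformity_ell2_def open_ell2_def)+

end

definition cls :: "('a::euclidean_space => real) => 'a ell2" where "cls = abs_ell2"

lemma cls_eq_iff: "f \<in> L2 ==> g \<in> L2 ==> cls f = cls g \<longleftrightarrow> (AE x in lebesgue. f x = g x)"
 unfolding cls_def using Quotient3_rel[OF Quotient3_ell2, of f g] by auto

lemma cls_surj: obtains f where "f \<in> L2" "v = cls f"
proof -
 have "abs_ell2 (rep_ell2 v) = v" by (rule Quotient3_abs_rep[OF Quotient3_ell2])
 moreover have "rep_ell2 v \<in> L2" using Quotient3_rep_reflp[OF Quotient3_ell2, of v] by simp
 ultimately show thesis using that[of "rep_ell2 v"] by (simp add: cls_def)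
qed

lemma cls_zero: "cls (%x. 0) = 0"
 and cls_add: "f \<in> L2 ==> g \<in> L2 ==> cls (%x. f x + g x) = cls f + cls g"
 and cls_diff: "f \<in> L2 ==> g \<in> L2 ==> cls (%x. f x - g x) = cls f - cls g"
 and cls_cmult: "f \<in> L2 ==> cls (%x. c * f x) = c *R cls f"
 and inner_cls: "f \<in> L2 ==> g \<in> L2 ==> cls f \<bullet> cls g = (LINT x|lebesgue. f x * g x)"
 unfolding cls_def
 by (simp_all add: zero_ell2.abs_eq plus_ell2.abs_eq minus_ell2.abs_eq scaleR_ell2.abs_eq inner_ell2.abs_eq)

lemma cls_sum:
 "finite I ==> (!!i. i \<in> I ==> f i \<in> L2) ==> (%x. \<Sum>i\<in>I. f i x) \<in> L2 \<and> cls (%x. \<Sum>i\<in>I. f i x) = (\<Sum>i\<in>I. cls (f i))"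
 by (induction I rule: finite_induct) (simp_all add: L2_zero cls_zero L2_add cls_add)

lemma norm_cls: "f \<in> L2 ==> norm (cls f) = L2_norm f"
 by (simp add: norm_eq_sqrt_inner inner_cls L2_norm_def power2_eq_square)

lemma norm_cls_power2: "f \<in> L2 ==> (norm (cls f))\<^sup>2 = (LINT x|lebesgue. (f x)^2)"
 unfolding power2_norm_eq_inner by (simp add: inner_cls power2_eq_square)

lemma nn_integral_cls: "f \<in> L2 ==> NL (%x. (f x)^2) = ennreal ((norm (cls f))^2)"
 by (simp add: norm_cls_power2 nn_integral_eq_integral L2D)

text \<open>Elements of \<open>L2\<close> are only Lebesgue measurable; a Borel representative makes
  products with translates measurable for Fubini's theorem.\<close>

lemma cls_borel: obtains f where "f \<in> L2" "f \<in> borel_measurable borel" "v = cls f"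
proof -
 obtain g where g: "g \<in> L2" "v = cls g" by (rule cls_surj)
 obtain f where f: "f \<in> borel_measurable lborel" "AE x in lborel. g x = f x"
  using completion_ex_borel_measurable_real[OF L2D(1)[OF g(1)]] by blast
 have ae: "AE x in lebesgue. g x = f x" by (rule AE_completion[OF f(2)])
 have m: "lmeas f" by (rule measurable_completion[OF f(1)])
 have "f \<in> L2" by (rule L2_cong_AE[OF g(1) ae m])
 thus thesis using f(1) ae g by (intro that[of f]) (auto simp: cls_eq_iff)
qed

lemma L2_AE_subseq:
 assumes f: "!!n. f n \<in> L2" and g: "g \<in> L2" and lim: "(%n. cls (f n)) ----> cls g"
 shows "EX r::nat=>nat. strict_mono r \<and> (AE x in lebesgue. (%n. f (r n) x) ----> g x)"
proof -
 have "(%n. (norm (cls (f n) - cls g))^2) ----> 0\<^sup>2"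
  using lim by (intro tendsto_power) (simp add: LIM_zero_iff tendsto_norm_zero_iff)
 moreover have "(norm (cls (f n) - cls g))^2 = (LINT x|lebesgue. norm ((f n x - g x)^2))" for n
  using norm_cls_power2[OF L2_diff[OF f g]] by (simp add: cls_diff f g)
 ultimately have "(%n. LINT x|lebesgue. norm ((f n x - g x)^2)) ----> 0" by simp
 from tendsto_L1_AE_subseq[OF L2D(2)[OF L2_diff[OF f g]] this]
 obtain r where r: "strict_mono r" "AE x in lebesgue. (%n. (f (r n) x - g x)^2) ----> 0" by blast
 have "AE x in lebesgue. (%n. f (r n) x) ----> g x"
  using r(2)
 proof eventually_elim
  case (elim x)
  hence "(%n. f (r n) x - g x) ----> 0" by simp
  thus ?case by (rule LIM_zero_cancel)
 qed
 with r(1) show ?thesis by blast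
qed

text \<open>Along a sequence with \<open>\<parallel>f (k + 1) - f k\<parallel>\<^sup>2 <= 4\<^sup>-\<^sup>k\<close>, the sum of \<open>2\<^sup>k (f (k + 1) - f k)\<^sup>2\<close> is
 integrable, hence finite almost everywhere, and it dominates the increments.\<close>

lemma L2_fast_Cauchy_AE:
 assumes f: "!!k. f k \<in> L2" and fast: "!!k. (norm (cls (f (Suc k)) - cls (f k)))^2 <= (1/4) ^ k"
 shows "AE x in lebesgue. convergent (%k. f k x)"
proof -
 define d where "d k x = f (Suc k) x - f k x" for k x
 have d: "d k \<in> L2" for k unfolding d_def by (intro L2_diff f)
 have [measurable]: "lmeas (d k)" for k by (rule L2D(1)[OF d])
 have I: "NL (%x. 2 ^ k * (d k x)^2) <= ennreal ((1/2) ^ k)" for k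
 proof -
  have "NL (%x. 2 ^ k * (d k x)^2) = ennreal (2 ^ k) * ennreal ((norm (cls (d k)))^2)"
   using nn_integral_cls[OF d] by (simp add: ennreal_mult nn_integral_cmult)
  also have "... <= ennreal (2 ^ k) * ennreal ((1/4) ^ k)"
   using fast[of k] unfolding d_def by (intro mult_left_mono) (auto simp: cls_diff f)
  also have "... = ennreal ((1/2) ^ k)"
   by (simp add: ennreal_mult[symmetric] power_mult_distrib[symmetric])
  finally show ?thesis .
 qed
 have "(\<integral>\<^sup>+x. (\<Sum>k. ennreal (2 ^ k * (d k x)^2)) \<partial>lebesgue) = (\<Sum>k. \<integral>\<^sup>+x. ennreal (2 ^ k * (d k x)^2) \<partial>lebesgue)"
  by (rule nn_integral_suminf) measurable
 also have "... <= (\<Sum>k. ennreal ((1/2) ^ k))" by (intro suminf_le I) auto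
 also have "... = ennreal (\<Sum>k. (1/2) ^ k)" by (rule suminf_ennreal2) auto
 finally have "(\<integral>\<^sup>+x. (\<Sum>k. ennreal (2 ^ k * (d k x)^2)) \<partial>lebesgue) ~= \<infinity>" by (auto simp: top_unique)
 hence "AE x in lebesgue. (\<Sum>k. ennreal (2 ^ k * (d k x)^2)) ~= \<infinity>" by (intro nn_integral_noteq_infinite) measurable
 thus ?thesis
 proof eventually_elim
  case (elim x)
  hence s: "summable (%k. 2 ^ k * (d k x)^2)" by (intro summable_suminf_not_top) auto
  have "norm (d k x) <= (1/2) ^ k + 2 ^ k * (d k x)^2" for k
  proof -
   have "0 <= (1 / 2 ^ k) * (1 - 2 ^ k * \<bar>d k x\<bar>)^2" by simp
   also have "... = (1 / 2 ^ k) - 2 * \<bar>d k x\<bar> + 2 ^ k * (d k x)^2"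
    by (simp add: power2_eq_square field_simps)
   finally show ?thesis by (simp add: power_divide)
  qed
  hence "summable (%k. d k x)"
   by (intro summable_comparison_test'[OF summable_add[OF summable_geometric[of "1/2::real"] s]]) auto
  hence "(%n. \<Sum>k<n. d k x) ----> suminf (%k. d k x)" by (rule summable_LIMSEQ)
  moreover have "(\<Sum>k<n. d k x) = f n x - f 0 x" for n by (induction n) (auto simp: d_def)
  ultimately have "(%n. f n x - f 0 x) ----> suminf (%k. d k x)" by simp
  from tendsto_add[OF this tendsto_const[of "f 0 x"]]
  show "convergent (%k. f k x)" by (auto simp: convergent_def)
 qed
qed

text \<open>Fatou's lemma for \<open>f l - f k\<close> with growing \<open>l\<close> bounds the
  distance from \<open>g\<close> to \<open>f k\<close> by the tail of the Cauchy sequence. This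
  gives both \<open>g \<in> L2\<close> and the convergence.\<close>

lemma L2_limit_from_AE:
 assumes f: "!!k. f k \<in> L2" and C: "Cauchy (%k. cls (f k))"
  and g: "lmeas g" and lim: "AE x in lebesgue. (%k. f k x) ----> g x"
 shows "g \<in> L2 \<and> (%k. cls (f k)) ----> cls g"
proof -
 have [measurable]: "lmeas g" "lmeas (f k)" for k using g L2D f by auto
 have F: "NL (%x. (g x - f k x)^2) <= ennreal (e^2)"
  if e: "e >= 0" "!!l. l >= M ==> norm (cls (f l) - cls (f k)) <= e" for k M e
 proof -
  have "AE x in lebesgue. ennreal ((g x - f k x)^2) = liminf (%l. ennreal ((f l x - f k x)^2))"
   using lim
  proof eventually_elim
   case (elim x)
   hence "(%l. ennreal ((f l x - f k x)^2)) ----> ennreal ((g x - f k x)^2)"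
    by (intro tendsto_intros)
   thus ?case by (rule lim_imp_Liminf[OF sequentially_bot, symmetric])
  qed
  hence "NL (%x. (g x - f k x)^2) = (\<integral>\<^sup>+x. liminf (%l. ennreal ((f l x - f k x)^2)) \<partial>lebesgue)"
   by (rule nn_integral_cong_AE)
  also have "... <= liminf (%l. \<integral>\<^sup>+x. ennreal ((f l x - f k x)^2) \<partial>lebesgue)"
   by (intro nn_integral_liminf) measurable
  also have "... <= limsup (%l. \<integral>\<^sup>+x. ennreal ((f l x - f k x)^2) \<partial>lebesgue)" by (rule Liminf_le_Limsup) simp
  also have "... <= ennreal (e^2)"
  proof (rule Limsup_bounded)
   show "\<forall>\<^sub>F l in sequentially. NL (%x. (f l x - f k x)^2) <= ennreal (e^2)"
    using eventually_ge_at_top[of M]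
   proof eventually_elim
    case (elim l)
    have "(norm (cls (f l) - cls (f k)))^2 <= e^2" using e(2)[OF elim] by (intro power_mono) auto
    thus ?case using nn_integral_cls[OF L2_diff[OF f f], of l k] by (simp add: cls_diff f)
   qed
  qed
  finally show ?thesis .
 qed
 have part: "(%x. g x - f k x) \<in> L2" and bound: "norm (cls (%x. g x - f k x)) <= e"
  if e: "e >= 0" "!!l. l >= M ==> norm (cls (f l) - cls (f k)) <= e" for k M e
 proof -
  have "integrable lebesgue (%x. (g x - f k x)^2)"
   using F[OF e] by (intro integrableI_nonneg) (auto simp: less_top[symmetric] top_unique)
  thus L: "(%x. g x - f k x) \<in> L2" by (simp add: L2_def)
  show "norm (cls (%x. g x - f k x)) <= e" using F[OF e] nn_integral_cls[OF L] e(1) by simp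
 qed
 obtain M where M: "!!k l. k >= M ==> l >= M ==> norm (cls (f l) - cls (f k)) < 1"
  using CauchyD[OF C, of 1] by auto
 have gL: "g \<in> L2"
  using L2_add[OF part[of 1 M M] f[of M]] M by force
 have "(%k. cls (f k)) ----> cls g"
 proof (rule LIMSEQ_I)
  fix e :: real assume e: "e > 0"
  then obtain K where K: "!!k l. k >= K ==> l >= K ==> norm (cls (f l) - cls (f k)) < e / 2"
   using CauchyD[OF C, of "e / 2"] by auto
  have "norm (cls (f k) - cls g) < e" if "k >= K" for k
  proof -
   have "norm (cls (%x. g x - f k x)) <= e / 2"
    by (rule bound[of _ K]) (use e K[OF that] in "auto intro: less_imp_le")
   thus ?thesis using e by (simp add: cls_diff gL f norm_minus_commute)
  qed
  thus "EX K. ALL k>=K. norm (cls (f k) - cls g) < e" by blast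
 qed
 with gL show ?thesis by blast
qed

lemma fast_subsequence:
 fixes X :: "nat => 'b::real_normed_vector"
 assumes "Cauchy X"
 obtains r :: "nat => nat" where "strict_mono r" "!!k. (norm (X (r (Suc k)) - X (r k)))^2 <= (1/4) ^ k"
proof -
 have "EX N. ALL m>=N. ALL n>=N. norm (X m - X n) < (1/2) ^ k" for k using CauchyD[OF assms, of "(1/2) ^ k"] by simp
 then obtain K where K: "!!k m n. m >= K k ==> n >= K k ==> norm (X m - X n) < (1/2) ^ k" by metis
 define r where "r k = (\<Sum>i\<le>k. K i) + k" for k
 have r: "strict_mono r" unfolding strict_mono_Suc_iff by (simp add: r_def)
 have ge: "K k <= r k" for k unfolding r_def by (rule trans_le_add1) (simp add: member_le_sum)
 have "(norm (X (r (Suc k)) - X (r k)))^2 <= (1/4) ^ k" for k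
 proof -
  have "norm (X (r (Suc k)) - X (r k)) < (1/2) ^ k"
   using ge[of k] strict_monoD[OF r, of k "Suc k"] by (intro K) auto
  hence "(norm (X (r (Suc k)) - X (r k)))^2 <= ((1/2) ^ k)^2" by simp
  also have "((1/2) ^ k)^2 = (1/4 :: real) ^ k" by (simp add: power2_eq_square flip: power_mult_distrib)
  finally show ?thesis .
 qed
 with r show thesis by (rule that)
qed

text \<open>Riesz-Fischer: a fast subsequence converges almost everywhere, its pointwise limit is
  its limit in norm, and a Cauchy sequence follows its subsequence.\<close>

instance ell2 :: (euclidean_space) banach
proof
 fix X :: "nat => 'a ell2" assume C: "Cauchy X"
 have "ALL k. EX f. f \<in> L2 \<and> X k = cls f" using cls_surj by metis
 then obtain f where f: "!!k. f k \<in> L2" and X: "!!k. X k = cls (f k)" by metis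
 obtain r where r: "strict_mono r" "!!k. (norm (X (r (Suc k)) - X (r k)))^2 <= (1/4) ^ k" by (rule fast_subsequence[OF C]) blast
 have conv: "AE x in lebesgue. convergent (%k. f (r k) x)"
  by (rule L2_fast_Cauchy_AE) (use f r X in auto)
 define g where "g x = lim (%k. f (r k) x)" for x
 have [measurable]: "lmeas (f k)" for k using L2D f by auto
 have gm: "lmeas g" unfolding g_def by (rule borel_measurable_lim_metric) measurable
 have "AE x in lebesgue. (%k. f (r k) x) ----> g x"
  using conv by eventually_elim (simp add: g_def convergent_LIMSEQ_iff)
 hence "(%k. cls (f (r k))) ----> cls g"
  using L2_limit_from_AE[of "%k. f (r k)", OF f _ gm] Cauchy_subseq_Cauchy[OF C r(1)] by (simp add: o_def X)
 hence "(X \<circ> r) ----> cls g" by (simp add: o_def X)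
 hence "X ----> cls g" by (rule Cauchy_converges_subseq[OF C r(1)])
 thus "convergent X" by (auto simp: convergent_def)
qed

section \<open>Density of test functions\<close>

lemma closed_form_zero:
 fixes W :: "'h::{real_inner,banach} set"
 assumes "subspace W" "closed W"
 shows "closed_form W (%_ _. 0)"
proof
 fix X :: "nat => 'h"
 assume X: "!!n. X n \<in> W" and C: "!!e. e > 0 ==> EX M. ALL m>=M. ALL n>=M. (X m - X n) \<bullet> (X m - X n) + 0 < e"
 have "Cauchy X"
 proof (rule CauchyI)
  fix e :: real assume e: "e > 0"
  then obtain M where M: "ALL m>=M. ALL n>=M. (X m - X n) \<bullet> (X m - X n) < e^2" using C[of "e^2"] by auto
  have "norm (X m - X n) < e" if "m >= M" "n >= M" for m n
  proof -
   have "(norm (X m - X n))^2 < e^2" using M that by (simp add: power2_norm_eq_inner)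
   thus ?thesis by (rule power_less_imp_less_base) (use e in simp)
  qed
  thus "EX M. ALL m>=M. ALL n>=M. norm (X m - X n) < e" by blast
 qed
 then obtain x where x: "X ----> x" using Cauchy_convergent_iff convergent_def by blast
 have "x \<in> W" using assms(2) X x by (meson closed_sequentially)
 moreover have "(%n. (X n - x) \<bullet> (X n - x) + 0) ----> (x - x) \<bullet> (x - x) + 0" by (intro tendsto_intros x)
 ultimately show "EX x:W. (%n. (X n - x) \<bullet> (X n - x) + 0) ----> 0" by auto
qed (use assms in auto)

lemma subspace_closure:
 fixes S :: "'h::real_normed_vector set"
 assumes S: "subspace S" shows "subspace (closure S)"
proof (rule subspaceI)
 show "0 \<in> closure S" using subspace_0[OF S] closure_subset by blast
next
 fix x y assume "x \<in> closure S" "y \<in> closure S"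
 then obtain X Y where "!!n. X n \<in> S" "X ----> x" "!!n. Y n \<in> S" "Y ----> y"
  unfolding closure_sequential by blast
 thus "x + y \<in> closure S" unfolding closure_sequential
  by (intro exI[of _ "%n. X n + Y n"]) (auto intro: tendsto_add subspace_add[OF S])
next
 fix c x assume "x \<in> closure S"
 then obtain X where "!!n. X n \<in> S" "X ----> x" unfolding closure_sequential by blast
 thus "c *R x \<in> closure S" unfolding closure_sequential
  by (intro exI[of _ "%n. c *R X n"]) (auto intro: tendsto_scaleR subspace_scale[OF S])
qed

lemma subspace_dense:
 fixes S :: "'h::{real_inner,banach} set"
 assumes S: "subspace S" and orth: "!!v. (!!s. s \<in> S ==> v \<bullet> s = 0) ==> v = 0"
 shows "closure S = UNIV"
proof -
 \<comment> \<open>With the zero form, \<open>Q\<close> is the inner product and the resolvent on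
   the closed subspace is the orthogonal projection.\<close>
 interpret c: closed_form "closure S" "%_ _. 0" by (rule closed_form_zero) (auto intro: subspace_closure S)
 have "x \<in> closure S" for x
 proof -
  obtain w where w: "w \<in> closure S" "!!s. s \<in> closure S ==> w \<bullet> s = x \<bullet> s"
   using c.resolvent_ex[of 1 x] by (auto simp: c.Q_def)
  have "x - w = 0" by (rule orth) (simp add: inner_diff_left w(2) subsetD[OF closure_subset])
  with w(1) show ?thesis by simp
 qed
 thus ?thesis by blast
qed

definition box_bump :: "'a::euclidean_space => 'a => nat => 'a => real" where
 "box_bump a b k x = (\<Prod>i\<in>Basis. step (real k * (x \<bullet> i - a \<bullet> i)) * step (real k * (b \<bullet> i - x \<bullet> i)))"

lemma smooth_box_bump: "smooth (box_bump a b k)"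
proof -
 have "smooth (%s. step (real k *R s + - real k * (a \<bullet> i)))" "smooth (%s. step ((- real k) *R s + real k * (b \<bullet> i)))" for i
  by (intro smooth_scale smooth_step)+
 from smooth_inner[OF this(1)] smooth_inner[OF this(2)]
 have "smooth (%x. step (real k *R (x \<bullet> i) + - real k * (a \<bullet> i)))" "smooth (%x. step ((- real k) *R (x \<bullet> i) + real k * (b \<bullet> i)))" for i .
 thus ?thesis unfolding box_bump_def[abs_def] by (intro smooth_prod smooth_mult) (simp_all add: algebra_simps)
qed

lemma box_bump_range: "0 <= box_bump a b k x" "box_bump a b k x <= 1"
 unfolding box_bump_def using step_range by (auto intro!: prod_nonneg prod_le_1 mult_le_one)

lemma box_bump_support: assumes "box_bump a b k x ~= 0" shows "x \<in> box a b"
proof -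
 have "a \<bullet> i < x \<bullet> i \<and> x \<bullet> i < b \<bullet> i" if "i \<in> Basis" for i
 proof -
  have "\<not> real k * (x \<bullet> i - a \<bullet> i) <= 0" "\<not> real k * (b \<bullet> i - x \<bullet> i) <= 0" using assms that step_0 unfolding box_bump_def by auto
  thus ?thesis by (auto simp: mult_le_0_iff)
 qed
 thus ?thesis by (simp add: mem_box)
qed

lemma box_bump_test: "test (box_bump a b k)"
proof -
 obtain r where "ALL x:box a b. norm x <= r" using bounded_box[of a b] unfolding bounded_iff by blast
 thus ?thesis unfolding test_iff using smooth_box_bump box_bump_support by blast
qed

lemma box_bump_tendsto: "(%k. box_bump a b k x) ----> indicator (box a b) x"
proof (cases "x \<in> box a b")
 case False
 hence "box_bump a b k x = 0" for k using box_bump_support by blast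
 thus ?thesis using False by simp
next
 case True
 have one: "(%k. step (real k * d)) ----> 1" if d: "d > 0" for d
 proof -
  obtain K where K: "1 / d <= real K" using real_arch_simple by blast
  have "step (real k * d) = 1" if "k >= K" for k
  proof -
   have "1 <= real K * d" using K d by (simp add: pos_divide_le_eq)
   also have "... <= real k * d" using that d by simp
   finally show ?thesis by (rule step_1)
  qed
  hence "\<forall>\<^sub>F k in sequentially. 1 = step (real k * d)" unfolding eventually_sequentially by metis
  thus ?thesis by (rule Lim_transform_eventually[OF tendsto_const])
 qed
 have "(%k. box_bump a b k x) ----> (\<Prod>i\<in>(Basis::'a set). 1 * 1)"
  unfolding box_bump_def using True by (intro tendsto_prod tendsto_mult one) (auto simp: mem_box)
 thus ?thesis using True by simp
qed

lemma L2_indicator: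
 assumes "A \<in> sets borel" "emeasure lborel A < \<infinity>" shows "(indicator A :: 'a::euclidean_space => real) \<in> L2"
proof -
 have "integrable lebesgue (indicator A :: 'a => real)" using assms by simp
 moreover have "(%x. (indicator A x :: real)^2) = indicator A" by (auto simp: indicator_def)
 ultimately show ?thesis by (auto simp: L2_def)
qed

text \<open>Smooth approximations of indicators show that \<open>f\<close> has integral 0 over every
  box, and induction over a generating system closed under intersections extends this to Borel sets.
  The truncation to the cubes \<open>D n\<close> makes \<open>f\<close> integrable.\<close>

lemma test_orthogonal_zero_AE:
 fixes f :: "'a::euclidean_space => real"
 assumes f: "f \<in> L2" "f \<in> borel_measurable borel"
  and orth: "!!h. test h ==> (LINT x|lebesgue. f x * h x) = 0"
 shows "AE x in lborel. f x = 0"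
proof -
 have [measurable]: "f \<in> borel_measurable borel" by (rule f(2))
 have bi: "integrable lborel (%x. f x * indicator (box a b) x)" for a b :: 'a
 proof -
  have "integrable lebesgue (%x. f x * indicator (box a b) x)"
   by (intro L2_mult_integrable f L2_indicator) (auto intro: emeasure_bounded_finite[OF bounded_box, unfolded infinity_ennreal_def])
  thus ?thesis by (simp add: integrable_completion)
 qed
 have box0: "(LINT x|lborel. f x * indicator (box a b) x) = 0" for a b :: 'a
 proof -
  have "(%k. LINT x|lborel. f x * box_bump a b k x) ----> (LINT x|lborel. f x * indicator (box a b) x)"
  proof (rule integral_dominated_convergence[where w = "%x. norm (f x * indicator (box a b) x)"])
   show "integrable lborel (%x. norm (f x * indicator (box a b) x))" using bi by simp
   show "AE x in lborel. (%k. f x * box_bump a b k x) ----> f x * indicator (box a b) x"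
    by (intro AE_I2 tendsto_intros box_bump_tendsto)
   show "AE x in lborel. norm (f x * box_bump a b k x) <= norm (f x * indicator (box a b) x)" for k
   proof (rule AE_I2)
    fix x show "norm (f x * box_bump a b k x) <= norm (f x * indicator (box a b) x)"
    proof (cases "x \<in> box a b")
     case True
     thus ?thesis using box_bump_range[of a b k x] by (simp add: abs_mult mult_left_le)
    next
     case False
     hence "box_bump a b k x = 0" using box_bump_support by blast
     thus ?thesis by simp
    qed
   qed
   show "(%x. f x * box_bump a b k x) \<in> borel_measurable lborel" for k
    using borel_measurable_times[OF f(2) test_measurable[OF box_bump_test[of a b k]]] by simp
   show "(%x. f x * indicator (box a b) x) \<in> borel_measurable lborel" by simp
  qed
  moreover have "(LINT x|lborel. f x * box_bump a b k x) = 0" for k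
   using orth[OF box_bump_test[of a b k]]
    integral_lebesgue_borel[OF borel_measurable_times[OF f(2) test_measurable[OF box_bump_test[of a b k]]]] by simp
  ultimately show ?thesis by (simp add: LIMSEQ_const_iff)
 qed
 define D where "D n = box (- real n *R One) (real n *R One :: 'a)" for n
 define g where "g n x = f x * indicator (D n) x" for n x
 have gi: "integrable lborel (g n)" for n unfolding g_def D_def by (rule bi)
 have "AE x in lborel. g n x = 0" for n
 proof (rule sigma_finite_measure.density_zero[OF sigma_finite_lborel gi])
  fix A :: "'a set" assume "A \<in> sets lborel"
  hence A: "A \<in> sigma_sets UNIV (range (%(a, b). box a b :: 'a set))" by (simp add: borel_eq_box)
  have I: "Int_stable (range (%(a, b). box a b :: 'a set))"
   by (auto simp: Int_stable_def box_Int_box)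
  have P: "range (%(a, b). box a b :: 'a set) \<subseteq> Pow UNIV" by simp
  from I P A have "(LINT x|lborel. indicator A x * g n x) = 0"
  proof (induction rule: sigma_sets_induct_disjoint)
   case (basic B)
   then obtain a b where B: "B = box a b" by auto
   define c d :: 'a where "c = (\<Sum>i\<in>Basis. max (a \<bullet> i) ((- real n *R One) \<bullet> i) *R i)"
    and "d = (\<Sum>i\<in>Basis. min (b \<bullet> i) ((real n *R One) \<bullet> i) *R i)"
   have "box a b \<inter> D n = box c d" unfolding D_def c_def d_def by (rule box_Int_box)
   hence "(%x. indicator B x * g n x) = (%x. f x * indicator (box c d) x)"
    unfolding B g_def by (auto simp: fun_eq_iff indicator_def)
   thus ?case using box0 by simp
  next
   case empty thus ?case by simp
  next
   case (compl A)
   hence i: "integrable lborel (%x. indicator A x * g n x)" using integrable_mult_indicator[OF _ gi, of A] by (simp add: borel_eq_box)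
   have "(%x. indicator (UNIV - A) x * g n x) = (%x. g n x - indicator A x * g n x)"
    by (auto simp: indicator_def)
   moreover have "(LINT x|lborel. g n x) = 0" unfolding g_def D_def by (rule box0)
   ultimately show ?case using compl i gi by simp
  next
   case (union A)
   hence [measurable]: "A i \<in> sets (borel :: 'a measure)" for i by (simp add: borel_eq_box image_subset_iff)
   have "set_integrable lborel (\<Union>i. A i) (g n)"
    unfolding set_integrable_def by (rule integrable_mult_indicator[OF _ gi]) simp
   hence "(LINT x:(\<Union>i. A i)|lborel. g n x) = (\<Sum>i. LINT x:A i|lborel. g n x)"
    using union by (intro lebesgue_integral_countable_add) (auto simp: disjoint_family_on_def)
   thus ?case using union by (simp add: set_lebesgue_integral_def)
  qed
  thus "set_lebesgue_integral lborel A (g n) = 0" by (simp add: set_lebesgue_integral_def)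
 qed
 hence "AE x in lborel. ALL n. g n x = 0" by (simp add: AE_all_countable)
 thus ?thesis
 proof eventually_elim
  case (elim x)
  obtain n where n: "norm x < real n" using reals_Archimedean2 by blast
  have "x \<in> D n" unfolding D_def mem_box
  proof (intro ballI)
   fix i :: 'a assume "i \<in> Basis"
   thus "(- real n *R One) \<bullet> i < x \<bullet> i \<and> x \<bullet> i < (real n *R One) \<bullet> i"
    using Basis_le_norm[of i x] n by auto
  qed
  thus "f x = 0" using elim[rule_format, of n] by (simp add: g_def)
 qed
qed

lemma test_orthogonal_zero:
 assumes "!!g. test g ==> v \<bullet> cls g = 0"
 shows "v = 0"
proof -
 obtain f where f: "f \<in> L2" "f \<in> borel_measurable borel" "v = cls f" by (rule cls_borel)
 have "AE x in lborel. f x = 0"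
  using assms f by (intro test_orthogonal_zero_AE) (auto simp: inner_cls test_L2)
 hence "AE x in lebesgue. f x = 0" by (rule AE_completion)
 thus ?thesis using f by (simp add: cls_zero[symmetric] cls_eq_iff L2_zero)
qed

lemma test_dense: "closure (cls ` (test_functions UNIV :: ('a::euclidean_space => real) set)) = UNIV"
proof (rule subspace_dense)
 show "subspace (cls ` (test_functions UNIV :: ('a => real) set))"
 proof (rule subspaceI)
  show "0 \<in> cls ` (test_functions UNIV :: ('a => real) set)" using test_zero cls_zero by auto
 next
  fix x y :: "'a ell2" assume "x \<in> cls ` test_functions UNIV" "y \<in> cls ` test_functions UNIV"
  thus "x + y \<in> cls ` test_functions UNIV"
   by (auto simp: cls_add[symmetric] test_L2 intro!: test_add)
 next
  fix c and x assume "x \<in> cls ` test_functions UNIV"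
  then obtain g where "test g" "x = cls g" by blast
  thus "c *R x \<in> cls ` test_functions UNIV" by (simp add: cls_cmult[symmetric] test_L2 test_cmult)
 qed
qed (use test_orthogonal_zero in blast)

section \<open>Mollification\<close>

lemma has_derivative_quadratic:
 fixes f :: "'b::real_normed_vector => 'c::real_normed_vector"
 assumes D: "bounded_linear D" and b: "!!h. norm h <= 1 ==> norm (f (x + h) - f x - D h) <= C * (norm h)^2"
 shows "(f has_derivative D) (at x)"
 unfolding has_derivative_at
proof (intro conjI D)
 show "(%h. norm (f (x + h) - f x - D h) / norm h) \<midarrow>0\<rightarrow> 0"
 proof (rule Lim_null_comparison)
  have "\<forall>\<^sub>F h :: 'b in at 0. norm h < 1"
   using eventually_at_ball[of 1 0 UNIV] by (auto elim: eventually_mono)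
  thus "\<forall>\<^sub>F h in at 0. norm (norm (f (x + h) - f x - D h) / norm h) <= C * norm h"
  proof eventually_elim
   case (elim h)
   hence "norm (f (x + h) - f x - D h) <= (C * norm h) * norm h" using b[of h] by (simp add: power2_eq_square)
   thus ?case by (cases "h = 0") (auto simp: pos_divide_le_eq)
  qed
  have "((%h::'b. C * norm h) ---> C * norm (0::'b)) (at 0)" by (intro tendsto_intros)
  thus "((%h::'b. C * norm h) ---> 0) (at 0)" by simp
 qed
qed

lemma test_taylor:
 fixes g :: "'a::euclidean_space => real"
 assumes g: "test g"
 obtains C where "C >= 0" "!!x h. \<bar>g (x + h) - g x - (\<Sum>b\<in>Basis. (h \<bullet> b) * pd b g x)\<bar> <= C * (norm h)^2"
proof -
 have "EX K. 0 <= K \<and> (ALL x y. \<bar>pd b g x - pd b g y\<bar> <= K * norm (x - y))" if "b \<in> Basis" for b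
  using test_increment_le[OF test_partial[OF g that]] by metis
 then obtain K where K: "!!b. b \<in> Basis ==> 0 <= K b"
  "!!b x y. b \<in> Basis ==> \<bar>pd b g x - pd b g y\<bar> <= K b * norm (x - y)" by metis
 define C where "C = (\<Sum>b\<in>Basis. K b)"
 have "\<bar>g (x + h) - g x - (\<Sum>b\<in>Basis. (h \<bullet> b) * pd b g x)\<bar> <= C * (norm h)^2" for x h
 proof -
  obtain s where s: "0 < s" "s < 1"
   "g (x + 1 *R h) - g (x + 0 *R h) = (1 - 0) * (\<Sum>b\<in>Basis. (h \<bullet> b) * pd b g (x + s *R h))"
   using MVT2[of 0 1 "%s. g (x + s *R h)" "%s. \<Sum>b\<in>Basis. (h \<bullet> b) * pd b g (x + s *R h)"]
    has_derivative_directional[OF smooth_diffable[OF test_smooth[OF g]]] by auto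
  hence "g (x + h) - g x - (\<Sum>b\<in>Basis. (h \<bullet> b) * pd b g x)
    = (\<Sum>b\<in>Basis. (h \<bullet> b) * (pd b g (x + s *R h) - pd b g x))"
   by (simp add: sum_subtractf right_diff_distrib)
  also have "\<bar>...\<bar> <= (\<Sum>b\<in>Basis. norm h * (K b * norm h))"
  proof (rule order_trans[OF sum_abs sum_mono])
   fix b :: 'a assume b: "b \<in> Basis"
   have "\<bar>pd b g (x + s *R h) - pd b g x\<bar> <= K b * norm (s *R h)"
    using K(2)[OF b, of "x + s *R h" x] by simp
   also have "... <= K b * norm h" using s K(1)[OF b] by (intro mult_left_mono) (auto simp: mult_left_le_one_le)
   finally show "\<bar>(h \<bullet> b) * (pd b g (x + s *R h) - pd b g x)\<bar> <= norm h * (K b * norm h)"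
    unfolding abs_mult using Basis_le_norm[OF b, of h] by (intro mult_mono) auto
  qed
  also have "... = C * (norm h)^2" by (simp add: C_def sum_distrib_left power2_eq_square mult_ac)
  finally show ?thesis .
 qed
 moreover have "C >= 0" using K by (auto simp: C_def intro: sum_nonneg)
 ultimately show thesis using that by blast
qed

lemma L2_norm_bound_on_ball:
 fixes g :: "'a::euclidean_space => real"
 assumes g: "g \<in> L2" and b: "!!x. norm x <= r ==> \<bar>g x\<bar> <= c" and z: "!!x. norm x > r ==> g x = 0" and c: "c >= 0"
 shows "norm (cls g) <= c * sqrt (measure lborel (cball (0::'a) r))"
proof -
 have "(norm (cls g))^2 = (LINT x|lebesgue. (g x)^2)" by (rule norm_cls_power2[OF g])
 also have "... <= (LINT x|lebesgue. c^2 * indicator (cball (0::'a) r) x)"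
 proof (rule LINT_mono[OF L2D(2)[OF g]])
  show "integrable lebesgue (%x. c^2 * indicator (cball (0::'a) r) x)" using emeasure_lborel_cball_finite[of "0::'a" r] by simp
  fix x
  show "(g x)^2 <= c^2 * indicator (cball 0 r) x"
   using b[of x] z[of x] power_mono[of "\<bar>g x\<bar>" c 2] by force
 qed
 also have "... = (c * sqrt (measure lborel (cball (0::'a) r)))^2" by (simp add: power_mult_distrib)
 finally show ?thesis by (rule power2_le_imp_le) (use c in simp)
qed

lemma test_reflect: assumes "test h" shows "test (%y. h (x - y))"
proof -
 obtain r where r: "!!y. h y ~= 0 ==> norm y <= r" using assms test_iff by blast
 have "smooth (%y. h ((-1) *R y + x))" by (rule smooth_scale[OF test_smooth[OF assms]])
 moreover have "norm y <= r + norm x" if "h (x - y) ~= 0" for y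
  using r[OF that] norm_triangle_ineq4[of x "x - y"] by simp
 ultimately show ?thesis unfolding test_iff by auto
qed

text \<open>Convolution with \<open>h\<close>, as the inner product with a reflected translate: it
  has a value at every point although \<open>v\<close> is only a class.\<close>

definition mollify :: "('a::euclidean_space => real) => 'a ell2 => 'a => real" where
 "mollify h v x = cls (%y. h (x - y)) \<bullet> v"

text \<open>Differentiation happens before pairing with \<open>v\<close>: the translates of
  \<open>q\<close> depend on \<open>x\<close> differentiably in the Hilbert space, with quadratic
  remainder, and the inner product with \<open>v\<close> is continuous.\<close>

lemma mollify_has_derivative:
 assumes q: "test q"
 shows "(mollify q v has_derivative (%h. \<Sum>b\<in>Basis. (h \<bullet> b) * mollify (pd b q) v x)) (at x)"
proof -
 define T where "T q x = cls (%y. q (x - y))" for q :: "'a => real" and x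
 define D where "D h = (\<Sum>b\<in>Basis. (h \<bullet> b) *R T (pd b q) x)" for h
 obtain C where C: "C >= 0" "!!x h. \<bar>q (x + h) - q x - (\<Sum>b\<in>Basis. (h \<bullet> b) * pd b q x)\<bar> <= C * (norm h)^2"
  using test_taylor[OF q] by blast
 obtain r where r: "r > 0" "!!y. q y ~= 0 ==> norm y <= r" using test_support[OF q] by blast
 \<comment> \<open>Radius of a ball containing the supports of all translates with
   \<open>norm h <= 1\<close>, where the uniform Taylor bound is converted into an \<open>L2\<close>
   bound.\<close>
 define R where "R = r + 1 + norm x"
 have bd: "bounded_linear D"
  unfolding D_def by (intro bounded_linear_sum bounded_linear_scaleR_const bounded_linear_inner_left)
 have "(T q has_derivative D) (at x)"
 proof (rule has_derivative_quadratic[OF bd])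
  fix h :: 'a assume h: "norm h <= 1"
  define g where "g y = q ((x - y) + h) - q (x - y) - (\<Sum>b\<in>Basis. (h \<bullet> b) * pd b q (x - y))" for y
  have t1: "test (%y. q ((x - y) + h))" using test_reflect[OF q, of "x + h"] by (simp add: algebra_simps)
  have t2: "test (%y. \<Sum>b\<in>Basis. (h \<bullet> b) * pd b q (x - y))"
   by (intro test_sum test_cmult test_reflect test_partial q)
  have s: "cls (%y. \<Sum>b\<in>Basis. (h \<bullet> b) * pd b q (x - y)) = D h"
   unfolding D_def T_def
   using cls_sum[of Basis "%b y. (h \<bullet> b) * pd b q (x - y)"]
   by (simp add: test_L2 test_cmult test_reflect test_partial q cls_cmult)
  have gL: "g \<in> L2" unfolding g_def by (intro test_L2 test_diff t1 t2 test_reflect[OF q])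
  have e: "(%y. q (x + h - y)) = (%y. q ((x - y) + h))" by (simp add: algebra_simps)
  have "cls g = T q (x + h) - T q x - D h"
   unfolding g_def T_def s[symmetric] e
   by (simp only: cls_diff test_L2 test_diff t1 t2 test_reflect[OF q])
  moreover have "norm (cls g) <= C * (norm h)^2 * sqrt (measure lborel (cball (0::'a) R))"
  proof (rule L2_norm_bound_on_ball[OF gL])
   show "\<bar>g y\<bar> <= C * (norm h)^2" for y unfolding g_def by (rule C(2))
   show "g y = 0" if y: "R < norm y" for y
   proof -
    have far: "r + 1 < norm (x - y)" using norm_triangle_ineq2[of y x] y by (simp add: R_def norm_minus_commute)
    hence "q ((x - y) + h) = 0" "q (x - y) = 0" using norm_triangle_ineq4[of "(x - y) + h" h] h r(2)[of "(x - y) + h"] r(2)[of "x - y"] by force+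
    moreover have "pd b q (x - y) = 0" for b
     using pd_zero_outside[of q r b "x - y"] r(2) far by force
    ultimately show ?thesis by (simp add: g_def)
   qed
  qed (use C in auto)
  ultimately show "norm (T q (x + h) - T q x - D h) <= C * sqrt (measure lborel (cball (0::'a) R)) * (norm h)^2"
   by (simp add: mult_ac)
 qed
 hence "((%x. T q x \<bullet> v) has_derivative (%h. D h \<bullet> v)) (at x)"
  by (rule bounded_linear.has_derivative[OF bounded_linear_inner_left])
 thus ?thesis unfolding mollify_def[abs_def] T_def D_def by (simp add: inner_sum_left)
qed

lemma mollify_partial:
 assumes "test h" "b \<in> Basis"
 shows "pd b (mollify h v) = mollify (pd b h) v"
proof
 fix x
 have "(\<Sum>c\<in>Basis. (b \<bullet> c) * mollify (pd c h) v x) = (\<Sum>c\<in>Basis. if c = b then mollify (pd c h) v x else 0)"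
  using assms(2) by (intro sum.cong) (auto simp: inner_Basis)
 thus "pd b (mollify h v) x = mollify (pd b h) v x"
  using pd_eq[OF mollify_has_derivative[OF assms(1)]] assms(2) by simp
qed

lemma mollify_iter_partial:
 assumes "test h" "bs \<in> lists Basis"
 shows "ip bs (mollify h v) = mollify (ip bs h) v"
 using assms(2)
proof (induction bs)
 case (Cons b bs)
 thus ?case using mollify_partial[OF test_iter[OF assms(1)]] by (simp add: ip_Cons)
qed simp

lemma smooth_mollify: assumes "test h" shows "smooth (mollify h v)"
 unfolding smooth_def
proof (intro ballI allI)
 fix bs x assume bs: "bs \<in> lists (Basis :: 'a set)"
 show "ip bs (mollify h v) differentiable (at x)"
  unfolding mollify_iter_partial[OF assms bs]
  by (rule differentiableI[OF mollify_has_derivative[OF test_iter[OF assms bs]]])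
qed

lemma nn_integral_affine:
 fixes f :: "'a::euclidean_space => ennreal"
 assumes [measurable]: "f \<in> borel_measurable borel" and "c ~= 0"
 shows "(\<integral>\<^sup>+x. f x \<partial>lborel) = ennreal (\<bar>c\<bar> ^ DIM('a)) * (\<integral>\<^sup>+x. f (t + c *R x) \<partial>lborel)"
 by (subst lborel_affine[OF assms(2), of t]) (simp add: nn_integral_density nn_integral_distr nn_integral_cmult)

lemma nn_integral_reflect:
 fixes f :: "'a::euclidean_space => ennreal"
 assumes "f \<in> borel_measurable borel"
 shows "(\<integral>\<^sup>+y. f (x - y) \<partial>lborel) = (\<integral>\<^sup>+x. f x \<partial>lborel)"
  and "(\<integral>\<^sup>+y. f (y - x) \<partial>lborel) = (\<integral>\<^sup>+x. f x \<partial>lborel)"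
 using nn_integral_affine[OF assms, of "-1" x] nn_integral_affine[OF assms, of 1 "- x"] by simp_all

definition mollifier :: "real => ('a::euclidean_space => real) => bool" where
 "mollifier e h \<longleftrightarrow> test h \<and> (ALL x. 0 <= h x) \<and> (LINT x|lborel. h x) = 1 \<and> (ALL x. h x ~= 0 --> norm x <= e)"

lemma mollifierD:
 assumes "mollifier e h"
 shows "test h" "0 <= h x" "(LINT x|lborel. h x) = 1" "h x ~= 0 ==> norm x <= e"
 using assms by (auto simp: mollifier_def)

lemma mollifier_shift_integral: assumes h: "mollifier e h" shows "(LINT y|lborel. h (x - y)) = 1"
proof -
 note t = mollifierD(1)[OF h]
 have [measurable]: "h \<in> borel_measurable borel" using test_measurable[OF t] .
 have "ennreal (LINT y|lborel. h (x - y)) = (\<integral>\<^sup>+y. ennreal (h (x - y)) \<partial>lborel)"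
  by (rule nn_integral_eq_integral[symmetric, OF test_integrable(1)[OF test_reflect[OF t]]]) (simp add: mollifierD(2)[OF h])
 also have "... = (\<integral>\<^sup>+y. ennreal (h y) \<partial>lborel)" by (rule nn_integral_reflect(1)) measurable
 finally show ?thesis using nn_integral_eq_integral[OF test_integrable(1)[OF t]] mollifierD(2,3)[OF h] by simp
qed

lemma bump_support: assumes "bump (x::'a::euclidean_space) ~= 0" shows "norm x <= 2 * real DIM('a)"
proof -
 have "norm x <= (\<Sum>b\<in>Basis. \<bar>x \<bullet> b\<bar>)" by (rule norm_le_l1)
 also have "... <= (\<Sum>b\<in>(Basis::'a set). 2)"
  using bump_0[of _ x] assms by (intro sum_mono) (meson linear)
 finally show ?thesis by simp
qed

lemma bump_scaled:
 fixes d x :: "'a::euclidean_space"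
 assumes "k > 0"
 shows "test (%x. bump (k *R x + d))"
  and "bump (k *R x) ~= 0 ==> norm x <= 2 * real DIM('a) / k"
proof -
 show "norm x <= 2 * real DIM('a) / k" if "bump (k *R x) ~= 0"
  using bump_support[OF that] assms by (simp add: pos_le_divide_eq mult.commute)
 have "norm x <= (2 * real DIM('a) + norm d) / k" if "bump (k *R x + d) ~= 0" for x :: 'a
 proof -
  show ?thesis using norm_triangle_ineq4[of "k *R x + d" d] bump_support[OF that] assms by (simp add: pos_le_divide_eq mult.commute)
 qed
 thus "test (%x. bump (k *R x + d))"
  unfolding test_iff using smooth_scale[OF smooth_bump] by blast
qed

lemma mollifier_exists:
 assumes "e > 0" obtains h :: "'a::euclidean_space => real" where "mollifier e h"
proof -
 define k where "k = 2 * real DIM('a) / e"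
 have k: "k > 0" using assms by (simp add: k_def)
 define d :: "'a => real" where "d x = bump (k *R x)" for x
 have t: "test d" using bump_scaled(1)[OF k, of 0] by (simp add: d_def[abs_def])
 define I where "I = (LINT x|lborel. d x)"
 have "0 < measure lborel (ball (0::'a) (1 / k))"
  using k by simp
 also have "... = (LINT x|lborel. indicator (ball (0::'a) (1 / k)) x)" by simp
 also have "... <= I" unfolding I_def
 proof (rule LINT_mono[OF _ test_integrable(1)[OF t]])
  show "integrable lborel (indicator (ball (0::'a) (1 / k)) :: 'a => real)" 
   using emeasure_lborel_ball_finite[of "0::'a" "1 / k"] by simp
  fix x :: 'a
  show "indicator (ball 0 (1 / k)) x <= d x"
  proof (cases "x \<in> ball 0 (1 / k)")
   case True
   hence "norm (k *R x) < 1" using k by (simp add: pos_less_divide_eq mult.commute)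
   hence "d x = 1" unfolding d_def by (intro bump_1) (meson Basis_le_norm less_imp_le order_trans)
   thus ?thesis by simp
  qed (use bump_range in "auto simp: d_def")
 qed
 finally have I: "I > 0" .
 have "mollifier e (%x. inverse I * d x)"
  unfolding mollifier_def
 proof (intro conjI allI impI)
  show "(LINT x|lborel. inverse I * d x) = 1" using I by (simp add: I_def)
  show "norm x <= e" if "inverse I * d x ~= 0" for x
   using bump_scaled(2)[OF k, of x] that by (simp add: d_def k_def)
  show "0 <= inverse I * d x" for x
   using I bump_range(1)[of "k *R x"] by (intro mult_nonneg_nonneg) (auto simp: d_def)
 qed (rule test_cmult[OF t])
 thus thesis by (rule that)
qed

lemma mollify_eq:
 assumes "test h" "g \<in> L2" "g \<in> borel_measurable borel"
 shows "mollify h (cls g) x = (LINT y|lborel. h (x - y) * g y)" "integrable lborel (%y. h (x - y) * g y)"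
proof -
 have m: "(%y. h (x - y) * g y) \<in> borel_measurable borel"
  by (intro borel_measurable_times assms test_measurable test_reflect)
 show "mollify h (cls g) x = (LINT y|lborel. h (x - y) * g y)"
  unfolding mollify_def by (simp add: inner_cls test_L2 test_reflect assms integral_lebesgue_borel[OF m])
 have "integrable lebesgue (%y. h (x - y) * g y)" by (intro L2_mult_integrable test_L2 test_reflect assms)
 thus "integrable lborel (%y. h (x - y) * g y)" using m by (simp add: integrable_completion)
qed

text \<open>Jensen's inequality for the probability density \<open>h (x - y)\<close> in
  \<open>y\<close>, read off from the nonnegative variance of \<open>g\<close> around its mean
  \<open>m\<close>; Tonelli then integrates over \<open>x\<close> first.\<close>

lemma mollify_contraction:
 assumes h: "mollifier e h"
 shows "mollify h v \<in> L2" and "norm (cls (mollify h v)) <= norm v"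
proof -
 note t = mollifierD(1)[OF h]
 obtain g where g: "g \<in> L2" "g \<in> borel_measurable borel" "v = cls g" by (rule cls_borel)
 have [measurable]: "g \<in> borel_measurable borel" "h \<in> borel_measurable borel" using g test_measurable[OF t] by auto
 have mm [measurable]: "mollify h v \<in> borel_measurable borel"
  by (intro borel_measurable_continuous_onI smooth_continuous smooth_mollify t)
 obtain C where C: "C >= 0" "!!x. \<bar>h x\<bar> <= C" using test_bounded[OF t] by blast
 have g2: "integrable lborel (%y. (g y)^2)" using L2D(2)[OF g(1)] by (simp add: integrable_completion)
 have i2: "integrable lborel (%y. h (x - y) * (g y)^2)" for x
 proof (rule LINT_bound[OF integrable_mult_right[OF g2, of C]])
  show "AE y in lborel. norm (h (x - y) * (g y)^2) <= norm (C * (g y)^2)"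
   using C by (intro AE_I2) (auto simp: abs_mult intro: mult_right_mono)
 qed measurable
 have "(mollify h v x)^2 <= (LINT y|lborel. h (x - y) * (g y)^2)" for x
 proof -
  define m where "m = mollify h v x"
  have m: "m = (LINT y|lborel. h (x - y) * g y)" unfolding m_def g(3) by (rule mollify_eq(1)[OF t g(1,2)])
  have one: "(LINT y|lborel. h (x - y)) = 1" by (rule mollifier_shift_integral[OF h])
  have "0 <= (LINT y|lborel. h (x - y) * (g y - m)^2)"
   by (intro Bochner_Integration.integral_nonneg mult_nonneg_nonneg mollifierD(2)[OF h]) simp
  also have "... = (LINT y|lborel. h (x - y) * (g y)^2 - (2 * m) * (h (x - y) * g y) + m^2 * h (x - y))"
   by (intro Bochner_Integration.integral_cong) (auto simp: power2_diff algebra_simps)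
  finally show ?thesis using i2 mollify_eq(2)[OF t g(1,2), of x] test_integrable(1)[OF test_reflect[OF t]] m one unfolding m_def[symmetric] by (simp add: power2_eq_square)
 qed
 hence "(\<integral>\<^sup>+x. ennreal ((mollify h v x)^2) \<partial>lborel) <= (\<integral>\<^sup>+x. ennreal (LINT y|lborel. h (x - y) * (g y)^2) \<partial>lborel)"
  by (intro nn_integral_mono ennreal_leI)
 also have "... = (\<integral>\<^sup>+x. \<integral>\<^sup>+y. ennreal (h (x - y) * (g y)^2) \<partial>lborel \<partial>lborel)"
  by (intro nn_integral_cong nn_integral_eq_integral[symmetric] i2 AE_I2 mult_nonneg_nonneg mollifierD(2)[OF h]) simp
 also have "... = (\<integral>\<^sup>+y. \<integral>\<^sup>+x. ennreal (h (x - y) * (g y)^2) \<partial>lborel \<partial>lborel)"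
  by (rule lborel_pair.Fubini') measurable
 also have "... = (\<integral>\<^sup>+y. ennreal ((g y)^2) * (\<integral>\<^sup>+x. ennreal (h (x - y)) \<partial>lborel) \<partial>lborel)"
  by (intro nn_integral_cong) (subst nn_integral_cmult[symmetric], measurable, simp add: ennreal_mult'' mult.commute)
 also have "... = (\<integral>\<^sup>+y. ennreal ((g y)^2) \<partial>lborel)"
 proof (intro nn_integral_cong)
  fix y
  have "(\<integral>\<^sup>+x. ennreal (h (x - y)) \<partial>lborel) = (\<integral>\<^sup>+x. ennreal (h x) \<partial>lborel)" by (rule nn_integral_reflect(2)) measurable
  also have "... = 1" using nn_integral_eq_integral[OF test_integrable(1)[OF t]] mollifierD(2,3)[OF h] by simp
  finally show "ennreal ((g y)^2) * (\<integral>\<^sup>+x. ennreal (h (x - y)) \<partial>lborel) = ennreal ((g y)^2)" by simp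
 qed
 also have "... = ennreal ((norm v)^2)" using nn_integral_cls[OF g(1)] g(3) by (simp add: nn_integral_completion)
 finally have F: "(\<integral>\<^sup>+x. ennreal ((mollify h v x)^2) \<partial>lborel) <= ennreal ((norm v)^2)" .
 have "integrable lborel (%x. (mollify h v x)^2)"
  using F by (intro integrableI_nonneg) (auto simp: less_top[symmetric] top_unique)
 hence "integrable lebesgue (%x. (mollify h v x)^2)" by (subst integrable_completion) auto
 moreover have "lmeas (mollify h v)" by (rule measurable_completion) simp
 ultimately show L: "mollify h v \<in> L2" by (simp add: L2_def)
 show "norm (cls (mollify h v)) <= norm v" using F nn_integral_cls[OF L] by (simp add: nn_integral_completion)
qed

lemma mollify_diff: "mollify h (v - w) x = mollify h v x - mollify h w x"
 by (simp add: mollify_def inner_diff_right)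

text \<open>A Lipschitz function moves by at most \<open>K * e\<close> under averaging over distance
  \<open>e\<close>, and for \<open>e <= 1\<close> the change is supported in the ball of radius
  \<open>r + 1\<close>.\<close>

lemma mollify_test_bound:
 assumes g: "g \<in> test_functions (UNIV :: 'a::euclidean_space set)"
 obtains C where "C >= 0" "!!e h. mollifier e h ==> e <= 1 ==> norm (cls (mollify h (cls g)) - cls g) <= C * e"
proof -
 obtain K where K: "K >= 0" "!!x y. \<bar>g x - g y\<bar> <= K * norm (x - y)" using test_increment_le[OF g] by blast
 obtain r where r: "r > 0" "!!x. g x ~= 0 ==> norm x <= r" using test_support[OF g] by blast
 define C where "C = K * sqrt (measure lborel (cball (0::'a) (r + 1)))"
 have "norm (cls (mollify h (cls g)) - cls g) <= C * e" if h: "mollifier e h" and e: "e <= 1" for e h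
 proof -
  note t = mollifierD(1)[OF h]
  have ne: "e >= 0"
  proof (rule ccontr)
   assume "\<not> e >= 0"
   hence "h = (%x. 0)" using mollifierD(4)[OF h] norm_ge_zero order_trans by blast
   thus False using mollifierD(3)[OF h] by simp
  qed
  have d: "mollify h (cls g) x - g x = (LINT y|lborel. h (x - y) * (g y - g x))"
   and di: "integrable lborel (%y. h (x - y) * (g y - g x))" for x
  proof -
   have one: "(LINT y|lborel. h (x - y)) = 1" by (rule mollifier_shift_integral[OF h])
   have i: "integrable lborel (%y. h (x - y) * g y)" "integrable lborel (%y. h (x - y) * g x)"
    using mollify_eq(2)[OF t test_L2[OF g] test_measurable[OF g]] test_integrable(1)[OF test_reflect[OF t]] by auto
   show "integrable lborel (%y. h (x - y) * (g y - g x))"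
    using Bochner_Integration.integrable_diff[OF i] by (simp add: right_diff_distrib)
   show "mollify h (cls g) x - g x = (LINT y|lborel. h (x - y) * (g y - g x))"
    using LINT_diff[OF i] one
    by (simp add: mollify_eq(1)[OF t test_L2[OF g] test_measurable[OF g]] right_diff_distrib)
  qed
  have "norm (cls (%x. mollify h (cls g) x - g x)) <= (K * e) * sqrt (measure lborel (cball (0::'a) (r + 1)))"
  proof (rule L2_norm_bound_on_ball)
   show "(%x. mollify h (cls g) x - g x) \<in> L2" by (intro L2_diff mollify_contraction(1)[OF h] test_L2[OF g])
   show "\<bar>mollify h (cls g) x - g x\<bar> <= K * e" for x
   proof -
    have one: "(LINT y|lborel. h (x - y)) = 1" by (rule mollifier_shift_integral[OF h])
    have "\<bar>mollify h (cls g) x - g x\<bar> <= (LINT y|lborel. norm (h (x - y) * (g y - g x)))"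
     unfolding d by simp
    also have "... <= (LINT y|lborel. h (x - y) * (K * e))"
    proof (rule LINT_mono[OF integrable_norm[OF di]])
     show "integrable lborel (%y. h (x - y) * (K * e))" using test_integrable(1)[OF test_reflect[OF t]] by simp
     fix y
     show "norm (h (x - y) * (g y - g x)) <= h (x - y) * (K * e)"
     proof (cases "h (x - y) = 0")
      case False
      hence "norm (x - y) <= e" by (rule mollifierD(4)[OF h])
      hence "\<bar>g y - g x\<bar> <= K * e" using K(2)[of y x] mult_left_mono[OF _ K(1)] by (metis norm_minus_commute order_trans)
      thus ?thesis using mollifierD(2)[OF h, of "x - y"] by (simp add: abs_mult mult_left_mono)
     qed simp
    qed
    also have "... = K * e" using one by simp
    finally show ?thesis .
   qed
   show "mollify h (cls g) x - g x = 0" if x: "r + 1 < norm x" for x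
   proof -
    have z: "h (x - y) * (g y - g x) = 0" for y
    proof (cases "h (x - y) = 0")
     case False
     thus ?thesis using mollifierD(4)[OF h] e x norm_triangle_ineq2[of x y] r(2)[of y] r(2)[of x] by force+
    qed simp
    show ?thesis unfolding d z by simp
   qed
  qed (use K ne in auto)
  thus ?thesis using mollify_contraction(1)[OF h] test_L2[OF g] by (simp add: cls_diff C_def mult_ac)
 qed
 moreover have "C >= 0" using K by (simp add: C_def)
 ultimately show thesis using that by blast
qed

text \<open>The explicit rate on test functions is carried to \<open>v\<close> by density and by the
  contraction property, in an \<open>e / 3\<close> argument.\<close>

lemma mollify_tendsto:
 assumes h: "!!n. mollifier (inverse (real (Suc n))) (h n)"
 shows "(%n. cls (mollify (h n) v)) ----> v"
proof (rule LIMSEQ_I)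
 fix e :: real assume e: "e > 0"
 have "v \<in> closure (cls ` test_functions UNIV)" by (simp add: test_dense)
 then obtain g where g: "test g" "dist (cls g) v < e / 3"
  using e by (auto simp: closure_approachable dest!: spec[of _ "e / 3"])
 obtain C where C: "C >= 0" "!!e h. mollifier e h ==> e <= 1 ==> norm (cls (mollify h (cls g)) - cls g) <= C * e"
  using mollify_test_bound[OF g(1)] by blast
 have "(%n. C * inverse (real (Suc n))) ----> C * 0" by (intro tendsto_intros LIMSEQ_inverse_real_of_nat)
 hence "\<forall>\<^sub>F n in sequentially. C * inverse (real (Suc n)) < e / 3" using e by (intro order_tendstoD) auto
 then obtain M where M: "!!n. n >= M ==> C * inverse (real (Suc n)) < e / 3" unfolding eventually_sequentially by blast
 have "norm (cls (mollify (h n) v) - v) < e" if n: "n >= M" for n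
 proof -
  have "cls (mollify (h n) (v - cls g)) = cls (mollify (h n) v) - cls (mollify (h n) (cls g))"
   unfolding mollify_diff[abs_def] by (intro cls_diff mollify_contraction(1)[OF h])
  hence eq: "cls (mollify (h n) v) - v = cls (mollify (h n) (v - cls g)) + (cls (mollify (h n) (cls g)) - cls g) + (cls g - v)"
   by simp
  have "norm (cls (mollify (h n) (v - cls g))) <= norm (v - cls g)" by (rule mollify_contraction(2)[OF h])
  moreover have "norm (cls (mollify (h n) (cls g)) - cls g) <= C * inverse (real (Suc n))"
   by (rule C(2)[OF h]) (simp add: inverse_le_1_iff)
  ultimately show ?thesis using g(2) M[OF n]
   norm_triangle_ineq[of "cls (mollify (h n) (v - cls g)) + (cls (mollify (h n) (cls g)) - cls g)" "cls g - v"]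
   norm_triangle_ineq[of "cls (mollify (h n) (v - cls g))" "cls (mollify (h n) (cls g)) - cls g"] unfolding eq by (simp_all add: dist_norm norm_minus_commute)
 qed
 thus "EX M. ALL n>=M. norm (cls (mollify (h n) v) - v) < e" by blast
qed

section \<open>Sobolev spaces\<close>

definition has_wderiv :: "'a::euclidean_space ell2 => 'a list => 'a ell2 => bool" where
 "has_wderiv v bs g \<longleftrightarrow>
  (ALL h:test_functions UNIV. v \<bullet> cls (ip bs h) = (- 1) ^ length bs * (g \<bullet> cls h))"

lemma has_wderiv_cls:
 assumes "f \<in> L2" "g \<in> L2" "bs \<in> lists Basis"
 shows "has_wderiv (cls f) bs (cls g) \<longleftrightarrow> has_weak_deriv f bs g"
 using assms by (simp add: has_wderiv_def has_weak_deriv_def inner_cls test_L2 test_iter)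

lemma has_wderiv_unique: assumes "has_wderiv v bs g" "has_wderiv v bs h" shows "g = h"
proof -
 have "(g - h) \<bullet> cls q = 0" if "test q" for q
 proof -
  show ?thesis using assms that unfolding has_wderiv_def by (simp add: inner_diff_left)
 qed
 thus ?thesis using test_orthogonal_zero[of "g - h"] by simp
qed

lemma has_wderiv_Nil: "has_wderiv v [] v"
 by (simp add: has_wderiv_def)

lemma has_wderiv_zero: "has_wderiv 0 bs 0"
 by (simp add: has_wderiv_def)

lemma has_wderiv_add: "has_wderiv v bs g ==> has_wderiv w bs h ==> has_wderiv (v + w) bs (g + h)"
 by (simp add: has_wderiv_def inner_add_left distrib_left)

lemma has_wderiv_scale: "has_wderiv v bs g ==> has_wderiv (c *R v) bs (c *R g)"
 by (simp add: has_wderiv_def)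

lemma has_wderiv_diff: "has_wderiv v bs g ==> has_wderiv w bs h ==> has_wderiv (v - w) bs (g - h)"
 using has_wderiv_add[OF _ has_wderiv_scale[of w bs h "- 1"]] by simp

lemma has_wderiv_closed:
 assumes w: "!!n. has_wderiv (X n) bs (G n)" and X: "X ----> x" and G: "G ----> g"
 shows "has_wderiv x bs g"
 unfolding has_wderiv_def
proof (intro ballI)
 fix h :: "'a => real" assume h: "test h"
 have 1: "(%n. X n \<bullet> cls (ip bs h)) ----> x \<bullet> cls (ip bs h)" by (intro tendsto_intros X)
 have 2: "(%n. (- 1) ^ length bs * (G n \<bullet> cls h)) ----> (- 1) ^ length bs * (g \<bullet> cls h)" by (intro tendsto_intros G)
 have e: "X n \<bullet> cls (ip bs h) = (- 1) ^ length bs * (G n \<bullet> cls h)" for n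
  using w h by (simp add: has_wderiv_def)
 show "x \<bullet> cls (ip bs h) = (- 1) ^ length bs * (g \<bullet> cls h)"
  by (rule LIMSEQ_unique[OF 1[unfolded e] 2])
qed

lemma has_wderiv_smooth:
 assumes "smooth f" "f \<in> L2" "ip bs f \<in> L2" "bs \<in> lists Basis"
 shows "has_wderiv (cls f) bs (cls (ip bs f))"
 unfolding has_wderiv_def
proof (intro ballI)
 fix g :: "'a => real" assume g: "test g"
 show "cls f \<bullet> cls (ip bs g) = (- 1) ^ length bs * (cls (ip bs f) \<bullet> cls g)"
  using iterated_integration_by_parts[OF g assms(1,4)] assms g
  by (simp add: inner_cls test_L2 test_iter mult.commute)
qed

lemma has_wderiv_test:
 "test g ==> bs \<in> lists Basis ==> has_wderiv (cls g) bs (cls (ip bs g))"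
 by (intro has_wderiv_smooth test_L2 test_iter test_smooth)

text \<open>The derivative falls on the mollifier. Differentiating \<open>h (x - y)\<close> in
  \<open>y\<close> instead of \<open>x\<close> produces the sign \<open>(- 1) ^ length bs\<close>,
  which the definition of the weak derivative cancels.\<close>

lemma ip_mollify:
 assumes w: "has_wderiv v bs g" and bs: "bs \<in> lists Basis" and h: "test h"
 shows "ip bs (mollify h v) = mollify h g"
proof
 fix x
 have "ip bs (%y. h (- y + x)) = (%y. prod_list (map (%_. - 1) bs) * ip (map (%b. b) bs) h (- y + x))"
  by (rule ip_affine[where T = uminus])
   (use bs in "auto intro: bounded_linear_minus bounded_linear_ident test_smooth[OF h]")
 moreover have "prod_list (map (%_. - 1 :: real) bs) = (- 1) ^ length bs" for bs :: "'a list" by (induction bs) auto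
 ultimately have e: "ip bs (%y. h (x - y)) = (%y. (- 1) ^ length bs * ip bs h (x - y))"
  by simp
 have t: "(%y. ip bs h (x - y)) \<in> L2" by (intro test_L2 test_reflect test_iter h bs)
 have "v \<bullet> cls (ip bs (%y. h (x - y))) = (- 1) ^ length bs * mollify (ip bs h) v x"
  unfolding e mollify_def using t by (simp add: cls_cmult inner_commute)
 moreover have "v \<bullet> cls (ip bs (%y. h (x - y))) = (- 1) ^ length bs * mollify h g x"
  using w test_reflect[OF h, of x] unfolding has_wderiv_def mollify_def by (simp add: inner_commute)
 ultimately show "ip bs (mollify h v) x = mollify h g x"
  using mollify_iter_partial[OF h bs] by simp
qed

lemma L2_dominated:
 assumes f: "lmeas f" and g: "g \<in> L2" and le: "!!x. \<bar>f x\<bar> <= \<bar>g x\<bar>"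
 shows "f \<in> L2" "norm (cls f) <= norm (cls g)"
proof -
 have sq: "(f x)^2 <= (g x)^2" for x using le[of x] by (simp add: abs_le_square_iff)
 have [measurable]: "lmeas f" by (rule f)
 have "integrable lebesgue (%x. (f x)^2)"
  by (rule LINT_bound[OF L2D(2)[OF g]]) (use sq in auto)
 with f show L: "f \<in> L2" by (simp add: L2_def)
 have "(norm (cls f))^2 <= (norm (cls g))^2"
  unfolding norm_cls_power2[OF L] norm_cls_power2[OF g] by (rule LINT_mono[OF L2D(2)[OF L] L2D(2)[OF g] sq])
 thus "norm (cls f) <= norm (cls g)" by simp
qed

lemma L2_dominated_convergence:
 fixes g :: "'a::euclidean_space => real"
 assumes f: "!!n. f n \<in> L2" and g: "g \<in> L2" and h: "h \<in> L2"
  and le: "!!n x. \<bar>f n x - g x\<bar> <= \<bar>h x\<bar>" and lim: "AE x in lebesgue. (%n. f n x) ----> g x"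
 shows "(%n. cls (f n)) ----> cls g"
proof -
 have sq: "(f n x - g x)^2 <= (h x)^2" for n x using le[of n x] by (simp add: abs_le_square_iff)
 have [measurable]: "lmeas (f n)" "lmeas g" for n using f g L2D by auto
 have "(%n. LINT x|lebesgue. (f n x - g x)^2) ----> (LINT x::'a|lebesgue. (0::real))"
 proof (rule integral_dominated_convergence[where w = "%x. (h x)^2"])
  show "AE x in lebesgue. (%n. (f n x - g x)^2) ----> 0"
   using lim
  proof eventually_elim
   case (elim x)
   from tendsto_power[OF tendsto_diff[OF elim tendsto_const[of "g x"]], of 2] show ?case by simp
  qed
 qed (use sq L2D(2)[OF h] in auto)
 hence "(%n. (norm (cls (f n) - cls g))^2) ----> 0"
  using norm_cls_power2[OF L2_diff[OF f g]] by (simp add: cls_diff f g)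
 hence "(%n. cls (f n) - cls g) ----> 0" by (simp add: tendsto_norm_zero_iff)
 thus ?thesis by (rule LIM_zero_cancel)
qed

lemma pd_cutoff:
 assumes "smooth h" "smooth F" "b \<in> Basis"
 shows "pd b (%x. h (s *R x) * F x) = (%x. h (s *R x) * pd b F x + s * (pd b h (s *R x) * F x))"
proof
 fix x
 have "pd b (%x. h (s *R x + 0)) x = s * pd b h (s *R x + 0)"
  by (rule pd_affine(1)) (auto intro: bounded_linear_scaleR_right smooth_diffable assms)
 moreover have "(%x. h (s *R x)) differentiable (at x)"
  using smooth_scale[OF assms(1), of s 0] by (simp add: smooth_diffable)
 ultimately show "pd b (%x. h (s *R x) * F x) x = h (s *R x) * pd b F x + s * (pd b h (s *R x) * F x)"
  by (simp add: pd_mult smooth_diffable assms)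
qed

lemma test_cutoff:
 assumes "test h" "smooth F" "s > 0"
 shows "test (%x. h (s *R x) * F x)"
proof -
 obtain r where r: "!!x. h x ~= 0 ==> norm x <= r" using test_support[OF assms(1)] by blast
 have "norm x <= r / s" if "h (s *R x) ~= 0" for x
  using r[OF that] assms(3) by (simp add: pos_le_divide_eq mult.commute)
 moreover have "smooth (%x. h (s *R x))" using smooth_scale[OF test_smooth[OF assms(1)], of s 0] by simp
 ultimately have "test (%x. h (s *R x))" unfolding test_iff by blast
 thus ?thesis using assms(2) by (rule test_mult(1))
qed

lemma cls_cutoff_snoc:
 assumes h: "test h" and F: "smooth F" and s: "s > 0" and b: "b \<in> Basis" and bs: "bs \<in> lists Basis"
 shows "cls (ip (bs @ [b]) (%x. h (s *R x) * F x))
  = cls (ip bs (%x. h (s *R x) * pd b F x)) + s *R cls (ip bs (%x. pd b h (s *R x) * F x))"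
proof -
 have t: "test (%x. h (s *R x) * pd b F x)"
  "test (%x. pd b h (s *R x) * F x)"
  by (intro test_cutoff h F s b smooth_partial test_partial)+
 show ?thesis
  using t bs by (simp add: ip_snoc pd_cutoff[OF test_smooth[OF h] F b] ip_add ip_cmult
    test_smooth smooth_mult test_iter test_L2 cls_add cls_cmult L2_cmult)
qed

text \<open>By the product rule a derivative falls either on \<open>F\<close> or, with a factor
  \<open>s <= 1\<close>, on the cut-off. The induction removes the derivative applied first and
  therefore generalises both \<open>h\<close> and \<open>F\<close>.\<close>

lemma cutoff_bounded:
 assumes "test h" "smooth F" "bs \<in> lists Basis"
  and "!!cs. cs \<in> lists Basis ==> length cs <= length bs ==> ip cs F \<in> L2"
 shows "EX C>=0. ALL s. 0 < s --> s <= 1 --> norm (cls (ip bs (%x. h (s *R x) * F x))) <= C"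
 using assms
proof (induction bs arbitrary: h F rule: rev_induct)
 case Nil
 obtain C where C: "C >= 0" "!!x. \<bar>h x\<bar> <= C" using test_bounded[OF Nil(1)] by blast
 have F: "F \<in> L2" using Nil(4)[of "[]"] by simp
 have "norm (cls (%x. h (s *R x) * F x)) <= norm (cls (%x. C * F x))" if "0 < s" for s
 proof (rule L2_dominated)
  show "lmeas (%x. h (s *R x) * F x)" by (intro L2D(1) test_L2 test_cutoff Nil that)
  show "\<bar>h (s *R x) * F x\<bar> <= \<bar>C * F x\<bar>" for x using C by (simp add: abs_mult mult_right_mono)
 qed (rule L2_cmult[OF F])
 thus ?case by (intro exI[of _ "norm (cls (%x. C * F x))"]) simp
next
 case (snoc b bs)
 hence b: "b \<in> Basis" "bs \<in> lists Basis" by auto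
 have "EX C>=0. ALL s. 0 < s --> s <= 1 --> norm (cls (ip bs (%x. h (s *R x) * pd b F x))) <= C"
 proof (rule snoc.IH[OF snoc.prems(1) smooth_partial[OF snoc.prems(2) b(1)] b(2)])
  fix cs assume "cs \<in> lists (Basis :: 'a set)" "length cs <= length bs"
  thus "ip cs (pd b F) \<in> L2" using snoc.prems(4)[of "cs @ [b]"] b by (simp add: ip_snoc)
 qed
 moreover have "EX C>=0. ALL s. 0 < s --> s <= 1 --> norm (cls (ip bs (%x. pd b h (s *R x) * F x))) <= C"
  by (intro snoc.IH test_partial snoc.prems b) auto
 ultimately obtain C D where C: "C >= 0" "!!s. 0 < s ==> s <= 1 ==> norm (cls (ip bs (%x. h (s *R x) * pd b F x))) <= C"
  and D: "D >= 0" "!!s. 0 < s ==> s <= 1 ==> norm (cls (ip bs (%x. pd b h (s *R x) * F x))) <= D" by blast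
 have "norm (cls (ip (bs @ [b]) (%x. h (s *R x) * F x))) <= C + D" if s: "0 < s" "s <= 1" for s
 proof -
  have "s * norm (cls (ip bs (%x. pd b h (s *R x) * F x))) <= 1 * D"
   using s D by (intro mult_mono) auto
  thus ?thesis
   unfolding cls_cutoff_snoc[OF snoc.prems(1,2) s(1) b]
   by (intro norm_triangle_le add_mono C s) (use s in simp)
 qed
 thus ?case using C(1) D(1) by (intro exI[of _ "C + D"]) simp
qed

text \<open>A derivative falling on the cut-off brings the factor \<open>s n\<close> in front of a
  term kept bounded by \<open>cutoff_bounded\<close>. What survives is the undifferentiated cut-off,
  which tends to 1 pointwise.\<close>

lemma cutoff_tendsto:
 fixes F :: "'a::euclidean_space => real"
 assumes h: "test h" "!!x. norm x <= 1 ==> h x = 1"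
  and s: "!!n. 0 < s n" "!!n. s n <= 1" "s ----> 0"
 shows "smooth F ==> bs \<in> lists Basis ==> (!!cs. cs \<in> lists Basis ==> length cs <= length bs ==> ip cs F \<in> L2) ==>
  (%n. cls (ip bs (%x. h (s n *R x) * F x))) ----> cls (ip bs F)"
proof (induction bs arbitrary: F rule: rev_induct)
 case Nil
 obtain C where C: "C >= 0" "!!x. \<bar>h x\<bar> <= C" using test_bounded[OF h(1)] by blast
 have F: "F \<in> L2" using Nil(3)[of "[]"] by simp
 have "(%n. cls (%x. h (s n *R x) * F x)) ----> cls F"
 proof (rule L2_dominated_convergence)
  show "(%x. h (s n *R x) * F x) \<in> L2" for n by (intro test_L2 test_cutoff h Nil s)
  show "(%x. (C + 1) * F x) \<in> L2" by (rule L2_cmult[OF F])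
  show "\<bar>h (s n *R x) * F x - F x\<bar> <= \<bar>(C + 1) * F x\<bar>" for n x
  proof -
   have "h (s n *R x) * F x - F x = (h (s n *R x) - 1) * F x" by (simp add: algebra_simps)
   moreover have "\<bar>h (s n *R x) - 1\<bar> <= \<bar>C + 1\<bar>" using C(2)[of "s n *R x"] by linarith
   ultimately show ?thesis by (simp add: abs_mult mult_right_mono)
  qed
  show "AE x in lebesgue. (%n. h (s n *R x) * F x) ----> F x"
  proof (rule AE_I2)
   fix x :: 'a
   have "(%n. s n * norm x) ----> 0 * norm x" by (intro tendsto_intros s)
   hence "\<forall>\<^sub>F n in sequentially. s n * norm x < 1" by (intro order_tendstoD) auto
   hence "\<forall>\<^sub>F n in sequentially. F x = h (s n *R x) * F x"
    by eventually_elim (simp add: h(2) less_imp_le[OF s(1)])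
   thus "(%n. h (s n *R x) * F x) ----> F x" by (rule Lim_transform_eventually[OF tendsto_const])
  qed
 qed (rule F)
 thus ?case by simp
next
 case (snoc b bs)
 hence b: "b \<in> Basis" "bs \<in> lists Basis" by auto
 have 1: "(%n. cls (ip bs (%x. h (s n *R x) * pd b F x))) ----> cls (ip bs (pd b F))"
 proof (rule snoc.IH[OF smooth_partial[OF snoc.prems(1) b(1)] b(2)])
  fix cs assume "cs \<in> lists (Basis :: 'a set)" "length cs <= length bs"
  thus "ip cs (pd b F) \<in> L2" using snoc.prems(3)[of "cs @ [b]"] b by (simp add: ip_snoc)
 qed
 obtain D where D: "D >= 0" "!!s. 0 < s ==> s <= 1 ==> norm (cls (ip bs (%x. pd b h (s *R x) * F x))) <= D"
  using cutoff_bounded[OF test_partial[OF h(1) b(1)] snoc.prems(1) b(2)] snoc.prems(3) by auto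
 have 2: "(%n. s n *R cls (ip bs (%x. pd b h (s n *R x) * F x))) ----> 0"
 proof (rule Lim_null_comparison)
  show "\<forall>\<^sub>F n in sequentially. norm (s n *R cls (ip bs (%x. pd b h (s n *R x) * F x))) <= s n * D"
   using D s by (intro always_eventually) (simp add: less_imp_le)
  show "(%n. s n * D) ----> 0" using tendsto_mult[OF s(3) tendsto_const[of D]] by simp
 qed
 show ?case
  unfolding cls_cutoff_snoc[OF h(1) snoc.prems(1) s(1) b] using tendsto_add[OF 1 2] by (simp add: ip_snoc)
qed

text \<open>Mollify, then cut off.\<close>

lemma test_dense_Sobolev:
 fixes v :: "'a::euclidean_space ell2"
 assumes g: "!!bs. bs \<in> lists Basis ==> length bs <= k ==> has_wderiv v bs (g bs)"
 obtains h :: "nat => 'a => real" where "!!n. test (h n)"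
  "!!bs. bs \<in> lists Basis ==> length bs <= k ==> (%n. cls (ip bs (h n))) ----> g bs"
proof -
 define W where "W = {bs \<in> lists (Basis :: 'a set). length bs <= k}"
 have "W = (\<Union>j\<in>{..k}. words j)" by (auto simp: W_def words_def)
 hence W: "finite W" by simp
 have "ALL n. EX q :: 'a => real. mollifier (inverse (real (Suc n))) q" using mollifier_exists by (metis inverse_positive_iff_positive of_nat_0_less_iff zero_less_Suc)
 then obtain q :: "nat => 'a => real" where q: "!!n. mollifier (inverse (real (Suc n))) (q n)" by metis
 define F where "F n = mollify (q n) v" for n
 have sF: "smooth (F n)" for n unfolding F_def by (rule smooth_mollify[OF mollifierD(1)[OF q]])
 have dF: "ip bs (F n) = mollify (q n) (g bs)" if "bs \<in> W" for bs n
  unfolding F_def using that by (intro ip_mollify g mollifierD(1)[OF q]) (auto simp: W_def)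
 define c :: "'a => real" where "c = bump"
 have c: "test c" "!!x. norm x <= 1 ==> c x = 1"
  using bump_scaled(1)[of 1 0] by (auto simp: c_def intro!: bump_1 order_trans[OF Basis_le_norm])
 \<comment> \<open>There are finitely many derivatives up to order \<open>k\<close>, so one dilation
   serves for all of them.\<close>
 have "EX s>0. ALL bs:W. norm (cls (ip bs (%x. c (s *R x) * F n x)) - cls (ip bs (F n))) < inverse (real (Suc n))" for n
 proof -
  have "ALL bs:W. \<forall>\<^sub>F m in sequentially. dist (cls (ip bs (%x. c (inverse (real (Suc m)) *R x) * F n x))) (cls (ip bs (F n))) < inverse (real (Suc n))"
  proof
   fix bs assume bs: "bs \<in> W"
   have "(%m. cls (ip bs (%x. c (inverse (real (Suc m)) *R x) * F n x))) ----> cls (ip bs (F n))"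
   proof (rule cutoff_tendsto[OF c])
    show "inverse (real (Suc m)) <= 1" for m by (simp add: inverse_le_1_iff)
    show "ip cs (F n) \<in> L2" if "cs \<in> lists Basis" "length cs <= length bs" for cs
     using that bs by (subst dF) (auto simp: W_def intro: mollify_contraction(1)[OF q])
   qed (use sF bs LIMSEQ_inverse_real_of_nat in "auto simp: W_def")
   thus "\<forall>\<^sub>F m in sequentially. dist (cls (ip bs (%x. c (inverse (real (Suc m)) *R x) * F n x))) (cls (ip bs (F n))) < inverse (real (Suc n))"
    by (rule tendstoD) simp
  qed
  hence "\<forall>\<^sub>F m in sequentially. ALL bs:W. dist (cls (ip bs (%x. c (inverse (real (Suc m)) *R x) * F n x))) (cls (ip bs (F n))) < inverse (real (Suc n))"
   by (rule eventually_ball_finite[OF W])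
  then obtain m where "ALL bs:W. dist (cls (ip bs (%x. c (inverse (real (Suc m)) *R x) * F n x))) (cls (ip bs (F n))) < inverse (real (Suc n))"
   using eventually_happens'[OF sequentially_bot] by blast
  thus ?thesis by (intro exI[of _ "inverse (real (Suc m))"]) (simp add: dist_norm)
 qed
 then obtain s where s: "!!n. s n > 0"
  "!!n bs. bs \<in> W ==> norm (cls (ip bs (%x. c (s n *R x) * F n x)) - cls (ip bs (F n))) < inverse (real (Suc n))"
  by metis
 show thesis
 proof (rule that[of "%n x. c (s n *R x) * F n x"])
  show "test (%x. c (s n *R x) * F n x)" for n by (intro test_cutoff c sF s)
  fix bs :: "'a list" assume "bs \<in> lists Basis" "length bs <= k"
  hence bs: "bs \<in> W" by (simp add: W_def)
  have "(%n. cls (ip bs (%x. c (s n *R x) * F n x)) - cls (ip bs (F n))) ----> 0"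
   using s(2)[OF bs] by (intro Lim_null_comparison[OF always_eventually LIMSEQ_inverse_real_of_nat]) (simp add: less_imp_le)
  from tendsto_add[OF this mollify_tendsto[OF q, of "g bs"]]
  show "(%n. cls (ip bs (%x. c (s n *R x) * F n x))) ----> g bs"
   by (simp add: dF[OF bs])
 qed
qed

section \<open>The Sobolev space as the domain of a closed form\<close>

definition Hs :: "nat => 'a::euclidean_space ell2 set" where
 "Hs k = {v. ALL bs:lists Basis. length bs <= k --> (EX g. has_wderiv v bs g)}"

definition wderiv :: "'a::euclidean_space list => 'a ell2 => 'a ell2" where
 "wderiv bs v = (THE g. has_wderiv v bs g)"

lemma wderiv_eq: "has_wderiv v bs g ==> wderiv bs v = g"
 unfolding wderiv_def using has_wderiv_unique by blast

lemma wderiv_Nil [simp]: "wderiv [] v = v"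
 by (rule wderiv_eq[OF has_wderiv_Nil])

lemma HsD: "v \<in> Hs k ==> bs \<in> lists Basis ==> length bs <= k ==> has_wderiv v bs (wderiv bs v)"
 using wderiv_eq unfolding Hs_def by blast

lemma subspace_Hs: "subspace (Hs k)"
 unfolding Hs_def
 by (rule subspaceI) (use has_wderiv_zero has_wderiv_add has_wderiv_scale in blast)+

lemma wderiv_add:
 assumes "v \<in> Hs k" "w \<in> Hs k" "bs \<in> lists Basis" "length bs <= k"
 shows "wderiv bs (v + w) = wderiv bs v + wderiv bs w"
 by (intro wderiv_eq has_wderiv_add HsD[OF _ assms(3,4)] assms(1,2))

lemma wderiv_scale:
 assumes "v \<in> Hs k" "bs \<in> lists Basis" "length bs <= k"
 shows "wderiv bs (c *R v) = c *R wderiv bs v"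
 by (intro wderiv_eq has_wderiv_scale HsD[OF _ assms(2,3)] assms(1))

lemma wderiv_diff:
 assumes "v \<in> Hs k" "w \<in> Hs k" "bs \<in> lists Basis" "length bs <= k"
 shows "wderiv bs (v - w) = wderiv bs v - wderiv bs w"
 by (intro wderiv_eq has_wderiv_diff HsD[OF _ assms(3,4)] assms(1,2))

lemma test_Hs: "test g ==> cls g \<in> Hs k"
 unfolding Hs_def using has_wderiv_test by blast

lemma wderiv_test: "test g ==> bs \<in> lists Basis ==> wderiv bs (cls g) = cls (ip bs g)"
 by (intro wderiv_eq has_wderiv_test)

lemma Hs_test_sequence:
 fixes v :: "'a::euclidean_space ell2"
 assumes v: "v \<in> Hs k"
 obtains g :: "nat => 'a => real" where "!!n. test (g n)" "(%n. cls (g n)) ----> v"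
  "!!bs. bs \<in> lists Basis ==> length bs <= k ==> (%n. wderiv bs (cls (g n))) ----> wderiv bs v"
proof -
 obtain g where g: "!!n. test (g n)"
  "!!bs. bs \<in> lists Basis ==> length bs <= k ==> (%n. cls (ip bs (g n))) ----> wderiv bs v"
  using test_dense_Sobolev[of k v "%bs. wderiv bs v"] HsD[OF v] by blast
 show thesis
 proof (rule that[OF g(1)])
  show "(%n. cls (g n)) ----> v" using g(2)[of "[]"] by simp
  show "(%n. wderiv bs (cls (g n))) ----> wderiv bs v" if "bs \<in> lists Basis" "length bs <= k" for bs
   using g(2)[OF that] by (simp add: wderiv_test g(1) that(1))
 qed
qed

text \<open>Only derivatives of the highest order enter, so that this is the form of
  \<open>(-Delta)^k\<close> itself; intermediate orders are controlled by interpolation.\<close>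

definition hform :: "nat => 'a::euclidean_space ell2 => 'a ell2 => real" where
 "hform k v w = (\<Sum>bs\<in>words k. wderiv bs v \<bullet> wderiv bs w)"

lemma wordsD: "bs \<in> words k ==> bs \<in> lists Basis" "bs \<in> words k ==> length bs = k"
 by (auto simp: words_def)

lemma Hs_interpolation:
 fixes v :: "'a::euclidean_space ell2"
 assumes v: "v \<in> Hs k" and j: "j <= k"
 shows "(\<Sum>bs\<in>words j. (norm (wderiv bs v))^2) <= v \<bullet> v + hform k v v"
proof -
 obtain g where g: "!!n. test (g n)" "(%n. cls (g n)) ----> v"
  "!!bs. bs \<in> lists Basis ==> length bs <= k ==> (%n. wderiv bs (cls (g n))) ----> wderiv bs v"
  by (rule Hs_test_sequence[OF v]) blast
 have w: "(norm (wderiv bs (cls (g n))))^2 = (LINT x|lebesgue. (ip bs (g n) x)^2)" if "bs \<in> lists Basis" for bs n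
  using that by (simp add: wderiv_test g(1) norm_cls_power2 test_L2 test_iter)
 have "(\<Sum>bs\<in>words j. (norm (wderiv bs (cls (g n))))^2) <= cls (g n) \<bullet> cls (g n) + hform k (cls (g n)) (cls (g n))" for n
 proof -
  have "(\<Sum>bs\<in>words j. (norm (wderiv bs (cls (g n))))^2) = (\<Sum>bs\<in>words j. LINT x|lebesgue. (ip bs (g n) x)^2)"
   by (intro sum.cong w refl wordsD)
  also have "... <= (LINT x|lebesgue. (g n x)^2) + (\<Sum>bs\<in>words k. LINT x|lebesgue. (ip bs (g n) x)^2)"
   by (rule interpolation_test[OF g(1) j])
  also have "(\<Sum>bs\<in>words k. LINT x|lebesgue. (ip bs (g n) x)^2) = hform k (cls (g n)) (cls (g n))"
   unfolding hform_def by (intro sum.cong) (auto simp: w[symmetric] wordsD power2_norm_eq_inner)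
  finally show ?thesis by (simp add: norm_cls_power2[symmetric] test_L2 g(1) power2_norm_eq_inner)
 qed
 moreover have "(%n. \<Sum>bs\<in>words j. (norm (wderiv bs (cls (g n))))^2) ----> (\<Sum>bs\<in>words j. (norm (wderiv bs v))^2)"
  using j by (intro tendsto_sum tendsto_power tendsto_norm g(3)) (auto simp: words_def)
 moreover have "(%n. cls (g n) \<bullet> cls (g n) + hform k (cls (g n)) (cls (g n))) ----> v \<bullet> v + hform k v v"
  unfolding hform_def by (intro tendsto_sum tendsto_inner tendsto_add g(2,3)) (auto simp: words_def)
 ultimately show ?thesis by (intro LIMSEQ_le) auto
qed

interpretation sob: semi_inner_form "Hs k" "hform k" for k
proof
 fix x y z :: "'a ell2" assume x: "x \<in> Hs k" and y: "y \<in> Hs k"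
 show "hform k x y = hform k y x" by (simp add: hform_def inner_commute)
 show "0 <= hform k x x" by (simp add: hform_def sum_nonneg)
 show "hform k (x + y) z = hform k x z + hform k y z"
  unfolding hform_def sum.distrib[symmetric] by (intro sum.cong refl) (auto simp: words_def wderiv_add[OF x y] inner_add_left)
 show "hform k (c *R x) z = c * hform k x z" for c
  unfolding hform_def sum_distrib_left by (intro sum.cong refl) (auto simp: words_def wderiv_scale[OF x])
qed (rule subspace_Hs)

lemma wderiv_norm_le:
 assumes v: "v \<in> Hs k" and bs: "bs \<in> lists Basis" "length bs <= k"
 shows "(norm (wderiv bs v))^2 <= v \<bullet> v + hform k v v"
proof -
 have "(norm (wderiv bs v))^2 <= (\<Sum>cs\<in>words (length bs). (norm (wderiv cs v))^2)"
  using bs by (intro member_le_sum) (auto simp: words_def finite_words[unfolded words_def])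
 also have "... <= v \<bullet> v + hform k v v" by (rule Hs_interpolation[OF v bs(2)])
 finally show ?thesis .
qed

text \<open>By interpolation the form norm dominates every derivative up to order \<open>k\<close>,
  so each sequence of derivatives converges, and weak derivatives are closed under such limits. Test
  functions provide density.\<close>

interpretation sob: hilbert_form "Hs k" "hform k" for k
proof
 fix X :: "nat => 'a ell2"
 assume X: "!!n. X n \<in> Hs k"
  and C: "!!e. e > 0 ==> EX M. ALL m>=M. ALL n>=M. (X m - X n) \<bullet> (X m - X n) + hform k (X m - X n) (X m - X n) < e"
 have "convergent (%n. wderiv bs (X n))" if bs: "bs \<in> lists Basis" "length bs <= k" for bs
 proof -
  have "Cauchy (%n. wderiv bs (X n))"
  proof (rule CauchyI)
   fix e :: real assume e: "e > 0"
   then obtain M where M: "ALL m>=M. ALL n>=M. (X m - X n) \<bullet> (X m - X n) + hform k (X m - X n) (X m - X n) < e^2"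
    using C[of "e^2"] by auto
   have "norm (wderiv bs (X m) - wderiv bs (X n)) < e" if "m >= M" "n >= M" for m n
   proof -
    have "(norm (wderiv bs (X m) - wderiv bs (X n)))^2 <= (X m - X n) \<bullet> (X m - X n) + hform k (X m - X n) (X m - X n)"
     using wderiv_norm_le[OF sob.V_diff[OF X X] bs] by (simp add: wderiv_diff[OF X X bs])
    also have "... < e^2" using M that by blast
    finally show ?thesis by (rule power_less_imp_less_base) (use e in simp)
   qed
   thus "EX M. ALL m>=M. ALL n>=M. norm (wderiv bs (X m) - wderiv bs (X n)) < e" by blast
  qed
  thus ?thesis by (simp add: Cauchy_convergent_iff)
 qed
 hence lim: "(%n. wderiv bs (X n)) ----> lim (%n. wderiv bs (X n))" if "bs \<in> lists Basis" "length bs <= k" for bs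
  using that convergent_LIMSEQ_iff by blast
 define x where "x = lim X"
 have x: "X ----> x" using lim[of "[]"] by (simp add: x_def)
 have wx: "has_wderiv x bs (lim (%n. wderiv bs (X n)))" if "bs \<in> lists Basis" "length bs <= k" for bs
  by (rule has_wderiv_closed[OF HsD[OF X that] x lim[OF that]])
 hence xH: "x \<in> Hs k" unfolding Hs_def by blast
 have l: "(%n. wderiv bs (X n - x)) ----> 0" if "bs \<in> lists Basis" "length bs <= k" for bs
  using tendsto_diff[OF lim[OF that] tendsto_const[of "wderiv bs x"]] wderiv_eq[OF wx[OF that]]
  by (simp add: wderiv_diff[OF X xH that])
 have "(%n. (X n - x) \<bullet> (X n - x) + hform k (X n - x) (X n - x)) ----> (x - x) \<bullet> (x - x) + (\<Sum>bs\<in>(words k :: 'a list set). 0 \<bullet> (0 :: 'a ell2))"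
  unfolding hform_def by (intro tendsto_add tendsto_inner tendsto_diff tendsto_sum x tendsto_const l) (auto simp: words_def)
 thus "EX x:Hs k. (%n. (X n - x) \<bullet> (X n - x) + hform k (X n - x) (X n - x)) ----> 0"
  using xH by (intro bexI[of _ x]) simp_all
next
 have "closure (cls ` test_functions UNIV) \<subseteq> closure (Hs k :: 'a ell2 set)"
  by (intro closure_mono image_subsetI test_Hs)
 thus "closure (Hs k :: 'a ell2 set) = UNIV" unfolding test_dense by blast
qed

text \<open>Identifies the operator behind the form on test functions. \<open>v\<close> is replaced
  by approximating test functions, for which the formula is integration by parts.\<close>

lemma hform_test:
 fixes v :: "'a::euclidean_space ell2"
 assumes v: "v \<in> Hs k" and h: "test h"
 shows "hform k v (cls h) = v \<bullet> cls (neg_laplacian_pow k h)"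
proof -
 obtain g where g: "!!n. test (g n)" "(%n. cls (g n)) ----> v"
  "!!bs. bs \<in> lists Basis ==> length bs <= k ==> (%n. wderiv bs (cls (g n))) ----> wderiv bs v"
  by (rule Hs_test_sequence[OF v]) blast
 have e: "hform k (cls (g n)) (cls h) = cls (g n) \<bullet> cls (neg_laplacian_pow k h)" for n
 proof -
  have "hform k (cls (g n)) (cls h) = (\<Sum>bs\<in>words k. LINT x|lebesgue. ip bs (g n) x * ip bs h x)"
   unfolding hform_def by (intro sum.cong refl) (simp add: wordsD wderiv_test g(1) h inner_cls test_L2 test_iter)
  thus ?thesis
   using integral_neg_laplacian_pow[OF g(1)[of n] h] by (simp add: inner_cls test_L2 g(1) h test_neg_laplacian_pow)
 qed
 have 1: "(%n. hform k (cls (g n)) (cls h)) ----> hform k v (cls h)"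
  unfolding hform_def by (intro tendsto_sum tendsto_inner g(3)) (auto simp: words_def)
 have 2: "(%n. cls (g n) \<bullet> cls (neg_laplacian_pow k h)) ----> v \<bullet> cls (neg_laplacian_pow k h)"
  by (intro tendsto_intros g(2))
 show ?thesis by (rule LIMSEQ_unique[OF 1[unfolded e] 2])
qed

section \<open>A Sobolev inequality\<close>

text \<open>The convex function \<open>a powr q\<close> lies above its tangent at \<open>c\<close>;
  Young's inequality with conjugate exponents is this statement.\<close>

lemma powr_tangent:
 fixes a c q :: real
 assumes q: "q > 1" and "a >= 0" "c >= 0"
 shows "q * c powr (q - 1) * a <= a powr q + (q - 1) * c powr q"
proof -
 have "1 / q + 1 / (q / (q - 1)) = 1" "q / (q - 1) > 1" using q by (simp_all add: field_simps)
 hence "a * c powr (q - 1) <= a powr q / q + (c powr (q - 1)) powr (q / (q - 1)) / (q / (q - 1))"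
  using assms by (intro Youngs_inequality) auto
 also have "(c powr (q - 1)) powr (q / (q - 1)) = c powr q" using q by (simp add: powr_powr)
 finally have "q * (a * c powr (q - 1)) <= q * (a powr q / q + c powr q / (q / (q - 1)))"
  using q by simp
 moreover have "q * (a / q + b / (q / (q - 1))) = a + (q - 1) * b" for a b using q by (simp add: distrib_left)
 ultimately show ?thesis by (simp only: mult_ac)
qed

text \<open>The tangent inequality is integrated with \<open>c\<close> equal to the mean
  \<open>I / A\<close>; the upper bound \<open>C\<close> provides integrability.\<close>

lemma (in finite_measure) Jensen_powr:
 assumes [measurable]: "F \<in> borel_measurable M" and F: "!!x. 0 <= F x" "!!x. F x <= C" and q: "q > 1"
 shows "(LINT x|M. F x) powr q <= measure M (space M) powr (q - 1) * (LINT x|M. F x powr q)"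
proof -
 define I A where "I = (LINT x|M. F x)" and "A = measure M (space M)"
 have iF: "integrable M F" by (rule integrable_const_bound[of _ C]) (use F in auto)
 have iFq: "integrable M (%x. F x powr q)"
  by (rule integrable_const_bound[of _ "C powr q"]) (use F q in "auto intro!: powr_mono2")
 have J: "0 <= (LINT x|M. F x powr q)" and I0: "I >= 0" unfolding I_def using F by auto
 have IC: "I <= A * C"
  using LINT_mono[OF iF integrable_const[of C]] F unfolding I_def A_def by simp
 show ?thesis
 proof (cases "I = 0")
  case False
  hence I: "I > 0" "A > 0" using I0 IC by (auto simp: A_def order_less_le)
  define c where "c = I / A"
  have c: "c > 0" using I by (simp add: c_def)
  have "q * c powr (q - 1) * F x <= F x powr q + (q - 1) * c powr q" for x by (rule powr_tangent[OF q F(1)]) (use c in simp)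
  hence "(LINT x|M. q * c powr (q - 1) * F x) <= (LINT x|M. F x powr q + (q - 1) * c powr q)"
   using iF iFq by (intro LINT_mono) auto
  hence *: "q * c powr (q - 1) * I <= (LINT x|M. F x powr q) + (q - 1) * c powr q * A"
   using iFq by (simp add: I_def A_def mult_ac)
  have "I = c * A" using I by (simp add: c_def)
  hence e: "q * c powr (q - 1) * I = q * (c powr q * A)" using c by (simp add: powr_diff)
  have "c powr q * A <= (LINT x|M. F x powr q)" using *[unfolded e] by (simp add: left_diff_distrib)
  hence "A powr (q - 1) * (c powr q * A) <= A powr (q - 1) * (LINT x|M. F x powr q)" by (intro mult_left_mono) auto
  moreover have "A powr (q - 1) * (c powr q * A) = I powr q"
   using I unfolding \<open>I = c * A\<close> by (simp add: powr_mult powr_diff)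
  ultimately show ?thesis by (simp add: I_def A_def)
 qed (use J in "auto simp: I_def")
qed

text \<open>Taylor expansion of \<open>g (x + s *R y)\<close> around \<open>s = 1\<close>, evaluated
  at \<open>s = 0\<close>, with integral remainder. Monomials in \<open>y\<close> and inverse
  factorials are bounded by 1; the weight \<open>s ^ (sg - 1)\<close> is kept because the later
  averages rest on it.\<close>

lemma Taylor_test:
 fixes g :: "'a::euclidean_space => real"
 assumes g: "test g" and sg: "sg >= 1" and y: "norm y <= 1"
 shows "\<bar>g x\<bar> <= (\<Sum>j<sg. \<Sum>bs\<in>words j. \<bar>ip bs g (x + y)\<bar>)
  + (\<Sum>bs\<in>words sg. I0 1 (%s. s ^ (sg - 1) * \<bar>ip bs g (x + s *R y)\<bar>))"
proof -
 define P where "P bs = prod_list (map (%b. y \<bullet> b) bs)" for bs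
 define H where "H m s = (\<Sum>bs\<in>words m. P bs * ip bs g (x + s *R y))" for m s
 \<comment> \<open>Reversal of the parameter: the Taylor formula expands from the left end point -1,
   which corresponds to \<open>x + y\<close>. The sign is the chain rule.\<close>
 define D where "D m s = (- 1) ^ m * H m (- s)" for m s
 have P: "\<bar>P bs\<bar> <= 1" if "bs \<in> lists Basis" for bs
  using that
 proof (induction bs)
  case (Cons b bs)
  thus ?case using Basis_le_norm[of b y] y by (simp add: P_def abs_mult mult_le_one)
 qed (simp add: P_def)
 have Hd: "(H m has_real_derivative H (Suc m) s) (at s)" for m s
 proof -
  have "(H m has_real_derivative (\<Sum>bs\<in>words m. P bs * (\<Sum>b\<in>Basis. (y \<bullet> b) * pd b (ip bs g) (x + s *R y)))) (at s)"
   unfolding H_def by (intro DERIV_sum DERIV_cmult has_derivative_directional smooth_diffable smooth_iter_partial test_smooth[OF g] wordsD)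
  thus ?thesis unfolding H_def sum_words_Suc by (simp add: sum_distrib_left ip_Cons P_def mult_ac)
 qed
 have cont: "continuous_on S (%s. ip bs g (x + s *R y))" if "bs \<in> lists Basis" for bs S
  by (intro continuous_on_compose2[OF smooth_continuous[OF smooth_iter_partial[OF test_smooth[OF g] that], of UNIV]] continuous_intros) simp
 have HI: "\<bar>H m s\<bar> <= (\<Sum>bs\<in>words m. \<bar>ip bs g (x + s *R y)\<bar>)" for m s
  unfolding H_def by (intro order_trans[OF sum_abs sum_mono]) (simp add: abs_mult mult_left_le_one_le P[OF wordsD(1)])
 have "(D m has_vector_derivative D (Suc m) t) (at t within {-1..0})" for m t
 proof -
  have "((%s. H m (- s)) has_real_derivative - H (Suc m) (- t)) (at t)"
   using DERIV_chain2[OF Hd DERIV_minus[OF DERIV_ident]] by simp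
  from DERIV_cmult[OF this, of "(- 1) ^ m"]
  show ?thesis by (simp add: D_def[abs_def] has_field_derivative_at_within has_real_derivative_iff_has_vector_derivative[symmetric])
 qed
 from Taylor_has_integral[where p = sg and Df = D and f = "D 0" and a = "-1" and b = 0, OF _ refl this] sg
 have "((%s. ((0 - (- s)) ^ (sg - 1) / fact (sg - 1)) *R D sg (- s)) has_integral D 0 0 - (\<Sum>i<sg. ((0 - (-1)) ^ i / fact i) *R D i (- 1))) {0..1}" using has_integral_reflect_real[where a = "- 1" and b = 0 and f = "%t. ((0 - t) ^ (sg - 1) / fact (sg - 1)) *R D sg t"] by simp
 moreover have "D 0 0 = g x" by (simp add: D_def H_def P_def)
 ultimately have I: "((%s. (s ^ (sg - 1) / fact (sg - 1)) * D sg (- s)) has_integral g x - (\<Sum>i<sg. (1 / fact i) * D i (- 1))) {0..1}" by simp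
 have c1: "C0 1 (%s. s ^ (sg - 1) * \<bar>ip bs g (x + s *R y)\<bar>)" if "bs \<in> words sg" for bs
  by (intro continuous_intros cont wordsD(1)[OF that])
 have "norm (I0 1 (%s. (s ^ (sg - 1) / fact (sg - 1)) * D sg (- s)))
   <= I0 1 (%s. \<Sum>bs\<in>words sg. s ^ (sg - 1) * \<bar>ip bs g (x + s *R y)\<bar>)"
 proof (rule integral_norm_bound_integral)
  show "(%s. (s ^ (sg - 1) / fact (sg - 1)) * D sg (- s)) integrable_on {0..1}" using I by blast
  show "(%s. \<Sum>bs\<in>words sg. s ^ (sg - 1) * \<bar>ip bs g (x + s *R y)\<bar>) integrable_on {0..1}"
   by (intro integrable_continuous_real continuous_on_sum c1)
  fix s :: real assume s: "s \<in> {0..1}"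
  have f: "\<bar>D sg (- s)\<bar> / fact (sg - 1) <= \<bar>D sg (- s)\<bar> / 1" by (intro divide_left_mono) auto
  have "norm ((s ^ (sg - 1) / fact (sg - 1)) * D sg (- s)) = s ^ (sg - 1) * (\<bar>D sg (- s)\<bar> / fact (sg - 1))"
   using s by (simp add: abs_mult)
  also have "... <= s ^ (sg - 1) * \<bar>H sg s\<bar>"
   using f s by (intro mult_left_mono) (auto simp: D_def abs_mult)
  also have "... <= s ^ (sg - 1) * (\<Sum>bs\<in>words sg. \<bar>ip bs g (x + s *R y)\<bar>)" using s by (intro mult_left_mono HI) auto
  finally show "norm ((s ^ (sg - 1) / fact (sg - 1)) * D sg (- s)) <= (\<Sum>bs\<in>words sg. s ^ (sg - 1) * \<bar>ip bs g (x + s *R y)\<bar>)"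
   by (simp add: sum_distrib_left)
 qed
 also have "... = (\<Sum>bs\<in>words sg. I0 1 (%s. s ^ (sg - 1) * \<bar>ip bs g (x + s *R y)\<bar>))"
  by (intro Henstock_Kurzweil_Integration.integral_sum integrable_continuous_real c1) auto
 finally have 1: "\<bar>g x - (\<Sum>i<sg. (1 / fact i) * D i (- 1))\<bar> <= (\<Sum>bs\<in>words sg. I0 1 (%s. s ^ (sg - 1) * \<bar>ip bs g (x + s *R y)\<bar>))"
  unfolding integral_unique[OF I] real_norm_def .
 have "\<bar>\<Sum>i<sg. (1 / fact i) * D i (- 1)\<bar> <= (\<Sum>j<sg. \<Sum>bs\<in>words j. \<bar>ip bs g (x + y)\<bar>)"
 proof (rule order_trans[OF sum_abs sum_mono])
  fix i
  have "\<bar>(1 / fact i) * D i (- 1)\<bar> = \<bar>H i 1\<bar> / fact i" by (simp add: D_def abs_mult)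
  also have "... <= \<bar>H i 1\<bar> / 1" by (intro divide_left_mono) auto
  also have "... <= (\<Sum>bs\<in>words i. \<bar>ip bs g (x + y)\<bar>)" using HI[of i 1] by simp
  finally show "\<bar>(1 / fact i) * D i (- 1)\<bar> <= (\<Sum>bs\<in>words i. \<bar>ip bs g (x + y)\<bar>)" .
 qed
 with 1 show ?thesis by linarith
qed

definition ball_measure :: "'a::euclidean_space measure" where
 "ball_measure = density lborel (%y. ennreal (indicator (cball 0 1) y))"

text \<open>Carries the part of the Taylor weight that remains after \<open>s powr (sg / p)\<close>
  has been spent on the bound of the \<open>2 * p\<close>-th power. Finiteness of this measure
  allows Jensen's inequality in the radius.\<close>

definition radial :: "real => real measure" where
 "radial dl = density lborel (%s. ennreal (indicator {0..1} s * s powr (dl - 1)))"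

lemma sets_radial [measurable_cong, simp]: "sets (radial dl) = sets borel"
 and sets_unit_ball [measurable_cong, simp]: "sets ball_measure = sets borel"
 and space_radial [simp]: "space (radial dl) = UNIV"
 and space_unit_ball [simp]: "space ball_measure = UNIV"
 by (simp_all add: radial_def ball_measure_def)

lemma finite_radial: assumes "dl > 0" shows "finite_measure (radial dl)"
proof
 have i: "((%s. s powr (dl - 1)) has_integral (1 powr (dl - 1 + 1) / (dl - 1 + 1))) {0..1}"
  by (rule has_integral_powr_from_0) (use assms in auto)
 have "emeasure (radial dl) UNIV = (\<integral>\<^sup>+s. ennreal (indicator {0..1} s * s powr (dl - 1)) \<partial>lborel)"
  by (simp add: radial_def emeasure_density)
 also have "... = ennreal (1 powr (dl - 1 + 1) / (dl - 1 + 1))"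
  by (rule nn_integral_has_integral_lebesgue[OF _ i]) simp
 finally show "emeasure (radial dl) (space (radial dl)) ~= \<infinity>" by simp
qed

interpretation unit_ball: finite_measure "ball_measure :: 'a::euclidean_space measure"
proof
 have "emeasure ball_measure (UNIV :: 'a set) = (\<integral>\<^sup>+y. indicator (cball (0::'a) 1) y \<partial>lborel)"
  by (auto simp: ball_measure_def emeasure_density intro!: nn_integral_cong simp: indicator_def)
 thus "emeasure ball_measure (space (ball_measure :: 'a measure)) ~= \<infinity>"
  using emeasure_lborel_cball_finite[of "0::'a" 1] by simp
qed

text \<open>Not normalised by the volume of the ball; \<open>s\<close> is the radius of the
  averaging ball around \<open>x\<close>.\<close>

definition ball_avg :: "('a::euclidean_space => real) => real => 'a => real" where
 "ball_avg G s x = (LINT y|ball_measure. G (x + s *R y))"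

locale bounded_borel =
 fixes G :: "'a::euclidean_space => real" and C :: real
 assumes G_meas [measurable]: "G \<in> borel_measurable borel" and G_range: "0 <= G x" "G x <= C"
begin

lemma integrable_shift: "integrable ball_measure (%y. G (x + s *R y))"
 by (rule unit_ball.integrable_const_bound[of _ C]) (use G_range in auto)

lemma ball_avg_nonneg: "0 <= ball_avg G s x"
 unfolding ball_avg_def by (intro Bochner_Integration.integral_nonneg G_range)

lemma ball_avg_le: "ball_avg G s x <= C * measure ball_measure (UNIV :: 'a set)"
 using LINT_mono[OF integrable_shift unit_ball.integrable_const[of C], of x s] G_range
 by (simp add: ball_avg_def mult.commute)

lemma ball_avg_measurable [measurable]: "(%(s, x). ball_avg G s x) \<in> borel_measurable (borel \<Otimes>\<^sub>M borel)"
 unfolding ball_avg_def by simp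

lemma square: "bounded_borel (%x. (G x)^2) (C^2)"
 by unfold_locales (use G_range in "auto intro!: power_mono")

lemma ball_avg_square: "(ball_avg G s x)^2 <= measure ball_measure (UNIV :: 'a set) * ball_avg (%x. (G x)^2) s x"
 using unit_ball.Jensen_powr[of "%y. G (x + s *R y)" C 2] G_range
 by (simp add: ball_avg_def)

lemma nn_ball_avg: "ennreal (ball_avg G s x) = (\<integral>\<^sup>+y. ennreal (G (x + s *R y)) \<partial>ball_measure)"
 unfolding ball_avg_def using nn_integral_eq_integral[OF integrable_shift] G_range by simp

lemma nn_integral_ball_avg:
 "(\<integral>\<^sup>+x. ennreal (ball_avg G s x) \<partial>lborel) = ennreal (measure ball_measure (UNIV :: 'a set)) * (\<integral>\<^sup>+x. ennreal (G x) \<partial>lborel)"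
proof -
 interpret pair_sigma_finite "lborel :: 'a measure" "ball_measure :: 'a measure" ..
 have "(\<integral>\<^sup>+x. ennreal (ball_avg G s x) \<partial>lborel) = (\<integral>\<^sup>+y. \<integral>\<^sup>+x. ennreal (G (x + s *R y)) \<partial>lborel \<partial>ball_measure)"
  unfolding nn_ball_avg by (rule Fubini'[symmetric]) measurable
 also have "... = (\<integral>\<^sup>+y. (\<integral>\<^sup>+x. ennreal (G x) \<partial>lborel) \<partial>(ball_measure :: 'a measure))"
  using nn_integral_affine[of "%x. ennreal (G x)" 1 "s *R _"] by (simp add: add.commute[of _ "s *R _"])
 finally show ?thesis by (simp add: mult.commute unit_ball.emeasure_eq_measure)
qed

lemma nn_integral_ball_avg_cmult:
 "(\<integral>\<^sup>+x. ennreal c * ennreal (ball_avg G s x) \<partial>lborel) = ennreal c * (ennreal (measure ball_measure (UNIV :: 'a set)) * (\<integral>\<^sup>+x. ennreal (G x) \<partial>lborel))"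
 unfolding nn_integral_ball_avg[of s, symmetric] by (rule nn_integral_cmult) measurable

text \<open>Once the restriction to the ball is dropped, the substitution \<open>x + s *R y\<close>
  costs exactly the Jacobian.\<close>

lemma ball_avg_scale:
 assumes s: "s > 0" and I: "(\<integral>\<^sup>+x. ennreal (G x) \<partial>lborel) <= 1"
 shows "ball_avg G s x <= s powr (- real DIM('a))"
proof -
 have "ennreal (ball_avg G s x) = (\<integral>\<^sup>+y. ennreal (indicator (cball 0 1) y) * ennreal (G (x + s *R y)) \<partial>lborel)"
  unfolding nn_ball_avg ball_measure_def
  by (rule nn_integral_density) (auto intro!: borel_measurable_indicator)
 also have "... <= (\<integral>\<^sup>+y. ennreal (G (x + s *R y)) \<partial>lborel)"
  by (intro nn_integral_mono) (simp add: indicator_def)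
 finally have "ennreal (s ^ DIM('a)) * ennreal (ball_avg G s x) <= ennreal (s ^ DIM('a)) * (\<integral>\<^sup>+y. ennreal (G (x + s *R y)) \<partial>lborel)"
  by (intro mult_left_mono) auto
 also have "... = (\<integral>\<^sup>+x. ennreal (G x) \<partial>lborel)"
  using nn_integral_affine[of "%x. ennreal (G x)" s x] s by simp
 finally have "ennreal (s ^ DIM('a) * ball_avg G s x) <= ennreal 1" using I s by (simp add: ennreal_mult ball_avg_nonneg)
 thus ?thesis using s by (simp add: powr_minus powr_realpow field_simps)
qed

end

text \<open>\<open>subcritical\<close> is the condition p <= 1 + 2 sigma / n cleared of
  denominators. The dimension is a real parameter because the type of the space variable is not
  fixed here.\<close>

locale Sobolev_exponents =
 fixes sg :: nat and p :: real and dim :: real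
 assumes p: "1 < p" and sg: "1 <= sg" and subcritical: "dim * (p - 1) <= 2 * real sg"
begin

text \<open>Splits the weight: \<open>s^(sg - 1) = s^(dl - 1) * s^(sg / p)\<close> for
  \<open>s > 0\<close>. Its positivity expresses \<open>p > 1\<close>.\<close>

definition "dl = real sg - real sg / p"

lemma dl: "dl > 0"
 using p sg by (simp add: dl_def field_simps)

definition radial_avg :: "('a::euclidean_space => real) => 'a => real" where
 "radial_avg G x = (LINT s|radial dl. indicator {0..1} s * s powr (real sg / p) * ball_avg G s x)"

text \<open>Of the \<open>p\<close> powers of the average \<open>m\<close> of \<open>G^2\<close>,
  one is kept for integration in \<open>x\<close> and the other \<open>p - 1\<close> are estimated
  pointwise by \<open>ball_avg_scale\<close>. The remaining factor
  \<open>s^(2 sg - dim (p - 1))\<close> is at most 1 by \<open>subcritical\<close>.\<close>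

lemma ball_avg_powr:
 fixes G :: "'a::euclidean_space => real"
 assumes G: "bounded_borel G C" and dim: "dim = real DIM('a)" and s: "0 < s" "s <= 1"
  and I: "(\<integral>\<^sup>+x. ennreal ((G x)^2) \<partial>lborel) <= 1"
 shows "(s powr (real sg / p) * ball_avg G s x) powr (2 * p)
  <= measure ball_measure (UNIV :: 'a set) powr p * ball_avg (%x. (G x)^2) s x"
proof -
 interpret bounded_borel G C by (rule G)
 interpret sq: bounded_borel "%x. (G x)^2" "C^2" by (rule square)
 define b m a where "b = measure ball_measure (UNIV :: 'a set)" and "m = ball_avg (%x. (G x)^2) s x" and "a = ball_avg G s x"
 have pos: "b >= 0" "m >= 0" "a >= 0" by (simp_all add: b_def m_def a_def sq.ball_avg_nonneg ball_avg_nonneg)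
 have am: "a^2 <= b * m" unfolding a_def b_def m_def by (rule ball_avg_square)
 have ms: "m <= s powr (- dim)" unfolding m_def dim by (rule sq.ball_avg_scale[OF s(1) I])
 have "(s powr (real sg / p) * a) powr (2 * p) = s powr (2 * real sg) * (a^2) powr p"
  using pos p by (simp add: powr_mult powr_powr mult.commute[of 2] flip: powr_numeral)
 also have "... <= s powr (2 * real sg) * (b * m) powr p"
  using am p by (intro mult_left_mono powr_mono2) auto
 also have "... = b powr p * (s powr (2 * real sg) * m powr (p - 1)) * m"
  using pos by (cases "m = 0") (simp_all add: powr_mult powr_diff)
 also have "... <= b powr p * 1 * m"
 proof (intro mult_left_mono mult_right_mono)
  have "m powr (p - 1) <= (s powr (- dim)) powr (p - 1)" using ms pos p by (intro powr_mono2) auto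
  hence "s powr (2 * real sg) * m powr (p - 1) <= s powr (2 * real sg) * s powr (- dim * (p - 1))"
   by (intro mult_left_mono) (simp_all add: powr_powr)
  also have "... <= 1" using s subcritical powr_mono'[of 0 "2 * real sg - dim * (p - 1)" s] by (simp flip: powr_add)
  finally show "s powr (2 * real sg) * m powr (p - 1) <= 1" .
 qed (use pos in auto)
 finally show ?thesis by (simp add: a_def b_def m_def)
qed

lemma ball_avg_Lp:
 fixes G :: "'a::euclidean_space => real"
 assumes G: "bounded_borel G C" and dim: "dim = real DIM('a)" and I: "(\<integral>\<^sup>+x. ennreal ((G x)^2) \<partial>lborel) <= 1"
 shows "(\<integral>\<^sup>+x. ennreal (ball_avg G 1 x powr (2 * p)) \<partial>lborel) <= ennreal (measure ball_measure (UNIV :: 'a set) powr (p + 1))"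
proof -
 interpret bounded_borel G C by (rule G)
 interpret sq: bounded_borel "%x. (G x)^2" "C^2" by (rule square)
 define b where "b = measure ball_measure (UNIV :: 'a set)"
 have "(\<integral>\<^sup>+x. ennreal (ball_avg G 1 x powr (2 * p)) \<partial>lborel) <= (\<integral>\<^sup>+x. ennreal (b powr p) * ennreal (ball_avg (%x. (G x)^2) 1 x) \<partial>lborel)"
  using ball_avg_powr[OF G dim _ _ I, of 1]
  by (intro nn_integral_mono) (simp add: b_def sq.ball_avg_nonneg flip: ennreal_mult)
 also have "... = ennreal (b powr p) * (ennreal b * (\<integral>\<^sup>+x. ennreal ((G x)^2) \<partial>lborel))"
  unfolding b_def by (rule sq.nn_integral_ball_avg_cmult)
 also have "... <= ennreal (b powr p) * (ennreal b * 1)" using I by (intro mult_left_mono) auto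
 finally show ?thesis by (simp add: powr_add b_def flip: ennreal_mult)
qed

text \<open>Jensen's inequality with respect to the finite measure \<open>radial dl\<close> brings
  the power inside; Tonelli reduces the rest to \<open>ball_avg_powr\<close> at each radius.\<close>

lemma radial_avg_Lp:
 fixes G :: "'a::euclidean_space => real"
 assumes G: "bounded_borel G C" and dim: "dim = real DIM('a)" and I: "(\<integral>\<^sup>+x. ennreal ((G x)^2) \<partial>lborel) <= 1"
 shows "(\<integral>\<^sup>+x. ennreal (radial_avg G x powr (2 * p)) \<partial>lborel)
  <= ennreal (measure (radial dl) UNIV powr (2 * p) * measure ball_measure (UNIV :: 'a set) powr (p + 1))"
proof -
 interpret bounded_borel G C by (rule G)
 interpret sq: bounded_borel "%x. (G x)^2" "C^2" by (rule square)
 interpret r: finite_measure "radial dl" by (rule finite_radial[OF dl])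
 interpret pair_sigma_finite "lborel :: 'a measure" "radial dl" ..
 define b A where "b = measure ball_measure (UNIV :: 'a set)" and "A = measure (radial dl) UNIV"
 define F where "F x s = indicator {0..1} s * s powr (real sg / p) * ball_avg G s x" for x s
 have [measurable]: "(%(x, s). F x s) \<in> borel_measurable (borel \<Otimes>\<^sub>M borel)" unfolding F_def by simp
 have F: "0 <= F x s" "F x s <= C * b" for x s
 proof -
  have "indicator {0..1} s * s powr (real sg / p) <= 1" using powr_le1[of "real sg / p" s] p by (auto simp: indicator_def)
  hence "F x s <= 1 * (C * b)"
   unfolding F_def by (intro mult_mono) (auto simp: b_def ball_avg_nonneg intro: ball_avg_le)
  thus "F x s <= C * b" by simp
 qed (simp add: F_def ball_avg_nonneg)
 have Fp: "F x s powr (2 * p) <= b powr p * ball_avg (%x. (G x)^2) s x" for x s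
 proof (cases "0 < s \<and> s <= 1")
  case True
  thus ?thesis using ball_avg_powr[OF G dim _ _ I, of s x] by (simp add: F_def b_def)
 next
  case False
  thus ?thesis using sq.ball_avg_nonneg by (cases "s = 0") (auto simp: F_def)
 qed
 have iF: "integrable (radial dl) (%s. F x s powr (2 * p))" for x
  by (rule r.integrable_const_bound[of _ "(C * b) powr (2 * p)"]) (use F p in "auto intro!: powr_mono2")
 have "ennreal (radial_avg G x powr (2 * p)) <= ennreal (A powr (2 * p - 1)) * (\<integral>\<^sup>+s. ennreal (F x s powr (2 * p)) \<partial>radial dl)" for x
 proof -
  have "radial_avg G x powr (2 * p) <= A powr (2 * p - 1) * (LINT s|radial dl. F x s powr (2 * p))"
   using r.Jensen_powr[of "F x" "C * b" "2 * p"] F p by (simp add: radial_avg_def F_def A_def)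
  moreover have "ennreal (LINT s|radial dl. F x s powr (2 * p)) = (\<integral>\<^sup>+s. ennreal (F x s powr (2 * p)) \<partial>radial dl)"
   by (rule nn_integral_eq_integral[symmetric, OF iF]) simp
  ultimately show ?thesis
   by (metis ennreal_leI ennreal_mult' powr_ge_zero)
 qed
 hence "(\<integral>\<^sup>+x. ennreal (radial_avg G x powr (2 * p)) \<partial>lborel)
   <= (\<integral>\<^sup>+x. ennreal (A powr (2 * p - 1)) * (\<integral>\<^sup>+s. ennreal (F x s powr (2 * p)) \<partial>radial dl) \<partial>lborel)"
  by (rule nn_integral_mono)
 also have "... = ennreal (A powr (2 * p - 1)) * (\<integral>\<^sup>+x. \<integral>\<^sup>+s. ennreal (F x s powr (2 * p)) \<partial>radial dl \<partial>lborel)"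
  by (rule nn_integral_cmult) measurable
 also have "(\<integral>\<^sup>+x. \<integral>\<^sup>+s. ennreal (F x s powr (2 * p)) \<partial>radial dl \<partial>lborel) = (\<integral>\<^sup>+s. \<integral>\<^sup>+x. ennreal (F x s powr (2 * p)) \<partial>lborel \<partial>radial dl)"
  by (rule Fubini'[symmetric]) measurable
 also have "... <= (\<integral>\<^sup>+s. ennreal (b powr (p + 1)) \<partial>radial dl)"
 proof (rule nn_integral_mono)
  fix s
  have "(\<integral>\<^sup>+x. ennreal (F x s powr (2 * p)) \<partial>lborel) <= (\<integral>\<^sup>+x. ennreal (b powr p) * ennreal (ball_avg (%x. (G x)^2) s x) \<partial>lborel)"
   using Fp by (intro nn_integral_mono) (simp add: sq.ball_avg_nonneg flip: ennreal_mult)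
  also have "... = ennreal (b powr p) * (ennreal b * (\<integral>\<^sup>+x. ennreal ((G x)^2) \<partial>lborel))"
   unfolding b_def by (rule sq.nn_integral_ball_avg_cmult)
  also have "... <= ennreal (b powr p) * (ennreal b * 1)" using I by (intro mult_left_mono) auto
  also have "... = ennreal (b powr (p + 1))" by (simp add: powr_add b_def flip: ennreal_mult)
  finally show "(\<integral>\<^sup>+x. ennreal (F x s powr (2 * p)) \<partial>lborel) <= ennreal (b powr (p + 1))" .
 qed
 also have "... = ennreal (b powr (p + 1) * A)" by (simp add: r.emeasure_eq_measure A_def ennreal_mult)
 also have "ennreal (A powr (2 * p - 1)) * ennreal (b powr (p + 1) * A) = ennreal (A powr (2 * p) * b powr (p + 1))"
  by (cases "A = 0") (simp_all add: A_def powr_diff flip: ennreal_mult)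
 finally show ?thesis by (simp add: A_def b_def mult_left_mono)
qed

end

lemma sum_powr_le:
 fixes X :: "'i => real"
 assumes I: "finite I" and X: "!!i. i \<in> I ==> 0 <= X i" and q: "q > 0"
 shows "(\<Sum>i\<in>I. X i) powr q <= real (card I) powr q * (\<Sum>i\<in>I. X i powr q)"
proof (cases "I = {}")
 case False
 define M where "M = Max (X ` I)"
 have M: "!!i. i \<in> I ==> X i <= M" using I by (simp add: M_def)
 have "M \<in> X ` I" unfolding M_def using I False by simp
 then obtain k where k: "k \<in> I" "M = X k" by blast
 have "(\<Sum>i\<in>I. X i) powr q <= (real (card I) * M) powr q" using sum_bounded_above[of I X M] M X q by (intro powr_mono2 sum_nonneg) auto
 also have "... = real (card I) powr q * M powr q" by (simp add: powr_mult)
 also have "M powr q <= (\<Sum>i\<in>I. X i powr q)" unfolding k(2) by (rule member_le_sum) (use k I in auto)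
 finally show ?thesis by (simp add: mult_left_mono)
qed simp

lemma sum_words_atMost:
 "(\<Sum>bs\<in>{bs \<in> lists Basis. length bs <= k}. f bs) = (\<Sum>j\<le>k. \<Sum>bs\<in>words j. f bs)"
proof -
 have e: "{bs \<in> lists Basis. length bs <= k} = (\<Union>j\<in>{..k}. words j)" by (auto simp: words_def)
 have "words i \<inter> words j = {}" if "i ~= j" for i j using that by (auto simp: words_def)
 thus ?thesis unfolding e by (intro sum.UNION_disjoint) auto
qed

lemma finite_words_atMost: "finite {bs \<in> lists (Basis :: 'a::euclidean_space set). length bs <= k}"
proof -
 have "{bs \<in> lists (Basis :: 'a set). length bs <= k} = (\<Union>j\<in>{..k}. words j)" by (auto simp: words_def)
 thus ?thesis by simp
qed

lemma measure_unit_ball_pos: "measure ball_measure (UNIV :: 'a::euclidean_space set) > 0"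
proof -
 have "emeasure ball_measure (UNIV :: 'a set) = (\<integral>\<^sup>+y. indicator (cball (0::'a) 1) y \<partial>lborel)"
  by (auto simp: ball_measure_def emeasure_density intro!: nn_integral_cong simp: indicator_def)
 thus ?thesis using content_cball_pos[of 1 "0::'a"] by (simp add: measure_def)
qed

lemma test_bounded_borel:
 assumes "test g" obtains C where "bounded_borel (%x. \<bar>g x\<bar>) C"
proof -
 obtain C where "!!x. \<bar>g x\<bar> <= C" using test_bounded[OF assms] by blast
 hence "bounded_borel (%x. \<bar>g x\<bar>) C" by unfold_locales (use test_measurable[OF assms] in auto)
 thus thesis by (rule that)
qed

context Sobolev_exponents
begin

text \<open>The Taylor inequality is averaged over \<open>y\<close> in the unit ball. In the
  remainder the integrals over \<open>y\<close> and \<open>s\<close> are exchanged, and the weight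
  is distributed between \<open>radial dl\<close> and the factor
  \<open>s powr (sg / p)\<close>.\<close>

lemma test_average_bound:
 fixes g :: "'a::euclidean_space => real"
 assumes g: "test g"
 shows "measure ball_measure (UNIV :: 'a set) * \<bar>g x\<bar> <= (\<Sum>j<sg. \<Sum>bs\<in>words j. ball_avg (%x. \<bar>ip bs g x\<bar>) 1 x)
  + (\<Sum>bs\<in>words sg. radial_avg (%x. \<bar>ip bs g x\<bar>) x)"
proof -
 interpret r: finite_measure "radial dl" by (rule finite_radial[OF dl])
 interpret P: pair_sigma_finite "ball_measure :: 'a measure" "radial dl" ..
 interpret Pf: finite_measure "(ball_measure :: 'a measure) \<Otimes>\<^sub>M radial dl"
  by (intro finite_measure_pair_measure) unfold_locales
 define G where "G bs x = \<bar>ip bs g x\<bar>" for bs x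
 define F where "F s = indicator {0..1} s * s powr (real sg / p)" for s
 define R where "R bs y = I0 1 (%s. s ^ (sg - 1) * G bs (x + s *R y))" for bs y
 have F: "0 <= F s" "F s <= 1" for s using powr_le1[of "real sg / p" s] p by (auto simp: F_def indicator_def)
 have [measurable]: "F \<in> borel_measurable borel" unfolding F_def by simp
 have R: "(LINT y|ball_measure. R bs y) = radial_avg (G bs) x" "integrable ball_measure (R bs)"
  if bs: "bs \<in> lists Basis" for bs
 proof -
  obtain C where "bounded_borel (G bs) C" using test_bounded_borel[OF test_iter[OF g bs]] unfolding G_def by blast
  then interpret bounded_borel "G bs" C .
  have Rr: "R bs y = (LINT s|radial dl. F s * G bs (x + s *R y))" for y
  proof -
   note t = test_iter[OF g bs]
   have "C0 1 (%s. s ^ (sg - 1) * G bs (x + s *R y))"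
    unfolding G_def by (intro continuous_intros continuous_on_compose2[OF smooth_continuous[OF test_smooth[OF t], of UNIV]]) simp
   hence "set_integrable lborel {0..1} (%s. s ^ (sg - 1) * G bs (x + s *R y))" by (rule borel_integrable_atLeastAtMost')
   hence "R bs y = (LINT s|lborel. indicator {0..1} s * (s ^ (sg - 1) * G bs (x + s *R y)))"
    unfolding R_def by (simp add: set_borel_integral_eq_integral(2)[symmetric] set_lebesgue_integral_def)
   \<comment> \<open>The split of the weight may fail at \<open>s = 0\<close>, hence equality almost
     everywhere.\<close>
   also have "... = (LINT s|lborel. (indicator {0..1} s * s powr (dl - 1)) * (F s * G bs (x + s *R y)))"
   proof (rule integral_cong_AE)
    show "AE s in lborel. indicator {0..1} s * (s ^ (sg - 1) * G bs (x + s *R y)) = (indicator {0..1} s * s powr (dl - 1)) * (F s * G bs (x + s *R y))"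
     using AE_lborel_singleton[of "0::real"]
    proof eventually_elim
     case (elim s)
     show ?case
     proof (cases "s \<in> {0..1}")
      case True
      hence s: "s > 0" using elim by auto
      have "s ^ (sg - 1) = s powr (dl - 1 + real sg / p)"
       using s sg by (simp add: dl_def powr_realpow[symmetric])
      also have "... = s powr (dl - 1) * s powr (real sg / p)" by (rule powr_add)
      finally show ?thesis using True by (simp add: F_def)
     qed simp
    qed
   qed measurable
   also have "... = (LINT s|radial dl. F s * G bs (x + s *R y))"
    unfolding radial_def by (rule integral_real_density[symmetric]) auto
   finally show ?thesis .
  qed
  have fm: "(%(y, s). F s * G bs (x + s *R y)) \<in> borel_measurable (ball_measure \<Otimes>\<^sub>M radial dl)" by simp
  have fi: "integrable (ball_measure \<Otimes>\<^sub>M radial dl) (%(y, s). F s * G bs (x + s *R y))"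
   by (rule Pf.integrable_const_bound[OF _ fm, of C]) (use F G_range in "auto simp: mult_left_le_one_le abs_mult intro!: AE_I2 order_trans[OF mult_left_le_one_le]")
  have "(LINT y|ball_measure. R bs y) = (LINT s|radial dl. LINT y|ball_measure. F s * G bs (x + s *R y))"
   unfolding Rr by (rule P.Fubini_integral[OF fi, symmetric])
  also have "... = radial_avg (G bs) x" unfolding radial_avg_def ball_avg_def F_def by simp
  finally show "(LINT y|ball_measure. R bs y) = radial_avg (G bs) x" .
  show "integrable ball_measure (R bs)" unfolding Rr[abs_def] using P.integrable_fst'[OF fi] by simp
 qed
 have i1: "integrable ball_measure (%y. G bs (x + y))" if bs: "bs \<in> lists Basis" for bs
 proof -
  obtain C where "bounded_borel (G bs) C" using test_bounded_borel[OF test_iter[OF g bs]] unfolding G_def by blast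
  from bounded_borel.integrable_shift[OF this, of x 1] show ?thesis by simp
 qed
 have "measure ball_measure (UNIV :: 'a set) * \<bar>g x\<bar> = (LINT y::'a|ball_measure. \<bar>g x\<bar>)" by simp
 also have "... <= (LINT y|ball_measure. (\<Sum>j<sg. \<Sum>bs\<in>words j. G bs (x + y)) + (\<Sum>bs\<in>words sg. R bs y))"
 proof (rule integral_mono_AE)
  show "integrable ball_measure (%y. (\<Sum>j<sg. \<Sum>bs\<in>words j. G bs (x + y)) + (\<Sum>bs\<in>words sg. R bs y))"
   by (intro Bochner_Integration.integrable_add Bochner_Integration.integrable_sum i1 R(2) wordsD)
  have "AE y in (ball_measure :: 'a measure). norm y <= 1"
   unfolding ball_measure_def by (subst AE_density) (auto simp: indicator_def)
  thus "AE y in ball_measure. \<bar>g x\<bar> <= (\<Sum>j<sg. \<Sum>bs\<in>words j. G bs (x + y)) + (\<Sum>bs\<in>words sg. R bs y)"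
   by eventually_elim (unfold G_def R_def, rule Taylor_test[OF g sg])
 qed simp
 also have "... = (\<Sum>j<sg. \<Sum>bs\<in>words j. ball_avg (G bs) 1 x) + (\<Sum>bs\<in>words sg. radial_avg (G bs) x)"
  by (simp add: i1 R wordsD(1) ball_avg_def)
 finally show ?thesis by (simp add: G_def[abs_def])
qed

text \<open>All derivatives are normalised to \<open>L2\<close> norm at most 1, as
  \<open>ball_avg_powr\<close> is not homogeneous in \<open>G\<close>; the general case follows by
  scaling.\<close>

lemma Sobolev_test:
 assumes dim: "dim = real DIM('a)"
 obtains C where "C >= 0" "!!g :: 'a::euclidean_space => real. test g ==>
  (!!bs. bs \<in> lists Basis ==> length bs <= sg ==> (norm (cls (ip bs g)))\<^sup>2 <= 1) ==>
  NL (%x. \<bar>g x\<bar> powr (2 * p)) <= ennreal C"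
proof -
 define W where "W = {bs \<in> lists (Basis :: 'a set). length bs <= sg}"
 define b A where "b = measure ball_measure (UNIV :: 'a set)" and "A = measure (radial dl) UNIV"
 define K where "K = b powr (p + 1) + A powr (2 * p) * b powr (p + 1)"
 define D where "D = b powr (- (2 * p)) * real (card W) powr (2 * p)"
 have b: "b > 0" unfolding b_def by (rule measure_unit_ball_pos)
 have W: "finite W" unfolding W_def by (rule finite_words_atMost)
 have "NL (%x. \<bar>g x\<bar> powr (2 * p)) <= ennreal (D * (real (card W) * K))"
  if g: "test g" and n: "!!bs. bs \<in> lists Basis ==> length bs <= sg ==> (norm (cls (ip bs g)))\<^sup>2 <= 1"
  for g :: "'a => real"
 proof -
  interpret r: finite_measure "radial dl" by (rule finite_radial[OF dl])
  define G where "G bs x = \<bar>ip bs g x\<bar>" for bs x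
  define X where "X bs x = (if length bs < sg then ball_avg (G bs) 1 x else radial_avg (G bs) x)" for bs x
  have X: "0 <= X bs x" "X bs \<in> borel_measurable borel" "(\<integral>\<^sup>+x. ennreal (X bs x powr (2 * p)) \<partial>lborel) <= ennreal K" if bs: "bs \<in> W" for bs x
  proof -
   have bs': "bs \<in> lists Basis" "length bs <= sg" using bs by (auto simp: W_def)
   note t = test_iter[OF g bs'(1)]
   obtain C where C: "bounded_borel (G bs) C" using test_bounded_borel[OF t] unfolding G_def by blast
   interpret bounded_borel "G bs" C by (rule C)
   have I: "(\<integral>\<^sup>+x. ennreal ((G bs x)^2) \<partial>lborel) <= 1"
    using nn_integral_cls[OF test_L2[OF t]] n[OF bs'] by (simp add: G_def nn_integral_completion)
   show "0 <= X bs x"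
    by (auto simp: X_def radial_avg_def ball_avg_nonneg)
   have "(%x. ball_avg (G bs) 1 x) \<in> borel_measurable borel" "radial_avg (G bs) \<in> borel_measurable borel"
    unfolding radial_avg_def[abs_def] by auto
   thus "X bs \<in> borel_measurable borel" by (cases "length bs < sg") (simp_all add: X_def[abs_def])
   show "(\<integral>\<^sup>+x. ennreal (X bs x powr (2 * p)) \<partial>lborel) <= ennreal K"
    using ball_avg_Lp[OF C dim I] radial_avg_Lp[OF C dim I]
    by (cases "length bs < sg") (auto simp: X_def K_def b_def A_def elim!: order_trans)
  qed
  have "\<bar>g x\<bar> powr (2 * p) <= D * (\<Sum>bs\<in>W. X bs x powr (2 * p))" for x
  proof -
   have "(\<Sum>bs\<in>W. X bs x) = (\<Sum>j<sg. \<Sum>bs\<in>words j. ball_avg (G bs) 1 x) + (\<Sum>bs\<in>words sg. radial_avg (G bs) x)"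
    unfolding W_def sum_words_atMost lessThan_Suc_atMost[symmetric] sum.lessThan_Suc
    by (intro arg_cong2[where f = "(+)"]) (auto simp: X_def words_def)
   hence "b * \<bar>g x\<bar> <= (\<Sum>bs\<in>W. X bs x)" using test_average_bound[OF g, of x] by (simp add: b_def G_def[abs_def])
   hence "(b * \<bar>g x\<bar>) powr (2 * p) <= (\<Sum>bs\<in>W. X bs x) powr (2 * p)" using b p by (intro powr_mono2) auto
   also have "... <= real (card W) powr (2 * p) * (\<Sum>bs\<in>W. X bs x powr (2 * p))" using X(1) W p by (intro sum_powr_le) auto
   finally have "b powr (- (2 * p)) * (b powr (2 * p) * \<bar>g x\<bar> powr (2 * p)) <= b powr (- (2 * p)) * (real (card W) powr (2 * p) * (\<Sum>bs\<in>W. X bs x powr (2 * p)))"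
    by (intro mult_left_mono) (auto simp: powr_mult)
   thus ?thesis using b by (simp add: D_def powr_minus mult.assoc[symmetric])
  qed
  hence "(\<integral>\<^sup>+x. ennreal (\<bar>g x\<bar> powr (2 * p)) \<partial>lborel) <= (\<integral>\<^sup>+x. ennreal D * (\<Sum>bs\<in>W. ennreal (X bs x powr (2 * p))) \<partial>lborel)"
   by (intro nn_integral_mono) (simp add: D_def sum_nonneg flip: ennreal_mult)
  also have "... = ennreal D * (\<Sum>bs\<in>W. \<integral>\<^sup>+x. ennreal (X bs x powr (2 * p)) \<partial>lborel)"
   using X(2) by (subst nn_integral_cmult) (auto intro!: arg_cong2[where f = "(*)"] nn_integral_sum simp del: sum_ennreal)
  also have "... <= ennreal D * (\<Sum>bs\<in>W. ennreal K)" by (intro mult_left_mono sum_mono X(3)) auto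
  finally show ?thesis by (simp add: ennreal_mult D_def K_def ennreal_of_nat_eq_real_of_nat nn_integral_completion)
 qed
 moreover have "D * (real (card W) * K) >= 0" by (simp add: D_def K_def)
 ultimately show thesis using that by blast
qed

text \<open>Scaling by \<open>1 / M\<close> produces the normalisation, and Fatou's lemma along an
  almost everywhere convergent subsequence passes from test functions to \<open>f\<close>. The
  strict bound by \<open>M^2\<close> is inherited by the approximating functions from some index
  on.\<close>

lemma Sobolev_inequality:
 assumes dim: "dim = real DIM('a)"
 obtains C where "C >= 0" "!!(f :: 'a::euclidean_space => real) M. f \<in> L2 ==> cls f \<in> Hs sg ==> M > 0 ==>
  cls f \<bullet> cls f + hform sg (cls f) (cls f) < M^2 ==> NL (%x. \<bar>f x\<bar> powr (2 * p)) <= ennreal (C * M powr (2 * p))"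
proof -
 obtain C where C: "C >= 0" "!!g :: 'a => real. test g ==>
  (!!bs. bs \<in> lists Basis ==> length bs <= sg ==> (norm (cls (ip bs g)))\<^sup>2 <= 1) ==>
  NL (%x. \<bar>g x\<bar> powr (2 * p)) <= ennreal C" using Sobolev_test[OF dim] by blast
 have "NL (%x. \<bar>f x\<bar> powr (2 * p)) <= ennreal (C * M powr (2 * p))"
  if f: "f \<in> L2" "cls f \<in> Hs sg" and M: "M > 0" and N: "cls f \<bullet> cls f + hform sg (cls f) (cls f) < M^2" for f :: "'a => real" and M
 proof -
  obtain g where g: "!!n. test (g n)" "(%n. cls (g n)) ----> cls f"
   "!!bs. bs \<in> lists Basis ==> length bs <= sg ==> (%n. wderiv bs (cls (g n))) ----> wderiv bs (cls f)"
   by (rule Hs_test_sequence[OF f(2)]) blast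
  have "(%n. cls (g n) \<bullet> cls (g n) + hform sg (cls (g n)) (cls (g n))) ----> cls f \<bullet> cls f + hform sg (cls f) (cls f)"
   unfolding hform_def by (intro tendsto_sum tendsto_inner tendsto_add g(2,3)) (auto simp: words_def)
  hence "\<forall>\<^sub>F n in sequentially. cls (g n) \<bullet> cls (g n) + hform sg (cls (g n)) (cls (g n)) < M^2" using N by (rule order_tendstoD)
  then obtain n0 where n0: "!!n. n >= n0 ==> cls (g n) \<bullet> cls (g n) + hform sg (cls (g n)) (cls (g n)) < M^2"
   unfolding eventually_sequentially by blast
  obtain r where r: "strict_mono r" "AE x in lebesgue. (%n. g (r n) x) ----> f x"
   using L2_AE_subseq[OF test_L2[OF g(1)] f(1) g(2)] by blast
  have b: "NL (%x. \<bar>g n x\<bar> powr (2 * p)) <= ennreal (C * M powr (2 * p))" if n: "n >= n0" for n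
  proof -
   have "(norm (cls (ip bs (%x. inverse M * g n x))))^2 <= 1" if bs: "bs \<in> lists Basis" "length bs <= sg" for bs
   proof -
    have "cls (ip bs (%x. inverse M * g n x)) = inverse M *R wderiv bs (cls (g n))"
     unfolding ip_cmult[OF test_smooth[OF g(1)] bs(1)] wderiv_test[OF g(1) bs(1)]
     by (rule cls_cmult[OF test_L2[OF test_iter[OF g(1) bs(1)]]])
    hence "(norm (cls (ip bs (%x. inverse M * g n x))))^2 = (norm (wderiv bs (cls (g n))))^2 / M^2"
     by (simp add: power_mult_distrib power_inverse divide_inverse)
    moreover have "(norm (wderiv bs (cls (g n))))^2 <= M^2"
     using wderiv_norm_le[OF test_Hs[OF g(1)] bs, of n] n0[OF n] by linarith
    ultimately show ?thesis using M by simp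
   qed
   hence "NL (%x. \<bar>inverse M * g n x\<bar> powr (2 * p)) <= ennreal C" by (intro C(2) test_cmult g(1))
   hence "ennreal (M powr (2 * p)) * NL (%x. \<bar>inverse M * g n x\<bar> powr (2 * p)) <= ennreal (M powr (2 * p)) * ennreal C"
    by (rule mult_left_mono) simp
   moreover have "ennreal (M powr (2 * p)) * NL (%x. \<bar>inverse M * g n x\<bar> powr (2 * p)) = NL (%x. \<bar>g n x\<bar> powr (2 * p))"
   proof -
    have [measurable]: "lmeas (g n)" by (rule L2D(1)[OF test_L2[OF g(1)]])
    have "M powr (2 * p) * \<bar>inverse M * g n x\<bar> powr (2 * p) = \<bar>g n x\<bar> powr (2 * p)" for x
     using M by (simp add: abs_mult flip: powr_mult mult.assoc)
    thus ?thesis by (subst nn_integral_cmult[symmetric]) (simp_all flip: ennreal_mult)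
   qed
   ultimately show ?thesis using C(1) by (simp add: mult.commute flip: ennreal_mult)
  qed
  have "NL (%x. \<bar>f x\<bar> powr (2 * p)) = (\<integral>\<^sup>+x. liminf (%n. ennreal (\<bar>g (r (n + n0)) x\<bar> powr (2 * p))) \<partial>lebesgue)"
  proof (rule nn_integral_cong_AE)
   show "AE x in lebesgue. ennreal (\<bar>f x\<bar> powr (2 * p)) = liminf (%n. ennreal (\<bar>g (r (n + n0)) x\<bar> powr (2 * p)))"
    using r(2)
   proof eventually_elim
    case (elim x)
    have "(%n. ennreal (\<bar>g (r n) x\<bar> powr (2 * p))) ----> ennreal (\<bar>f x\<bar> powr (2 * p))"
     using p by (intro tendsto_ennrealI tendsto_powr' tendsto_rabs elim tendsto_const) auto
    from lim_imp_Liminf[OF sequentially_bot LIMSEQ_ignore_initial_segment[OF this, of n0]] show ?case by simp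
   qed
  qed
  also have "... <= liminf (%n. \<integral>\<^sup>+x. ennreal (\<bar>g (r (n + n0)) x\<bar> powr (2 * p)) \<partial>lebesgue)"
  proof (rule nn_integral_liminf)
   fix n
   have [measurable]: "lmeas (g (r (n + n0)))" by (rule L2D(1)[OF test_L2[OF g(1)]])
   show "lmeas (%x. ennreal (\<bar>g (r (n + n0)) x\<bar> powr (2 * p)))" by simp
  qed
  also have "... <= limsup (%n. \<integral>\<^sup>+x. ennreal (\<bar>g (r (n + n0)) x\<bar> powr (2 * p)) \<partial>lebesgue)" by (rule Liminf_le_Limsup) simp
  also have "... <= ennreal (C * M powr (2 * p))"
   by (intro Limsup_bounded always_eventually allI b) (meson le_add2 order_trans seq_suble[OF r(1)])
  finally show ?thesis .
 qed
 thus thesis using C(1) that by blast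
qed

end

section \<open>The power nonlinearity on the Sobolev space\<close>

definition rep :: "'a::euclidean_space ell2 => 'a => real" where
 "rep v = (SOME f. f \<in> L2 \<and> v = cls f)"

lemma rep: "rep v \<in> L2" "cls (rep v) = v"
proof -
 have "EX f. f \<in> L2 \<and> v = cls f" using cls_surj by metis
 from someI_ex[OF this] show "rep v \<in> L2" "cls (rep v) = v" unfolding rep_def by auto
qed

text \<open>The power acts on a chosen representative; on \<open>Hs sg\<close> the lemma
  \<open>nonlin_cls\<close> shows that every representative gives the same class.\<close>

definition nonlin :: "real => 'a::euclidean_space ell2 => 'a ell2" where
 "nonlin p v = cls (%x. \<bar>rep v x\<bar> powr p)"

text \<open>The tangent inequality at the larger of the two absolute values.\<close>

lemma abs_powr_diff_le:
 fixes a b p :: real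
 assumes p: "p > 1"
 shows "\<bar>\<bar>a\<bar> powr p - \<bar>b\<bar> powr p\<bar> <= p * (\<bar>a\<bar> + \<bar>b\<bar>) powr (p - 1) * \<bar>a - b\<bar>"
proof -
 have le: "t powr p - s powr p <= p * (t + s) powr (p - 1) * (t - s)" if "0 <= s" "s <= t" for s t
 proof -
  have "t powr p = t powr (p - 1) * t" using that by (cases "t = 0") (auto simp: powr_diff)
  hence "t powr p - s powr p <= p * t powr (p - 1) * (t - s)"
   using powr_tangent[OF p, of s t] that by (simp add: algebra_simps)
  also have "... <= p * (t + s) powr (p - 1) * (t - s)"
   using that p by (intro mult_right_mono mult_left_mono powr_mono2) auto
  finally show ?thesis .
 qed
 have "\<bar>\<bar>a\<bar> powr p - \<bar>b\<bar> powr p\<bar> <= p * (\<bar>a\<bar> + \<bar>b\<bar>) powr (p - 1) * \<bar>\<bar>a\<bar> - \<bar>b\<bar>\<bar>"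
 proof (cases "\<bar>b\<bar> <= \<bar>a\<bar>")
  case True
  thus ?thesis using le[of "\<bar>b\<bar>" "\<bar>a\<bar>"] p by (simp add: powr_mono2)
 next
  case False
  thus ?thesis using le[of "\<bar>a\<bar>" "\<bar>b\<bar>"] p by (simp add: powr_mono2 add.commute)
 qed
 also have "... <= p * (\<bar>a\<bar> + \<bar>b\<bar>) powr (p - 1) * \<bar>a - b\<bar>" using p by (intro mult_left_mono) auto
 finally show ?thesis .
qed

lemma powr_mult_le_sum:
 fixes X Y p :: real
 assumes "p > 1" "X >= 0" "Y >= 0"
 shows "X powr (p - 1) * Y <= X powr p + Y powr p"
proof -
 have M: "m powr p = m powr (p - 1) * m" if "m >= 0" for m using that by (cases "m = 0") (auto simp: powr_diff)
 show ?thesis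
 proof (cases "X <= Y")
  case True
  hence "X powr (p - 1) * Y <= Y powr (p - 1) * Y" using assms by (intro mult_right_mono powr_mono2) auto
  thus ?thesis using M[OF assms(3)] by (simp add: add_increasing)
 next
  case False
  hence "X powr (p - 1) * Y <= X powr (p - 1) * X" by (intro mult_left_mono) auto
  thus ?thesis using M[OF assms(2)] by (simp add: add_increasing2)
 qed
qed

context Sobolev_exponents
begin

lemma powr_square_eq: "(\<bar>x\<bar> powr p)^2 = \<bar>x\<bar> powr (2 * p)" for x :: real
 by (simp add: power2_eq_square flip: powr_add)

lemma powr_L2:
 fixes f :: "'a::euclidean_space => real"
 assumes dim: "dim = real DIM('a)" and f: "f \<in> L2" "cls f \<in> Hs sg"
 shows "(%x. \<bar>f x\<bar> powr p) \<in> L2"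
proof -
 have [measurable]: "lmeas f" by (rule L2D(1)[OF f(1)])
 obtain C where C: "C >= 0" "!!(f :: 'a => real) M. f \<in> L2 ==> cls f \<in> Hs sg ==> M > 0 ==>
  cls f \<bullet> cls f + hform sg (cls f) (cls f) < M^2 ==> NL (%x. \<bar>f x\<bar> powr (2 * p)) <= ennreal (C * M powr (2 * p))"
  using Sobolev_inequality[OF dim] by blast
 define k where "k = cls f \<bullet> cls f + hform sg (cls f) (cls f) + 1"
 have "k > 0" using sob.nonneg[OF f(2)] by (simp add: k_def add_nonneg_pos)
 hence "NL (%x. \<bar>f x\<bar> powr (2 * p)) <= ennreal (C * sqrt k powr (2 * p))"
  by (intro C(2) f) (auto simp: k_def)
 hence "integrable lebesgue (%x. \<bar>f x\<bar> powr (2 * p))"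
  by (intro integrableI_nonneg) (auto simp: less_top[symmetric] top_unique)
 thus ?thesis by (simp add: L2_def powr_square_eq)
qed

lemma nonlin_cls:
 fixes f :: "'a::euclidean_space => real"
 assumes dim: "dim = real DIM('a)" and f: "f \<in> L2" "cls f \<in> Hs sg"
 shows "nonlin p (cls f) = cls (%x. \<bar>f x\<bar> powr p)"
proof -
 have "AE x in lebesgue. rep (cls f) x = f x" using rep[of "cls f"] f(1) by (simp add: cls_eq_iff[symmetric])
 moreover have "(%x. \<bar>rep (cls f) x\<bar> powr p) \<in> L2" using rep[of "cls f"] f by (intro powr_L2[OF dim]) auto
 ultimately show ?thesis unfolding nonlin_def by (subst cls_eq_iff) (auto intro: powr_L2[OF dim f])
qed

text \<open>Normalising the difference of the arguments turns the product in
 \<open>\<bar>\<bar>f\<bar>\<^sup>p - \<bar>g\<bar>\<^sup>p\<bar> <= p (\<bar>f\<bar> + \<bar>g\<bar>)\<^sup>p\<^sup>-\<^sup>1 \<bar>f - g\<bar>\<close> into a sum, so that no Hoelder inequality is needed.\<close>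

lemma nonlin_bound:
 assumes dim: "dim = real DIM('a)" and M: "M > 0"
 obtains K where "K > 0" "!!(v :: 'a::euclidean_space ell2) w l. v \<in> Hs sg ==> w \<in> Hs sg ==> l > 0 ==>
  v \<bullet> v + hform sg v v < M^2 ==> w \<bullet> w + hform sg w w < M^2 ==> (v - w) \<bullet> (v - w) + hform sg (v - w) (v - w) < l^2 ==>
  norm (nonlin p v - nonlin p w) <= K * l"
proof -
 obtain C where C: "C >= 0" "!!(f :: 'a => real) M. f \<in> L2 ==> cls f \<in> Hs sg ==> M > 0 ==>
  cls f \<bullet> cls f + hform sg (cls f) (cls f) < M^2 ==> NL (%x. \<bar>f x\<bar> powr (2 * p)) <= ennreal (C * M powr (2 * p))"
  using Sobolev_inequality[OF dim] by blast
 \<comment> \<open>\<open>p^2\<close> comes from the pointwise difference bound, the first 2 from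
   squaring a sum, and \<open>2 powr (2 * p)\<close> from the power of the two-term sum of
   \<open>\<bar>f x\<bar>\<close> and \<open>\<bar>g x\<bar>\<close>.\<close>
 define E where "E = 2 * p^2 * 2 powr (2 * p)"
 define K where "K = sqrt (E * (2 * (C * M powr (2 * p)) + C) + 1)"
 have E: "E >= 0" by (simp add: E_def)
 have K2: "0 <= E * (2 * (C * M powr (2 * p)) + C)" using E C(1) by simp
 have "norm (nonlin p v - nonlin p w) <= K * l"
  if v: "v \<in> Hs sg" "v \<bullet> v + hform sg v v < M^2" and w: "w \<in> Hs sg" "w \<bullet> w + hform sg w w < M^2"
   and l: "l > 0" "(v - w) \<bullet> (v - w) + hform sg (v - w) (v - w) < l^2" for v w :: "'a ell2" and l
 proof -
  define f g where "f = rep v" and "g = rep w"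
  have f: "f \<in> L2" "cls f = v" and g: "g \<in> L2" "cls g = w" by (simp_all add: f_def g_def rep)
  have [measurable]: "lmeas f" "lmeas g" using f g L2D by auto
  define d where "d x = f x - g x" for x
  have d: "d \<in> L2" "cls d = v - w" unfolding d_def using f g by (simp_all add: L2_diff cls_diff)
  have [measurable]: "lmeas d" by (rule L2D(1)[OF d(1)])
  define D where "D x = \<bar>f x\<bar> powr p - \<bar>g x\<bar> powr p" for x
  have DL: "D \<in> L2" "nonlin p v - nonlin p w = cls D"
   unfolding D_def using powr_L2[OF dim f(1)] powr_L2[OF dim g(1)] f g v w by (simp_all add: L2_diff cls_diff nonlin_def f_def g_def)
  have D: "(D x)^2 <= (E * l^2) * (\<bar>f x\<bar> powr (2 * p) + \<bar>g x\<bar> powr (2 * p)) + (E * l^2 * l powr (- (2 * p))) * \<bar>d x\<bar> powr (2 * p)" for x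
  proof -
   \<comment> \<open>After integration the factor \<open>l powr (- (2 * p))\<close> hidden in
     \<open>Y\<close> cancels against the Sobolev bound of \<open>d\<close>, and exactly
     \<open>l^2\<close> is left.\<close>
   define X Y where "X = \<bar>f x\<bar> + \<bar>g x\<bar>" and "Y = \<bar>d x\<bar> / l"
   have XY: "X >= 0" "Y >= 0" using l by (auto simp: X_def Y_def)
   have "\<bar>D x\<bar> <= p * X powr (p - 1) * \<bar>d x\<bar>" unfolding D_def X_def d_def using abs_powr_diff_le p by blast
   also have "... = (p * l) * (X powr (p - 1) * Y)" using l by (simp add: Y_def)
   also have "... <= (p * l) * (X powr p + Y powr p)" using p l XY by (intro mult_left_mono powr_mult_le_sum) auto
   finally have "(D x)^2 <= ((p * l) * (X powr p + Y powr p))^2" by (intro abs_le_square_iff[THEN iffD1]) auto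
   also have "... = (p * l)^2 * (X powr p + Y powr p)^2" by (rule power_mult_distrib)
   finally have D1: "(D x)^2 <= (p * l)^2 * (X powr p + Y powr p)^2" .
   have "(X powr p + Y powr p)^2 <= 2 * (2 powr (2 * p) * (\<bar>f x\<bar> powr (2 * p) + \<bar>g x\<bar> powr (2 * p)) + 2 powr (2 * p) * (l powr (- (2 * p)) * \<bar>d x\<bar> powr (2 * p)))"
   proof -
    have "(X powr p + Y powr p)^2 <= 2 * ((X powr p)^2 + (Y powr p)^2)"
     using zero_le_power2[of "X powr p - Y powr p"] by (simp add: power2_sum power2_diff)
    also have "... = 2 * (X powr (2 * p) + Y powr (2 * p))" using powr_square_eq[of X] powr_square_eq[of Y] XY by simp
    finally have 1: "(X powr p + Y powr p)^2 <= 2 * (X powr (2 * p) + Y powr (2 * p))" .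
    have 2: "X powr (2 * p) <= 2 powr (2 * p) * (\<bar>f x\<bar> powr (2 * p) + \<bar>g x\<bar> powr (2 * p))"
     using sum_powr_le[of "UNIV :: bool set" "%b. if b then \<bar>f x\<bar> else \<bar>g x\<bar>" "2 * p"] p by (simp add: UNIV_bool X_def add.commute)
    have "Y powr (2 * p) = 1 * (l powr (- (2 * p)) * \<bar>d x\<bar> powr (2 * p))"
     by (simp add: Y_def powr_divide powr_minus field_simps)
    also have "... <= 2 powr (2 * p) * (l powr (- (2 * p)) * \<bar>d x\<bar> powr (2 * p))"
     using p by (intro mult_right_mono ge_one_powr_ge_zero) auto
    finally have 3: "Y powr (2 * p) <= 2 powr (2 * p) * (l powr (- (2 * p)) * \<bar>d x\<bar> powr (2 * p))" .
    show ?thesis by (rule order_trans[OF 1 mult_left_mono[OF add_mono[OF 2 3]]]) simp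
   qed
   hence "(p * l)^2 * (X powr p + Y powr p)^2 <= (p * l)^2 * (2 * (2 powr (2 * p) * (\<bar>f x\<bar> powr (2 * p) + \<bar>g x\<bar> powr (2 * p)) + 2 powr (2 * p) * (l powr (- (2 * p)) * \<bar>d x\<bar> powr (2 * p))))"
    by (rule mult_left_mono) simp
   from order_trans[OF D1 this] show ?thesis by (simp add: E_def algebra_simps)
  qed
  have "ennreal ((norm (cls D))^2) = NL (%x. (D x)^2)" by (rule nn_integral_cls[OF DL(1), symmetric])
  also have "... <= (\<integral>\<^sup>+x. ennreal (E * l^2) * (ennreal (\<bar>f x\<bar> powr (2 * p)) + ennreal (\<bar>g x\<bar> powr (2 * p))) + ennreal (E * l^2 * l powr (- (2 * p))) * ennreal (\<bar>d x\<bar> powr (2 * p)) \<partial>lebesgue)"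
   using D E by (intro nn_integral_mono) (simp flip: ennreal_mult ennreal_plus)
  also have "... = ennreal (E * l^2) * (NL (%x. \<bar>f x\<bar> powr (2 * p)) + NL (%x. \<bar>g x\<bar> powr (2 * p)))
    + ennreal (E * l^2 * l powr (- (2 * p))) * NL (%x. \<bar>d x\<bar> powr (2 * p))"
   by (simp add: nn_integral_add nn_integral_cmult)
  also have "... <= ennreal (E * l^2) * (ennreal (C * M powr (2 * p)) + ennreal (C * M powr (2 * p))) + ennreal (E * l^2 * l powr (- (2 * p))) * ennreal (C * l powr (2 * p))"
   using f g d v w l M by (intro add_mono mult_left_mono C(2)) (auto intro: sob.V_diff)
  also have "... = ennreal (E * l^2 * (C * M powr (2 * p) + C * M powr (2 * p)) + (E * l^2 * l powr (- (2 * p))) * (C * l powr (2 * p)))"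
   using E C(1) by (simp flip: ennreal_mult ennreal_plus)
  also have "E * l^2 * (C * M powr (2 * p) + C * M powr (2 * p)) + (E * l^2 * l powr (- (2 * p))) * (C * l powr (2 * p))
    = (E * (2 * (C * M powr (2 * p)) + C)) * l^2"
   by (simp add: powr_minus field_simps)
  finally have "(norm (cls D))^2 <= (E * (2 * (C * M powr (2 * p)) + C)) * l^2"
   using K2 by simp
  also have "... <= K^2 * l^2" using K2 by (intro mult_right_mono) (auto simp: K_def)
  finally have "(norm (cls D))^2 <= (K * l)^2" by (simp add: power_mult_distrib)
  thus ?thesis unfolding DL(2) by (rule power2_le_imp_le) (use l K2 in "simp add: K_def")
 qed
 moreover have "K > 0" using K2 by (simp add: K_def)
 ultimately show thesis using that by blast
qed

text \<open>\<open>nonlin_bound\<close> asks for strict inequalities: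
  \<open>M' = \<bar>M\<bar> + 1\<close> provides them for \<open>v\<close> and \<open>w\<close>, and
  letting \<open>l\<close> decrease to the form norm of \<open>v - w\<close> covers also the case
  where it vanishes.\<close>

lemma semilinear_nonlin:
 assumes dim: "dim = real DIM('a::euclidean_space)"
 shows "semilinear_form (Hs sg) (hform sg) (nonlin p :: 'a ell2 => 'a ell2)"
proof
 fix M :: real
 define M' where "M' = \<bar>M\<bar> + 1"
 have "M' > 0" by (simp add: M'_def)
 then obtain K where K: "K > 0" "!!(v :: 'a ell2) w l. v \<in> Hs sg ==> w \<in> Hs sg ==> l > 0 ==>
  v \<bullet> v + hform sg v v < M'^2 ==> w \<bullet> w + hform sg w w < M'^2 ==> (v - w) \<bullet> (v - w) + hform sg (v - w) (v - w) < l^2 ==>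
  norm (nonlin p v - nonlin p w) <= K * l" using nonlin_bound[OF dim] by blast
 have sq: "v \<bullet> v + hform sg v v < l^2" if "v \<in> Hs sg" "sob.N sg v < l" for v and l
 proof -
  have "v \<bullet> v + hform sg v v = (sob.N sg v)^2" using sob.nonneg[OF that(1)] by (simp add: sob.N_def)
  also have "... < l^2" using that by (intro power_strict_mono) (auto)
  finally show ?thesis .
 qed
 have "norm (nonlin p v - nonlin p w) <= K * sob.N sg (v - w)"
  if v: "v \<in> Hs sg" "sob.N sg v <= M" and w: "w \<in> Hs sg" "sob.N sg w <= M" for v w :: "'a ell2"
 proof -
  have "norm (nonlin p v - nonlin p w) / K <= l" if l: "sob.N sg (v - w) < l" for l
  proof -
   have "l > 0" using l by (rule le_less_trans[rotated]) (simp add: sob.V_diff v w)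
   thus ?thesis
    using K(2)[OF v(1) w(1), of l] sq[of v M'] sq[of w M'] sq[OF _ l] v w K(1)
    by (simp add: M'_def sob.V_diff pos_divide_le_eq mult.commute)
  qed
  hence "norm (nonlin p v - nonlin p w) / K <= sob.N sg (v - w)" by (rule dense_ge)
  thus ?thesis using K(1) by (simp add: pos_divide_le_eq mult.commute)
 qed
 thus "EX K>=0. ALL v:(Hs sg :: 'a ell2 set). ALL w:Hs sg. sob.N sg v <= M --> sob.N sg w <= M -->
   norm (nonlin p v - nonlin p w) <= K * sob.N sg (v - w)"
  using K(1) by (intro exI[of _ K]) auto
qed

end

section \<open>Functions of time and space\<close>

text \<open>The negative Laplacian in space, expressed by partial derivatives on the product space;
  commuting it with \<open>partial_t\<close> is then an instance of
  \<open>pd_commute\<close>.\<close>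

definition lap_x :: "(real \<times> 'a::euclidean_space => real) => real \<times> 'a => real" where
 "lap_x f z = - (\<Sum>b\<in>Basis. pd (0, b) (pd (0, b) f) z)"

abbreviation partial_t :: "(real \<times> 'a::euclidean_space => real) => real \<times> 'a => real" where
 "partial_t \<equiv> pd (1, 0)"

lemma pd_slice: "pd b (%x. f (t, x)) = (%x. pd (0, b) f (t, x))"
 by (simp add: partial_deriv_def fun_eq_iff)

lemma neg_laplacian_slice: "neg_laplacian (%x. f (t, x)) = (%x. lap_x f (t, x))"
proof -
 have "pd b (pd b (%x. f (t, x))) x = pd (0, b) (pd (0, b) f) (t, x)" for b x
  unfolding pd_slice[of b f t] pd_slice[of b "pd (0, b) f" t] ..
 thus ?thesis by (simp add: neg_laplacian_def lap_x_def fun_eq_iff)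
qed

lemma lap_pow_slice: "neg_laplacian_pow k (%x. f (t, x)) = (%x. (lap_x ^^ k) f (t, x))"
proof (induction k)
 case (Suc k)
 show ?case unfolding lap_pow_Suc Suc.IH neg_laplacian_slice[of "(lap_x ^^ k) f"] by simp
qed simp

lemma time_deriv_slice: "time_deriv (%t x. f (t, x)) = (%t x. partial_t f (t, x))"
proof (intro ext)
 fix t and x :: 'a show "time_deriv (%t x. f (t, x)) t x = partial_t f (t, x)"
  using deriv_shift_0[of "%s. f (s, x)" t] unfolding time_deriv_def partial_deriv_def o_def by simp
qed

lemma Basis_pair: "b \<in> Basis ==> (0, b) \<in> Basis" "(1, 0) \<in> (Basis :: (real \<times> 'a::euclidean_space) set)"
 by (auto simp: Basis_prod_def)

lemma smooth_lap_x: "smooth f ==> smooth (lap_x f)"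
 unfolding lap_x_def[abs_def] by (intro smooth_minus smooth_sum smooth_partial Basis_pair)

lemma test_lap_x: "test f ==> test (lap_x f)"
 using test_cmult[OF test_sum[of Basis "%b. pd (0, b) (pd (0, b) f)"], of "-1"]
 by (simp add: lap_x_def[abs_def] test_partial Basis_pair)

lemma test_lap_x_pow: "test f ==> test ((lap_x ^^ k) f)"
 by (induction k) (simp_all add: test_lap_x)

lemma smooth_lap_x_pow: "smooth f ==> smooth ((lap_x ^^ k) f)"
 by (induction k) (simp_all add: smooth_lap_x)

lemma lap_x_cmult: assumes f: "smooth f" shows "lap_x (%z. c * f z) = (%z. c * lap_x f z)"
proof -
 have c: "pd (0, b) (%z. c * g z) = (%z. c * pd (0, b) g z)" if "smooth g" for g b
  using pd_cmult[OF smooth_diffable[OF that]] by blast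
 have "pd (0, b) (pd (0, b) (%z. c * f z)) = (%z. c * pd (0, b) (pd (0, b) f) z)"
  if "b \<in> Basis" for b unfolding c[OF f] c[OF smooth_partial[OF f Basis_pair(1)[OF that]]] ..
 thus ?thesis by (simp add: lap_x_def fun_eq_iff sum_distrib_left)
qed

lemma lap_x_pow_cmult: "smooth f ==> (lap_x ^^ k) (%z. c * f z) = (%z. c * (lap_x ^^ k) f z)"
 by (induction k) (simp_all add: lap_x_cmult smooth_lap_x_pow)

lemma partial_t_lap_x: assumes f: "smooth f" shows "partial_t (lap_x f) = lap_x (partial_t f)"
proof
 fix z
 note B = Basis_pair
 have s: "smooth (pd (0, b) (pd (0, b) f))" if "b \<in> Basis" for b by (intro smooth_partial f B that)
 have "partial_t (lap_x f) z = partial_t (%z. (- 1) * (\<Sum>b\<in>Basis. pd (0, b) (pd (0, b) f) z)) z"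
  by (simp add: lap_x_def[abs_def])
 also have "... = (- 1) * partial_t (%z. \<Sum>b\<in>Basis. pd (0, b) (pd (0, b) f) z) z"
  by (rule pd_cmult) (intro smooth_diffable smooth_sum s)
 also have "... = (- 1) * (\<Sum>b\<in>Basis. partial_t (pd (0, b) (pd (0, b) f)) z)"
  by (subst pd_sum) (auto intro: smooth_diffable s)
 also have "... = lap_x (partial_t f) z"
  unfolding lap_x_def by (simp add: pd_commute[of _ "(1, 0)"] smooth_partial f B)
 finally show "partial_t (lap_x f) z = lap_x (partial_t f) z" .
qed

lemma partial_t_lap_x_pow: "smooth f ==> partial_t ((lap_x ^^ k) f) = (lap_x ^^ k) (partial_t f)"
 by (induction k) (simp_all add: partial_t_lap_x smooth_lap_x_pow)

definition stretch :: "real => real => real \<times> 'a::euclidean_space => real \<times> 'a" where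
 "stretch c g z = (c * fst z, g *R snd z)"

lemma bounded_linear_stretch: "bounded_linear (stretch c g)"
 unfolding stretch_def[abs_def]
 by (intro bounded_linear_Pair bounded_linear_const_mult bounded_linear_scaleR_right[THEN bounded_linear_compose] bounded_linear_fst bounded_linear_snd)

lemma partial_stretch:
 fixes f :: "real \<times> 'a::euclidean_space => real"
 assumes "smooth f"
 shows "partial_t (%z. f (stretch d g z)) = (%z. d * partial_t f (stretch d g z))"
  and "pd (0, b) (%z. f (stretch d g z)) = (%z. g * pd (0, b) f (stretch d g z))"
proof -
 have "pd c (%z. f (stretch d g z + 0)) z = k * pd c f (stretch d g z + 0)"
  if "stretch d g c = k *R c" for c k z
  by (rule pd_affine(1)[OF bounded_linear_stretch that smooth_diffable[OF assms]])
 thus "partial_t (%z. f (stretch d g z)) = (%z. d * partial_t f (stretch d g z))"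
  "pd (0, b) (%z. f (stretch d g z)) = (%z. g * pd (0, b) f (stretch d g z))"
  by (simp_all add: stretch_def fun_eq_iff)
qed

lemma smooth_stretch: assumes "smooth f" shows "smooth (%z. f (stretch d g z))"
proof -
 have "smooth (%z. f (stretch d g z + 0))"
  by (rule smooth_affine[where e = "%c. c" and k = "%c. if fst c = 0 then g else d", OF bounded_linear_stretch _ assms])
   (auto simp: stretch_def Basis_prod_def)
 thus ?thesis by simp
qed

lemma lap_x_pow_stretch:
 "smooth f ==> (lap_x ^^ k) (%z. f (stretch d e z)) = (%z. e ^ (2 * k) * (lap_x ^^ k) f (stretch d e z))"
proof (induction k)
 case (Suc k)
 define h where "h = (lap_x ^^ k) f"
 have h: "smooth h" unfolding h_def by (rule smooth_lap_x_pow[OF Suc.prems])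
 have "pd (0, b) (pd (0, b) (%z. e ^ (2 * k) * h (stretch d e z)))
   = (%z. e ^ (2 * Suc k) * pd (0, b) (pd (0, b) h) (stretch d e z))" if b: "b \<in> Basis" for b
 proof -
  have c: "pd (0, b) (%z. c * g (stretch d e z)) = (%z. (c * e) * pd (0, b) g (stretch d e z))" if "smooth g" for c g
   using pd_cmult[OF smooth_diffable[OF smooth_stretch[OF that, of d e]], of "(0, b)" c] partial_stretch(2)[OF that]
   by auto
  show ?thesis unfolding c[OF h] c[OF smooth_partial[OF h Basis_pair(1)[OF b]]] by auto
 qed
 hence "lap_x (%z. e ^ (2 * k) * h (stretch d e z)) = (%z. e ^ (2 * Suc k) * lap_x h (stretch d e z))"
  unfolding lap_x_def by (simp add: sum_distrib_left)
 thus ?case unfolding funpow.simps o_apply Suc.IH[OF Suc.prems] h_def .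
qed simp

section \<open>Nonexistence of global solutions\<close>

lemma bump_pair:
 fixes t :: real
 shows "\<bar>t\<bar> >= 2 ==> bump (t, x) = 0" and "b \<in> Basis ==> \<bar>x \<bullet> b\<bar> >= 2 ==> bump (t, x) = 0"
  and "\<bar>t\<bar> <= 1 ==> (!!b. b \<in> Basis ==> \<bar>x \<bullet> b\<bar> <= 1) ==> bump (t, x) = 1"
proof -
 show "bump (t, x) = 0" if "\<bar>t\<bar> >= 2" by (rule bump_0[OF Basis_pair(2)]) (use that in simp)
 show "bump (t, x) = 0" if "b \<in> Basis" "\<bar>x \<bullet> b\<bar> >= 2" by (rule bump_0[OF Basis_pair(1)[OF that(1)]]) (use that in simp)
 show "bump (t, x) = 1" if "\<bar>t\<bar> <= 1" "!!b. b \<in> Basis ==> \<bar>x \<bullet> b\<bar> <= 1"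
  by (rule bump_1) (use that in "auto simp: Basis_prod_def")
qed

text \<open>Smooth multiples of a power of \<open>bump\<close>. Each derivative lowers the power by
  one, so derivatives of a high power of the cut-off are dominated by a lower power of it, which
  Young's inequality needs.\<close>

definition bump_mult :: "nat => (real \<times> 'a::euclidean_space => real) set" where
 "bump_mult m = {f. EX h. smooth h \<and> f = (%z. bump z ^ m * h z)}"

lemma bump_mult_mono: assumes "f \<in> bump_mult n" "m <= n" shows "f \<in> bump_mult m"
proof -
 obtain h where h: "smooth h" "f = (%z. bump z ^ n * h z)" using assms by (auto simp: bump_mult_def)
 have "f = (%z. bump z ^ m * (bump z ^ (n - m) * h z))" using assms(2) by (simp add: h(2) flip: mult.assoc power_add)
 thus ?thesis unfolding bump_mult_def using smooth_mult[OF smooth_power[OF smooth_bump] h(1)] by blast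
qed

lemma bump_mult_partial:
 assumes f: "f \<in> bump_mult (Suc m)" and b: "b \<in> Basis" shows "pd b f \<in> bump_mult m"
proof -
 obtain g where g: "smooth g" "f = (%z. bump z ^ Suc m * g z)" using f by (auto simp: bump_mult_def)
 have p: "pd b (%z. bump z ^ Suc k) z = real (Suc k) * bump z ^ k * pd b bump z" for z k
 proof (induction k)
  case (Suc k)
  have "pd b (%z. bump z * bump z ^ Suc k) z = bump z * (real (Suc k) * bump z ^ k * pd b bump z) + pd b bump z * bump z ^ Suc k"
   unfolding Suc[symmetric] by (intro pd_mult smooth_diffable smooth_bump smooth_power)
  thus ?case by (simp add: algebra_simps)
 qed simp
 have "pd b f z = bump z ^ m * (real (Suc m) * (pd b bump z * g z) + bump z * pd b g z)" for z
  unfolding g(2) pd_mult[OF smooth_diffable[OF smooth_power[OF smooth_bump]] smooth_diffable[OF g(1)]] p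
  by (simp add: algebra_simps)
 moreover have "smooth (%z. real (Suc m) * (pd b bump z * g z) + bump z * pd b g z)"
  by (intro smooth_add smooth_mult smooth_const smooth_partial smooth_bump g b)
 ultimately show ?thesis unfolding bump_mult_def by blast
qed

lemma bump_mult_lap_x:
 fixes f :: "real \<times> 'a::euclidean_space => real"
 assumes f: "f \<in> bump_mult (m + 2)" shows "lap_x f \<in> bump_mult m"
proof -
 have "pd (0, b) (pd (0, b) f) \<in> bump_mult m" if "b \<in> Basis" for b :: 'a
  using f by (intro bump_mult_partial Basis_pair that) simp
 hence "EX h. smooth h \<and> pd (0, b) (pd (0, b) f) = (%z. bump z ^ m * h z)" if "b \<in> Basis" for b :: 'a
  using that by (simp add: bump_mult_def)
 then obtain h where h: "!!b :: 'a. b \<in> Basis ==> smooth (h b)"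
  "!!b :: 'a. b \<in> Basis ==> pd (0, b) (pd (0, b) f) = (%z. bump z ^ m * h b z)" by metis
 have "lap_x f = (%z. bump z ^ m * (- (\<Sum>b\<in>Basis. h b z)))"
  unfolding lap_x_def[abs_def] by (simp add: h(2) sum_distrib_left)
 moreover have "smooth (%z. - (\<Sum>b\<in>Basis. h b z))" by (intro smooth_minus smooth_sum h)
 ultimately show ?thesis unfolding bump_mult_def by blast
qed

lemma bump_mult_lap_x_pow: "f \<in> bump_mult (m + 2 * k) ==> (lap_x ^^ k) f \<in> bump_mult m"
 by (induction k arbitrary: m) (simp_all add: bump_mult_lap_x)

lemma bump_mult_bounded:
 assumes f: "f \<in> bump_mult (Suc m)"
 obtains B where "B >= 0" "!!z. \<bar>f z\<bar> <= B * bump z ^ m"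
proof -
 obtain h where h: "smooth h" "f = (%z. bump z ^ Suc m * h z)" using f by (auto simp: bump_mult_def)
 have "test (%z. bump z * h z)" using test_mult(1)[OF bump_scaled(1)[of 1 0] h(1)] by simp
 then obtain B where B: "B >= 0" "!!z. \<bar>bump z * h z\<bar> <= B" using test_bounded by blast
 have "\<bar>f z\<bar> <= B * bump z ^ m" for z
  using mult_right_mono[OF B(2), of "bump z ^ m" z] bump_range(1)[of z] by (simp add: h(2) abs_mult mult_ac)
 thus thesis using B(1) that by blast
qed

definition adj_op :: "nat => (real \<times> 'a::euclidean_space => real) => real \<times> 'a => real" where
 "adj_op sg f z = partial_t (partial_t f) z - (lap_x ^^ sg) (partial_t f) z + (lap_x ^^ sg) f z - partial_t f z"

text \<open>Under \<open>g ^ (2 * sg) = c\<close> a time derivative and the operator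
  \<open>(-Delta)^sg\<close> scale alike, by \<open>c\<close>. The second time derivative and the
  mixed term are of order \<open>c^2\<close>, so for small \<open>c\<close> the parabolic part
  dominates.\<close>

lemma adjoint_stretch:
 assumes F: "smooth F" and a: "g ^ (2 * sg) = c"
 shows "adj_op sg (%z. F (stretch c g z)) z = c * (c * partial_t (partial_t F) (stretch c g z)
  - c * (lap_x ^^ sg) (partial_t F) (stretch c g z) + (lap_x ^^ sg) F (stretch c g z) - partial_t F (stretch c g z))"
proof -
 have tF: "smooth (partial_t F)" by (intro smooth_partial F Basis_pair)
 have "partial_t (%z. c * partial_t F (stretch c g z)) = (%z. c * (c * partial_t (partial_t F) (stretch c g z)))"
  using pd_cmult[OF smooth_diffable[OF smooth_stretch[OF tF, of c g]], of "(1, 0)" c] partial_stretch(1)[OF tF] by auto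
 moreover have "(lap_x ^^ sg) (%z. c * partial_t F (stretch c g z)) = (%z. c * (c * (lap_x ^^ sg) (partial_t F) (stretch c g z)))"
  unfolding lap_x_pow_cmult[OF smooth_stretch[OF tF]] lap_x_pow_stretch[OF tF] a ..
 ultimately show ?thesis
  unfolding adj_op_def partial_stretch(1)[OF F] lap_x_pow_stretch[OF F] a by (simp add: algebra_simps)
qed

text \<open>The exponent leaves room for \<open>2 * sg + 1\<close> derivatives and for one further
  factor \<open>bump\<close> that makes the smooth cofactor bounded.\<close>

lemma bump_adjoint_bound:
 obtains B where "B >= 0" "!!c g (z :: real \<times> 'a::euclidean_space). 0 <= c ==> c <= 1 ==> g ^ (2 * sg) = c ==>
  \<bar>adj_op sg (%z. bump (stretch c g z) ^ (m + 2 * sg + 3)) z\<bar> <= c * (B * bump (stretch c g z) ^ m)"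
proof -
 define F :: "real \<times> 'a => real" where "F z = bump z ^ (m + 2 * sg + 3)" for z
 have F: "smooth F" unfolding F_def[abs_def] by (intro smooth_power smooth_bump)
 have "F \<in> bump_mult (m + 2 * sg + 3)" unfolding bump_mult_def F_def[abs_def] by force
 hence B0: "F \<in> bump_mult (Suc (Suc (Suc m + 2 * sg)))" by (simp add: numeral_3_eq_3)
 hence B1: "partial_t F \<in> bump_mult (Suc (Suc m + 2 * sg))" by (intro bump_mult_partial Basis_pair)
 have B: "F \<in> bump_mult (Suc m + 2 * sg)" "partial_t F \<in> bump_mult (Suc m + 2 * sg)"
  using bump_mult_mono[OF B0] bump_mult_mono[OF B1] by auto
 have "partial_t (partial_t F) \<in> bump_mult (Suc m + 2 * sg)" by (rule bump_mult_partial[OF B1 Basis_pair(2)])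
 hence "partial_t (partial_t F) \<in> bump_mult (Suc m)" "partial_t F \<in> bump_mult (Suc m)"
  "(lap_x ^^ sg) F \<in> bump_mult (Suc m)" "(lap_x ^^ sg) (partial_t F) \<in> bump_mult (Suc m)"
  using B by (auto intro: bump_mult_lap_x_pow bump_mult_mono)
 then obtain C1 C2 C3 C4 where C: "C1 >= 0" "!!z. \<bar>partial_t (partial_t F) z\<bar> <= C1 * bump z ^ m" "C2 >= 0" "!!z. \<bar>partial_t F z\<bar> <= C2 * bump z ^ m"
  "C3 >= 0" "!!z. \<bar>(lap_x ^^ sg) F z\<bar> <= C3 * bump z ^ m" "C4 >= 0" "!!z. \<bar>(lap_x ^^ sg) (partial_t F) z\<bar> <= C4 * bump z ^ m"
  by (metis bump_mult_bounded)
 have "\<bar>adj_op sg (%z. F (stretch c g z)) z\<bar> <= c * ((C1 + C2 + C3 + C4) * bump (stretch c g z) ^ m)"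
  if a: "0 <= c" "c <= 1" "g ^ (2 * sg) = c" for c g and z
 proof -
  define s where "s = stretch c g z"
  have m: "\<bar>c * r\<bar> <= \<bar>r\<bar>" for r using a by (simp add: abs_mult mult_left_le_one_le)
  have "\<bar>c * partial_t (partial_t F) s - c * (lap_x ^^ sg) (partial_t F) s + (lap_x ^^ sg) F s - partial_t F s\<bar>
    <= C1 * bump s ^ m + C2 * bump s ^ m + C3 * bump s ^ m + C4 * bump s ^ m"
   using m[of "partial_t (partial_t F) s"] m[of "(lap_x ^^ sg) (partial_t F) s"] C(2)[of s] C(4)[of s] C(6)[of s] C(8)[of s] by linarith
  thus ?thesis
   unfolding adjoint_stretch[OF F a(3)] s_def[symmetric] using a by (simp add: abs_mult mult_left_mono distrib_right)
 qed
 thus thesis using that[of "C1 + C2 + C3 + C4"] C unfolding F_def by simp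
qed

lemma pd_const_on_open:
 assumes U: "open U" and c: "!!z. z \<in> U ==> f z = c" and z: "z \<in> U"
 shows "pd b f z = 0"
proof (rule pd_eq[of f "%_. 0"])
 have "((%_. c) has_derivative (%_. 0)) (at z)" by simp
 thus "(f has_derivative (%_. 0)) (at z)"
  by (rule has_derivative_transform_within_open[OF _ U z]) (simp add: c)
qed

text \<open>With \<open>sg >= 1\<close> every term of the adjoint contains a derivative. This
  confines the error terms to the region where the cut-off varies.\<close>

lemma adjoint_zero_on_open:
 assumes sg: "sg >= 1" and U: "open U" and c: "!!z. z \<in> U ==> f z = c" and z: "z \<in> U"
 shows "adj_op sg f z = 0"
proof -
 have t: "partial_t f z = 0" if "z \<in> U" for z using pd_const_on_open[OF U c that] .
 have tt: "partial_t (partial_t f) z = 0" by (rule pd_const_on_open[OF U t z])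
 have "(lap_x ^^ k) g z = 0" if k: "k >= 1" and g: "!!z. z \<in> U ==> g z = c" and z: "z \<in> U" for g c z k
  using k z
 proof (induction k arbitrary: z rule: dec_induct)
  case base
  have "pd (0, b) g z = 0" if "z \<in> U" for z b using pd_const_on_open[OF U g that] .
  thus ?case using pd_const_on_open[OF U _ base, of "pd (0, _) g" 0] by (simp add: lap_x_def)
 next
  case (step k)
  have "pd (0, b) ((lap_x ^^ k) g) z = 0" if "z \<in> U" for z b using pd_const_on_open[OF U step.IH that] .
  thus ?case using pd_const_on_open[OF U _ step.prems, of "pd (0, _) ((lap_x ^^ k) g)" 0]
   by (simp add: lap_x_def[of "(lap_x ^^ k) g" z])
 qed
 thus ?thesis using tt sg c t z by (simp add: adj_op_def)
qed

lemma is_weak_solution_iff: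
 shows "is_weak_solution sg p u0 u1 T u \<longleftrightarrow> Lp_loc p T u \<and> (ALL f:test_functions ({t. ereal t < T} \<times> UNIV).
  (LINT z:time_interval T \<times> UNIV|lebesgue. \<bar>u (fst z) (snd z)\<bar> powr p * f z)
  + (LINT x|lebesgue. u0 x * (f (0, x) + (lap_x ^^ sg) f (0, x) - partial_t f (0, x)))
  + (LINT x|lebesgue. u1 x * f (0, x))
  = (LINT z:time_interval T \<times> UNIV|lebesgue. u (fst z) (snd z) * adj_op sg f z))"
  (is "_ \<longleftrightarrow> _ \<and> (ALL f:?X. ?P f)")
proof -
 let ?Q = "%g. (LINT (t, x):time_interval T \<times> UNIV|lebesgue. \<bar>u t x\<bar> powr p * g t x)
    + (LINT x|lebesgue. u0 x * (g 0 x + neg_laplacian_pow sg (g 0) x - time_deriv g 0 x))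
    + (LINT x|lebesgue. u1 x * g 0 x)
    = (LINT (t, x):time_interval T \<times> UNIV|lebesgue.
      u t x * (time_deriv (time_deriv g) t x - neg_laplacian_pow sg (time_deriv g t) x
           + neg_laplacian_pow sg (g t) x - time_deriv g t x))"
 have e: "?Q (%t x. f (t, x)) \<longleftrightarrow> ?P f" for f
 proof -
  have t: "time_deriv (%t x. f (t, x)) = (%t x. partial_t f (t, x))" "time_deriv (%t x. partial_t f (t, x)) = (%t x. partial_t (partial_t f) (t, x))"
   by (rule time_deriv_slice)+
  have l: "neg_laplacian_pow sg (%x. f (t, x)) = (%x. (lap_x ^^ sg) f (t, x))"
   "neg_laplacian_pow sg (%x. partial_t f (t, x)) = (%x. (lap_x ^^ sg) (partial_t f) (t, x))" for t
   by (rule lap_pow_slice)+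
  show ?thesis unfolding t l by (simp add: case_prod_unfold adj_op_def)
 qed
 have "(ALL g. (%(t, x). g t x) \<in> ?X --> ?Q g) \<longleftrightarrow> (ALL f:?X. ?P f)"
 proof (intro iffI ballI allI impI)
  fix f assume *: "ALL g. (%(t, x). g t x) \<in> ?X --> ?Q g" and "f \<in> ?X"
  hence "?Q (%t x. f (t, x))" using *[rule_format, of "%t x. f (t, x)"] by simp
  thus "?P f" unfolding e .
 next
  fix g assume "ALL f:?X. ?P f" and "(%(t, x). g t x) \<in> ?X"
  hence "?P (%(t, x). g t x)" by blast
  thus "?Q g" unfolding e[symmetric] by simp
 qed
 thus ?thesis unfolding is_weak_solution_def by blast
qed

text \<open>Either \<open>b <= K * a powr (p - 1)\<close> and the first term suffices, or
  \<open>a\<close> is bounded by a power of \<open>b / K\<close> and the second does. The constants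
  are not sharp; what counts is that the power of \<open>K\<close> in the second term tends to 0 as
  \<open>K\<close> grows.\<close>

lemma Young_with_parameter:
 fixes a b K p :: real
 assumes "a >= 0" "b >= 0" "K > 0" "p > 1"
 shows "a * b <= K * a powr p + K powr (- 1 / (p - 1)) * b powr (p / (p - 1))"
proof (cases "b <= K * a powr (p - 1)")
 case True
 have "a * b <= a * (K * a powr (p - 1))" using True assms by (intro mult_left_mono)
 also have "... = K * a powr p" using assms by (cases "a = 0") (auto simp: powr_diff)
 finally show ?thesis by (simp add: add_increasing2)
next
 case False
 hence ab: "K * a powr (p - 1) < b" by simp
 moreover have "0 <= K * a powr (p - 1)" using assms by simp
 ultimately have "a powr (p - 1) <= b / K" using assms(3) by (simp add: pos_le_divide_eq mult.commute)
 hence "(a powr (p - 1)) powr (1 / (p - 1)) <= (b / K) powr (1 / (p - 1))" using assms by (intro powr_mono2) auto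
 hence "a <= (b / K) powr (1 / (p - 1))" using assms by (simp add: powr_powr)
 hence "a * b <= (b / K) powr (1 / (p - 1)) * b" using assms by (intro mult_right_mono)
 also have "... = K powr (- 1 / (p - 1)) * (b powr (1 / (p - 1)) * b powr 1)"
  using assms by (simp add: powr_divide powr_minus_divide)
 finally show ?thesis using assms unfolding powr_add[symmetric] by (simp add: field_simps add_increasing)
qed

lemma emeasure_cbox_pair:
 fixes c :: real
 assumes "a >= 0" "c >= 0"
 shows "emeasure lborel (cbox (- a, - c *R One) (a, c *R (One :: 'a::euclidean_space))) = ennreal (2 * a * (2 * c) ^ DIM('a))"
proof -
 have "(\<Prod>b\<in>Basis. (c *R (One :: 'a) - - c *R One) \<bullet> b) = (\<Prod>b\<in>(Basis :: 'a set). 2 * c)" by (intro prod.cong) (auto simp: inner_add_left)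
 moreover have "emeasure lborel (cbox (- a) a) = ennreal (2 * a)" using assms by simp
 ultimately have "emeasure (lborel \<Otimes>\<^sub>M lborel) (cbox (- a) a \<times> cbox (- c *R One) (c *R (One :: 'a))) = ennreal (2 * a * (2 * c) ^ DIM('a))"
  using assms by (subst lborel.emeasure_pair_measure_Times) (simp_all flip: ennreal_mult)
 thus ?thesis unfolding lborel_prod cbox_Pair_eq .
qed

lemma no_global_weak_solution:
 fixes u1 :: "'a::euclidean_space => real"
 assumes sg: "sg >= 1" and u1: "integrable lebesgue u1"
  and pos: "Liminf at_top (%R::real. ereal (LINT x:ball 0 R|lebesgue. u1 x)) > 0"
  and p: "1 < p" "p <= 1 + 2 * real sg / real DIM('a)"
  and w: "is_weak_solution sg p (%x. 0) u1 \<infinity> u"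
 shows False
proof -
 \<comment> \<open>\<open>u\<close> extended by 0 to negative times, so that all integrals run over
   the full space-time.\<close>
 define v where "v z = indicator ({0..} \<times> UNIV) z * u (fst z) (snd z)" for z
 have ti: "time_interval \<infinity> = {0..}" by (auto simp: time_interval_def)
 have Lp: "Lp_loc p \<infinity> u" using w unfolding is_weak_solution_iff by blast
 hence vm [measurable]: "lmeas v"
  by (simp add: Lp_loc_def set_borel_measurable_def ti v_def[abs_def] case_prod_unfold)
 have vp: "\<bar>v z\<bar> powr p = indicator ({0..} \<times> UNIV) z * \<bar>u (fst z) (snd z)\<bar> powr p" for z
  by (auto simp: v_def indicator_def)
 have weak: "(LINT z|lebesgue. \<bar>v z\<bar> powr p * f z) + (LINT x|lebesgue. u1 x * f (0, x)) = (LINT z|lebesgue. v z * adj_op sg f z)"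
  if f: "test f" for f
 proof -
  have "f \<in> test_functions ({t. ereal t < \<infinity>} \<times> UNIV)" using f by simp
  moreover have "(LINT z:time_interval \<infinity> \<times> UNIV|lebesgue. \<bar>u (fst z) (snd z)\<bar> powr p * f z) = (LINT z|lebesgue. \<bar>v z\<bar> powr p * f z)"
   by (simp add: set_lebesgue_integral_def ti vp mult.assoc)
  ultimately show ?thesis using w unfolding is_weak_solution_iff by (auto simp: set_lebesgue_integral_def ti v_def mult.assoc)
 qed
 \<comment> \<open>\<open>m\<close> is large enough for \<open>l <= m * p\<close>. Then the power
   \<open>m * p\<close> of \<open>bump\<close> produced by Young's inequality is at most its power
   \<open>l\<close>, which is the cut-off \<open>f N\<close>.\<close>
 obtain m where m: "(2 * real sg + 3) / (p - 1) + 1 <= real m" using real_arch_simple by blast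
 define l where "l = m + 2 * sg + 3"
 have "(2 * real sg + 3) / (p - 1) >= 0" using p by simp
 hence m1: "m >= 1" using m by linarith
 have mp: "real l <= real m * p"
 proof -
  have "(2 * real sg + 3) / (p - 1) <= real m" using m by simp
  thus ?thesis using p by (simp add: pos_divide_le_eq l_def algebra_simps)
 qed
 obtain B where B: "B >= 0" "!!d h (z :: real \<times> 'a). 0 <= d ==> d <= 1 ==> h ^ (2 * sg) = d ==>
  \<bar>adj_op sg (%z. bump (stretch d h z) ^ l) z\<bar> <= d * (B * bump (stretch d h z) ^ m)"
  using bump_adjoint_bound[of sg m] unfolding l_def by blast
 \<comment> \<open>\<open>h N\<close> is the inverse spatial radius of the cut-off; its power
   \<open>d N\<close> is the inverse length in time.\<close>
 define h d where "h N = inverse (real (Suc N))" and "d N = h N ^ (2 * sg)" for N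
 have h: "0 < h N" "h N <= 1" for N by (simp_all add: h_def inverse_le_1_iff)
 have d: "0 < d N" "d N <= 1" for N using h[of N] by (auto simp: d_def power_le_one)
 define s :: "nat => real \<times> 'a => real \<times> 'a" where "s N = stretch (d N) (h N)" for N
 define f where "f N z = bump (s N z) ^ l" for N z
 define U :: "(real \<times> 'a) set" where "U = {z. \<bar>fst z\<bar> < 1 \<and> (ALL b:Basis. \<bar>snd z \<bullet> b\<bar> < 1)}"
 have sc: "continuous_on UNIV (s N)" for N unfolding s_def by (rule linear_continuous_on[OF bounded_linear_stretch])
 have "U = {z. \<bar>fst z\<bar> < 1} \<inter> (\<Inter>b\<in>Basis. {z. \<bar>snd z \<bullet> b\<bar> < 1})" by (auto simp: U_def)
 hence sU: "open (s N -` U)" for N using sc by (auto intro!: open_INT open_Collect_less continuous_intros)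
 have f1: "f N z = 1" if "s N z \<in> U" for N z
 proof -
  have "bump (fst (s N z), snd (s N z)) = 1" using that by (intro bump_pair(3)) (auto simp: U_def)
  thus ?thesis by (simp add: f_def)
 qed
 have fr: "0 <= f N z" "f N z <= 1" for N z using bump_range[of "s N z"] by (auto simp: f_def power_le_one)
 define Q :: "nat => (real \<times> 'a) set" where "Q N = cbox (- (2 / d N), - (2 / h N) *R One) (2 / d N, (2 / h N) *R One)" for N
 have Q: "z \<in> Q N" if "bump (s N z) ~= 0" for N z
 proof -
  have "bump (d N * fst z, h N *R snd z) ~= 0" using that by (simp add: s_def stretch_def)
  hence "\<bar>d N * fst z\<bar> < 2" "\<bar>(h N *R snd z) \<bullet> b\<bar> < 2" if "b \<in> Basis" for b
   using bump_pair(1,2) that by (meson not_le)+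
  hence "d N * \<bar>fst z\<bar> < 2" "!!b. b \<in> Basis ==> h N * \<bar>snd z \<bullet> b\<bar> < 2" using d[of N] h[of N] SOME_Basis by (auto simp: abs_mult)
  hence "\<bar>fst z\<bar> <= 2 / d N" "!!b. b \<in> Basis ==> \<bar>snd z \<bullet> b\<bar> <= 2 / h N"
   using d[of N] h[of N] by (auto simp: pos_le_divide_eq mult.commute less_imp_le)
  hence "fst z \<in> cbox (- (2 / d N)) (2 / d N)" "snd z \<in> cbox (- (2 / h N) *R One) ((2 / h N) *R One)"
   unfolding mem_box by (auto simp: abs_le_iff minus_le_iff)
  thus ?thesis unfolding Q_def cbox_Pair_eq by (simp add: mem_Times_iff)
 qed
 have ft: "test (f N)" for N
 proof -
  obtain r where "ALL z:Q N. norm z <= r" using bounded_cbox unfolding Q_def bounded_iff by blast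
  moreover have "bump (s N z) ~= 0" if "f N z ~= 0" for z using that by (auto simp: f_def l_def)
  moreover have "smooth (f N)" unfolding f_def[abs_def] s_def by (intro smooth_power smooth_stretch[OF smooth_bump])
  ultimately show ?thesis unfolding test_iff using Q by blast
 qed
 have fi: "integrable lebesgue (%z. \<bar>v z\<bar> powr p * f N z)" for N
 proof -
  define L where "L = ({0..} \<times> UNIV) \<inter> Q N"
  have cl: "closed ({0..} \<times> UNIV :: (real \<times> 'a) set)" by (intro closed_Times) auto
  have "compact L" unfolding L_def Q_def by (rule closed_Int_compact[OF cl compact_cbox])
  hence si: "set_integrable lebesgue L (%(t, x). \<bar>u t x\<bar> powr p)" using Lp unfolding Lp_loc_def ti by (auto simp: L_def)
  have [measurable]: "lmeas (f N)" by (rule L2D(1)[OF test_L2[OF ft]])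
  show ?thesis
  proof (rule LINT_bound[OF si[unfolded set_integrable_def]])
   have "norm (\<bar>v z\<bar> powr p * f N z) <= norm (indicator L z *R (case z of (t, x) => \<bar>u t x\<bar> powr p))" for z
   proof (cases "f N z = 0")
    case False
    hence "z \<in> Q N" by (intro Q) (auto simp: f_def l_def)
    hence e: "\<bar>v z\<bar> powr p = indicator L z *R (case z of (t, x) => \<bar>u t x\<bar> powr p)"
     unfolding vp by (auto simp: L_def indicator_def)
    show ?thesis unfolding e[symmetric] using fr[of N z] by (simp add: mult_left_le)
   qed simp
   thus "AE z in lebesgue. norm (\<bar>v z\<bar> powr p * f N z) <= norm (indicator L z *R (case z of (t, x) => \<bar>u t x\<bar> powr p))" by simp
  qed measurable
 qed
 \<comment> \<open>Outside \<open>A N\<close> the cut-off equals 1 and its adjoint vanishes. Every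
   point lies outside \<open>A N\<close> for large \<open>N\<close>.\<close>
 define A where "A N = - (s N -` U)" for N
 have Am [measurable]: "A N \<in> sets lebesgue" for N
  using sU[of N] unfolding A_def by simp
 define p' where "p' = p / (p - 1)"
 define M where "M = B powr p' * 4 ^ Suc DIM('a)"
 have M: "M >= 0" by (simp add: M_def)
 have fA: "integrable lebesgue (%z. \<bar>v z\<bar> powr p * f N z * indicator (A N) z)" for N
  using integrable_mult_indicator[OF Am fi[of N]] by (simp add: mult.commute)
 \<comment> \<open>The weight \<open>K\<close> stays free: the value 1/2 will give integrability of
   \<open>\<bar>v z\<bar> powr p\<close>, and large values will remove the constant
   \<open>M\<close>.\<close>
 have main: "(LINT z|lebesgue. \<bar>v z\<bar> powr p * f N z) + (LINT x|lebesgue. u1 x * f N (0, x))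
   <= K * (LINT z|lebesgue. \<bar>v z\<bar> powr p * f N z * indicator (A N) z) + K powr (- 1 / (p - 1)) * M"
  if K: "K > 0" for K N
 proof -
  define c where "c = K powr (- 1 / (p - 1)) * (d N * B) powr p'"
  have Qi: "emeasure lborel (Q N) = ennreal (2 * (2 / d N) * (2 * (2 / h N)) ^ DIM('a))"
   unfolding Q_def by (rule emeasure_cbox_pair) (use d[of N] h[of N] in auto)
  hence iQ: "integrable lebesgue (indicator (Q N) :: real \<times> 'a => real)" by (subst integrable_completion) (auto simp: Q_def)
  have "(LINT z|lebesgue. v z * adj_op sg (f N) z) <= (LINT z|lebesgue. K * (\<bar>v z\<bar> powr p * f N z * indicator (A N) z) + c * indicator (Q N) z)"
  proof (rule integral_mono')
   show "integrable lebesgue (%z. K * (\<bar>v z\<bar> powr p * f N z * indicator (A N) z) + c * indicator (Q N) z)"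
    using fA iQ by simp
   fix z
   have c0: "c >= 0" by (simp add: c_def)
   show nn: "0 <= K * (\<bar>v z\<bar> powr p * f N z * indicator (A N) z) + c * indicator (Q N) z"
    using K c0 fr[of N z] by simp
   have ab: "\<bar>adj_op sg (f N) z\<bar> <= d N * (B * bump (s N z) ^ m)"
    unfolding f_def[abs_def] s_def by (rule B(2)) (use d[of N] in "auto simp: d_def")
   show "v z * adj_op sg (f N) z <= K * (\<bar>v z\<bar> powr p * f N z * indicator (A N) z) + c * indicator (Q N) z"
   proof (cases "s N z \<in> U \<or> bump (s N z) = 0")
    case True
    have "adj_op sg (f N) z = 0"
    proof (cases "s N z \<in> U")
     case True
     thus ?thesis by (intro adjoint_zero_on_open[OF sg sU[of N], where c = 1]) (auto intro: f1)
    next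
     case False
     thus ?thesis using True ab m1 by (simp add: power_0_left)
    qed
    thus ?thesis using nn by simp
   next
    case False
    define k where "k = bump (s N z)"
    have k: "0 < k" "k <= 1" using False bump_range[of "s N z"] by (auto simp: k_def)
    have "v z * adj_op sg (f N) z <= \<bar>v z\<bar> * \<bar>adj_op sg (f N) z\<bar>"
     unfolding abs_mult[symmetric] by simp
    also have "... <= \<bar>v z\<bar> * (d N * (B * k ^ m))" unfolding k_def by (rule mult_left_mono[OF ab]) simp
    also have "... = (\<bar>v z\<bar> * k ^ m) * (d N * B)" by simp
    also have "... <= K * (\<bar>v z\<bar> * k ^ m) powr p + c"
     unfolding c_def p'_def using k d[of N] B(1) K p by (intro Young_with_parameter) auto
    also have "(\<bar>v z\<bar> * k ^ m) powr p = \<bar>v z\<bar> powr p * k powr (real m * p)"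
     using k by (simp add: powr_mult powr_powr flip: powr_realpow)
    also have "... <= \<bar>v z\<bar> powr p * f N z"
    proof (rule mult_left_mono)
     have "k powr (real m * p) <= k powr real l" using k mp by (intro powr_mono') auto
     thus "k powr (real m * p) <= f N z" using k by (simp add: f_def k_def powr_realpow)
    qed simp
    finally show ?thesis using False Q K by (simp add: A_def)
   qed
  qed
  also have "... = K * (LINT z|lebesgue. \<bar>v z\<bar> powr p * f N z * indicator (A N) z) + c * measure lborel (Q N)"
   using fA iQ by (simp add: Q_def)
  also have "c * measure lborel (Q N) <= K powr (- 1 / (p - 1)) * M"
  proof -
   \<comment> \<open>Power counting: \<open>Q N\<close> has volume of order
     \<open>h^(- n) / d\<close>, and Young's inequality contributes \<open>d^p'\<close>. With
     \<open>d = h^(2 sg)\<close> the product stays bounded when \<open>n + 2 sg <= 2 sg p'\<close>,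
     which is the upper bound on \<open>p\<close>.\<close>
   have n: "real DIM('a) * (p - 1) <= 2 * real sg" using p by (simp add: field_simps)
   have "real DIM('a) + 2 * real sg <= 2 * real sg * p'" using n p by (simp add: algebra_simps p'_def pos_le_divide_eq)
   hence "h N powr (2 * real sg * p') <= h N powr (real DIM('a) + 2 * real sg)" using h[of N] by (intro powr_mono') auto
   also have "h N powr (2 * real sg * p') = d N powr p'" using h[of N] by (simp add: d_def powr_powr flip: powr_realpow)
   also have "h N powr (real DIM('a) + 2 * real sg) = h N ^ DIM('a) * d N"
    using h[of N] by (simp add: d_def powr_add flip: powr_realpow)
   finally have a: "d N powr p' <= h N ^ DIM('a) * d N" .
   have "(d N * B) powr p' * measure lborel (Q N) = M * (d N powr p' / (h N ^ DIM('a) * d N))" using Qi d[of N] h[of N] by (simp add: measure_def field_simps powr_mult M_def)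
   also have "... <= M * 1" using a d[of N] h[of N] M by (intro mult_left_mono) auto
   finally show ?thesis unfolding c_def mult.assoc by (intro mult_left_mono) auto
  qed
  finally show ?thesis using weak[OF ft[of N]] by simp
 qed
 define J where "J = (LINT x|lebesgue. u1 x)"
 have [measurable]: "lmeas u1" using u1 by simp
 have fU: "\<forall>\<^sub>F N in sequentially. s N z \<in> U" for z
 proof -
  have g0: "h ----> 0" unfolding h_def by (rule LIMSEQ_inverse_real_of_nat)
  hence "d ----> 0" using sg unfolding d_def by simp
  hence "(%N. \<bar>d N * fst z\<bar>) ----> \<bar>0 * fst z\<bar>" by (intro tendsto_intros)
  hence 1: "\<forall>\<^sub>F N in sequentially. \<bar>d N * fst z\<bar> < 1" by (intro order_tendstoD) auto
  have "\<forall>\<^sub>F N in sequentially. \<bar>(h N *R snd z) \<bullet> b\<bar> < 1" for b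
  proof -
   have "(%N. \<bar>(h N *R snd z) \<bullet> b\<bar>) ----> \<bar>(0 *R snd z) \<bullet> b\<bar>" by (intro tendsto_intros g0)
   thus ?thesis by (intro order_tendstoD) auto
  qed
  hence "\<forall>\<^sub>F N in sequentially. ALL b:Basis. \<bar>(h N *R snd z) \<bullet> b\<bar> < 1" by (intro eventually_ball_finite) auto
  with 1 show ?thesis by eventually_elim (simp add: U_def s_def stretch_def)
 qed
 have f_lim: "(%N. f N z) ----> 1" for z
 proof -
  have "\<forall>\<^sub>F N in sequentially. 1 = f N z" using fU[of z] by eventually_elim (simp add: f1)
  thus ?thesis by (rule Lim_transform_eventually[OF tendsto_const])
 qed
 have J_lim: "(%N. LINT x|lebesgue. u1 x * f N (0, x)) ----> J"
  unfolding J_def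
 proof (rule integral_dominated_convergence[where w = "%x. norm (u1 x)"])
  fix N
  have "smooth (%x. f N (0, x))" by (rule smooth_slice[OF test_smooth[OF ft]])
  hence "(%x. f N (0, x)) \<in> borel_measurable lborel" by (simp add: borel_measurable_continuous_onI smooth_continuous)
  hence [measurable]: "lmeas (%x. f N (0, x))" by (rule measurable_completion)
  show "lmeas (%x. u1 x * f N (0, x))" by simp
  show "AE x in lebesgue. norm (u1 x * f N (0, x)) <= norm (u1 x)" using fr by (intro AE_I2) (simp add: abs_mult mult_left_le)
 next
  show "AE x in lebesgue. (%N. u1 x * f N (0, x)) ----> u1 x"
   using tendsto_mult[OF tendsto_const f_lim] by simp
 qed (use u1 in auto)
 \<comment> \<open>For integrable \<open>u1\<close> the lower limit is a limit, equal to the whole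
   integral \<open>J\<close>.\<close>
 have "((%R::real. LINT x:ball 0 R|lebesgue. u1 x) ---> J) at_top"
  unfolding J_def set_lebesgue_integral_def
 proof (rule integral_dominated_convergence_at_top[where w = "%x. norm (u1 x)"])
  show "AE x in lebesgue. ((%R. indicator (ball 0 R) x *R u1 x) ---> u1 x) at_top"
  proof (rule AE_I2)
   fix x :: 'a
   have "\<forall>\<^sub>F R in at_top. u1 x = indicator (ball 0 R) x *R u1 x"
    using eventually_gt_at_top[of "norm x"] by eventually_elim simp
   thus "((%R. indicator (ball 0 R) x *R u1 x) ---> u1 x) at_top" by (rule Lim_transform_eventually[OF tendsto_const])
  qed
  have [measurable]: "ball 0 R \<in> sets (lebesgue :: 'a measure)" for R by simp
  show "lmeas (%x. indicator (ball 0 R) x *R u1 x)" for R by simp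
 qed (use u1 in "auto simp: indicator_def intro!: always_eventually")
 hence "Liminf at_top (%R::real. ereal (LINT x:ball 0 R|lebesgue. u1 x)) = ereal J"
  by (intro lim_imp_Liminf) (auto)
 hence J: "J > 0" using pos by simp
 have "\<forall>\<^sub>F N in sequentially. (LINT z|lebesgue. \<bar>v z\<bar> powr p * f N z) <= 2 * ((1/2) powr (- 1 / (p - 1)) * M)"
  using order_tendstoD(1)[OF J_lim J]
 proof eventually_elim
  case (elim N)
  have "(LINT z|lebesgue. \<bar>v z\<bar> powr p * f N z * indicator (A N) z) <= (LINT z|lebesgue. \<bar>v z\<bar> powr p * f N z)"
   by (rule LINT_mono[OF fA fi]) (use fr in "auto simp: indicator_def")
  thus ?case using main[of "1/2" N] elim by simp
 qed
 hence 1: "limsup (%N. \<integral>\<^sup>+z. ennreal (\<bar>v z\<bar> powr p * f N z) \<partial>lebesgue) <= ennreal (2 * ((1/2) powr (- 1 / (p - 1)) * M))"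
  by (intro Limsup_bounded) (auto elim!: eventually_mono simp: nn_integral_eq_integral[OF fi] fr ennreal_leI)
 have 2: "NL (%z. \<bar>v z\<bar> powr p) <= liminf (%N. \<integral>\<^sup>+z. ennreal (\<bar>v z\<bar> powr p * f N z) \<partial>lebesgue)"
 proof -
  have "ennreal (\<bar>v z\<bar> powr p) = liminf (%N. ennreal (\<bar>v z\<bar> powr p * f N z))" for z
  proof (rule lim_imp_Liminf[OF sequentially_bot, symmetric])
   have "(%N. \<bar>v z\<bar> powr p * f N z) ----> \<bar>v z\<bar> powr p * 1" by (intro tendsto_mult tendsto_const f_lim)
   thus "(%N. ennreal (\<bar>v z\<bar> powr p * f N z)) ----> ennreal (\<bar>v z\<bar> powr p)" by simp
  qed
  thus ?thesis using nn_integral_liminf[of "%N z. ennreal (\<bar>v z\<bar> powr p * f N z)" lebesgue] borel_measurable_integrable[OF fi] by simp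
 qed
 have "NL (%z. \<bar>v z\<bar> powr p) <= ennreal (2 * ((1/2) powr (- 1 / (p - 1)) * M))"
  by (rule order_trans[OF 2 order_trans[OF Liminf_le_Limsup[OF sequentially_bot] 1]])
 also have "... < \<infinity>" by simp
 finally have "NL (%z. \<bar>v z\<bar> powr p) < \<infinity>" .
 hence vi: "integrable lebesgue (%z. \<bar>v z\<bar> powr p)" by (intro integrableI_nonneg) auto
 have tail: "(%N. LINT z|lebesgue. \<bar>v z\<bar> powr p * indicator (A N) z) ----> (LINT z::real \<times> 'a|lebesgue. 0)"
 proof (rule integral_dominated_convergence[where w = "%z. \<bar>v z\<bar> powr p"])
  show "AE z in lebesgue. (%N. \<bar>v z\<bar> powr p * indicator (A N) z) ----> 0"
  proof (rule AE_I2)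
   fix z
   have "\<forall>\<^sub>F N in sequentially. 0 = \<bar>v z\<bar> powr p * indicator (A N) z" using fU[of z] by eventually_elim (simp add: A_def)
   thus "(%N. \<bar>v z\<bar> powr p * indicator (A N) z) ----> 0" by (rule Lim_transform_eventually[OF tendsto_const])
  qed
 qed (use vi in "auto simp: indicator_def")
 \<comment> \<open>\<open>K\<close> is fixed while \<open>N\<close> grows: the integral over
   \<open>A N\<close> is the tail of an integrable function, so only the term with \<open>M\<close>
   remains.\<close>
 have JK: "J <= K powr (- 1 / (p - 1)) * M" if K: "K > 0" for K
 proof (rule LIMSEQ_le[OF J_lim])
  show "(%N. K * (LINT z|lebesgue. \<bar>v z\<bar> powr p * indicator (A N) z) + K powr (- 1 / (p - 1)) * M) ----> K powr (- 1 / (p - 1)) * M"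
   using tendsto_add[OF tendsto_mult[OF tendsto_const[of K] tail] tendsto_const[of "K powr (- 1 / (p - 1)) * M"]] by simp
  have "(LINT x|lebesgue. u1 x * f N (0, x)) <= K * (LINT z|lebesgue. \<bar>v z\<bar> powr p * indicator (A N) z) + K powr (- 1 / (p - 1)) * M" for N
  proof -
   have "(LINT z|lebesgue. \<bar>v z\<bar> powr p * f N z * indicator (A N) z) <= (LINT z|lebesgue. \<bar>v z\<bar> powr p * indicator (A N) z)"
    using fr integrable_mult_indicator[OF Am vi] by (intro LINT_mono fA) (auto simp: mult.commute indicator_def mult_left_le_one_le)
   hence "K * (LINT z|lebesgue. \<bar>v z\<bar> powr p * f N z * indicator (A N) z) <= K * (LINT z|lebesgue. \<bar>v z\<bar> powr p * indicator (A N) z)"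
    using K by simp
   moreover have "0 <= (LINT z|lebesgue. \<bar>v z\<bar> powr p * f N z)" using fr by simp
   ultimately show ?thesis using main[OF K, of N] by linarith
  qed
  thus "EX N0. ALL N>=N0. (LINT x|lebesgue. u1 x * f N (0, x)) <= K * (LINT z|lebesgue. \<bar>v z\<bar> powr p * indicator (A N) z) + K powr (- 1 / (p - 1)) * M" by blast
 qed
 have "((%K. K powr (- 1 / (p - 1)) * M) ---> 0 * M) at_top"
  using p by (intro tendsto_mult tendsto_neg_powr filterlim_ident) auto
 hence "\<forall>\<^sub>F K in at_top. K powr (- 1 / (p - 1)) * M < J" using J by (intro order_tendstoD) auto
 then obtain K where "K powr (- 1 / (p - 1)) * M < J" "K > 0"
  using eventually_happens'[OF trivial_limit_at_top_linorder eventually_conj[OF _ eventually_gt_at_top[of 0]]] by blast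
 thus False using JK by force
qed

section \<open>Curves of test functions and Fubini's theorem\<close>

lemma test_slice: assumes "test f" shows "test (%x. f (t::real, x::'a::euclidean_space))"
proof -
 obtain r where r: "!!z. f z ~= 0 ==> norm z <= r" using test_support[OF assms] by blast
 have "norm x <= r" if "f (t, x) ~= 0" for x using r[OF that] norm_snd_le[of x t] by linarith
 thus ?thesis unfolding test_iff using smooth_slice[OF test_smooth[OF assms]] by blast
qed

abbreviation slice :: "(real \<times> 'a::euclidean_space => real) => real => 'a ell2" where
 "slice f t \<equiv> cls (%x. f (t, x))"

lemma slice_L2: "test f ==> (%x. f (t::real, x)) \<in> L2"
 by (rule test_L2[OF test_slice])

text \<open>The second-order Taylor bound is uniform in space and all supports lie in one ball, so
  differentiability in time holds in the \<open>L2\<close> norm.\<close>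

lemma slice_derivative:
 fixes f :: "real \<times> 'a::euclidean_space => real"
 assumes f: "test f"
 shows "(slice f has_vector_derivative slice (partial_t f) t) (at t within S)"
proof -
 note ft = test_partial[OF f Basis_pair(2)]
 obtain C where C: "C >= 0" "!!x h. \<bar>f (x + h) - f x - (\<Sum>b\<in>Basis. (h \<bullet> b) * pd b f x)\<bar> <= C * (norm h)^2"
  using test_taylor[OF f] by blast
 obtain r where r: "!!z. f z ~= 0 ==> norm z <= r" using test_support[OF f] by blast
 have tay: "\<bar>f (t + h, x) - f (t, x) - h * partial_t f (t, x)\<bar> <= C * (norm h)^2" for h x
 proof -
  have "(\<Sum>b\<in>Basis. ((h, 0 :: 'a) \<bullet> b) * pd b f (t, x)) = h * partial_t f (t, x)"
   unfolding Basis_prod_def by (subst sum.union_disjoint) (auto simp: sum.reindex inj_on_def)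
  thus ?thesis using C(2)[of "(t, x)" "(h, 0)"] by simp
 qed
 have "(slice f has_derivative (%h. h *R slice (partial_t f) t)) (at t)"
 proof (rule has_derivative_quadratic[OF bounded_linear_scaleR_left])
  fix h
  let ?g = "%x. f (t + h, x) - f (t, x) - h * partial_t f (t, x)"
  have g: "?g \<in> L2" by (intro L2_diff L2_cmult slice_L2 f ft)
  have "norm (cls ?g) <= (C * (norm h)^2) * sqrt (measure lborel (cball (0::'a) r))"
  proof (rule L2_norm_bound_on_ball[OF g tay])
   fix x :: 'a assume "r < norm x"
   hence "r < norm (s, x)" for s using norm_snd_le[of x s] by linarith
   hence "f (s, x) = 0" "partial_t f (s, x) = 0" for s
    using r pd_zero_outside[of f r "(1, 0)" "(s, x)"] by (auto simp: not_le[symmetric])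
   thus "?g x = 0" by simp
  qed (use C in auto)
  thus "norm (slice f (t + h) - slice f t - h *R slice (partial_t f) t) <= (C * sqrt (measure lborel (cball (0::'a) r))) * (norm h)^2"
   by (simp add: cls_diff cls_cmult slice_L2 f ft L2_diff L2_cmult mult_ac)
 qed
 thus ?thesis unfolding has_vector_derivative_def by (rule has_derivative_at_withinI)
qed

lemma slice_continuous: "test f ==> continuous_on S (slice f)"
 by (rule continuous_on_vector_derivative[OF slice_derivative])

text \<open>\<open>h\<close> is only measurable for the completed measure. A Borel function
  \<open>k\<close> equal to it almost everywhere goes through Fubini's theorem, and for almost every
  \<open>t\<close> the slices of \<open>k\<close> can be exchanged back for those of
  \<open>h\<close>.\<close>

lemma Fubini_lebesgue:
 fixes h :: "real \<times> 'a::euclidean_space => real"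
 assumes h: "integrable lebesgue h" and out: "!!t x. t \<notin> {0..r} ==> h (t, x) = 0"
  and inside: "!!t. t \<in> {0..r} ==> lmeas (%x. h (t, x))"
   "!!t. t \<in> {0..r} ==> (LINT x|lebesgue. h (t, x)) = c t"
  and c: "C0 r c"
 shows "(LINT z|lebesgue. h z) = I0 r c"
proof -
 obtain k where k: "k \<in> borel_measurable lborel" "AE z in lborel. h z = k z"
  using completion_ex_borel_measurable_real[OF borel_measurable_integrable[OF h]] by blast
 have km [measurable]: "k \<in> borel_measurable borel" using k(1) by simp
 have hk: "AE z in lebesgue. h z = k z" by (rule AE_completion[OF k(2)])
 have ki: "integrable (lborel \<Otimes>\<^sub>M lborel) k" using integrable_cong_AE[OF borel_measurable_integrable[OF h] measurable_completion[OF k(1)] hk] h by (simp add: integrable_completion lborel_prod)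
 have "(LINT z|lebesgue. h z) = (LINT z|lebesgue. k z)"
  by (rule integral_cong_AE[OF borel_measurable_integrable[OF h] measurable_completion[OF k(1)] hk])
 also have "... = (LINT z|(lborel \<Otimes>\<^sub>M lborel). k z)" by (simp add: lborel_prod integral_completion)
 also have "... = (LINT t|lborel. LINT x|lborel. k (t, x))" by (rule lborel_pair.integral_fst'[OF ki, symmetric])
 also have "... = (LINT t|lborel. indicator {0..r} t * c t)"
 proof (rule integral_cong_AE)
  show "(%t. LINT x|lborel. k (t, x)) \<in> borel_measurable lborel" by simp
  show "(%t. indicator {0..r} t * c t) \<in> borel_measurable lborel"
   using borel_measurable_continuous_on_indicator[OF _ c] by simp
  have "AE z in lborel \<Otimes>\<^sub>M lborel. h z = k z" by (subst lborel_prod) (rule k(2))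
  from lborel_pair.AE_pair[OF this]
  show "AE t in lborel. (LINT x|lborel. k (t, x)) = indicator {0..r} t * c t"
  proof eventually_elim
   case (elim t)
   have m: "(%x. k (t, x)) \<in> borel_measurable borel" by simp
   have "(LINT x|lborel. k (t, x)) = (LINT x|lebesgue. k (t, x))" by (rule integral_lebesgue_borel[OF m, symmetric])
   also have "... = (LINT x|lebesgue. h (t, x))"
   proof (rule integral_cong_AE)
    show "lmeas (%x. k (t, x))" by (intro measurable_completion) simp
    show "lmeas (%x. h (t, x))" using inside(1)[of t] out[of t] by force
    show "AE x in lebesgue. k (t, x) = h (t, x)" using AE_completion[OF elim] by auto
   qed
   also have "... = indicator {0..r} t * c t" using inside(2)[of t] out[of t] by (cases "t \<in> {0..r}") auto
   finally show ?case .
  qed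
 qed
 also have "... = I0 r c"
  using set_borel_integral_eq_integral(2)[OF borel_integrable_atLeastAtMost'[OF c]] by (simp add: set_lebesgue_integral_def)
 finally show ?thesis .
qed

text \<open>The compact support of \<open>f\<close> reduces the integral to a compact slab, where
  \<open>w\<close> is integrable; on each time slice the integral is an inner product of two
  \<open>L2\<close> functions.\<close>

lemma space_time_integral:
 fixes w :: "real \<times> 'a::euclidean_space => real" and f :: "real \<times> 'a => real"
 assumes m: "set_borel_measurable lebesgue (I \<times> UNIV) w"
  and loc: "!!K. compact K ==> K \<subseteq> I \<times> UNIV ==> set_integrable lebesgue K w"
  and I: "I \<subseteq> {0..}" "{0..s} \<subseteq> I"
  and w: "!!t. t \<in> {0..s} ==> (%x. w (t, x)) \<in> L2" "C0 s (%t. cls (%x. w (t, x)))"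
  and f: "test f" "!!t x. f (t, x) ~= 0 ==> t <= s"
 shows "(LINT z:I \<times> UNIV|lebesgue. w z * f z) = I0 s (%t. cls (%x. w (t, x)) \<bullet> slice f t)"
 unfolding set_lebesgue_integral_def
proof (rule Fubini_lebesgue)
 obtain r where r: "!!z. f z ~= 0 ==> norm z <= r" using test_support[OF f(1)] by blast
 obtain C where C: "C >= 0" "!!z. \<bar>f z\<bar> <= C" using test_bounded[OF f(1)] by blast
 define K where "K = {0..s} \<times> cball (0::'a) r"
 have "compact K" "K \<subseteq> I \<times> UNIV" using I unfolding K_def by (auto intro: compact_Times)
 hence Ki: "set_integrable lebesgue K w" by (rule loc)
 have [measurable]: "lmeas f" by (rule L2D(1)[OF test_L2[OF f(1)]])
 have e: "indicator (I \<times> UNIV) z *R (w z * f z) = (indicator K z *R w z) * f z" for z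
 proof (cases "f z = 0")
  case False
  obtain t x where z: "z = (t, x)" by (cases z)
  have "t <= s" "norm x <= r" using f(2) r[OF False] False norm_snd_le[of x t] z by auto
  thus ?thesis using I z by (auto simp: K_def indicator_def)
 qed simp
 show "integrable lebesgue (%z. indicator (I \<times> UNIV) z *R (w z * f z))"
  unfolding e
 proof (rule LINT_bound[OF integrable_mult_left[OF Ki[unfolded set_integrable_def], of C]])
  show "lmeas (%z. (indicator K z *R w z) * f z)" using Ki by (auto simp: set_integrable_def)
  show "AE z in lebesgue. norm ((indicator K z *R w z) * f z) <= norm ((indicator K z *R w z) * C)"
   using C by (intro AE_I2) (auto simp: abs_mult intro!: mult_left_mono)
 qed
 show "indicator (I \<times> UNIV) (t, x) *R (w (t, x) * f (t, x)) = 0" if "t \<notin> {0..s}" for t x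
  using that f(2)[of t x] I(1) by force
 have i: "indicator (I \<times> UNIV) (t, x) *R (w (t, x) * f (t, x)) = w (t, x) * f (t, x)" if "t \<in> {0..s}" for t x
  using that I by auto
 show "lmeas (%x. indicator (I \<times> UNIV) (t, x) *R (w (t, x) * f (t, x)))" if t: "t \<in> {0..s}" for t
  unfolding i[OF t] by (intro borel_measurable_times L2D(1)[OF w(1)[OF t]] L2D(1)[OF slice_L2[OF f(1)]])
 show "(LINT x|lebesgue. indicator (I \<times> UNIV) (t, x) *R (w (t, x) * f (t, x))) = cls (%x. w (t, x)) \<bullet> slice f t" if t: "t \<in> {0..s}" for t
  unfolding i[OF t] by (simp add: inner_cls w(1)[OF t] slice_L2[OF f(1)])
 show "C0 s (%t. cls (%x. w (t, x)) \<bullet> slice f t)"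
  by (intro continuous_on_inner w(2) slice_continuous f(1))
qed

text \<open>The support is compact in an open set, which leaves room for two times: \<open>f\<close>
  vanishes after \<open>r\<close>, hence in a neighbourhood of \<open>l\<close>, and
  \<open>l\<close> is still below \<open>T\<close>.\<close>

lemma test_time_bound:
 fixes f :: "real \<times> 'a::euclidean_space => real"
 assumes f: "f \<in> test_functions ({t. ereal t < T} \<times> UNIV)" and T: "0 < T"
 obtains r l where "0 < r" "r < l" "ereal l < T" "!!t x. f (t, x) ~= 0 ==> t <= r"
proof -
 define K where "K = fst ` closure {z. f z ~= 0}"
 have K: "compact K" "!!t. t \<in> K ==> ereal t < T" "!!t x. f (t, x) ~= 0 ==> t \<in> K"
 proof -
  have c: "compact (closure {z. f z ~= 0})" "closure {z. f z ~= 0} \<subseteq> {t. ereal t < T} \<times> UNIV"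
   using f by (simp_all add: test_functions_def)
  show "compact K" unfolding K_def by (rule compact_continuous_image[OF continuous_on_fst[OF continuous_on_id] c(1)])
  show "ereal t < T" if "t \<in> K" for t using c(2) that by (auto simp: K_def)
  show "t \<in> K" if "f (t, x) ~= 0" for t x
  proof -
   have "(t, x) \<in> closure {z. f z ~= 0}" by (rule subsetD[OF closure_subset]) (use that in simp)
   thus ?thesis unfolding K_def by force
  qed
 qed
 obtain s where s: "0 < s" "ereal s < T" using ereal_dense2[OF T] by auto
 have "EX M. ereal M < T \<and> (ALL t:K. t <= M)"
 proof (cases "K = {}")
  case True
  thus ?thesis using s by blast
 next
  case False
  then obtain M where "M \<in> K" "ALL t:K. t <= M" using compact_attains_sup[OF K(1)] by blast
  thus ?thesis using K(2) by blast
 qed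
 then obtain M where M: "ereal M < T" "!!t. t \<in> K ==> t <= M" by blast
 have "ereal (max s M) < T" using s M by simp
 then obtain l where l: "ereal (max s M) < ereal l" "ereal l < T" using ereal_dense2 by blast
 show thesis by (rule that[of "max s M" l]) (use s l M(2)[OF K(3)] in "auto simp: le_max_iff_disj")
qed

section \<open>Energy solutions and the abstract equation\<close>

lemma Sobolev_H_iff: "f \<in> Sobolev_H k \<longleftrightarrow> f \<in> L2 \<and> cls f \<in> Hs k"
proof -
 have "(EX g:L2. has_weak_deriv f bs g) \<longleftrightarrow> (EX g. has_wderiv (cls f) bs g)" if "f \<in> L2" "bs \<in> lists Basis" for bs
 proof
  assume "EX g. has_wderiv (cls f) bs g"
  then obtain g where "has_wderiv (cls f) bs (cls (rep g))" by (metis rep(2))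
  thus "EX g:L2. has_weak_deriv f bs g" using has_wderiv_cls[OF that(1) rep(1) that(2)] rep(1) by blast
 qed (use has_wderiv_cls that in blast)
 thus ?thesis unfolding Sobolev_H_def Hs_def by blast
qed

lemma weak_deriv_cls:
 assumes f: "f \<in> L2" "cls f \<in> Hs k" and bs: "bs \<in> lists Basis" "length bs <= k"
 shows "weak_deriv bs f \<in> L2" "cls (weak_deriv bs f) = wderiv bs (cls f)"
proof -
 have "EX g. g \<in> L2 \<and> has_weak_deriv f bs g" using f bs Sobolev_H_iff[of f k] by (auto simp: Sobolev_H_def)
 from someI_ex[OF this] have w: "weak_deriv bs f \<in> L2" "has_weak_deriv f bs (weak_deriv bs f)" by (auto simp: weak_deriv_def)
 thus "weak_deriv bs f \<in> L2" "cls (weak_deriv bs f) = wderiv bs (cls f)"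
  using has_wderiv_cls[OF f(1) w(1) bs(1)] by (auto intro!: wderiv_eq[symmetric])
qed

lemma H_norm_eq:
 assumes f: "f \<in> L2" "cls f \<in> Hs k"
 shows "(H_norm k f)^2 = (\<Sum>j\<le>k. \<Sum>bs\<in>words j. (norm (wderiv bs (cls f)))^2)"
proof -
 have "(H_norm k f)^2 = (\<Sum>bs \<in> {bs \<in> lists Basis. length bs <= k}. (L2_norm (weak_deriv bs f))^2)"
  unfolding H_norm_def by (simp add: sum_nonneg)
 also have "... = (\<Sum>bs \<in> {bs \<in> lists Basis. length bs <= k}. (norm (wderiv bs (cls f)))^2)"
  by (intro sum.cong refl) (metis (mono_tags, lifting) mem_Collect_eq weak_deriv_cls[OF f] norm_cls)
 finally show ?thesis by (simp only: sum_words_atMost)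
qed

text \<open>\<open>H_norm\<close> contains all orders, the form norm only the orders 0 and
  \<open>k\<close>, which are distinct as \<open>k >= 1\<close>. Interpolation bounds each of the
  \<open>k + 1\<close> orders by the squared form norm.\<close>

lemma H_norm_equiv:
 assumes f: "f \<in> L2" "cls f \<in> Hs k" and k: "k >= 1"
 shows "sob.N k (cls f) <= H_norm k f" "H_norm k f <= sqrt (real (Suc k)) * sob.N k (cls f)"
proof -
 let ?v = "cls f"
 have H: "0 <= H_norm k f" unfolding H_norm_def by (intro real_sqrt_ge_zero sum_nonneg) simp
 have N: "(sob.N k ?v)^2 = ?v \<bullet> ?v + hform k ?v ?v" using sob.nonneg[OF f(2)] by (simp add: sob.N_def)
 have "?v \<bullet> ?v + hform k ?v ?v = (\<Sum>j\<in>{0, k}. \<Sum>bs\<in>words j. (norm (wderiv bs ?v))^2)"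
  using k by (simp add: hform_def power2_norm_eq_inner)
 also have "... <= (H_norm k f)^2" unfolding H_norm_eq[OF f] by (intro sum_mono2 sum_nonneg) auto
 finally show "sob.N k ?v <= H_norm k f" unfolding N[symmetric] using H by (rule power2_le_imp_le)
 have "(H_norm k f)^2 <= (\<Sum>j\<le>k. ?v \<bullet> ?v + hform k ?v ?v)"
  unfolding H_norm_eq[OF f] by (intro sum_mono Hs_interpolation f) simp
 also have "... = (sqrt (real (Suc k)) * sob.N k ?v)^2" by (simp add: N power_mult_distrib)
 finally show "H_norm k f <= sqrt (real (Suc k)) * sob.N k ?v"
  by (rule power2_le_imp_le) (simp add: sob.N_def sob.nonneg[OF f(2)])
qed

lemma continuous_in_H_iff:
 assumes k: "k >= 1"
 shows "continuous_in_H k I u \<longleftrightarrow> (ALL t:I. u t \<in> L2) \<and> sob.Vcont k I (%t. cls (u t))"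
proof -
 have "((%s. H_norm k (%x. u s x - u t x)) ---> 0) (at t within I) \<longleftrightarrow> ((%s. sob.N k (cls (u s) - cls (u t))) ---> 0) (at t within I)"
  if u: "!!t. t \<in> I ==> u t \<in> L2 \<and> cls (u t) \<in> Hs k" and t: "t \<in> I" for t
 proof -
  have e: "sob.N k (cls (u s) - cls (u t)) <= H_norm k (%x. u s x - u t x)"
   "H_norm k (%x. u s x - u t x) <= sqrt (real (Suc k)) * sob.N k (cls (u s) - cls (u t))"
   "0 <= sob.N k (cls (u s) - cls (u t))" if "s \<in> I" for s using u[OF t] u[OF that] H_norm_equiv[OF _ _ k, of "%x. u s x - u t x"] by (auto simp: L2_diff cls_diff sob.V_diff)
  have I: "\<forall>\<^sub>F s in at t within I. s \<in> I" by (auto simp: eventually_at_filter)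
  show ?thesis
  proof
   assume l: "((%s. H_norm k (%x. u s x - u t x)) ---> 0) (at t within I)"
   show "((%s. sob.N k (cls (u s) - cls (u t))) ---> 0) (at t within I)"
    by (rule tendsto_sandwich[OF eventually_mono[OF I e(3)] eventually_mono[OF I e(1)] tendsto_const l])
  next
   assume l: "((%s. sob.N k (cls (u s) - cls (u t))) ---> 0) (at t within I)"
   show "((%s. H_norm k (%x. u s x - u t x)) ---> 0) (at t within I)"
    by (rule tendsto_sandwich[OF eventually_mono[OF I order_trans[OF e(3,1)]] eventually_mono[OF I e(2)] tendsto_const])
     (assumption | rule tendsto_mult_right_zero[OF l])+
  qed
 qed
 thus ?thesis unfolding continuous_in_H_def sob.Vcont_def Sobolev_H_iff by blast
qed

lemma continuous_in_L2_iff: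
 "continuous_in_L2 I w \<longleftrightarrow> (ALL t:I. w t \<in> L2) \<and> continuous_on I (%t. cls (w t))"
proof -
 have "((%s. L2_norm (%x. w s x - w t x)) ---> 0) (at t within I) \<longleftrightarrow> ((%s. cls (w s)) ---> cls (w t)) (at t within I)"
  if w: "ALL t:I. w t \<in> L2" and t: "t \<in> I" for t
 proof -
  have "((%s. L2_norm (%x. w s x - w t x)) ---> 0) (at t within I) \<longleftrightarrow> ((%s. norm (cls (w s) - cls (w t))) ---> 0) (at t within I)"
   by (rule Lim_cong_within) (use w t in "auto simp: norm_cls[symmetric] L2_diff cls_diff")
  thus ?thesis by (simp add: tendsto_norm_zero_iff LIM_zero_iff)
 qed
 thus ?thesis unfolding continuous_in_L2_def continuous_on_def by blast
qed

lemma has_L2_deriv_iff: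
 assumes u: "u t \<in> L2" "\<forall>\<^sub>F s in at t within {0..}. u s \<in> L2"
 shows "has_L2_deriv u w t \<longleftrightarrow> w \<in> L2 \<and> ((%t. cls (u t)) has_vector_derivative cls w) (at t within {0..})"
proof -
 let ?U = "%t. cls (u t)"
 have "((%s. L2_norm (%x. (u s x - u t x) / (s - t) - w x)) ---> 0) (at t within {0..})
  \<longleftrightarrow> ((%s. norm ((?U s - ?U t) - (s - t) *R cls w) / norm (s - t)) ---> 0) (at t within {0..})" if w: "w \<in> L2"
 proof (rule tendsto_cong)
  have "\<forall>\<^sub>F s in at t within {0..}. s ~= t" by (simp add: eventually_at_filter)
  with u(2) show "\<forall>\<^sub>F s in at t within {0..}. L2_norm (%x. (u s x - u t x) / (s - t) - w x) = norm ((?U s - ?U t) - (s - t) *R cls w) / norm (s - t)"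
  proof eventually_elim
   case (elim s)
   have d: "(%x. inverse (s - t) * (u s x - u t x)) \<in> L2" by (intro L2_cmult L2_diff elim u)
   have "L2_norm (%x. (u s x - u t x) / (s - t) - w x) = norm (cls (%x. inverse (s - t) * (u s x - u t x) - w x))"
    using norm_cls[OF L2_diff[OF d w]] by (simp add: divide_inverse mult.commute)
   also have "... = norm (inverse (s - t) *R (?U s - ?U t) - cls w)"
    using d elim u w by (simp add: cls_diff cls_cmult L2_diff)
   also have "inverse (s - t) *R (?U s - ?U t) - cls w = inverse (s - t) *R ((?U s - ?U t) - (s - t) *R cls w)"
    using elim by (simp add: scaleR_diff_right)
   finally show ?case by (simp add: divide_inverse)
  qed
 qed
 thus ?thesis
  unfolding has_L2_deriv_def has_vector_derivative_def has_derivative_iff_norm by (auto intro: bounded_linear_scaleR_left)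
qed

lemma eventually_time_interval:
 assumes "t \<in> time_interval T" shows "\<forall>\<^sub>F s in at t within {0..}. s \<in> time_interval T"
proof -
 have "open {s. ereal s < T}" by (rule open_Collect_less) (auto intro: continuous_on_ereal)
 hence "\<forall>\<^sub>F s in nhds t. ereal s < T" using assms by (intro eventually_nhds_in_open[of "{s. ereal s < T}", simplified]) (auto simp: time_interval_def)
 thus ?thesis by (auto simp: eventually_at_filter time_interval_def elim: eventually_mono)
qed

lemma C1_in_L2_D:
 assumes c: "C1_in_L2 (time_interval T) u" and t: "t \<in> time_interval T"
 shows "((%t. cls (u t)) has_vector_derivative cls (L2_deriv u t)) (at t within {0..})"
proof -
 have "has_L2_deriv u (L2_deriv u t) t" using c t someI_ex[of "%w. has_L2_deriv u w t"] by (auto simp: C1_in_L2_def L2_deriv_def)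
 moreover have "u t \<in> L2" "\<forall>\<^sub>F s in at t within {0..}. u s \<in> L2"
  using c t eventually_mono[OF eventually_time_interval[OF t]] by (auto simp: C1_in_L2_def)
 ultimately show ?thesis using has_L2_deriv_iff by blast
qed

text \<open>Vector derivatives on an interval are unique, so whichever function is chosen in
  \<open>L2_deriv\<close>, its class must be \<open>W t\<close>.\<close>

lemma C1_in_L2_I:
 assumes u: "!!t. t \<in> time_interval T ==> u t \<in> L2"
  and d: "!!t. t \<in> time_interval T ==> ((%t. cls (u t)) has_vector_derivative W t) (at t within {0..})"
  and W: "continuous_on (time_interval T) W"
 shows "C1_in_L2 (time_interval T) u" "!!t. t \<in> time_interval T ==> L2_deriv u t \<in> L2 \<and> cls (L2_deriv u t) = W t"
proof -
 have ex: "has_L2_deriv u (rep (W t)) t" and un: "has_L2_deriv u w t ==> w \<in> L2 \<and> cls w = W t" if t: "t \<in> time_interval T" for t w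
 proof -
  have "\<forall>\<^sub>F s in at t within {0..}. u s \<in> L2" using eventually_time_interval[OF t] by eventually_elim (rule u)
  note i = has_L2_deriv_iff[OF u[OF t] this]
  show "has_L2_deriv u (rep (W t)) t" unfolding i using rep d[OF t] by metis
  assume "has_L2_deriv u w t"
  hence w: "w \<in> L2" "((%t. cls (u t)) has_vector_derivative cls w) (at t within {0..})" unfolding i by auto
  have "cls w = W t"
   by (rule vector_derivative_unique_within_closed_interval[of 0 "t + 1" t "%t. cls (u t)"])
    (use t w(2) d[OF t] in "auto simp: time_interval_def intro: has_vector_derivative_within_subset")
  thus "w \<in> L2 \<and> cls w = W t" using w by blast
 qed
 show L: "!!t. t \<in> time_interval T ==> L2_deriv u t \<in> L2 \<and> cls (L2_deriv u t) = W t"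
  unfolding L2_deriv_def using un someI[of "%w. has_L2_deriv u w _", OF ex] by blast
 have "continuous_on (time_interval T) (%t. cls (L2_deriv u t)) \<longleftrightarrow> continuous_on (time_interval T) W"
  by (intro continuous_on_cong refl) (use L in blast)
 thus "C1_in_L2 (time_interval T) u"
  unfolding C1_in_L2_def continuous_in_L2_iff using u ex L W by blast
qed

lemmas has_vector_derivative_inner = bounded_bilinear.has_vector_derivative[OF bounded_bilinear_inner]

text \<open>Integrating by parts in time once more turns the weak formulation into an identity in which
 the test function enters only through its time derivative.\<close>

lemma weak_core:
 fixes U W F :: "real => 'a::euclidean_space ell2"
 assumes r: "0 < r" "r < l" and c: "C0 l U" "C0 l W" "C0 l F" and U0: "U 0 = 0"
  and D: "!!t. t \<in> {0..l} ==> (U has_vector_derivative W t) (at t within {0..l})"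
  and f: "test f" "!!t x. f (t, x) ~= 0 ==> t <= r"
 shows "I0 l (%t. F t \<bullet> slice f t) + y0 \<bullet> slice f 0 = I0 l (%t. U t \<bullet> slice (adj_op sg f) t)
  \<longleftrightarrow> I0 l (%t. (U t + W t - I0 t F - y0) \<bullet> slice (partial_t f) t
     + I0 t (%s. U s + W s) \<bullet> slice ((lap_x ^^ sg) (partial_t f)) t) = 0"
proof -
 define L :: "(real \<times> 'a => real) => real \<times> 'a => real" where "L = lap_x ^^ sg"
 define S G where "S t = I0 t U" and "G t = I0 t F" for t
 have cS: "C0 l S" "C0 l G" unfolding S_def G_def by (intro cont_int0 c)+
 have t1: "test (partial_t f)" by (intro test_partial f Basis_pair)
 have tests: "test (partial_t (partial_t f))" "test (L f)" "test (L (partial_t f))"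
  unfolding L_def by (intro test_partial test_lap_x_pow f Basis_pair)+
 note ts = f(1) t1 tests
 have Lt: "partial_t (L f) = L (partial_t f)" unfolding L_def by (rule partial_t_lap_x_pow[OF test_smooth[OF f(1)]])
 have Y: "I0 t (%s. U s + W s) = S t + U t" if t: "t \<in> {0..l}" for t
 proof -
  have "(W has_integral U t - U 0) {0..t}"
   using t by (intro fundamental_theorem_of_calculus has_vector_derivative_within_subset[OF D]) auto
  from has_integral_add[OF integrable_integral[OF int_initial[OF c(1) t]] this] show ?thesis using U0 unfolding S_def by auto
 qed
 define z where "z t = (U t + W t - G t - y0) \<bullet> slice (partial_t f) t + (S t + U t) \<bullet> slice (L (partial_t f)) t" for t
 define e where "e t = (U t \<bullet> slice (adj_op sg f) t - F t \<bullet> slice f t) + z t" for t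
 have adj: "slice (adj_op sg f) t = slice (partial_t (partial_t f)) t - slice (L (partial_t f)) t + slice (L f) t - slice (partial_t f) t" for t
  unfolding adj_op_def L_def[symmetric] by (simp add: cls_add cls_diff L2_add L2_diff slice_L2 ts)
 \<comment> \<open>The boundary term whose time derivative is \<open>e\<close>. It vanishes at
   \<open>l\<close>, since \<open>f\<close> is 0 nearby, and at 0 only the term with
   \<open>y0\<close> is left because \<open>U 0 = 0\<close>.\<close>
 define E where "E t = U t \<bullet> slice (partial_t f) t + S t \<bullet> slice (L f) t - G t \<bullet> slice f t - y0 \<bullet> slice f t" for t
 have "(e has_integral E l - E 0) {0..l}"
 proof (rule fundamental_theorem_of_calculus)
  fix t assume t: "t \<in> {0..l}"
  have "(E has_vector_derivative (U t \<bullet> slice (partial_t (partial_t f)) t + W t \<bullet> slice (partial_t f) t)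
    + (S t \<bullet> slice (L (partial_t f)) t + U t \<bullet> slice (L f) t) - (G t \<bullet> slice (partial_t f) t + F t \<bullet> slice f t)
    - (y0 \<bullet> slice (partial_t f) t + 0 \<bullet> slice f t)) (at t within {0..l})"
   unfolding E_def Lt[symmetric] S_def G_def
   by (intro has_vector_derivative_diff has_vector_derivative_add has_vector_derivative_inner slice_derivative ts D[OF t]
     integral_has_vector_derivative[OF _ t] c has_vector_derivative_const)
  thus "(E has_vector_derivative e t) (at t within {0..l})"
   by (simp add: e_def z_def adj algebra_simps)
 qed (use r in simp)
 moreover have "E 0 = - (y0 \<bullet> slice f 0)" using U0 by (simp add: E_def S_def G_def)
 moreover have "E l = 0"
 proof -
  have z0: "f (t, x) = 0" if "r < t" for t x using f(2) that by force
  have "open {z :: real \<times> 'a. r < fst z}" by (intro open_Collect_less continuous_intros)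
  hence "partial_t f (l, x) = 0" for x
   by (rule pd_const_on_open[of _ f 0]) (use z0 r in "auto simp: split_paired_all")
  moreover have f0: "(%x. f (l, x)) = (%x. 0 * 0)" using z0[OF r(2)] by simp
  moreover have "L f (l, x) = 0" for x
   using fun_cong[OF lap_pow_cmult[OF smooth_const[of 0], of sg 0], of x] unfolding L_def fun_cong[OF lap_pow_slice[of sg f l], symmetric] f0 by simp
  ultimately show ?thesis by (simp add: E_def cls_zero)
 qed
 ultimately have I: "(e has_integral y0 \<bullet> slice f 0) {0..l}" by simp
 have i: "(%t. U t \<bullet> slice (adj_op sg f) t) integrable_on {0..l}" "(%t. F t \<bullet> slice f t) integrable_on {0..l}" "z integrable_on {0..l}"
  unfolding adj z_def[abs_def]
  by (intro integrable_continuous_real continuous_on_inner continuous_on_add continuous_on_diff continuous_on_const c cS slice_continuous ts)+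
 have "I0 l e = I0 l (%t. U t \<bullet> slice (adj_op sg f) t) - I0 l (%t. F t \<bullet> slice f t) + I0 l z"
  unfolding e_def using i by (simp add: Henstock_Kurzweil_Integration.integral_add Henstock_Kurzweil_Integration.integral_diff integrable_diff)
 moreover have "I0 l z = I0 l (%t. (U t + W t - I0 t F - y0) \<bullet> slice (partial_t f) t
     + I0 t (%s. U s + W s) \<bullet> slice ((lap_x ^^ sg) (partial_t f)) t)"
  by (rule integral_cong) (simp add: z_def Y G_def L_def)
 ultimately show ?thesis using integral_unique[OF I] by linarith
qed

lemma deriv_step_zero: assumes "x < 0 \<or> x > 1" shows "deriv step x = 0"
proof (cases "x < 0")
 case True
 thus ?thesis using pd_const_on_open[of "{..<0}" step 0 x 1] step_0 by (simp add: pd_real)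
next
 case False
 thus ?thesis using pd_const_on_open[of "{1<..}" step 1 x 1] step_1 assms by (simp add: pd_real)
qed

text \<open>On nonnegative times the cut-off falls from 1 to 0 between \<open>t0 - e\<close> and
  \<open>t0\<close>, so minus its derivative approximates a point mass at \<open>t0\<close>. The
  factor \<open>step (t + 2)\<close> makes the support compact on the negative side.\<close>

lemma time_cutoff:
 assumes e: "0 < e" "e <= t0"
 obtains h :: "real => real" where "smooth h" "!!t. h t ~= 0 ==> -2 <= t \<and> t <= t0" "h 0 = 1"
  "!!t. 0 <= t ==> deriv h t <= 0" "!!t. 0 <= t ==> deriv h t ~= 0 ==> \<bar>t - t0\<bar> <= e"
proof
 let ?h = "%t. step ((t0 - t) / e) * step (t + 2)"
 have "smooth (%t. step ((- 1 / e) *R t + t0 / e))" "smooth (%t. step (1 *R t + 2))" by (intro smooth_scale smooth_step)+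
 thus "smooth ?h" by (intro smooth_mult) (simp_all add: diff_divide_distrib)
 show "-2 <= t \<and> t <= t0" if "?h t ~= 0" for t
 proof -
  have "\<not> (t0 - t) / e <= 0" "\<not> t + 2 <= 0" using that step_0[of "(t0 - t) / e"] step_0[of "t + 2"] by auto
  thus ?thesis using e by (simp add: not_le zero_less_divide_iff)
 qed
 show "?h 0 = 1" using e by (simp add: step_1)
 have d: "deriv ?h t = deriv step ((t0 - t) / e) * (- 1 / e)" if t: "0 <= t" for t
 proof (rule DERIV_imp_deriv)
  have "((%t. (t0 - t) / e) has_real_derivative - 1 / e) (at t)" using e by (auto intro!: derivative_eq_intros)
  from DERIV_chain2[OF smooth_deriv_real[OF smooth_step] this]
  have "((%t. step ((t0 - t) / e)) has_real_derivative deriv step ((t0 - t) / e) * (- 1 / e)) (at t)" .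
  thus "(?h has_real_derivative deriv step ((t0 - t) / e) * (- 1 / e)) (at t)"
   by (rule has_field_derivative_transform_within_open[of _ _ _ "{-1<..}"]) (use t in "auto simp: step_1")
 qed
 show "deriv ?h t <= 0" if "0 <= t" for t
  unfolding d[OF that] using deriv_step_nonneg[of "(t0 - t) / e"] e by simp
 show "\<bar>t - t0\<bar> <= e" if "0 <= t" "deriv ?h t ~= 0" for t
 proof -
  have "\<not> ((t0 - t) / e < 0 \<or> (t0 - t) / e > 1)" using that(2) deriv_step_zero unfolding d[OF that(1)] by force
  thus ?thesis using e by (auto simp: divide_less_0_iff)
 qed
qed

text \<open>For a cut-off with \<open>h 0 = 1\<close> and \<open>h r = 0\<close> the derivative
  integrates to -1, so \<open>Z t0\<close> equals the integral of
  \<open>deriv h t * (Z t - Z t0)\<close>. This is small when \<open>deriv h\<close> is concentrated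
  where \<open>Z\<close> is close to \<open>Z t0\<close>.\<close>

lemma vanishing_of_concentration:
 fixes Z :: "real => real"
 assumes Z: "C0 r Z" and t0: "0 < t0" "t0 < r"
  and zero: "!!h. smooth h ==> (!!t. h t ~= 0 ==> -2 <= t \<and> t <= t0) ==> I0 r (%t. deriv h t * Z t) = 0"
 shows "Z t0 = 0"
proof -
 have "\<bar>Z t0\<bar> <= d" if d: "d > 0" for d
 proof -
  obtain s where s: "s > 0" "!!t. t \<in> {0..r} ==> dist t t0 < s ==> dist (Z t) (Z t0) < d"
   using Z t0 d unfolding continuous_on_iff by (metis atLeastAtMost_iff less_imp_le)
  define e where "e = min (s / 2) t0"
  have e: "0 < e" "e <= t0" "e < s" using s t0 by (auto simp: e_def)
  obtain h :: "real => real" where h: "smooth h" "!!t. h t ~= 0 ==> -2 <= t \<and> t <= t0" "h 0 = 1"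
   "!!t. 0 <= t ==> deriv h t <= 0" "!!t. 0 <= t ==> deriv h t ~= 0 ==> \<bar>t - t0\<bar> <= e" using time_cutoff[OF e(1,2)] by blast
  have D: "(h has_vector_derivative deriv h t) (at t within {0..r})" for t
   using smooth_deriv_real[OF h(1)] by (simp add: has_field_derivative_at_within has_real_derivative_iff_has_vector_derivative[symmetric])
  have "h r = 0" using h(2)[of r] t0 by auto
  hence I: "(deriv h has_integral - 1) {0..r}"
   using fundamental_theorem_of_calculus[of 0 r h, OF _ D] t0 h(3) by simp
  have cd: "continuous_on S (deriv h)" for S
   using smooth_continuous[OF smooth_partial[OF h(1), of 1]] by (simp add: pd_real[abs_def])
  have "((%t. deriv h t * Z t) has_integral 0) {0..r}"
   using integrable_integral[OF integrable_continuous_real[OF continuous_on_mult[OF cd Z]]] zero[OF h(1,2)] by simp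
  from has_integral_diff[OF this has_integral_mult_left[OF I, of "Z t0"]]
  have J: "((%t. deriv h t * (Z t - Z t0)) has_integral Z t0) {0..r}" by (simp add: right_diff_distrib)
  have "norm (I0 r (%t. deriv h t * (Z t - Z t0))) <= I0 r (%t. - deriv h t * d)"
  proof (rule integral_norm_bound_integral)
   show "(%t. deriv h t * (Z t - Z t0)) integrable_on {0..r}" using J by blast
   show "(%t. - deriv h t * d) integrable_on {0..r}" by (intro integrable_continuous_real continuous_intros cd)
   fix t assume t: "t \<in> {0..r}"
   show "norm (deriv h t * (Z t - Z t0)) <= - deriv h t * d"
   proof (cases "deriv h t = 0")
    case False
    thus ?thesis using h(5)[of t] t e s(2)[OF t] h(4)[of t] by (simp add: dist_real_def abs_mult)
   qed simp
  qed
  also have "... = d" using integral_unique[OF has_integral_mult_left[OF has_integral_neg[OF I], of d]] by simp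
  finally show ?thesis using integral_unique[OF J] by simp
 qed
 hence "\<bar>Z t0\<bar> <= 0" by (rule dense_ge)
 thus ?thesis by simp
qed

text \<open>Weak differentiation is tested against fixed functions and therefore commutes with the
  integral; continuity in the form norm makes each curve of derivatives continuous.\<close>

lemma Hs_integral:
 fixes U :: "real => 'a::euclidean_space ell2"
 assumes U: "sob.Vcont k {0..r} U" and t: "t \<in> {0..r}"
 shows "I0 t U \<in> Hs k"
 unfolding Hs_def
proof (intro CollectI ballI impI exI)
 fix bs :: "'a list" assume bs: "bs \<in> lists Basis" "length bs <= k"
 have "C0 r (%s. wderiv bs (U s))"
  unfolding continuous_on_def
 proof
  fix t assume t: "t \<in> {0..r}"
  have "((%s. wderiv bs (U s) - wderiv bs (U t)) ---> 0) (at t within {0..r})"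
  proof (rule Lim_null_comparison)
   show "((%s. sob.N k (U s - U t)) ---> 0) (at t within {0..r})" using U t by (simp add: sob.Vcont_def)
   show "\<forall>\<^sub>F s in at t within {0..r}. norm (wderiv bs (U s) - wderiv bs (U t)) <= sob.N k (U s - U t)"
    using sob.eventually_in_V[OF U]
   proof eventually_elim
    case (elim s)
    have "U t \<in> Hs k" using sob.Vcont_in_V[OF U t] .
    hence "norm (wderiv bs (U s - U t)) <= sob.N k (U s - U t)"
     unfolding sob.N_def by (intro real_le_rsqrt wderiv_norm_le bs sob.V_diff elim)
    thus ?case by (simp only: wderiv_diff[OF elim \<open>U t \<in> Hs k\<close> bs])
   qed
  qed
  thus "((%s. wderiv bs (U s)) ---> wderiv bs (U t)) (at t within {0..r})" by (rule LIM_zero_cancel)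
 qed
 note cd = this
 note cU = sob.Vcont_continuous[OF U]
 show "has_wderiv (I0 t U) bs (I0 t (%s. wderiv bs (U s)))"
  unfolding has_wderiv_def
 proof
  fix g :: "'a => real" assume g: "test g"
  have "I0 t U \<bullet> cls (ip bs g) = I0 t (%s. U s \<bullet> cls (ip bs g))"
   by (rule int_blin[OF cU t bounded_linear_inner_left, symmetric])
  also have "... = I0 t (%s. (- 1) ^ length bs * (wderiv bs (U s) \<bullet> cls g))"
   using t sob.Vcont_in_V[OF U] HsD[OF _ bs] g by (intro HK_cong) (auto simp: has_wderiv_def)
  also have "... = (- 1) ^ length bs * (I0 t (%s. wderiv bs (U s)) \<bullet> cls g)"
   by (subst integral_mult_right) (simp add: int_blin[OF cd t bounded_linear_inner_left])
  finally show "I0 t U \<bullet> cls (ip bs g) = (- 1) ^ length bs * (I0 t (%s. wderiv bs (U s)) \<bullet> cls g)" .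
 qed
qed

text \<open>A compact set has finite measure, so
  \<open>\<bar>r\<bar> <= 1 + \<bar>r\<bar> powr p\<close> gives integrability of \<open>u\<close>
  from that of its power.\<close>

lemma Lp_loc_set_integrable:
 fixes u :: "real => 'a::euclidean_space => real"
 assumes L: "Lp_loc p T u" and p: "p > 1" and K: "compact K" "K \<subseteq> time_interval T \<times> UNIV"
 shows "set_integrable lebesgue K (%z. \<bar>u (fst z) (snd z)\<bar> powr p)" "set_integrable lebesgue K (%z. u (fst z) (snd z))"
proof -
 show i: "set_integrable lebesgue K (%z. \<bar>u (fst z) (snd z)\<bar> powr p)"
  using L K unfolding Lp_loc_def by (simp add: case_prod_unfold)
 have Ks [measurable]: "K \<in> sets lebesgue" using K(1) by (simp add: lmeasurable_compact fmeasurableD)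
 have m: "lmeas (%z. indicator K z *R u (fst z) (snd z))"
 proof -
  have "lmeas (%z. indicator (time_interval T \<times> UNIV) z *R u (fst z) (snd z))"
   using L by (simp add: Lp_loc_def set_borel_measurable_def case_prod_unfold)
  hence "lmeas (%z. indicator K z *R (indicator (time_interval T \<times> UNIV) z *R u (fst z) (snd z)))" by simp
  moreover have "(%z. indicator K z *R (indicator (time_interval T \<times> UNIV) z *R u (fst z) (snd z))) = (%z. indicator K z *R u (fst z) (snd z))"
   using K(2) by (intro ext) (auto simp: indicator_def)
  ultimately show ?thesis by simp
 qed
 have iK: "integrable lebesgue (indicator K :: real \<times> 'a => real)"
  using fmeasurableD2[OF lmeasurable_compact[OF K(1)]] by (simp add: less_top)
 show "set_integrable lebesgue K (%z. u (fst z) (snd z))"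
  unfolding set_integrable_def
 proof (rule LINT_bound[OF Bochner_Integration.integrable_add[OF iK i[unfolded set_integrable_def]] m])
  have "\<bar>r\<bar> <= 1 + \<bar>r\<bar> powr p" for r :: real
  proof (cases "\<bar>r\<bar> <= 1")
   case False
   hence "\<bar>r\<bar> powr 1 <= \<bar>r\<bar> powr p" using p by (intro powr_mono) auto
   thus ?thesis by simp
  qed (simp add: add_increasing2)
  thus "AE z in lebesgue. norm (indicator K z *R u (fst z) (snd z)) <= norm (indicator K z + indicator K z *R (\<bar>u (fst z) (snd z)\<bar> powr p))"
   by (intro AE_I2) (auto simp: indicator_def)
 qed
qed

lemma adjoint_support:
 assumes "sg >= 1" "!!t x. f (t, x) ~= 0 ==> t <= r" "adj_op sg f (t, x) ~= 0" shows "t <= r"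
proof (rule ccontr)
 assume t: "\<not> t <= r"
 have "open {z :: real \<times> 'a. r < fst z}" by (intro open_Collect_less continuous_intros)
 hence "adj_op sg f (t, x) = 0"
 proof (rule adjoint_zero_on_open[OF assms(1)])
  fix z :: "real \<times> 'a" assume "z \<in> {z. r < fst z}"
  thus "f z = 0" using assms(2)[of "fst z" "snd z"] by auto
 qed (use t in simp)
 thus False using assms(3) by simp
qed

lemma adjoint_test: assumes "test f" shows "test (adj_op sg f)"
proof -
 have t: "test (partial_t f)" by (rule test_partial[OF assms Basis_pair(2)])
 show ?thesis unfolding adj_op_def[abs_def]
  by (intro test_diff test_add test_lap_x_pow test_partial[OF t Basis_pair(2)] t assms)
qed

context Sobolev_exponents
begin

lemma weak_formulation_typed:
 fixes u :: "real => 'a::euclidean_space => real" and f :: "real \<times> 'a => real"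
 assumes dim: "dim = real DIM('a)" and L: "Lp_loc p T u"
  and u: "ALL t:time_interval T. u t \<in> L2" "sob.Vcont sg (time_interval T) (%t. cls (u t))"
  and r: "0 <= r" "ereal r < T" and f: "test f" "ALL t x. f (t, x) ~= 0 --> t <= r"
 shows "(LINT z:time_interval T \<times> UNIV|lebesgue. \<bar>u (fst z) (snd z)\<bar> powr p * f z) = I0 r (%t. nonlin p (cls (u t)) \<bullet> slice f t)"
  and "(LINT z:time_interval T \<times> UNIV|lebesgue. u (fst z) (snd z) * adj_op sg f z) = I0 r (%t. cls (u t) \<bullet> slice (adj_op sg f) t)"
proof -
 interpret sl: semilinear_form "Hs sg" "hform sg" "nonlin p :: 'a ell2 => 'a ell2" by (rule semilinear_nonlin[OF dim])
 have sub: "{0..r} \<subseteq> time_interval T" using r(2) by (auto simp: time_interval_def intro: le_less_trans[of _ "ereal r"])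
 have I: "time_interval T \<subseteq> {0..}" by (auto simp: time_interval_def)
 have V: "sob.Vcont sg {0..r} (%t. cls (u t))" by (rule sob.Vcont_subset[OF u(2) sub])
 have m: "set_borel_measurable lebesgue (time_interval T \<times> UNIV) (%z. u (fst z) (snd z))"
  using L by (simp add: Lp_loc_def case_prod_unfold)
 have "lmeas (%z. \<bar>indicator (time_interval T \<times> UNIV) z *R u (fst z) (snd z)\<bar> powr p)" using m by (simp add: set_borel_measurable_def)
 moreover have "\<bar>indicator (time_interval T \<times> UNIV) z *R u (fst z) (snd z)\<bar> powr p = indicator (time_interval T \<times> UNIV) z *R (\<bar>u (fst z) (snd z)\<bar> powr p)" for z
  by (simp add: indicator_def)
 ultimately have mp: "set_borel_measurable lebesgue (time_interval T \<times> UNIV) (%z. \<bar>u (fst z) (snd z)\<bar> powr p)"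
  by (simp add: set_borel_measurable_def)
 have n: "(%x. \<bar>u t x\<bar> powr p) \<in> L2" "cls (%x. \<bar>u t x\<bar> powr p) = nonlin p (cls (u t))" if "t \<in> {0..r}" for t
  using powr_L2[OF dim] nonlin_cls[OF dim] bspec[OF u(1)] sob.Vcont_in_V[OF V that] that sub by auto
 have cn: "C0 r (%t. cls (%x. \<bar>u t x\<bar> powr p))"
  using sl.f_Vcont[OF V] by (rule continuous_on_eq) (simp add: n)
 have "(LINT z:time_interval T \<times> UNIV|lebesgue. \<bar>u (fst z) (snd z)\<bar> powr p * f z) = I0 r (%t. cls (%x. \<bar>u (fst (t, x)) (snd (t, x))\<bar> powr p) \<bullet> slice f t)"
  by (rule space_time_integral[OF mp Lp_loc_set_integrable(1)[OF L p] I sub _ _ f(1) f(2)[rule_format]]) (use n cn in auto)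
 also have "... = I0 r (%t. nonlin p (cls (u t)) \<bullet> slice f t)"
  by (rule HK_cong) (simp add: n)
 finally show "(LINT z:time_interval T \<times> UNIV|lebesgue. \<bar>u (fst z) (snd z)\<bar> powr p * f z) = I0 r (%t. nonlin p (cls (u t)) \<bullet> slice f t)" .
 have "(LINT z:time_interval T \<times> UNIV|lebesgue. u (fst z) (snd z) * adj_op sg f z) = I0 r (%t. cls (%x. u (fst (t, x)) (snd (t, x))) \<bullet> slice (adj_op sg f) t)"
  by (rule space_time_integral[OF m Lp_loc_set_integrable(2)[OF L p] I sub _ _ adjoint_test[OF f(1)] adjoint_support[OF sg f(2)[rule_format]]])
   (use u(1) sub sob.Vcont_continuous[OF V] in auto)
 thus "(LINT z:time_interval T \<times> UNIV|lebesgue. u (fst z) (snd z) * adj_op sg f z) = I0 r (%t. cls (u t) \<bullet> slice (adj_op sg f) t)" by simp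
qed

text \<open>Products of a function \<open>j\<close> of time and \<open>k\<close> of space turn the
  weak formulation into the vanishing of the integral of \<open>deriv j t * Z t\<close>.
  Concentrating \<open>j\<close> gives the integrated equation at each time, tested with
  \<open>k\<close>; density of test functions in the form norm then admits the vectors
  \<open>R h g\<close>, which is \<open>mild\<close>.\<close>

lemma energy_solution_sol:
 fixes u :: "real => 'a::euclidean_space => real"
 assumes dim: "dim = real DIM('a)" and e: "energy_solution sg p (%x. 0) u1 T u" and u1: "u1 \<in> L2"
  and l: "0 <= l" "ereal l < T"
 shows "semilinear_form.sol (Hs sg) (hform sg) (nonlin p) l 0 (cls u1) (%t. cls (u t)) (%t. cls (u t) + cls (L2_deriv u t))"
proof -
 interpret sl: semilinear_form "Hs sg" "hform sg" "nonlin p :: 'a ell2 => 'a ell2" by (rule semilinear_nonlin[OF dim])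
 define U W F where "U t = cls (u t)" and "W t = cls (L2_deriv u t)" and "F t = nonlin p (U t)" for t
 let ?I = "time_interval T"
 have eH: "continuous_in_H sg ?I u" and eC: "C1_in_L2 ?I u" and w: "is_weak_solution sg p (%x. 0) u1 T u" and T: "0 < T"
  and i0: "AE x in lebesgue. u 0 x = 0" "AE x in lebesgue. L2_deriv u 0 x = u1 x"
  using e by (auto simp: energy_solution_def)
 have uL: "ALL t:?I. u t \<in> L2" and V: "sob.Vcont sg ?I U"
  using eH unfolding continuous_in_H_iff[OF sg] U_def by auto
 have WL: "ALL t:?I. L2_deriv u t \<in> L2" and cW: "continuous_on ?I W"
  using eC unfolding C1_in_L2_def continuous_in_L2_iff W_def by auto
 have UW: "(U has_vector_derivative W t) (at t within {0..})" if "t \<in> ?I" for t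
  using C1_in_L2_D[OF eC that] by (simp add: U_def[abs_def] W_def)
 have sub: "{0..l} \<subseteq> ?I" if "ereal l < T" for l using that by (auto simp: time_interval_def intro: le_less_trans[of _ "ereal l"])
 have z: "0 \<in> ?I" using T by (simp add: time_interval_def zero_ereal_def)
 have U0: "U 0 = 0" "W 0 = cls u1"
  using i0 bspec[OF uL z] bspec[OF WL z] u1 by (simp_all add: U_def W_def cls_zero[symmetric] cls_eq_iff L2_zero)
 have D: "(U has_vector_derivative W t) (at t within {0..l})" if "t \<in> {0..l}" "ereal l < T" for t l
  using sub[OF that(2)] that(1) by (intro has_vector_derivative_within_subset[OF UW]) auto
 have c: "C0 l U" "C0 l W" "C0 l F" if "ereal l < T" for l
  using sob.Vcont_continuous[OF V] cW sl.f_Vcont[OF sob.Vcont_subset[OF V sub[OF that]]] sub[OF that]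
  by (auto simp: F_def[abs_def] intro: continuous_on_subset)
 have point: "(U t0 + W t0 - I0 t0 F - cls u1) \<bullet> cls k + I0 t0 (%s. U s + W s) \<bullet> cls (neg_laplacian_pow sg k) = 0"
  if t0: "0 < t0" "ereal t0 < T" and k: "test k" for t0 and k :: "'a => real"
 proof -
  obtain l where l: "t0 < l" "ereal l < T" using ereal_dense2[OF t0(2)] by auto
  define Z where "Z t = (U t + W t - I0 t F - cls u1) \<bullet> cls k + I0 t (%s. U s + W s) \<bullet> cls (neg_laplacian_pow sg k)" for t
  have "Z t0 = 0"
  proof (rule vanishing_of_concentration[OF _ t0(1) l(1)])
   show "C0 l Z" unfolding Z_def
    by (intro continuous_on_add continuous_on_inner continuous_on_diff cont_int0 continuous_on_const c[OF l(2)])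
   fix j :: "real => real" assume j: "smooth j" "!!t. j t ~= 0 ==> -2 <= t \<and> t <= t0"
   define f where "f z = j (fst z) * k (snd z)" for z
   obtain r where r: "!!x. k x ~= 0 ==> norm x <= r" using test_support[OF k] by blast
   have supp: "t <= t0" "norm (t, x) <= \<bar>t0\<bar> + 2 + r" if "f (t, x) ~= 0" for t x
   proof -
    have "-2 <= t" "t <= t0" "norm x <= r" using that j(2) r by (auto simp: f_def)
    thus "t <= t0" "norm (t, x) <= \<bar>t0\<bar> + 2 + r" using norm_Pair_le[of t x] by auto
   qed
   have f: "test f" unfolding test_iff
   proof
    show "smooth f" unfolding f_def by (intro smooth_mult smooth_fst smooth_snd j(1) test_smooth[OF k])
    show "EX r. ALL z. f z ~= 0 --> norm z <= r" using supp(2) by auto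
   qed
   have "closure {z. f z ~= 0} \<subseteq> {z. fst z <= t0}"
    by (rule closure_minimal) (use supp(1) in "auto intro!: closed_Collect_le continuous_intros")
   also have "... \<subseteq> {t. ereal t < T} \<times> UNIV" using t0(2) by (auto intro: le_less_trans[of _ "ereal t0"])
   finally have fT: "f \<in> test_functions ({t. ereal t < T} \<times> UNIV)" using f by (simp add: test_functions_def)
   have sp: "ALL t x. f (t, x) ~= 0 --> t <= l" using supp(1) l(1) by force
   have t00: "0 <= l" using t0 l by simp
   have L: "Lp_loc p T u" using w unfolding is_weak_solution_iff by blast
   note typed = weak_formulation_typed[OF dim L uL V[unfolded U_def[abs_def]] t00 l(2) f sp]
   have "I0 l (%t. F t \<bullet> slice f t) + cls u1 \<bullet> slice f 0 = I0 l (%t. U t \<bullet> slice (adj_op sg f) t)"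
    using bspec[OF conjunct2[OF w[unfolded is_weak_solution_iff]] fT] unfolding typed inner_cls[OF u1 slice_L2[OF f]] F_def U_def by simp
   hence "I0 l (%t. (U t + W t - I0 t F - cls u1) \<bullet> slice (partial_t f) t
     + I0 t (%s. U s + W s) \<bullet> slice ((lap_x ^^ sg) (partial_t f)) t) = 0"
    by (rule iffD1[OF weak_core, rotated -1]) (rule t0 l c U0 f D supp(1) | assumption)+
   moreover have "slice (partial_t f) t = deriv j t *R cls k" "slice ((lap_x ^^ sg) (partial_t f)) t = deriv j t *R cls (neg_laplacian_pow sg k)" for t
   proof -
    have pt: "(%x. partial_t f (t, x)) = (%x. deriv j t * k x)"
    proof
     fix x
     have "((%s. j s * k x) has_real_derivative deriv j t * k x) (at t)" by (intro DERIV_cmult_right smooth_deriv_real j(1))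
     thus "partial_t f (t, x) = deriv j t * k x"
      using fun_cong[OF fun_cong[OF time_deriv_slice[of f]], of t x] by (simp add: time_deriv_def f_def DERIV_imp_deriv)
    qed
    show "slice (partial_t f) t = deriv j t *R cls k" unfolding pt by (rule cls_cmult[OF test_L2[OF k]])
    show "slice ((lap_x ^^ sg) (partial_t f)) t = deriv j t *R cls (neg_laplacian_pow sg k)"
     unfolding lap_pow_slice[symmetric] pt lap_pow_cmult[OF test_smooth[OF k]]
     by (rule cls_cmult[OF test_L2[OF test_neg_laplacian_pow[OF k]]])
   qed
   ultimately show "I0 l (%t. deriv j t * Z t) = 0" by (simp add: Z_def distrib_left)
  qed
  thus ?thesis by (simp add: Z_def)
 qed
 have Y: "I0 t (%s. U s + W s) \<in> Hs sg" if t: "t \<in> {0..l}" for t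
 proof -
  have "(W has_integral U t - U 0) {0..t}"
   using t l by (intro fundamental_theorem_of_calculus has_vector_derivative_within_subset[OF D]) auto
  from has_integral_add[OF integrable_integral[OF int_initial[OF c(1)[OF l(2)] t]] this]
  show ?thesis using sob.V_add[OF Hs_integral[OF sob.Vcont_subset[OF V sub[OF l(2)]] t] sob.Vcont_in_V[OF V]] subsetD[OF sub[OF l(2)] t] by (simp add: integral_unique U0)
 qed
 show ?thesis unfolding sl.sol_def
 proof (intro conjI ballI)
  have "sob.mild sg l (cls u1) F (%t. U t + W t)"
  proof (rule sl.mildI)
   show "C0 l F" "C0 l (%t. U t + W t)" by (intro continuous_on_add c l)+
   fix h t :: real and g :: "'a ell2" assume h: "h > 0" and t: "t \<in> {0..l}"
   define Y1 where "Y1 = I0 t (%s. U s + W s)"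
   have YH: "Y1 \<in> Hs sg" unfolding Y1_def by (rule Y[OF t])
   define v where "v = U t + W t - I0 t F - cls u1"
   have tst: "v \<bullet> cls k + hform sg Y1 (cls k) = 0" if k: "test k" for k :: "'a => real"
   proof (cases "t = 0")
    case True
    hence "v = 0" "Y1 = 0" by (simp_all add: v_def Y1_def U0)
    thus ?thesis by (simp add: hform_test[OF sob.V_zero k])
   next
    case False
    hence "0 < t" "ereal t < T" using t l(2) by (auto intro: le_less_trans[of _ "ereal l"])
    from point[OF this k] show ?thesis unfolding hform_test[OF YH k] unfolding v_def Y1_def .
   qed
   have R: "sob.R sg h g \<in> Hs sg" by (rule sob.R_in_V[OF h])
   have "v \<bullet> d + hform sg Y1 d = 0" if d: "d \<in> Hs sg" for d
   proof -
    obtain q :: "nat => 'a => real" where q: "!!n. test (q n)" "(%n. cls (q n)) ----> d"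
     "!!bs. bs \<in> lists Basis ==> length bs <= sg ==> (%n. wderiv bs (cls (q n))) ----> wderiv bs d"
     by (rule Hs_test_sequence[OF d]) blast
    have w: "(%n. wderiv bs (cls (q n))) ----> wderiv bs d" if "bs \<in> words sg" for bs
     using that by (intro q(3)) (simp_all add: words_def)
    have "(%n. v \<bullet> cls (q n) + hform sg Y1 (cls (q n))) ----> v \<bullet> d + hform sg Y1 d"
     unfolding hform_def by (intro tendsto_add tendsto_sum tendsto_inner tendsto_const q(2) w)
    thus ?thesis unfolding tst[OF q(1)] by (simp add: LIMSEQ_const_iff)
   qed
   from this[OF R] have "v \<bullet> sob.R sg h g + hform sg Y1 (sob.R sg h g) = 0" .
   moreover have "hform sg Y1 (sob.R sg h g) = Y1 \<bullet> sob.B sg h g"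
    using sob.a_R[OF h YH, of g] sob.sym[OF YH R] by (simp add: inner_commute)
   ultimately show "(U t + W t) \<bullet> sob.R sg h g + I0 t (%t. U t + W t) \<bullet> sob.B sg h g = cls u1 \<bullet> sob.R sg h g + I0 t F \<bullet> sob.R sg h g"
    by (simp add: v_def Y1_def inner_diff_left)
  qed
  thus "sob.mild sg l (cls u1) (%t. nonlin p (cls (u t))) (%t. cls (u t) + cls (L2_deriv u t))"
   by (simp add: F_def[abs_def] U_def[abs_def] W_def[abs_def])
  show "0 \<in> Hs sg" by (rule sob.V_zero)
  fix t assume t: "t \<in> {0..l}"
  have "((%s. exp s *R (U s + W s)) has_integral exp t *R U t - exp 0 *R U 0) {0..t}"
  proof (rule fundamental_theorem_of_calculus)
   fix s assume s: "s \<in> {0..t}"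
   have "((%s. exp s *R U s) has_vector_derivative exp s *R W s + exp s *R U s) (at s within {0..t})"
    using s t l(2) by (intro has_vector_derivative_scaleR has_field_derivative_at_within[OF DERIV_exp] has_vector_derivative_within_subset[OF D[of s l]]) auto
   thus "((%s. exp s *R U s) has_vector_derivative exp s *R (U s + W s)) (at s within {0..t})" by (simp add: scaleR_add_right add.commute)
  qed (use t in simp)
  hence "I0 t (%s. exp s *R (U s + W s)) = exp t *R U t" using U0 by auto
  thus "cls (u t) = exp (- t) *R (0 + I0 t (%s. exp s *R (cls (u s) + cls (L2_deriv u s))))"
   by (simp add: U_def W_def flip: exp_add)
 qed
qed

end

text \<open>A curve in the Hilbert space is a class for each time separately, with no joint
  measurability. Here \<open>U t\<close> is approximated by one of countably many values
  \<open>U (q n)\<close>, with index depending measurably on \<open>t\<close>; the approximation is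
  fast enough to converge almost everywhere on every slice.\<close>

lemma joint_representative:
 fixes U :: "real => 'a::euclidean_space ell2"
 assumes I: "I \<in> sets borel" and c: "continuous_on I U"
 obtains u :: "real \<times> 'a => real" where "u \<in> borel_measurable borel" "!!t. t \<in> I ==> (%x. u (t, x)) \<in> L2 \<and> slice u t = U t"
proof (cases "I = {}")
 case True
 thus ?thesis using that[of "%z. 0"] by simp
next
 case False
 obtain S where S: "countable S" "S \<subseteq> I" "I \<subseteq> closure S" by (rule separable)
 have "S ~= {}" using S(3) False by auto
 define q where "q = from_nat_into S"
 have q: "q n \<in> I" for n using from_nat_into[OF \<open>S ~= {}\<close>] S(2) by (auto simp: q_def)
 have near: "EX n. norm (U (q n) - U t) < e" if t: "t \<in> I" and e: "e > 0" for t e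
 proof -
  obtain d where d: "d > 0" "!!s. s \<in> I ==> dist s t < d ==> dist (U s) (U t) < e"
   using c t e unfolding continuous_on_iff by metis
  obtain s where s: "s \<in> S" "dist s t < d" using S(3) t d(1) by (meson closure_approachable subsetD)
  obtain n where "s = q n" using from_nat_into_surj[OF S(1) s(1)] by (auto simp: q_def)
  thus ?thesis using d(2)[OF q] s(2) by (auto simp: dist_norm)
 qed
 have "EX f. f \<in> L2 \<and> f \<in> borel_measurable borel \<and> U (q n) = cls f" for n using cls_borel[of "U (q n)"] by metis
 then obtain r where r: "!!n. r n \<in> L2" "!!n. r n \<in> borel_measurable borel" "!!n. cls (r n) = U (q n)" by metis
 \<comment> \<open>The indicator makes the condition Borel in \<open>t\<close> on the whole line and
   satisfiable off \<open>I\<close>. The tolerance \<open>(1/2) ^ k / 4\<close> yields the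
   increments required by \<open>L2_fast_Cauchy_AE\<close>.\<close>
 define N where "N k t = (LEAST n. indicator I t *R norm (U (q n) - U t) < (1/2) ^ k / 4)" for k :: nat and t
 have N: "norm (U (q (N k t)) - U t) < (1/2) ^ k / 4" if t: "t \<in> I" for k t
  using LeastI_ex[of "%n. indicator I t *R norm (U (q n) - U t) < (1/2) ^ k / 4"] near[OF t, of "(1/2) ^ k / 4"] t
  by (simp add: N_def)
 have [measurable]: "N k \<in> measurable borel (count_space UNIV)" for k
 proof -
  have [measurable]: "(%t. indicator I t *R norm (U (q n) - U t)) \<in> borel_measurable borel" for n
   by (intro borel_measurable_continuous_on_indicator I continuous_on_norm continuous_on_diff c continuous_on_const)
  show ?thesis unfolding N_def[abs_def] by measurable
 qed
 define v where "v k z = r (N k (fst z)) (snd z)" for k and z :: "real \<times> 'a"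
 have fs: "fst \<in> measurable (borel :: (real \<times> 'a) measure) borel" "snd \<in> measurable (borel :: (real \<times> 'a) measure) borel"
  by (intro borel_measurable_continuous_onI continuous_on_fst continuous_on_snd continuous_on_id)+
 have v: "v k \<in> borel_measurable borel" for k
  unfolding v_def[abs_def]
  by (rule measurable_compose_countable[of "%n z. r n (snd z)", OF measurable_compose[OF fs(2) r(2)] measurable_compose[OF fs(1)]]) measurable
 define u where "u z = lim (%k. v k z)" for z
 have u: "u \<in> borel_measurable borel" unfolding u_def[abs_def] by (rule borel_measurable_lim_metric[OF v])
 have main: "(%x. u (t, x)) \<in> L2 \<and> slice u t = U t" if t: "t \<in> I" for t
 proof -
  let ?f = "%k. r (N k t)"
  have b: "norm (cls (?f k) - U t) < (1/2) ^ k / 4" for k using N[OF t] by (simp add: r(3))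
  have "(norm (cls (?f (Suc k)) - cls (?f k)))^2 <= (1/4) ^ k" for k
  proof -
   have "norm (cls (?f (Suc k)) - cls (?f k)) <= norm (cls (?f (Suc k)) - U t) + norm (cls (?f k) - U t)"
    using norm_triangle_ineq4[of "cls (?f (Suc k)) - U t" "cls (?f k) - U t"] by simp
   also have "... <= (1/2) ^ k"
   proof -
    have "(0::real) <= (1/2) ^ k" by simp
    thus ?thesis using b[of k] b[of "Suc k"] unfolding power_Suc by linarith
   qed
   finally have "(norm (cls (?f (Suc k)) - cls (?f k)))^2 <= ((1/2) ^ k)^2" by simp
   thus ?thesis by (simp add: power2_eq_square flip: power_mult_distrib)
  qed
  from L2_fast_Cauchy_AE[of ?f, OF r(1) this] have "AE x in lebesgue. convergent (%k. ?f k x)" .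
  hence ae: "AE x in lebesgue. (%k. ?f k x) ----> u (t, x)"
   by eventually_elim (simp add: u_def v_def convergent_LIMSEQ_iff)
  have lim: "(%k. cls (?f k)) ----> U t"
  proof (rule LIM_zero_cancel, rule Lim_null_comparison)
   show "\<forall>\<^sub>F k in sequentially. norm (cls (?f k) - U t) <= (1/2) ^ k / 4" using b by (simp add: less_imp_le)
   show "(%k. (1/2) ^ k / 4 :: real) ----> 0" using tendsto_divide_zero[OF LIMSEQ_power_zero[of "1/2::real"]] by simp
  qed
  have "(%x. u (t, x)) \<in> borel_measurable borel"
   by (rule measurable_compose[OF _ u]) (intro borel_measurable_continuous_onI continuous_on_Pair continuous_on_const continuous_on_id)
  hence "lmeas (%x. u (t, x))" by (intro measurable_completion) simp
  from L2_limit_from_AE[of ?f, OF r(1) LIMSEQ_imp_Cauchy[OF lim] this ae]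
  show ?thesis using LIMSEQ_unique[OF lim] by metis
 qed
 show ?thesis using that[OF u main] .
qed

lemma time_interval_borel: "time_interval T \<in> sets borel"
 unfolding time_interval_def by simp

lemma compact_time_slab:
 fixes K :: "(real \<times> 'a::euclidean_space) set"
 assumes K: "compact K" "K \<subseteq> time_interval T \<times> UNIV" and T: "0 < T"
 obtains t r where "0 <= t" "ereal t < T" "K \<subseteq> {0..t} \<times> cball 0 r"
proof (cases "K = {}")
 case True
 thus ?thesis using that[of 0] T by (simp add: zero_ereal_def)
next
 case False
 obtain z where z: "z \<in> K" "!!w. w \<in> K ==> fst w <= fst z"
  using continuous_attains_sup[OF K(1) False continuous_on_fst[OF continuous_on_id]] by blast
 obtain r where r: "!!w. w \<in> K ==> norm w <= r" using compact_imp_bounded[OF K(1)] by (auto simp: bounded_iff)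
 have "fst z \<in> time_interval T" using K(2) z(1) by auto
 moreover have "K \<subseteq> {0..fst z} \<times> cball 0 r"
 proof
  fix w assume w: "w \<in> K"
  show "w \<in> {0..fst z} \<times> cball 0 r" using K(2) w z(2)[OF w] r[OF w] norm_snd_le[of "snd w" "fst w"] by (cases w) (auto simp: time_interval_def)
 qed
 ultimately show ?thesis using that[of "fst z"] by (auto simp: time_interval_def)
qed


lemma at_within_time_interval:
 assumes "t \<in> time_interval T" "t < r" "ereal r < T"
 shows "at t within time_interval T = at t within {0..r}" "at t within {0..} = at t within {0..r}"
proof -
 have sub: "s \<in> time_interval T" if "0 <= s" "s < r" for s
  using that assms(3) by (auto simp: time_interval_def intro: less_trans[of _ "ereal r"])
 show "at t within time_interval T = at t within {0..r}"
  by (rule at_within_nhd[of t "{..<r}"]) (use assms sub in "auto simp: time_interval_def")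
 show "at t within {0..} = at t within {0..r}"
  by (rule at_within_nhd[of t "{..<r}"]) (use assms in auto)
qed

lemma time_interval_less: assumes "t \<in> time_interval T" obtains r where "t < r" "ereal r < T"
proof -
 have "ereal t < T" using assms by (simp add: time_interval_def)
 from ereal_dense2[OF this] show ?thesis using that by auto
qed

context Sobolev_exponents
begin

text \<open>On a slice, the integral of the power over a ball is the inner product of
  \<open>nonlin p\<close> with the indicator of the ball. Continuity of the nonlinearity along the
  curve bounds it uniformly on compact time intervals, and Tonelli integrates in time.\<close>

lemma Lp_loc_curve:
 fixes u :: "real \<times> 'a::euclidean_space => real"
 assumes dim: "dim = real DIM('a)" and m: "u \<in> borel_measurable borel" and T: "0 < T"
  and u: "ALL t:time_interval T. (%x. u (t, x)) \<in> L2" and V: "sob.Vcont sg (time_interval T) (slice u)"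
 shows "Lp_loc p T (%t x. u (t, x))"
 unfolding Lp_loc_def
proof (intro conjI allI impI)
 interpret sl: semilinear_form "Hs sg" "hform sg" "nonlin p :: 'a ell2 => 'a ell2" by (rule semilinear_nonlin[OF dim])
 have [measurable]: "time_interval T \<times> (UNIV :: 'a set) \<in> sets borel" by (intro borel_Times time_interval_borel) simp
 note m [measurable]
 thus "set_borel_measurable lebesgue (time_interval T \<times> UNIV) (%(t, x). u (t, x))"
  unfolding set_borel_measurable_def by (intro measurable_completion) (simp)
 fix K :: "(real \<times> 'a) set" assume K: "compact K \<and> K \<subseteq> time_interval T \<times> UNIV"
 obtain s r where s: "0 <= s" "ereal s < T" and Kr: "K \<subseteq> {0..s} \<times> cball 0 r"
  using compact_time_slab[OF conjunct1[OF K] conjunct2[OF K] T] by blast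
 have sub: "{0..s} \<subseteq> time_interval T" using s(2) by (auto simp: time_interval_def intro: le_less_trans[of _ "ereal s"])
 have Vs: "sob.Vcont sg {0..s} (slice u)" by (rule sob.Vcont_subset[OF V sub])
 have "compact ((%t. nonlin p (slice u t)) ` {0..s})" by (intro compact_continuous_image sl.f_Vcont[OF Vs] compact_Icc)
 then obtain M where M: "!!t. t \<in> {0..s} ==> norm (nonlin p (slice u t)) <= M"
  using compact_imp_bounded[of "(%t. nonlin p (slice u t)) ` {0..s}"] unfolding bounded_iff by blast
 define B where "B = cball (0::'a) r"
 have B [measurable]: "B \<in> sets borel" by (simp add: B_def)
 have BL: "(indicator B :: 'a => real) \<in> L2"
 proof -
  have "lmeas (indicator B :: 'a => real)" by (intro measurable_completion) simp
  moreover have "integrable lebesgue (%x. (indicator B x)^2 :: real)"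
   using emeasure_compact_finite[of "cball (0::'a) r"]
   by (simp add: B_def power2_eq_square flip: indicator_inter_arith)
  ultimately show ?thesis by (simp add: L2_def)
 qed
 define C where "C = M * norm (cls (indicator B :: 'a => real))"
 define h where "h z = indicator ({0..s} \<times> B) z * \<bar>u z\<bar> powr p" for z
 have S [measurable]: "{0..s} \<times> B \<in> sets borel" by (intro borel_Times B) simp
 have h [measurable]: "h \<in> borel_measurable borel" unfolding h_def[abs_def] by simp
 have inner: "(\<integral>\<^sup>+x. ennreal (h (t, x)) \<partial>lborel) <= ennreal C * indicator {0..s} t" for t
 proof (cases "t \<in> {0..s}")
  case True
  let ?g = "%x. \<bar>u (t, x)\<bar> powr p"
  have ut: "(%x. u (t, x)) \<in> L2" "slice u t \<in> Hs sg" using u True sub sob.Vcont_in_V[OF Vs True] by auto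
  have g: "?g \<in> L2" "cls ?g = nonlin p (slice u t)" using powr_L2[OF dim ut] nonlin_cls[OF dim ut] by auto
  have he: "h (t, x) = ?g x * indicator B x" for x using True by (simp add: h_def indicator_def)
  have "(\<integral>\<^sup>+x. ennreal (h (t, x)) \<partial>lborel) = NL (%x. h (t, x))" by (rule nn_integral_completion[symmetric])
  also have "... = ennreal (LINT x|lebesgue. ?g x * indicator B x)"
   unfolding he by (rule nn_integral_eq_integral[OF L2_mult_integrable[OF g(1) BL]]) auto
  also have "(LINT x|lebesgue. ?g x * indicator B x) = nonlin p (slice u t) \<bullet> cls (indicator B)"
   unfolding g(2)[symmetric] by (rule inner_cls[OF g(1) BL, symmetric])
  also have "... <= C" unfolding C_def by (rule order_trans[OF norm_cauchy_schwarz mult_right_mono[OF M[OF True] norm_ge_zero]])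
  finally show ?thesis using True by (simp add: ennreal_leI)
 qed (simp add: h_def indicator_times)
 have "integrable (lborel \<Otimes>\<^sub>M lborel) h"
 proof (rule integrableI_nonneg)
  have "(\<integral>\<^sup>+z. ennreal (h z) \<partial>(lborel \<Otimes>\<^sub>M lborel)) = (\<integral>\<^sup>+t. \<integral>\<^sup>+x. ennreal (h (t, x)) \<partial>lborel \<partial>lborel)"
   by (rule lborel.nn_integral_fst[symmetric]) (use h in "simp add: lborel_prod")
  also have "... <= (\<integral>\<^sup>+t. ennreal C * indicator {0..s} t \<partial>lborel)" by (intro nn_integral_mono inner)
  also have "... < \<infinity>" using s(1) by (simp add: nn_integral_cmult_indicator ennreal_mult_less_top)
  finally show "(\<integral>\<^sup>+z. ennreal (h z) \<partial>(lborel \<Otimes>\<^sub>M lborel)) < \<infinity>" .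
 qed (use h in "auto simp: lborel_prod h_def")
 hence "set_integrable lebesgue ({0..s} \<times> B) (%z. \<bar>u z\<bar> powr p)"
  by (simp add: set_integrable_def lborel_prod integrable_completion h_def[abs_def])
 thus "set_integrable lebesgue K (%(t, x). \<bar>u (t, x)\<bar> powr p)"
  using set_integrable_subset[of lebesgue "{0..s} \<times> B" _ K] Kr K
  by (simp add: case_prod_unfold B_def lmeasurable_compact fmeasurableD)
qed


text \<open>The curve is realised by a jointly measurable function with time derivative
  \<open>y - U\<close>, from \<open>u' + u = y\<close>. By \<open>weak_core\<close> the weak
  formulation reduces to an integrand that vanishes at every time, as testing the mild equation with
  slices of the test function shows.\<close>

lemma sol_energy_solution:
 fixes u1 :: "'a::euclidean_space => real"
 assumes dim: "dim = real DIM('a)" and u1: "u1 \<in> L2" and T: "0 < T"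
  and s: "!!l. 0 <= l ==> ereal l < T ==> semilinear_form.sol (Hs sg) (hform sg) (nonlin p) l 0 (cls u1) U y"
 obtains u where "energy_solution sg p (%x. 0) u1 T u" "!!t. t \<in> time_interval T ==> u t \<in> L2 \<and> cls (u t) = U t"
proof -
 interpret sl: semilinear_form "Hs sg" "hform sg" "nonlin p :: 'a ell2 => 'a ell2" by (rule semilinear_nonlin[OF dim])
 let ?I = "time_interval T"
 have I: "0 <= t" "ereal t < T" if "t \<in> ?I" for t using that by (auto simp: time_interval_def)
 have z: "0 \<in> ?I" using T by (simp add: time_interval_def zero_ereal_def)
 have sub: "{0..l} \<subseteq> ?I" if "ereal l < T" for l using that by (auto simp: time_interval_def intro: le_less_trans[of _ "ereal l"])
 have V: "sob.Vcont sg ?I U"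
  unfolding sob.Vcont_def
 proof
  fix t assume t: "t \<in> ?I"
  obtain l where l: "t < l" "ereal l < T" by (rule time_interval_less[OF t])
  show "U t \<in> Hs sg \<and> ((%s. sob.N sg (U s - U t)) ---> 0) (at t within ?I)" using sl.sol_Vcont[OF s[of l]] l I(1)[OF t] unfolding sob.Vcont_def at_within_time_interval(1)[OF t l] by simp
 qed
 have cy: "continuous_on ?I y"
  unfolding continuous_on_def
 proof
  fix t assume t: "t \<in> ?I"
  obtain l where l: "t < l" "ereal l < T" by (rule time_interval_less[OF t])
  show "(y ---> y t) (at t within ?I)" using sob.mildD(2)[OF sl.solD(1)[OF s[of l]]] l I(1)[OF t] unfolding continuous_on_def at_within_time_interval(1)[OF t l] by simp
 qed
 note cU = sob.Vcont_continuous[OF V]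
 obtain v :: "real \<times> 'a => real" where v: "v \<in> borel_measurable borel" "!!t. t \<in> ?I ==> (%x. v (t, x)) \<in> L2 \<and> slice v t = U t"
  by (rule joint_representative[OF time_interval_borel cU]) blast
 define u where "u t x = v (t, x)" for t x
 have u: "u t \<in> L2 \<and> cls (u t) = U t" if "t \<in> ?I" for t using v(2)[OF that] by (simp add: u_def[abs_def])
 define W where "W t = y t - U t" for t
 have D: "(U has_vector_derivative W t) (at t within {0..l})" if t: "t \<in> {0..l}" and l: "ereal l < T" for t l
 proof -
  have "0 <= l" using t by simp
  note sl = s[OF this l]
  have "C0 l (%s. exp s *R y s)"
   by (intro continuous_on_scaleR continuous_on_exp continuous_on_id sob.mildD(2)[OF sl.solD(1)[OF sl]])
  from integral_has_vector_derivative[OF this t]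
  have "((%t. I0 t (%s. exp s *R y s)) has_vector_derivative exp t *R y t) (at t within {0..l})" .
  moreover have "((%t. exp (- t)) has_field_derivative - exp (- t)) (at t within {0..l})" by (auto intro!: derivative_eq_intros)
  ultimately have "((%t. exp (- t) *R I0 t (%s. exp s *R y s)) has_vector_derivative
    exp (- t) *R (exp t *R y t) + (- exp (- t)) *R I0 t (%s. exp s *R y s)) (at t within {0..l})"
   by (rule has_vector_derivative_scaleR[rotated])
  moreover have "exp (- t) *R (exp t *R y t) + (- exp (- t)) *R I0 t (%s. exp s *R y s) = W t"
   using sl.solD(3)[OF sl t] by (simp add: W_def flip: exp_add)
  ultimately show ?thesis
   using has_vector_derivative_transform[OF t, of U "%t. exp (- t) *R I0 t (%s. exp s *R y s)"] sl.solD(3)[OF sl] by simp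
 qed
 have du: "((%t. cls (u t)) has_vector_derivative W t) (at t within {0..})" if t: "t \<in> ?I" for t
 proof -
  obtain l where l: "t < l" "ereal l < T" by (rule time_interval_less[OF t])
  have t': "t \<in> {0..l}" using t l I by simp
  have "cls (u s) = U s" if "s \<in> {0..l}" for s using u sub[OF l(2)] that by blast
  thus ?thesis unfolding at_within_time_interval(2)[OF t l]
   by (rule has_vector_derivative_transform[OF t' _ D[OF t' l(2)]])
 qed
 have cW: "continuous_on ?I W" unfolding W_def by (intro continuous_on_diff cy cU)
 have C1: "C1_in_L2 ?I u" and L2d: "!!t. t \<in> ?I ==> L2_deriv u t \<in> L2 \<and> cls (L2_deriv u t) = W t"
  using C1_in_L2_I[OF _ du cW] u by blast+
 have Vu: "sob.Vcont sg ?I (%t. cls (u t))" using V u by (subst sob.Vcont_cong[of _ _ U]) auto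
 have U0: "U 0 = 0" "y 0 = cls u1"
  using sl.solD(3)[OF s[of 0], of 0] sob.mild_initial[OF sl.solD(1)[OF s[of 0]]] T by (simp_all add: zero_ereal_def)
 have W0: "W 0 = cls u1" by (simp add: W_def U0)
 have init: "AE x in lebesgue. u 0 x = 0" "AE x in lebesgue. L2_deriv u 0 x = u1 x"
  using cls_eq_iff[of "u 0" "%x. 0"] cls_eq_iff[of "L2_deriv u 0" u1] u[OF z] L2d[OF z] U0 W0 u1 by (simp_all add: cls_zero L2_zero)
 have L: "Lp_loc p T u"
  using Lp_loc_curve[OF dim v(1) T, folded u_def] u Vu by blast
 have uL: "ALL t:?I. u t \<in> L2" using u by blast
 have weak: "is_weak_solution sg p (%x. 0) u1 T u"
  unfolding is_weak_solution_iff
 proof (intro conjI ballI L)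
  fix f assume f: "f \<in> test_functions ({t. ereal t < T} \<times> (UNIV :: 'a set))"
  hence fU: "test f" by (simp add: test_functions_def)
  obtain r l where r: "0 < r" "r < l" "ereal l < T" "!!t x. f (t, x) ~= 0 ==> t <= r" by (rule test_time_bound[OF f T]) blast
  have l: "0 <= l" using r by simp
  note m = sl.solD(1)[OF s[OF l r(3)]]
  have fs: "ALL t x. f (t, x) ~= 0 --> t <= l" using r by force
  note typed = weak_formulation_typed[OF dim L uL Vu l r(3) fU fs]
  have e: "cls (u t) = U t" if "t \<in> {0..l}" for t using u sub[OF r(3)] that by blast
  have c: "C0 l U" "C0 l W"
   by (intro continuous_on_subset[OF cU sub] continuous_on_subset[OF cW sub] r(3))+
  have "(U t + W t - I0 t (%t. nonlin p (U t)) - cls u1) \<bullet> slice (partial_t f) t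
    + I0 t (%s. U s + W s) \<bullet> slice ((lap_x ^^ sg) (partial_t f)) t = 0" if t: "t \<in> {0..l}" for t
  proof -
   define h where "h x = partial_t f (t, x)" for x
   have h: "test h"
    unfolding h_def[abs_def] by (intro test_slice test_partial[OF fU Basis_pair(2)])
   have Lh: "slice ((lap_x ^^ sg) (partial_t f)) t = cls (neg_laplacian_pow sg h)"
    unfolding lap_pow_slice[symmetric] h_def ..
   \<comment> \<open>The image of \<open>h\<close> under \<open>1 + (-Delta)^sg\<close>, so that the
     resolvent with parameter 1 returns \<open>h\<close>.\<close>
   let ?g = "cls h + cls (neg_laplacian_pow sg h)"
   have R: "sob.R sg 1 ?g = cls h" "sob.B sg 1 ?g = cls (neg_laplacian_pow sg h)"
    by (rule sl.R_of_domain[OF test_Hs[OF h]]; rule hform_test[OF _ h]; assumption)+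
   have "y t \<bullet> cls h + I0 t y \<bullet> cls (neg_laplacian_pow sg h) = cls u1 \<bullet> cls h + I0 t (%t. nonlin p (U t)) \<bullet> cls h"
    using sl.mild_test[OF m t zero_less_one, of ?g] unfolding R .
   thus ?thesis unfolding Lh by (simp add: W_def h_def[abs_def] inner_diff_left)
  qed
  hence "I0 l (%t. (U t + W t - I0 t (%t. nonlin p (U t)) - cls u1) \<bullet> slice (partial_t f) t
    + I0 t (%s. U s + W s) \<bullet> slice ((lap_x ^^ sg) (partial_t f)) t) = I0 l (%t. 0)"
   by (rule HK_cong)
  hence "I0 l (%t. nonlin p (U t) \<bullet> slice f t) + cls u1 \<bullet> slice f 0 = I0 l (%t. U t \<bullet> slice (adj_op sg f) t)"
   by (intro iffD2[OF weak_core[OF r(1,2) c sob.mildD(1)[OF m] U0(1) D[OF _ r(3)] fU r(4)]]) (assumption | simp)+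
  moreover have "I0 l (%t. nonlin p (cls (u t)) \<bullet> slice f t) = I0 l (%t. nonlin p (U t) \<bullet> slice f t)"
   "I0 l (%t. cls (u t) \<bullet> slice (adj_op sg f) t) = I0 l (%t. U t \<bullet> slice (adj_op sg f) t)"
   by (auto intro!: HK_cong simp: e)
  ultimately show "(LINT z:?I \<times> UNIV|lebesgue. \<bar>u (fst z) (snd z)\<bar> powr p * f z)
    + (LINT x|lebesgue. 0 * (f (0, x) + (lap_x ^^ sg) f (0, x) - partial_t f (0, x))) + (LINT x|lebesgue. u1 x * f (0, x))
    = (LINT z:?I \<times> UNIV|lebesgue. u (fst z) (snd z) * adj_op sg f z)"
   unfolding typed inner_cls[OF u1 slice_L2[OF fU]] by simp
 qed
 show ?thesis using Vu T C1 init weak u that unfolding continuous_in_H_iff[OF sg] energy_solution_def by blast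
qed

end

section \<open>Maximal energy solutions and blow-up\<close>

context Sobolev_exponents
begin

text \<open>Divergence can fail only if the norm drops below some \<open>M\<close> at times
  arbitrarily close to \<open>T\<close>. There the form norm of \<open>u\<close> is below
  \<open>M\<close> and \<open>y\<close>, the sum of \<open>u\<close> and its time derivative, below
  \<open>2 * M\<close>, so the abstract solution continues past \<open>T\<close>; converted back, it
  contradicts maximality.\<close>

lemma energy_norm_blow_up:
 fixes u :: "real => 'a::euclidean_space => real"
 assumes dim: "dim = real DIM('a)" and u1: "u1 \<in> L2" and m: "maximal_energy_solution sg p (%x. 0) u1 (ereal T) u"
 shows "filterlim (energy_norm sg u) at_top (at_left T)"
proof (rule ccontr)
 assume "\<not> filterlim (energy_norm sg u) at_top (at_left T)"
 then obtain M where M: "\<not> eventually (%t. M <= energy_norm sg u t) (at_left T)" by (auto simp: filterlim_at_top)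
 interpret sl: semilinear_form "Hs sg" "hform sg" "nonlin p :: 'a ell2 => 'a ell2" by (rule semilinear_nonlin[OF dim])
 have e: "energy_solution sg p (%x. 0) u1 (ereal T) u" using m by (simp add: maximal_energy_solution_def)
 hence T: "0 < T" and eH: "continuous_in_H sg (time_interval (ereal T)) u" and eC: "C1_in_L2 (time_interval (ereal T)) u"
  by (auto simp: energy_solution_def)
 let ?U = "%t. cls (u t)" and ?W = "%t. cls (L2_deriv u t)"
 have I: "t \<in> time_interval (ereal T) \<longleftrightarrow> 0 <= t \<and> t < T" for t by (simp add: time_interval_def)
 have uL: "u t \<in> L2" "?U t \<in> Hs sg" "L2_deriv u t \<in> L2" if "0 <= t" "t < T" for t
  using eH eC that sob.Vcont_in_V[of sg "time_interval (ereal T)" ?U t]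
  unfolding continuous_in_H_iff[OF sg] C1_in_L2_def continuous_in_L2_iff by (auto simp: I)
 have s: "sl.sol r 0 (cls u1) ?U (%t. ?U t + ?W t)" if "0 <= r" "r < T" for r
  by (rule energy_solution_sol[OF dim e u1 that(1)]) (use that in simp)
 have freq: "EX t. 0 <= t \<and> t < T \<and> T - t < d \<and> sob.N sg (?U t) <= 2 * M \<and> norm (?U t + ?W t) <= 2 * M" if d: "d > 0" for d
 proof -
  have "max 0 (T - d) < T" using T d by simp
  then obtain t where t: "max 0 (T - d) < t" "t < T" "energy_norm sg u t < M"
   using M unfolding eventually_at_left[OF T] by (meson not_le)
  have t0: "0 <= t" using t(1) by simp
  note v = uL[OF t0 t(2)]
  have H: "0 <= H_norm sg (u t)" unfolding H_norm_def by (intro real_sqrt_ge_zero sum_nonneg) simp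
  have "H_norm sg (u t) <= energy_norm sg u t" "norm (?W t) <= energy_norm sg u t"
   unfolding energy_norm_def norm_cls[OF v(3)] by auto
  moreover have "sob.N sg (?U t) <= H_norm sg (u t)" by (rule H_norm_equiv(1)[OF v(1,2) sg])
  moreover have "norm (?U t) <= sob.N sg (?U t)" by (rule sob.norm_le_N[OF v(2)])
  ultimately show ?thesis using t H norm_triangle_ineq[of "?U t" "?W t"] by (intro exI[of _ t]) auto
 qed
 obtain r v x where r: "r > T" and v: "sl.sol r 0 (cls u1) v x" "!!t. 0 <= t ==> t < T ==> v t = ?U t"
  using sl.sol_continuation[OF s freq] by blast
 have "sl.sol r' 0 (cls u1) v x" if "ereal r' < ereal r" for r' using sl.sol_restrict[OF v(1)] that by simp
 moreover have "0 < ereal r" using T r by simp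
 ultimately obtain u' where u': "energy_solution sg p (%x. 0) u1 (ereal r) u'" "!!t. t \<in> time_interval (ereal r) ==> u' t \<in> L2 \<and> cls (u' t) = v t"
  using sol_energy_solution[OF dim u1, of "ereal r" v x] by blast
 have "AE x in lebesgue. u' t x = u t x" if "t \<in> time_interval (ereal T)" for t
 proof -
  have t: "0 <= t" "t < T" using that by (simp_all add: I)
  thus ?thesis using r u'(2)[of t] v(2)[OF t] uL(1)[OF t] cls_eq_iff[of "u' t" "u t"] by (simp add: time_interval_def)
 qed
 thus False using m u'(1) r unfolding maximal_energy_solution_def by (metis less_ereal.simps(1))
qed

text \<open>The abstract maximal time serves. An energy solution living longer would yield an
  abstract solution beyond it, whether or not it extends \<open>u\<close>.\<close>

lemma maximal_energy_solution_exists: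
 fixes u1 :: "'a::euclidean_space => real"
 assumes dim: "dim = real DIM('a)" and u1: "u1 \<in> L2" and no_global: "!!u. \<not> energy_solution sg p (%x. 0) u1 \<infinity> u"
 shows "EX T u. maximal_energy_solution sg p (%x. 0) u1 (ereal T) u"
proof -
 interpret sl: semilinear_form "Hs sg" "hform sg" "nonlin p :: 'a ell2 => 'a ell2" by (rule semilinear_nonlin[OF dim])
 have ng: "\<not> (ALL t>=0. sl.sol t 0 (cls u1) U y)" for U y
 proof
  assume "ALL t>=0. sl.sol t 0 (cls u1) U y"
  thus False using sol_energy_solution[OF dim u1, of \<infinity> U y] no_global by auto
 qed
 obtain T U y where T: "0 < T" and s: "ALL t. 0 <= t --> t < T --> sl.sol t 0 (cls u1) U y"
   and max: "ALL t>T. ALL u y. \<not> sl.sol t 0 (cls u1) u y"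
  using sl.maximal_sol_exists[OF sob.V_zero ng] by auto
 obtain u where u: "energy_solution sg p (%x. 0) u1 (ereal T) u"
  by (rule sol_energy_solution[OF dim u1, of "ereal T" U y]) (use T s in auto)
 have "\<not> energy_solution sg p (%x. 0) u1 T' u'" if T': "ereal T < T'" for T' u'
 proof
  assume e: "energy_solution sg p (%x. 0) u1 T' u'"
  obtain t where t: "T < t" "ereal t < T'" using ereal_dense2[OF T'] by auto
  show False using energy_solution_sol[OF dim e u1 _ t(2)] max t T by auto
 qed
 thus ?thesis using u unfolding maximal_energy_solution_def by blast
qed

end

theorem theorem1p5:
  fixes \<sigma> :: nat and p :: real and u1 :: "real ^ 'n \<Rightarrow> real"
  assumes "\<sigma> \<ge> 1"
    and "integrable lebesgue u1" and "u1 \<in> L2"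
    and "Liminf at_top (\<lambda>R::real. ereal (LINT x:ball 0 R|lebesgue. u1 x)) > 0"
    and "1 < p" and "p \<le> 1 + 2 * real \<sigma> / real CARD('n)"
  shows "(\<nexists>u. energy_solution \<sigma> p (\<lambda>x. 0) u1 \<infinity> u) \<and>
    (\<exists>T\<^sub>\<epsilon>::real. \<exists>u. maximal_energy_solution \<sigma> p (\<lambda>x. 0) u1 (ereal T\<^sub>\<epsilon>) u) \<and>
    (\<forall>T u. maximal_energy_solution \<sigma> p (\<lambda>x. 0) u1 T u \<longrightarrow>
       (\<exists>T\<^sub>\<epsilon>::real. T = ereal T\<^sub>\<epsilon> \<and> filterlim (energy_norm \<sigma> u) at_top (at_left T\<^sub>\<epsilon>)))"
proof -
 interpret Sobolev_exponents \<sigma> p "real DIM(real ^ 'n)"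
  using assms by unfold_locales (simp_all add: field_simps)
 have no_global: "\<not> energy_solution \<sigma> p (%x. 0) u1 \<infinity> u" for u
  using no_global_weak_solution[OF assms(1,2,4,5), of u] assms(6) by (auto simp: energy_solution_def)
 have "EX T\<^sub>\<epsilon>::real. T = ereal T\<^sub>\<epsilon> \<and> filterlim (energy_norm \<sigma> u) at_top (at_left T\<^sub>\<epsilon>)"
  if m: "maximal_energy_solution \<sigma> p (%x. 0) u1 T u" for T u
 proof -
  \<comment> \<open>A maximal solution with infinite \<open>T\<close> would be a global one, so
    \<open>T\<close> is a real number.\<close>
  have "T ~= \<infinity>" "0 < T" using m no_global by (auto simp: maximal_energy_solution_def energy_solution_def)
  then obtain r where "T = ereal r" by (cases T) auto
  thus ?thesis using energy_norm_blow_up[OF refl assms(3)] m by blast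
 qed
 thus ?thesis using no_global maximal_energy_solution_exists[OF refl assms(3) no_global] by blast
qed

end
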